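(* Let $X$ be a reduced square-tiled surface tiled by $N$ unit squares. Then the Lagrange spectrum $\mathcal{L}(X)$ of its orbit $\mathrm{SL}(2,\mathbb{R})\cdot X$ contains the half-line $[r(X),+\infty)$, where $$r(X)=\frac{N}{M^-(X)^2}\cdot\max\{\,2M^+(X)^2+1,\ 7,\ p(X)+2\,\}.$$
   Context: A translation surface $X=(S,w)$ is a compact Riemann surface with a nonzero holomorphic 1-form; its conical singularities are the zeros of $w$ (marked points allowed for tori). A saddle connection is a flat geodesic segment joining two conical singularities with none in its interior; $\mathrm{Hol}(X)\subset\mathbb{C}$ is the set of periods $v=\int_\gamma w$ of saddle connections. For $v\in\mathrm{Hol}(X)$ put $\mathrm{Area}(v)=|\Re v|\cdot|\Im v|$ and $$a(X)=\liminf_{|\Im v|\to\infty,\ v\in\mathrm{Hol}(X)}\frac{\mathrm{Area}(v)}{\mathrm{Area}(X)},$$ with $a(X)=0$ if $X$ has a vertical saddle connection. The group $\mathrm{SL}(2,\mathbb{R})$ acts on translation surfaces by post-composing charts with linear maps, and $\mathcal{L}(X)=\{1/a(Y): Y\in \mathrm{SL}(2,\mathbb{R})\cdot X\}$. A square-tiled surface (origami) is a translation surface $X$ which is a translation cover of $\mathbb{R}^2/\mathbb{Z}^2$ ramified only over $0$, with conical singularities lying over $0$; it is reduced if the subgroup of $\mathbb{R}^2$ generated by $\mathrm{Hol}(X)$ is $\mathbb{Z}^2$. For reduced $X$ and a conical singularity $p$, let $\rho:X\to\mathbb{R}^2/\mathbb{Z}^2$, $\rho(\zeta)=\int_p^\zeta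 w \bmod \mathbb{Z}^2$. The multiplicity $m(\gamma)$ of a saddle connection $\gamma$ is the degree of $\rho\circ\gamma$ onto its image closed geodesic (that is, $\int_\gamma w=\pm m(\gamma)(p'+iq')$ with $p',q'$ coprime integers). For a rational co-slope $p/q\in\mathbb{Q}$, $m_X(p/q)$ is the minimum of $m(\gamma)$ over saddle connections $\gamma$ of $X$ parallel to $p+iq$. Put $M^+(X)=\max_{p/q\in\mathbb{Q}}m_X(p/q)$ and $M^-(X)=\min_{p/q\in\mathbb{Q}}m_X(p/q)$. The orbit $E(X)=\mathrm{SL}(2,\mathbb{Z})\cdot X$ is finite, and $p(X)$ is the maximal length of a cycle of the action of $\begin{pmatrix}1&1\\0&1\end{pmatrix}$ on $E(X)$ (the maximal width of the cusps of the quotient of the upper half plane by the stabilizer of $X$). *)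

theory Defs
  imports
    "HOL-Complex_Analysis.Complex_Analysis"
    "HOL-Computational_Algebra.Group_Closure"
    "HOL-Library.Extended_Real"
begin

text \<open>The type of points of \<open>\<real>\<^sup>2/\<int>\<^sup>2\<close>, with the quotient topology;
  \<open>\<real>\<^sup>2\<close> is identified with the complex plane.\<close>

definition gauss_ints :: "complex set" where
  "gauss_ints = {Complex (of_int m) (of_int n) | m n :: int. True}"

lemma gauss_ints_0: "0 \<in> gauss_ints"
proof -
  have "0 = Complex (of_int 0) (of_int 0)"
    by (simp add: complex_eq_iff)
  then show ?thesis
    unfolding gauss_ints_def by blast
qed

lemma gauss_ints_diff:
  assumes "z \<in> gauss_ints" "w \<in> gauss_ints"
  shows "z - w \<in> gauss_ints"
proof -
  from assms obtain a b c d where "z = Complex (of_int a) (of_int b)"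
      "w = Complex (of_int c) (of_int d)"
    unfolding gauss_ints_def by blast
  then have "z - w = Complex (of_int (a - c)) (of_int (b - d))"
    by (simp add: complex_eq_iff)
  then show ?thesis
    unfolding gauss_ints_def by blast
qed

quotient_type torus = complex / "\<lambda>z w. z - w \<in> gauss_ints"
proof (rule equivpI)
  show "reflp (\<lambda>z w. z - w \<in> gauss_ints)"
    by (simp add: reflp_def gauss_ints_0)
  show "symp (\<lambda>z w. z - w \<in> gauss_ints)"
    using gauss_ints_diff[OF gauss_ints_0] by (fastforce simp: symp_def)
  show "transp (\<lambda>z w. z - w \<in> gauss_ints)"
  proof (rule transpI)
    fix x y z
    assume "x - y \<in> gauss_ints" "y - z \<in> gauss_ints"
    then have "(x - y) - (0 - (y - z)) \<in> gauss_ints"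
      using gauss_ints_diff gauss_ints_0 by blast
    then show "x - z \<in> gauss_ints" by simp
  qed
qed

instantiation torus :: topological_space
begin

definition open_torus :: "torus set \<Rightarrow> bool" where
  "open_torus U \<longleftrightarrow> open (abs_torus -` U)"

instance
  by standard (auto simp: open_torus_def vimage_Union)

end


text \<open>
  A compact Riemann surface with a holomorphic 1-form. The underlying space is a subset of a
  Hausdorff space. A chart is a pair of its domain and its coordinate function (values outside the
  domain are irrelevant); the 1-form \<open>w\<close> is \<open>form X c z dz\<close> in the chart \<open>c\<close>.
\<close>

type_synonym 'a chart = "'a set \<times> ('a \<Rightarrow> complex)"

record 'a form_surface =
  surf :: "'a set"
  atlas :: "'a chart set"
  form :: "'a chart \<Rightarrow> complex \<Rightarrow> complex"
  cone_pts :: "'a set"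

definition riemann_surface :: "'a::t2_space set \<Rightarrow> 'a chart set \<Rightarrow> bool" where
  "riemann_surface S \<A> \<longleftrightarrow>
     connected S \<and> (\<Union>(U, \<phi>)\<in>\<A>. U) = S \<and>
     (\<forall>(U, \<phi>)\<in>\<A>. openin (top_of_set S) U \<and> open (\<phi> ` U) \<and>
        homeomorphism U (\<phi> ` U) \<phi> (inv_into U \<phi>)) \<and>
     (\<forall>(U, \<phi>)\<in>\<A>. \<forall>(V, \<psi>)\<in>\<A>. (\<psi> \<circ> inv_into U \<phi>) holomorphic_on (\<phi> ` (U \<inter> V)))"

definition holomorphic_form ::
    "'a chart set \<Rightarrow> ('a chart \<Rightarrow> complex \<Rightarrow> complex) \<Rightarrow> bool" where
  "holomorphic_form \<A> w \<longleftrightarrow>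
     (\<forall>(U, \<phi>)\<in>\<A>. w (U, \<phi>) holomorphic_on (\<phi> ` U)) \<and>
     (\<forall>(U, \<phi>)\<in>\<A>. \<forall>(V, \<psi>)\<in>\<A>. \<forall>x\<in>U \<inter> V.
        w (U, \<phi>) (\<phi> x) = w (V, \<psi>) (\<psi> x) * deriv (\<psi> \<circ> inv_into U \<phi>) (\<phi> x))"

definition form_zeros :: "'a form_surface \<Rightarrow> 'a set" where
  "form_zeros X = {x. \<exists>(U, \<phi>)\<in>atlas X. x \<in> U \<and> form X (U, \<phi>) (\<phi> x) = 0}"

text \<open>
  The conical singularities are the zeros of the form; if the surface is a torus, they are
  an arbitrary finite set of marked points.
\<close>

definition translation_surface :: "'a::t2_space form_surface \<Rightarrow> bool" where
  "translation_surface X \<longleftrightarrow>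
     compact (surf X) \<and> riemann_surface (surf X) (atlas X) \<and>
     holomorphic_form (atlas X) (form X) \<and>
     (\<exists>(U, \<phi>)\<in>atlas X. \<exists>x\<in>U. form X (U, \<phi>) (\<phi> x) \<noteq> 0) \<and>
     finite (cone_pts X) \<and> form_zeros X \<subseteq> cone_pts X \<and> cone_pts X \<subseteq> surf X \<and>
     (cone_pts X = form_zeros X \<or> surf X homeomorphic (UNIV :: torus set))"


text \<open>
  The flat structure of a translation surface: the space, the conical singularities, and the
  translation charts, i.e. all injective local primitives of \<open>w\<close> on open sets without conical
  singularities. The group \<open>SL(2,\<real>)\<close> acts on flat structures. On the domain of a translation
  chart with coordinate \<open>z\<close> we have \<open>w = dz\<close>.
\<close>

record 'a flat_structure =
  pts :: "'a set"
  sing :: "'a set"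
  charts :: "'a chart set"

definition flat :: "'a::t2_space form_surface \<Rightarrow> 'a flat_structure" where
  "flat X = \<lparr> pts = surf X, sing = cone_pts X,
     charts = {(U, f). openin (top_of_set (surf X)) U \<and> U \<inter> cone_pts X = {} \<and> inj_on f U \<and>
       (\<forall>(V, \<phi>)\<in>atlas X. \<forall>x\<in>U \<inter> V.
          ((f \<circ> inv_into V \<phi>) has_field_derivative form X (V, \<phi>) (\<phi> x)) (at (\<phi> x)))} \<rparr>"

definition lin :: "real^2^2 \<Rightarrow> complex \<Rightarrow> complex" where
  "lin A z = Complex (A$1$1 * Re z + A$1$2 * Im z) (A$2$1 * Re z + A$2$2 * Im z)"

definition act :: "real^2^2 \<Rightarrow> 'a flat_structure \<Rightarrow> 'a flat_structure" where
  "act A X = X\<lparr> charts := (\<lambda>(U, f). (U, lin A \<circ> f)) ` charts X \<rparr>"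

definition SL2R :: "(real^2^2) set" where
  "SL2R = {A. det A = 1}"

definition SL2Z :: "(real^2^2) set" where
  "SL2Z = {A \<in> SL2R. \<forall>i j. A$i$j \<in> \<int>}"

text \<open>The total area: the supremum of the areas covered by finitely many disjoint charts.\<close>

definition surface_area :: "'a flat_structure \<Rightarrow> real" where
  "surface_area X = enn2real
     (SUP F\<in>{F. finite F \<and> F \<subseteq> charts X \<and> pairwise (\<lambda>c d. fst c \<inter> fst d = {}) F}.
        \<Sum>(U, f)\<in>F. emeasure lborel (f ` U))"

text \<open>
  Straight segments are parametrized on \<open>[0,1]\<close> with constant velocity. The integral of
  \<open>w\<close> along a path is the total increment of a continuous primitive \<open>g\<close> of \<open>w\<close> along the path.
\<close>

definition saddle_connection :: "'a::t2_space flat_structure \<Rightarrow> (real \<Rightarrow> 'a) \<Rightarrow> bool" where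
  "saddle_connection X \<gamma> \<longleftrightarrow>
     path \<gamma> \<and> path_image \<gamma> \<subseteq> pts X \<and> \<gamma> 0 \<in> sing X \<and> \<gamma> 1 \<in> sing X \<and>
     (\<forall>t\<in>{0<..<1}. \<gamma> t \<notin> sing X) \<and>
     (\<exists>v. v \<noteq> 0 \<and> (\<forall>t\<in>{0<..<1}. \<exists>(U, f)\<in>charts X. \<gamma> t \<in> U \<and>
        (\<forall>\<^sub>F s in nhds t. \<gamma> s \<in> U \<and> f (\<gamma> s) = f (\<gamma> t) + of_real (s - t) * v)))"

definition has_period :: "'a::t2_space flat_structure \<Rightarrow> (real \<Rightarrow> 'a) \<Rightarrow> complex \<Rightarrow> bool" where
  "has_period X \<gamma> v \<longleftrightarrow>
     (\<exists>g :: real \<Rightarrow> complex. continuous_on {0..1} g \<and> g 1 - g 0 = v \<and>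
        (\<forall>t\<in>{0<..<1}. \<exists>(U, f)\<in>charts X. \<gamma> t \<in> U \<and>
           (\<forall>\<^sub>F s in nhds t. \<gamma> s \<in> U \<and> g s - g t = f (\<gamma> s) - f (\<gamma> t))))"

definition Hol :: "'a::t2_space flat_structure \<Rightarrow> complex set" where
  "Hol X = {v. \<exists>\<gamma>. saddle_connection X \<gamma> \<and> has_period X \<gamma> v}"

definition lagrange_a :: "'a::t2_space flat_structure \<Rightarrow> ereal" where
  "lagrange_a X =
     (if \<exists>v\<in>Hol X. Re v = 0 then 0
      else Liminf (inf (filtercomap (\<lambda>v. \<bar>Im v\<bar>) at_top) (principal (Hol X)))
             (\<lambda>v. ereal (\<bar>Re v\<bar> * \<bar>Im v\<bar> / surface_area X)))"

text \<open>The values lie in the extended reals, where \<open>1 / 0 = \<infinity>\<close>.\<close>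

definition lagrange_spectrum :: "'a::t2_space flat_structure \<Rightarrow> ereal set" where
  "lagrange_spectrum X = {1 / lagrange_a (act A X) | A. A \<in> SL2R}"


text \<open>
  A map to the torus which is locally \<open>z + c\<close> in translation charts, with the conical
  singularities (which include all ramification points) lying over 0.
\<close>

definition square_covering :: "'a::t2_space flat_structure \<Rightarrow> ('a \<Rightarrow> torus) \<Rightarrow> bool" where
  "square_covering X \<rho> \<longleftrightarrow>
     continuous_on (pts X) \<rho> \<and> (\<forall>x\<in>sing X. \<rho> x = abs_torus 0) \<and>
     (\<forall>(U, f)\<in>charts X. \<forall>x\<in>U. \<exists>V c. openin (top_of_set (pts X)) V \<and> x \<in> V \<and> V \<subseteq> U \<and>
        (\<forall>y\<in>V. \<rho> y = abs_torus (f y + c)))"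

text \<open>The (open) unit squares are the components of the preimage of \<open>(0,1) \<times> (0,1)\<close>.\<close>

definition unit_squares :: "'a::t2_space flat_structure \<Rightarrow> ('a \<Rightarrow> torus) \<Rightarrow> 'a set set" where
  "unit_squares X \<rho> =
     components {x \<in> pts X. \<exists>s t. 0 < s \<and> s < 1 \<and> 0 < t \<and> t < 1 \<and> \<rho> x = abs_torus (Complex s t)}"

definition square_tiled :: "'a::t2_space flat_structure \<Rightarrow> nat \<Rightarrow> bool" where
  "square_tiled X N \<longleftrightarrow>
     (\<exists>\<rho>. square_covering X \<rho> \<and> finite (unit_squares X \<rho>) \<and> card (unit_squares X \<rho>) = N)"

definition reduced_origami :: "'a::t2_space flat_structure \<Rightarrow> bool" where
  "reduced_origami X \<longleftrightarrow> group_closure (Hol X) = gauss_ints"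

text \<open>
  The degree of \<open>\<rho> \<circ> \<gamma>\<close> onto its image, read off from the period. Since the signs of \<open>p\<close>, \<open>q\<close> are free, the sign of the period is
  irrelevant.
\<close>

definition multiplicity :: "'a::t2_space flat_structure \<Rightarrow> (real \<Rightarrow> 'a) \<Rightarrow> nat" where
  "multiplicity X \<gamma> =
     (THE m. \<exists>p q :: int. coprime p q \<and>
        has_period X \<gamma> (of_nat m * Complex (of_int p) (of_int q)))"

definition mult_coslope :: "'a::t2_space flat_structure \<Rightarrow> rat \<Rightarrow> nat" where
  "mult_coslope X r =
     (LEAST m. \<exists>\<gamma> v c. saddle_connection X \<gamma> \<and> has_period X \<gamma> v \<and> m = multiplicity X \<gamma> \<and>
        (case quotient_of r of (p, q) \<Rightarrow> v = of_real c * Complex (of_int p) (of_int q)))"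

definition M_plus :: "'a::t2_space flat_structure \<Rightarrow> nat" where
  "M_plus X = Max (range (mult_coslope X))"

definition M_minus :: "'a::t2_space flat_structure \<Rightarrow> nat" where
  "M_minus X = Min (range (mult_coslope X))"

definition translation_equivalent ::
    "'a::t2_space flat_structure \<Rightarrow> 'a flat_structure \<Rightarrow> bool" where
  "translation_equivalent X Y \<longleftrightarrow>
     (\<exists>h k. homeomorphism (pts X) (pts Y) h k \<and> h ` sing X = sing Y \<and>
        (\<forall>U f. U \<subseteq> pts Y \<longrightarrow> ((U, f) \<in> charts Y \<longleftrightarrow> (k ` U, f \<circ> h) \<in> charts X)))"

text \<open>The orbit \<open>SL(2,\<int>) \<cdot> X\<close>, as a set of isomorphism classes of translation surfaces.\<close>

definition SL2Z_orbit :: "'a::t2_space flat_structure \<Rightarrow> 'a flat_structure set set" where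
  "SL2Z_orbit X =
     (let E = (\<lambda>A. act A X) ` SL2Z
      in E // {(Y, Z). Y \<in> E \<and> Z \<in> E \<and> translation_equivalent Y Z})"

definition parabolic :: "real^2^2" where
  "parabolic = vector [vector [1, 1], vector [0, 1]]"

definition cycle_length :: "'a flat_structure set \<Rightarrow> nat" where
  "cycle_length C = card {((\<lambda>D. act parabolic ` D) ^^ k) C | k. True}"

definition cusp_width :: "'a::t2_space flat_structure \<Rightarrow> nat" where
  "cusp_width X = Max (cycle_length ` SL2Z_orbit X)"

definition r_bound :: "'a::t2_space flat_structure \<Rightarrow> nat \<Rightarrow> real" where
  "r_bound X N = real N / real (M_minus X) ^ 2 *
     real (max (2 * M_plus X ^ 2 + 1) (max 7 (cusp_width X + 2)))"

end

theory Submission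
  imports Defs "HOL-Combinatorics.Permutations"
begin

text \<open>
  A basis \<open>(v, w)\<close> of \<open>\<int>\<^sup>2\<close> cuts \<open>X\<close> into \<open>N\<close> parallelograms, and the multiplicity of the direction
  \<open>v\<close> can be read off from the type of this tiling: the two permutations that glue the parallelograms
  along \<open>v\<close> and \<open>w\<close>, and the set of parallelograms with a conical corner. There are finitely many
  types, and the basis changes \<open>(v, w + v)\<close> and \<open>(v + w, w)\<close> permute them. Along a continued fraction
  the types of consecutive convergents therefore follow an action of a pair of permutations, and by
  recurrence any finite word can be extended by digits 1 and 2 to reach a type of minimal
  multiplicity \<open>M\<^sup>-\<close>.

  By an argument of Hall, every \<open>R \<ge> 7\<close> is a digit plus two continued fractions with digits at most 4.
  Placing ever longer pieces of this expansion at convergents of minimal multiplicity yields \<open>\<alpha>\<close> with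
  \<open>limsup (\<zeta>\<^sub>n + \<beta>\<^sub>n) = R\<close>, where \<open>1 / (\<zeta>\<^sub>n + \<beta>\<^sub>n)\<close> is the area of a convergent, and the limsup is
  attained along saddle connections of multiplicity \<open>M\<^sup>-\<close>. Since \<open>R \<ge> 4\<close>, periods that are not
  multiples of a convergent do not lower the liminf of areas. Hence shearing co-slope \<open>\<alpha>\<close> to the vertical gives a surface with
  \<open>1 / a = R N / (M\<^sup>-)\<^sup>2\<close>.
\<close>

section \<open>Sums of two continued fractions\<close>

text \<open>Sums of two expansions with digits at most 4 approximate every number of an interval of
  length 1, so one free digit \<open>A\<close> is enough to reach any \<open>R\<close>. The bound 7
  makes \<open>A\<close> at least 6, while an index with digit at most 4 contributes at most 5 + 1:
  only the planted digits can govern the limsup. Finite words suffice because their error is uniform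
  over all tails in [0, 1], so that blocks can be chained freely. Steering can only run forward and
  with small digits. On a finite set of types running forward long enough also undoes a prefix. Base
  changes alternate between the two vectors, so words are kept at even length and planted digits sit
  at even indices. The geometric obstacle is that the covering is given locally and may ramify over
  the lattice, just where saddle connections begin and end. Open strips between lattice lines avoid
  the lattice and can be lifted; the lift extends to the closed strip, whose edge carries the saddle
  connections. The fibre over the centre of a parallelogram changes with the basis, hence types live
  on fixed labels and are tied to fibres by some bijection.\<close>

text \<open>
  Hall's argument: in a sum of two intervals, the longer gap is removed from the interval that
  carries it, and the other interval is long enough to keep the sum covered.
\<close>

lemma sum_of_trees:
  fixes lo hi g :: "'n \<Rightarrow> real" and rank :: "'n \<Rightarrow> nat"
  assumes split: "\<And>n. n \<in> S \<Longrightarrow> \<exists>n1\<in>S. \<exists>n2\<in>S. rank n < rank n1 \<and> rank n < rank n2 \<and>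
      lo n1 \<le> lo n \<and> hi n \<le> hi n2 \<and> lo n2 - hi n1 \<le> g n \<and>
      g n \<le> hi n1 - lo n1 \<and> g n \<le> hi n2 - lo n2 \<and> g n1 \<le> g n \<and> g n2 \<le> g n"
    and bound: "\<And>n. n \<in> S \<Longrightarrow> \<eta> \<le> g n \<Longrightarrow> rank n \<le> B"
    and "n \<in> S" "m \<in> S" "lo n + lo m \<le> x" "x \<le> hi n + hi m"
    and "g n \<le> hi m - lo m" "g m \<le> hi n - lo n"
  shows "\<exists>n\<in>S. \<exists>m\<in>S. lo n + lo m \<le> x \<and> x \<le> hi n + hi m \<and> g n < \<eta> \<and> g m < \<eta>"
  using assms(3-)
\<comment> \<open>Only a node with gap at least \<eta> is refined; its rank is at most
  \<open>B\<close> and grows strictly, so the truncated difference decreases.\<close>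
proof (induction "(Suc B - rank n) + (Suc B - rank m)" arbitrary: n m rule: less_induct)
  case less
  \<comment> \<open>The invariant that each gap is at most the length of the other interval
    survives, because \<open>g m <= g n\<close> and \<open>g n\<close> is at most the length of each
    child.\<close>
  have step: "\<exists>n'\<in>S. rank n < rank n' \<and> lo n' + lo m \<le> x \<and> x \<le> hi n' + hi m \<and>
      g n' \<le> hi m - lo m \<and> g m \<le> hi n' - lo n'"
    if "n \<in> S" "lo n + lo m \<le> x" "x \<le> hi n + hi m" "g n \<le> hi m - lo m" "g m \<le> g n" for n m
  proof -
    obtain n1 n2 where n: "n1 \<in> S" "n2 \<in> S" "rank n < rank n1" "rank n < rank n2"
      "lo n1 \<le> lo n" "hi n \<le> hi n2" "lo n2 - hi n1 \<le> g n"
      "g n \<le> hi n1 - lo n1" "g n \<le> hi n2 - lo n2" "g n1 \<le> g n" "g n2 \<le> g n"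
      using split[OF \<open>n \<in> S\<close>] by blast
    show ?thesis
    proof (cases "x \<le> hi n1 + hi m")
      case True
      with n that show ?thesis by (intro bexI[of _ n1]) auto
    next
      case False
      with n that show ?thesis by (intro bexI[of _ n2]) auto
    qed
  qed
  show ?case
  proof (cases "g n < \<eta> \<and> g m < \<eta>")
    case True
    with less.prems show ?thesis by blast
  next
    case False
    show ?thesis
    proof (cases "g m \<le> g n")
      case True
      with False have "rank n \<le> B" using bound[OF \<open>n \<in> S\<close>] by linarith
      obtain n' where n': "n' \<in> S" "rank n < rank n'" "lo n' + lo m \<le> x" "x \<le> hi n' + hi m"
         "g n' \<le> hi m - lo m" "g m \<le> hi n' - lo n'"
        using step[of n m] less.prems True by blast
      show ?thesis
        by (rule less.hyps[of n' m]) (use n' \<open>rank n \<le> B\<close> less.prems in auto)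
    next
      case g: False
      with False have "rank m \<le> B" using bound[OF \<open>m \<in> S\<close>] by linarith
      obtain n' where n': "n' \<in> S" "rank m < rank n'" "lo n' + lo n \<le> x" "x \<le> hi n' + hi n"
         "g n' \<le> hi n - lo n" "g n \<le> hi n' - lo n'"
        using step[of m n] less.prems g by (force simp: add.commute)
      show ?thesis
        by (rule less.hyps[of n n']) (use n' \<open>rank m \<le> B\<close> less.prems in auto)
    qed
  qed
qed

section \<open>Continued fractions as Moebius maps of the tail\<close>

fun cfe :: "nat list \<Rightarrow> real \<Rightarrow> real" where
  "cfe [] t = t"
| "cfe (d # ds) t = 1 / (real d + cfe ds t)"

lemma cfe_append: "cfe (v @ w) t = cfe v (cfe w t)"
  by (induction v) auto

text \<open>\<open>cfe w (1 / y) = (p y + p') / (q y + q')\<close>; appending a digit on the right is the usual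
  recursion for numerators and denominators.\<close>

definition mob_step :: "nat \<Rightarrow> real \<times> real \<times> real \<times> real \<Rightarrow> real \<times> real \<times> real \<times> real" where
  "mob_step d = (\<lambda>(p, p', q, q'). (real d * p + p', p, real d * q + q', q))"

definition mob :: "nat list \<Rightarrow> real \<times> real \<times> real \<times> real" where
  "mob w = fold mob_step w (0, 1, 1, 0)"

definition "mobp w = fst (mob w)"
definition "mobp' w = fst (snd (mob w))"
definition "mobq w = fst (snd (snd (mob w)))"
definition "mobq' w = snd (snd (snd (mob w)))"

lemmas mob_sel_defs = mobp_def mobp'_def mobq_def mobq'_def

lemma mob_Nil [simp]: "mobp [] = 0" "mobp' [] = 1" "mobq [] = 1" "mobq' [] = 0"
  by (auto simp: mob_sel_defs mob_def)

lemma mob_snoc [simp]: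
  "mobp (w @ [d]) = real d * mobp w + mobp' w" "mobp' (w @ [d]) = mobp w"
  "mobq (w @ [d]) = real d * mobq w + mobq' w" "mobq' (w @ [d]) = mobq w"
  by (auto simp: mob_sel_defs mob_def mob_step_def split: prod.split)

text \<open>The facts are proved together since the linear growth of the denominators rests on
  \<open>mobq' w >= 1\<close> for nonempty words. That growth later limits the depth of nodes with a
  large gap; the determinant, 1 up to sign, turns differences of Moebius values into plain
  quotients.\<close>

lemma mob_bounds:
  assumes "\<forall>d\<in>set w. 1 \<le> d"
  shows "1 \<le> mobq w" "0 \<le> mobq' w" "mobq' w \<le> mobq w" "real (length w) \<le> mobq w"
    "w \<noteq> [] \<Longrightarrow> 1 \<le> mobq' w" "\<bar>mobp w * mobq' w - mobp' w * mobq w\<bar> = 1"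
  using assms
proof (induction w rule: rev_induct)
  case (snoc d w)
  { case 1
    then have "1 * mobq w \<le> real d * mobq w" using snoc.IH(1) by (intro mult_right_mono) auto
    moreover have "1 \<le> mobq w" "0 \<le> mobq' w" using 1 snoc.IH by auto
    ultimately show ?case unfolding mob_snoc by linarith }
  { case 2 then show ?case using snoc.IH by auto }
  { case 3
    then have "1 * mobq w \<le> real d * mobq w" using snoc.IH(1) by (intro mult_right_mono) auto
    moreover have "0 \<le> mobq' w" using 3 snoc.IH by auto
    ultimately show ?case unfolding mob_snoc by linarith }
  { case 4
    then have "1 * mobq w \<le> real d * mobq w" using snoc.IH(1) by (intro mult_right_mono) auto
    moreover have "real (length w) \<le> mobq w" "1 \<le> mobq w"
      "w \<noteq> [] \<Longrightarrow> 1 \<le> mobq' w" using 4 snoc.IH by auto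
    moreover have "mobq (w @ [d]) = real d * mobq w + mobq' w" "real (length (w @ [d])) = real (length w) + 1"
      by simp_all
    moreover have "w = [] \<Longrightarrow> real (length w) = 0" "0 \<le> mobq' w" using 4 snoc.IH by auto
    ultimately show ?case by (cases "w = []") linarith+ }
  { case 5 then show ?case using snoc.IH by auto }
  { case 6 then have "\<bar>mobp w * mobq' w - mobp' w * mobq w\<bar> = 1" using snoc.IH(6) by auto
    moreover have "mobp (w @ [d]) * mobq' (w @ [d]) - mobp' (w @ [d]) * mobq (w @ [d])
      = - (mobp w * mobq' w - mobp' w * mobq w)" by (simp add: algebra_simps)
    ultimately show ?case by simp }
qed auto

definition moeb :: "nat list \<Rightarrow> real \<Rightarrow> real" where
  "moeb w y = (mobp w * y + mobp' w) / (mobq w * y + mobq' w)"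

lemma moeb_pos: "\<forall>d\<in>set w. 1 \<le> d \<Longrightarrow> 0 < y \<Longrightarrow> 0 < mobq w * y + mobq' w"
  using mob_bounds(1,2)[of w] by (meson add_pos_nonneg less_le_trans mult_pos_pos zero_less_one)

lemma moeb_snoc:
  assumes "\<forall>d\<in>set w. 1 \<le> d" "0 < y"
  shows "moeb (w @ [d]) y = moeb w (real d + 1 / y)"
proof -
  have p: "mobq w * (real d + 1/y) + mobq' w \<noteq> 0"
    using moeb_pos[of w "real d + 1 / y"] assms by (auto simp: add_nonneg_pos)
  have "mobp w * (real d + 1/y) + mobp' w = (mobp (w @ [d]) * y + mobp' (w @ [d])) / y"
       "mobq w * (real d + 1/y) + mobq' w = (mobq (w @ [d]) * y + mobq' (w @ [d])) / y"
    using assms by (auto simp: field_simps)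
  then show ?thesis unfolding moeb_def using assms(2) by simp
qed

lemma cfe_eq_moeb:
  assumes "\<forall>d\<in>set w. 1 \<le> d" "0 < y"
  shows "cfe w (1 / y) = moeb w y"
  using assms
proof (induction w arbitrary: y rule: rev_induct)
  case Nil then show ?case by (simp add: moeb_def)
next
  case (snoc d w)
  have "cfe (w @ [d]) (1 / y) = cfe w (1 / (real d + 1 / y))" by (simp add: cfe_append)
  also have "\<dots> = moeb w (real d + 1 / y)" using snoc by (intro snoc.IH) (auto simp: add_pos_pos)
  also have "\<dots> = moeb (w @ [d]) y" using snoc.prems by (subst moeb_snoc) auto
  finally show ?case .
qed

lemma moeb_diff:
  assumes "\<forall>d\<in>set w. 1 \<le> d" "0 < x" "0 < y"
  shows "moeb w x - moeb w y = (mobp w * mobq' w - mobp' w * mobq w) * (x - y) /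
     ((mobq w * x + mobq' w) * (mobq w * y + mobq' w))"
  using moeb_pos[OF assms(1,2)] moeb_pos[OF assms(1,3)]
  by (simp add: moeb_def field_simps)

text \<open>Up to sign the difference of two values is \<open>t' - t\<close> divided by two
  denominators, each of them at least \<open>mobq w\<close> and hence at least 1.\<close>

lemma cfe_diff:
  assumes w: "\<forall>d\<in>set w. 1 \<le> d" and "0 \<le> t" "t \<le> 1" "0 \<le> t'" "t' \<le> 1"
  shows "\<bar>cfe w t - cfe w t'\<bar> \<le> 1 / mobq w"
proof -
  have E: "cfe w t = (mobp w + mobp' w * t) / (mobq w + mobq' w * t)" if "0 \<le> t" for t
  proof (cases "t = 0")
    case False
    then have "mobp w * (1/t) + mobp' w = (mobp w + mobp' w * t) / t"
      "mobq w * (1/t) + mobq' w = (mobq w + mobq' w * t) / t" by (auto simp: field_simps)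
    moreover have "cfe w t = moeb w (1/t)" using cfe_eq_moeb[of w "1/t"] w that False by simp
    ultimately show ?thesis using False by (simp add: moeb_def)
  next
    \<comment> \<open>The tail 0 is not of the form \<open>1 / y\<close>; the last digit of
      \<open>w\<close> takes the role of \<open>y\<close> instead.\<close>
    case True
    show ?thesis
    proof (cases w rule: rev_cases)
      case (snoc v d)
      have "cfe w 0 = cfe v (1 / real d)" by (simp add: snoc cfe_append)
      also have "\<dots> = moeb v (real d)" using w by (intro cfe_eq_moeb) (auto simp: snoc)
      finally show ?thesis using True by (simp add: snoc moeb_def mult.commute)
    qed (use True in simp)
  qed
  define Q where "Q t = mobq w + mobq' w * t" for t
  have q: "1 \<le> mobq w" "0 \<le> mobq' w" using mob_bounds[of w] w by auto
  have Q: "mobq w \<le> Q t" "mobq w \<le> Q t'" using q assms by (auto simp: Q_def)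
  have "cfe w t - cfe w t' = (mobp w * mobq' w - mobp' w * mobq w) * (t' - t) / (Q t * Q t')"
    unfolding E[OF \<open>0 \<le> t\<close>] E[OF \<open>0 \<le> t'\<close>] Q_def[symmetric]
    using Q q by (simp add: divide_simps) (simp add: Q_def algebra_simps)
  then have "\<bar>cfe w t - cfe w t'\<bar> = \<bar>t' - t\<bar> / (Q t * Q t')"
    using mob_bounds(6)[OF w] Q q by (simp add: abs_mult)
  also have "\<dots> \<le> 1 / (mobq w * 1)"
    using Q q assms by (intro frac_le mult_mono) auto
  finally show ?thesis by simp
qed

text \<open>
  The continued fractions with digits in \<open>{1..4}\<close> lie in \<open>[0.207, 0.829]\<close>; the interval \<open>[hs, ht]\<close> is
  slightly smaller, chosen rational and such that \<open>[1/(4 + ht), 1/(1 + hs)]\<close> contains it. The node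
  \<open>(w, i)\<close> is the interval of the expansions with prefix \<open>w\<close> and next digit in \<open>{i..4}\<close>; splitting off
  the digit \<open>i\<close> removes an open interval of length \<open>node_gap\<close>.
\<close>

definition "hs = (22/100 :: real)"
definition "ht = (81/100 :: real)"

definition ends :: "nat list \<times> nat \<Rightarrow> real \<times> real" where
  "ends = (\<lambda>(w, i). (moeb w (real i + hs), moeb w (4 + ht)))"

definition "node_lo n = min (fst (ends n)) (snd (ends n))"
definition "node_hi n = max (fst (ends n)) (snd (ends n))"
definition node_gap :: "nat list \<times> nat \<Rightarrow> real" where
  "node_gap = (\<lambda>(w, i). (1 + hs - ht) /
     ((mobq w * (real i + ht) + mobq' w) * (mobq w * (real i + 1 + hs) + mobq' w)))"

definition "nodes = {(w, i). set w \<subseteq> {1..4::nat} \<and> i \<in> {1..3::nat}}"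

definition node_rank :: "nat list \<times> nat \<Rightarrow> nat" where
  "node_rank = (\<lambda>(w, i). 3 * length w + i)"

lemma node_length:
  assumes "\<forall>d\<in>set w. 1 \<le> d" "0 < x" "0 < y"
  shows "\<bar>moeb w x - moeb w y\<bar> = \<bar>x - y\<bar> / ((mobq w * x + mobq' w) * (mobq w * y + mobq' w))"
  unfolding moeb_diff[OF assms] using moeb_pos[OF assms(1,2)] moeb_pos[OF assms(1,3)] mob_bounds(6)[OF assms(1)]
  by (simp add: abs_mult)

text \<open>Whether the map preserves order depends on the sign of the determinant, hence on the
  parity of the length of \<open>w\<close>. In the decreasing case the two children of a node change
  sides.\<close>

lemma moeb_mono_cases:
  assumes "\<forall>d\<in>set w. 1 \<le> d"
  obtains "\<And>x y. 0 < x \<Longrightarrow> x \<le> y \<Longrightarrow> moeb w x \<le> moeb w y"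
  | "\<And>x y. 0 < x \<Longrightarrow> x \<le> y \<Longrightarrow> moeb w y \<le> moeb w x"
proof -
  define s where "s = mobp w * mobq' w - mobp' w * mobq w"
  have D: "moeb w x - moeb w y = s * (x - y) / ((mobq w * x + mobq' w) * (mobq w * y + mobq' w))"
    "0 < (mobq w * x + mobq' w) * (mobq w * y + mobq' w)" if "0 < x" "0 < y" for x y
    using moeb_diff[OF assms that] moeb_pos[OF assms that(1)] moeb_pos[OF assms that(2)] by (auto simp: s_def)
  have "\<bar>s\<bar> = 1" using mob_bounds(6)[OF assms] by (simp add: s_def)
  then consider "s = 1" | "s = -1" by linarith
  then show ?thesis
  proof cases
    case 1
    have "moeb w x - moeb w y \<le> 0" if "0 < x" "x \<le> y" for x y
      using D[of x y] that 1 by (simp add: divide_nonpos_pos)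
    then show ?thesis using that(1) by force
  next
    case 2
    have "0 \<le> moeb w x - moeb w y" if "0 < x" "x \<le> y" for x y
      using D[of x y] that 2 by (simp add: divide_nonneg_pos)
    then show ?thesis using that(2) by force
  qed
qed

text \<open>The factor \<open>q * (i + ht) + q'\<close> is common to both sides. What remains
  follows from \<open>1 + hs - ht <= ht - hs\<close>, that is 0.41 <= 0.59.\<close>

lemma gap_le_left:
  fixes q q' i :: real
  assumes "0 < q" "0 \<le> q'" "1 \<le> i"
  shows "(1 + hs - ht) / ((q * (i + ht) + q') * (q * (i + 1 + hs) + q'))
     \<le> (ht - hs) / ((q * (i + hs) + q') * (q * (i + ht) + q'))"
proof -
  have p: "0 < q * (i + hs) + q'" "0 < q * (i + ht) + q'" "0 < q * (i + 1 + hs) + q'"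
    using assms by (auto simp: hs_def ht_def intro!: add_pos_nonneg mult_pos_pos)
  have "(1 + hs - ht) * (q * (i + hs) + q') \<le> (ht - hs) * (q * (i + 1 + hs) + q')"
    using assms p(1) by (intro mult_mono) (auto simp: hs_def ht_def algebra_simps)
  then have "(1 + hs - ht) / (q * (i + 1 + hs) + q') \<le> (ht - hs) / (q * (i + hs) + q')"
    using p by (simp add: divide_simps)
  then have "(1 + hs - ht) / (q * (i + 1 + hs) + q') / (q * (i + ht) + q')
     \<le> (ht - hs) / (q * (i + hs) + q') / (q * (i + ht) + q')"
    using p by (intro divide_right_mono) auto
  then show ?thesis by (simp add: mult.commute)
qed

text \<open>The factor \<open>q * (i + 1 + hs) + q'\<close> cancels; then the coefficients of
  \<open>q\<close> and of \<open>q'\<close> are compared separately.\<close>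

lemma gap_le_right:
  fixes q q' i :: real
  assumes "0 < q" "0 \<le> q'" "1 \<le> i" "i \<le> 3"
  shows "(1 + hs - ht) / ((q * (i + ht) + q') * (q * (i + 1 + hs) + q'))
     \<le> (3 - i + ht - hs) / ((q * (i + 1 + hs) + q') * (q * (4 + ht) + q'))"
proof -
  have p: "0 < q * (i + ht) + q'" "0 < q * (4 + ht) + q'" "0 < q * (i + 1 + hs) + q'"
    using assms by (auto simp: hs_def ht_def intro!: add_pos_nonneg mult_pos_pos)
  \<comment> \<open>The right-hand side of the next inequality is concave in \<open>i\<close>, so
    the endpoints 1 and 3 are the critical cases; this product linearises it.\<close>
  have "0 \<le> (3 - i) * (i - 1)" using assms by simp
  then have "(1 + hs - ht) * (4 + ht) \<le> (3 - i + ht - hs) * (i + ht)"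
    using assms by (simp add: hs_def ht_def algebra_simps)
  then have "q * ((1 + hs - ht) * (4 + ht)) \<le> q * ((3 - i + ht - hs) * (i + ht))"
    using assms by (intro mult_left_mono) auto
  moreover have "(1 + hs - ht) * q' \<le> (3 - i + ht - hs) * q'"
    using assms by (intro mult_right_mono) (auto simp: hs_def ht_def)
  ultimately have "(1 + hs - ht) * (q * (4 + ht) + q') \<le> (3 - i + ht - hs) * (q * (i + ht) + q')"
    by (simp add: algebra_simps)
  then have "(1 + hs - ht) / (q * (i + ht) + q') \<le> (3 - i + ht - hs) / (q * (4 + ht) + q')"
    using p by (simp add: divide_simps)
  then have "(1 + hs - ht) / (q * (i + ht) + q') / (q * (i + 1 + hs) + q')
     \<le> (3 - i + ht - hs) / (q * (4 + ht) + q') / (q * (i + 1 + hs) + q')"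
    using p by (intro divide_right_mono) auto
  then show ?thesis by (simp add: mult.commute)
qed

lemma node_gap_Suc: 
  assumes "\<forall>d\<in>set w. 1 \<le> d" "1 \<le> i"
  shows "node_gap (w, Suc i) \<le> node_gap (w, i)"
proof -
  have q: "1 \<le> mobq w" "0 \<le> mobq' w" using mob_bounds[of w] assms by auto
  show ?thesis unfolding node_gap_def prod.case
    by (rule divide_left_mono)
       (use q assms(2) in \<open>auto simp: hs_def ht_def intro!: mult_mono add_pos_nonneg mult_pos_pos\<close>)
qed

lemma node_gap_snoc: 
  assumes "\<forall>d\<in>set w. 1 \<le> d" "1 \<le> i" "i \<le> d"
  shows "node_gap (w @ [d], 1) \<le> node_gap (w, i)"
proof -
  define q q' where "q = mobq w" "q' = mobq' w"
  have q: "1 \<le> q" "0 \<le> q'" using mob_bounds[of w] assms by (auto simp: q_q'_def)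
  have i: "1 \<le> real i" "real i \<le> real d" using assms by auto
  have "q * real i \<le> q * real d" "q * 1 \<le> q * real i" "0 \<le> q * real d"
    using q i by (auto intro: mult_left_mono)
  note m = this
  have "q * (real i + ht) + q' \<le> (real d * q + q') * (1 + ht) + q"
    unfolding ht_def distrib_left distrib_right using m q
    by (simp only: mult.commute[of q "real d"])
  moreover have "q * (real i + 1 + hs) + q' \<le> (real d * q + q') * (1 + 1 + hs) + q"
    unfolding hs_def distrib_left distrib_right using m q
    by (simp only: mult.commute[of q "real d"])
  moreover have "0 < q * (real i + ht) + q'" "0 < q * (real i + 1 + hs) + q'"
    using q i by (auto simp: hs_def ht_def intro!: add_pos_nonneg mult_pos_pos)
  ultimately show ?thesis unfolding node_gap_def prod.case mob_snoc q_q'_def[symmetric] of_nat_1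
    by (intro divide_left_mono mult_mono mult_pos_pos) (auto simp: hs_def ht_def)
qed

text \<open>Here \<open>1 / (4 + ht) <= hs\<close> and \<open>ht <= 1 / (1 + hs)\<close> enter: the
  tails allowed after the digit \<open>d\<close> cover at least \<open>[hs, ht]\<close>.\<close>

lemma digit_interval:
  assumes w: "\<forall>d\<in>set w. 1 \<le> d" and d: "1 \<le> d"
  shows "node_lo (w @ [d], 1) \<le> min (moeb w (real d + hs)) (moeb w (real d + ht))"
    "max (moeb w (real d + hs)) (moeb w (real d + ht)) \<le> node_hi (w @ [d], 1)"
proof -
  have wd: "\<forall>d\<in>set (w @ [d]). 1 \<le> d" using w d by auto
  have e: "ends (w @ [d], 1) = (moeb w (real d + 1 / (1 + hs)), moeb w (real d + 1 / (4 + ht)))"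
    unfolding ends_def prod.case of_nat_1 by (subst (1 2) moeb_snoc) (use w in \<open>auto simp: hs_def ht_def\<close>)
  have o: "0 < real d + 1 / (4 + ht)" "real d + 1 / (4 + ht) \<le> real d + hs"
    "real d + hs \<le> real d + ht" "real d + ht \<le> real d + 1 / (1 + hs)"
    by (auto simp: hs_def ht_def add_nonneg_pos)
  have p: "0 < real d + hs" "0 < real d + ht" using o by auto
  have "node_lo (w @ [d], 1) \<le> min (moeb w (real d + hs)) (moeb w (real d + ht)) \<and>
    max (moeb w (real d + hs)) (moeb w (real d + ht)) \<le> node_hi (w @ [d], 1)"
    using w
  proof (cases rule: moeb_mono_cases)
    case 1
    note m = 1[OF o(1,2)] 1[OF p(1) o(3)] 1[OF p(2) o(4)]
    show ?thesis unfolding node_lo_def node_hi_def e using m by auto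
  next
    case 2
    note m = 2[OF o(1,2)] 2[OF p(1) o(3)] 2[OF p(2) o(4)]
    show ?thesis unfolding node_lo_def node_hi_def e using m by auto
  qed
  then show "node_lo (w @ [d], 1) \<le> min (moeb w (real d + hs)) (moeb w (real d + ht))"
    "max (moeb w (real d + hs)) (moeb w (real d + ht)) \<le> node_hi (w @ [d], 1)" by auto
qed

text \<open>The left child fixes the digit \<open>i\<close>, the right one demands a larger digit.
  For \<open>i = 3\<close> only the digit 4 remains, so the right child is a longer word rather than
  a range of digits.\<close>

lemma node_children:
  assumes "n \<in> nodes"
  obtains l r w i where "l \<in> nodes" "r \<in> nodes" "n = (w, i)"
     "node_rank n < node_rank l" "node_rank n < node_rank r"
     "node_gap l \<le> node_gap n" "node_gap r \<le> node_gap n"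
     "node_lo l \<le> min (moeb w (real i + hs)) (moeb w (real i + ht))"
     "max (moeb w (real i + hs)) (moeb w (real i + ht)) \<le> node_hi l"
     "node_lo r \<le> min (moeb w (real i + 1 + hs)) (moeb w (4 + ht))"
     "max (moeb w (real i + 1 + hs)) (moeb w (4 + ht)) \<le> node_hi r"
     "\<forall>d\<in>set w. 1 \<le> d" "1 \<le> i" "i \<le> 3"
proof -
  obtain w i where n: "n = (w, i)" "set w \<subseteq> {1..4}" "1 \<le> i" "i \<le> 3"
    using assms by (auto simp: nodes_def)
  have w: "\<forall>d\<in>set w. 1 \<le> d" using n by auto
  define l where "l = (w @ [i], 1::nat)"
  have l: "l \<in> nodes" "node_rank n < node_rank l" "node_gap l \<le> node_gap n"
    "node_lo l \<le> min (moeb w (real i + hs)) (moeb w (real i + ht))"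
    "max (moeb w (real i + hs)) (moeb w (real i + ht)) \<le> node_hi l"
    using n w node_gap_snoc[of w i i] digit_interval[of w i]
    by (auto simp: l_def nodes_def node_rank_def)
  show ?thesis
  proof (cases "i = 3")
    case True
    define r where "r = (w @ [4], 1::nat)"
    have "r \<in> nodes" "node_rank n < node_rank r" "node_gap r \<le> node_gap n"
      "node_lo r \<le> min (moeb w (real i + 1 + hs)) (moeb w (4 + ht))"
      "max (moeb w (real i + 1 + hs)) (moeb w (4 + ht)) \<le> node_hi r"
      using n w node_gap_snoc[of w 3 4] digit_interval[of w 4] True
      by (auto simp: r_def nodes_def node_rank_def)
    then show ?thesis using that[of l r w i] l n w by simp
  next
    case False
    define r where "r = (w, Suc i)"
    have "r \<in> nodes" "node_rank n < node_rank r" "node_gap r \<le> node_gap n"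
      "node_lo r \<le> min (moeb w (real i + 1 + hs)) (moeb w (4 + ht))"
      "max (moeb w (real i + 1 + hs)) (moeb w (4 + ht)) \<le> node_hi r"
      using n w node_gap_Suc[of w i] False
      by (auto simp: r_def nodes_def node_rank_def node_lo_def node_hi_def ends_def add.commute)
    then show ?thesis using that[of l r w i] l n w by simp
  qed
qed

lemma node_split:
  assumes "n \<in> nodes"
  shows "\<exists>n1\<in>nodes. \<exists>n2\<in>nodes. node_rank n < node_rank n1 \<and> node_rank n < node_rank n2 \<and>
      node_lo n1 \<le> node_lo n \<and> node_hi n \<le> node_hi n2 \<and> node_lo n2 - node_hi n1 \<le> node_gap n \<and>
      node_gap n \<le> node_hi n1 - node_lo n1 \<and> node_gap n \<le> node_hi n2 - node_lo n2 \<and>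
      node_gap n1 \<le> node_gap n \<and> node_gap n2 \<le> node_gap n"
proof -
  obtain l r w i where n: "l \<in> nodes" "r \<in> nodes" "n = (w, i)"
     "node_rank n < node_rank l" "node_rank n < node_rank r"
     "node_gap l \<le> node_gap n" "node_gap r \<le> node_gap n"
     and b: "node_lo l \<le> min (moeb w (real i + hs)) (moeb w (real i + ht))"
     "max (moeb w (real i + hs)) (moeb w (real i + ht)) \<le> node_hi l"
     "node_lo r \<le> min (moeb w (real i + 1 + hs)) (moeb w (4 + ht))"
     "max (moeb w (real i + 1 + hs)) (moeb w (4 + ht)) \<le> node_hi r"
     and w: "\<forall>d\<in>set w. 1 \<le> d" and i: "1 \<le> i" "i \<le> 3"
    using node_children[OF assms] by metis
  have q: "1 \<le> mobq w" "0 \<le> mobq' w" using mob_bounds[of w] w by auto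
  have pos: "0 < real i + hs" "0 < real i + ht" "0 < real i + 1 + hs" "0 < 4 + ht"
    by (auto simp: hs_def ht_def add_nonneg_pos)
  have le: "real i + hs \<le> real i + ht" "real i + ht \<le> real i + 1 + hs" "real i + 1 + hs \<le> 4 + ht"
    using i by (auto simp: hs_def ht_def)
  have gl: "node_gap n \<le> \<bar>moeb w (real i + hs) - moeb w (real i + ht)\<bar>"
    unfolding node_length[OF w pos(1,2)] n(3) node_gap_def prod.case
    using gap_le_left[of "mobq w" "mobq' w" "real i"] q i by (simp add: hs_def ht_def)
  have gr: "node_gap n \<le> \<bar>moeb w (real i + 1 + hs) - moeb w (4 + ht)\<bar>"
  proof -
    have "\<bar>real i + 1 + hs - (4 + ht)\<bar> = 3 - real i + ht - hs" using le by (simp add: hs_def ht_def)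
    then show ?thesis
    unfolding node_length[OF w pos(3,4)] n(3) node_gap_def prod.case
    using gap_le_right[of "mobq w" "mobq' w" "real i"] q i by simp
  qed
  have gg: "node_gap n = \<bar>moeb w (real i + ht) - moeb w (real i + 1 + hs)\<bar>"
    unfolding node_length[OF w pos(2,3)] n(3) node_gap_def prod.case
    by (simp add: hs_def ht_def)
  have lr: "node_gap n \<le> node_hi l - node_lo l" "node_gap n \<le> node_hi r - node_lo r"
    using gl gr b by auto
  have nlh: "node_lo n = min (moeb w (real i + hs)) (moeb w (4 + ht))"
    "node_hi n = max (moeb w (real i + hs)) (moeb w (4 + ht))"
    by (auto simp: node_lo_def node_hi_def ends_def n(3))
  show ?thesis
    using w
  proof (cases rule: moeb_mono_cases)
    case 1
    note m = 1[OF pos(1) le(1)] 1[OF pos(2) le(2)] 1[OF pos(3) le(3)]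
    show ?thesis using n lr
      by (intro bexI[of _ l] bexI[of _ r] conjI) (use m b gg in \<open>auto simp: nlh[unfolded n(3)]\<close>)
  next
    case 2
    note m = 2[OF pos(1) le(1)] 2[OF pos(2) le(2)] 2[OF pos(3) le(3)]
    show ?thesis using n lr
      by (intro bexI[of _ r] bexI[of _ l] conjI) (use m b gg in \<open>auto simp: nlh[unfolded n(3)]\<close>)
  qed
qed

text \<open>The first bound makes words with a large gap short. The second makes a small gap a large
  denominator and so, by \<open>cfe_diff\<close>, the influence of the tail negligible; its constant
  comes from \<open>i <= 3\<close> and \<open>q' <= q\<close>.\<close>

lemma node_gap_bounds:
  assumes "(w, i) \<in> nodes"
  shows "node_gap (w, i) \<le> 1 / mobq w" "1 / mobq w ^ 2 \<le> 100 * node_gap (w, i)" 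
proof -
  have w: "\<forall>d\<in>set w. 1 \<le> d" and i: "1 \<le> i" "i \<le> 3" using assms by (auto simp: nodes_def)
  define q q' where "q = mobq w" "q' = mobq' w"
  have q: "1 \<le> q" "0 \<le> q'" "q' \<le> q" using mob_bounds[of w] w by (auto simp: q_q'_def)
  have i': "1 \<le> real i" "real i \<le> 3" using i by auto
  have m: "q * 1 \<le> q * real i" "q * real i \<le> q * 3" using q i' by (auto intro: mult_left_mono)
  have a: "q \<le> q * (real i + ht) + q'" "1 \<le> q * (real i + 1 + hs) + q'"
    unfolding hs_def ht_def distrib_left using m q by linarith+
  have b: "q * (real i + ht) + q' \<le> 5 * q" "q * (real i + 1 + hs) + q' \<le> 6 * q"
    unfolding hs_def ht_def distrib_left using m q by linarith+
  have "node_gap (w, i) \<le> 1 / (q * 1)"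
    unfolding node_gap_def prod.case q_q'_def[symmetric]
    using a q by (intro frac_le mult_mono) (auto simp: hs_def ht_def)
  then show "node_gap (w, i) \<le> 1 / mobq w" by (simp add: q_q'_def)
  have "1 / (100 * q ^ 2) \<le> (1 + hs - ht) / (5 * q * (6 * q))"
    using q by (simp add: divide_simps hs_def ht_def power2_eq_square)
  also have "\<dots> \<le> node_gap (w, i)"
    unfolding node_gap_def prod.case q_q'_def[symmetric]
    using a b q by (intro divide_left_mono mult_mono mult_pos_pos) (auto simp: hs_def ht_def)
  finally show "1 / mobq w ^ 2 \<le> 100 * node_gap (w, i)" by (simp add: q_q'_def)
qed

theorem hall_approximation:
  assumes x: "45/100 \<le> x" "x \<le> 145/100" and e: "0 < \<epsilon>"
  obtains b c where "set b \<subseteq> {1..4}" "set c \<subseteq> {1..4}"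
    "\<And>t t'. 0 \<le> t \<Longrightarrow> t \<le> 1 \<Longrightarrow> 0 \<le> t' \<Longrightarrow> t' \<le> 1 \<Longrightarrow> \<bar>cfe b t + cfe c t' - x\<bar> < \<epsilon>"
proof -
  \<comment> \<open>A gap below \<eta> gives
    \<open>1 / q^2 < 100 * \<eta> = (\<epsilon> / 10)^2\<close>, so the tail changes the value of
    either word by less than \<open>\<epsilon> / 10\<close>.\<close>
  define \<eta> where "\<eta> = \<epsilon>^2 / 10000"
  \<comment> \<open>From \<open>\<eta> <= 1 / q\<close> and \<open>length w <= q\<close> the rank
    \<open>3 * length w + i\<close> is at most \<open>3 / \<eta> + 3\<close>.\<close>
  define B where "B = nat \<lceil>3 / \<eta>\<rceil> + 3"
  have eta: "0 < \<eta>" using e by (simp add: \<eta>_def)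
  have bound: "node_rank n \<le> B" if "n \<in> nodes" "\<eta> \<le> node_gap n" for n
  proof -
    obtain w i where wi: "n = (w, i)" by (cases n)
    then have n: "n = (w, i)" "\<forall>d\<in>set w. 1 \<le> d" "i \<le> 3"
      using that by (auto simp: nodes_def)
    have q: "1 \<le> mobq w" "length w \<le> mobq w" using mob_bounds[OF n(2)] by auto
    have "\<eta> \<le> 1 / mobq w" using that node_gap_bounds(1)[of w i] n by simp
    then have "mobq w \<le> 1 / \<eta>" using eta q by (simp add: field_simps)
    then have "real (3 * length w) \<le> 3 / \<eta>" using q by simp
    then show ?thesis using n unfolding B_def node_rank_def by simp linarith
  qed
  let ?n = "([]::nat list, 1::nat)"
  have n: "?n \<in> nodes" by (simp add: nodes_def)
  \<comment> \<open>The sum of two copies of the root interval is about [0.416, 1.639], which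
    contains the range of \<open>x\<close>.\<close>
  have E: "node_lo ?n = 1 / (4 + ht)" "node_hi ?n = 1 / (1 + hs)"
    by (auto simp: node_lo_def node_hi_def ends_def moeb_def hs_def ht_def)
  have G: "node_gap ?n \<le> node_hi ?n - node_lo ?n"
    unfolding E by (simp add: node_gap_def hs_def ht_def)
  obtain n m where nm: "n \<in> nodes" "m \<in> nodes" "node_lo n + node_lo m \<le> x" "x \<le> node_hi n + node_hi m"
     "node_gap n < \<eta>" "node_gap m < \<eta>"
    using sum_of_trees[of nodes node_rank node_lo node_hi node_gap \<eta> B, OF node_split bound n n, of x] G x
    unfolding E by (auto simp: hs_def ht_def)
  have dev: "\<bar>cfe w t - y\<bar> < \<epsilon> / 2"
    if "(w, i) \<in> nodes" "node_gap (w, i) < \<eta>" "0 \<le> t" "t \<le> 1" "node_lo (w, i) \<le> y" "y \<le> node_hi (w, i)" for w i t y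
  proof -
    have w: "\<forall>d\<in>set w. 1 \<le> d" and i: "1 \<le> i" "i \<le> 3" using that by (auto simp: nodes_def)
    have q: "1 \<le> mobq w" using mob_bounds[OF w] by auto
    have "1 / mobq w ^ 2 < 100 * \<eta>" using node_gap_bounds(2)[OF that(1)] that by linarith
    then have "(1 / mobq w) ^ 2 < (\<epsilon> / 10) ^ 2" by (simp add: \<eta>_def power_divide)
    then have sm: "1 / mobq w < \<epsilon> / 10" using power2_less_imp_less[of "1 / mobq w" "\<epsilon> / 10"] e by auto
    have ends: "ends (w, i) = (cfe w (1 / (real i + hs)), cfe w (1 / (4 + ht)))"
      unfolding ends_def prod.case by (subst (1 2) cfe_eq_moeb) (use w in \<open>auto simp: hs_def ht_def add_nonneg_pos\<close>)
    define A where "A = cfe w (1 / (real i + hs))"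
    define B where "B = cfe w (1 / (4 + ht))"
    define d where "d = 1 / mobq w"
    have "0 \<le> 1 / (real i + hs)" "1 / (real i + hs) \<le> 1" "0 \<le> 1 / (4 + ht)" "1 / (4 + ht) \<le> 1"
      using i by (auto simp: hs_def ht_def)
    then have "\<bar>cfe w t - A\<bar> \<le> d" "\<bar>cfe w t - B\<bar> \<le> d"
      unfolding A_def B_def d_def using that(3,4) by (auto intro!: cfe_diff w)
    moreover have "min A B \<le> y" "y \<le> max A B"
      using that(5,6) unfolding node_lo_def node_hi_def ends A_def B_def by auto
    moreover have "d < \<epsilon> / 10" using sm by (simp add: d_def)
    ultimately show ?thesis using e by (auto simp: min_def max_def abs_if split: if_splits)
  qed
  obtain b i c j where bc: "n = (b, i)" "m = (c, j)" by (cases n; cases m) auto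
  obtain y where y: "node_lo n \<le> y" "y \<le> node_hi n" "node_lo m \<le> x - y" "x - y \<le> node_hi m"
  proof -
    have "node_lo n \<le> node_hi n" "node_lo m \<le> node_hi m" by (auto simp: node_lo_def node_hi_def)
    then show ?thesis using nm(3,4) that[of "max (node_lo n) (x - node_hi m)"] by auto
  qed
  show ?thesis
  proof
    show "set b \<subseteq> {1..4}" "set c \<subseteq> {1..4}" using nm bc by (auto simp: nodes_def)
    fix t t' :: real assume t: "0 \<le> t" "t \<le> 1" "0 \<le> t'" "t' \<le> 1"
    have "\<bar>cfe b t - y\<bar> < \<epsilon> / 2" "\<bar>cfe c t' - (x - y)\<bar> < \<epsilon> / 2"
      using dev[of b i t y] dev[of c j t' "x - y"] t nm bc y by auto
    then show "\<bar>cfe b t + cfe c t' - x\<bar> < \<epsilon>" by linarith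
  qed
qed

section \<open>Continued fractions and the Lagrange value\<close>

lemma eventually_norm_filter:
  fixes g :: "'b \<Rightarrow> real"
  shows "eventually P (inf (filtercomap g at_top) (principal K)) \<longleftrightarrow> (\<exists>B. \<forall>v\<in>K. B \<le> g v \<longrightarrow> P v)"
  by (auto simp: eventually_inf_principal eventually_filtercomap_at_top_linorder)

lemma Liminf_real_eqI:
  fixes f :: "'b \<Rightarrow> real"
  assumes lo: "\<And>e. 0 < e \<Longrightarrow> eventually (\<lambda>x. c - e \<le> f x) F"
    and up: "\<And>e. 0 < e \<Longrightarrow> frequently (\<lambda>x. f x \<le> c + e) F"
  shows "Liminf F (\<lambda>x. ereal (f x)) = ereal c"
proof (rule antisym)
  show "Liminf F (\<lambda>x. ereal (f x)) \<le> ereal c"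
  proof (rule ccontr)
    assume "\<not> ?thesis"
    then obtain y where y: "ereal c < ereal y" "ereal y < Liminf F (\<lambda>x. ereal (f x))"
      using ereal_dense2 by (metis not_le)
    then have "eventually (\<lambda>x. y < f x) F" using less_LiminfD by fastforce
    then have "eventually (\<lambda>x. \<not> f x \<le> c + (y - c)) F" by (rule eventually_mono) auto
    then show False using up[of "y - c"] y by (simp add: frequently_def)
  qed
  show "ereal c \<le> Liminf F (\<lambda>x. ereal (f x))"
    unfolding le_Liminf_iff
  proof (intro allI impI)
    fix y :: ereal assume y: "y < ereal c"
    then obtain r where r: "y < ereal r" "r < c" using ereal_dense2 by fastforce
    show "\<forall>\<^sub>F x in F. y < ereal (f x)"
      using lo[of "c - r"] r
      by (auto elim!: eventually_mono) (meson ereal_less_eq(3) less_le_trans)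
  qed
qed

text \<open>
  The convergents \<open>P n / Q n\<close> start with \<open>0/1, 1/0\<close>, so that the digit \<open>a n\<close> first occurs in the
  convergent \<open>n + 2\<close> and \<open>\<alpha> = a 0 + 1/(a 1 + \<dots>)\<close>.
\<close>

locale cf_seq =
  fixes a :: "nat \<Rightarrow> nat"
  assumes a_pos: "1 \<le> a n"
begin

fun P :: "nat \<Rightarrow> nat" where
  "P 0 = 0" | "P (Suc 0) = 1" | "P (Suc (Suc n)) = a n * P (Suc n) + P n"

fun Q :: "nat \<Rightarrow> nat" where
  "Q 0 = 1" | "Q (Suc 0) = 0" | "Q (Suc (Suc n)) = a n * Q (Suc n) + Q n"

lemma det: "real (P (Suc n)) * real (Q n) - real (P n) * real (Q (Suc n)) = (-1) ^ n"
  by (induction n) (auto simp: algebra_simps)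

lemma det2: "real (P (Suc (Suc n))) * real (Q n) - real (P n) * real (Q (Suc (Suc n))) = real (a n) * (-1) ^ n"
proof -
  have "real (P (Suc (Suc n))) * real (Q n) - real (P n) * real (Q (Suc (Suc n)))
     = real (a n) * (real (P (Suc n)) * real (Q n) - real (P n) * real (Q (Suc n)))"
    by (simp add: algebra_simps)
  then show ?thesis by (simp add: det)
qed

lemma Q_pos: "0 < Q (Suc (Suc n))"
proof -
  have "0 < Q (Suc (Suc n)) \<and> 0 < Q (Suc (Suc (Suc n)))"
    using a_pos by (induction n) (auto simp: Suc_le_eq)
  then show ?thesis by blast
qed

lemma Q_pos': "2 \<le> n \<Longrightarrow> 0 < Q n"
  using Q_pos[of "n - 2"] by (simp add: numeral_2_eq_2 Suc_diff_Suc del: Q.simps)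

lemma Q_mono: "Q (Suc n) \<le> Q (Suc (Suc n))"
  using a_pos[of n] by (cases "a n") auto

declare P.simps(3) [simp del] Q.simps(3) [simp del]

lemma Q_mono': "1 \<le> m \<Longrightarrow> m \<le> n \<Longrightarrow> Q m \<le> Q n"
proof (induction n)
  case (Suc n)
  then show ?case using Q_mono[of "n - 1"] by (cases "m = Suc n") (auto simp: le_Suc_eq)
qed auto

lemma Q_ge: "n \<le> Q (Suc (Suc n))"
proof (induction n)
  case (Suc n)
  show ?case
  proof (cases n)
    case 0 then show ?thesis using Q_pos[of 1] by simp
  next
    case (Suc m)
    have "1 * Q (Suc (Suc n)) \<le> a (Suc n) * Q (Suc (Suc n))" using a_pos by (intro mult_right_mono) auto
    moreover have "1 \<le> Q (Suc n)" using Q_pos[of m] Suc by simp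
    ultimately show ?thesis using \<open>n \<le> Q (Suc (Suc n))\<close> Q.simps(3)[of "Suc n"] by linarith
  qed
qed auto

text \<open>Even convergents increase, odd ones decrease, and every even one lies below every odd
  one; the supremum of the even ones works. Strict monotonicity makes all inequalities
  strict.\<close>

lemma alpha_ex: "\<exists>\<alpha>. \<forall>n. (-1) ^ n * (real (P n) - \<alpha> * real (Q n)) < 0"
proof -
  define x where "x k = real (P (2 * k)) / real (Q (2 * k))" for k
  \<comment> \<open>The odd convergents start at index 3, since the convergent 1 is 1/0.\<close>
  define y where "y k = real (P (2 * k + 3)) / real (Q (2 * k + 3))" for k
  have Qe: "0 < Q (2 * k)" for k using Q_pos[of "2 * (k - 1)"] by (cases k) auto
  have Qo: "0 < Q (2 * k + 3)" for k using Q_pos[of "2 * k + 1"] by (simp add: numeral_eq_Suc)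
  have ap: "0 < real (a n)" for n using a_pos[of n] by linarith
  have frac: "p / q < p' / q'" if "0 < q" "0 < q'" "0 < p' * q - p * q'" for p q p' q' :: real
    using that by (simp add: divide_simps mult.commute)
  have xs: "x k < x (Suc k)" for k
    unfolding x_def using det2[of "2 * k"] Qe[of k] Qe[of "Suc k"] ap[of "2*k"] by (intro frac) auto
  have ys: "y (Suc k) < y k" for k
  proof -
    have "2 * Suc k + 3 = Suc (Suc (2 * k + 3))" "(-1 :: real) ^ (2 * k + 3) = -1" by simp_all
    then show ?thesis unfolding y_def using det2[of "2 * k + 3"] Qo[of k] Qo[of "Suc k"] ap[of "2*k+3"]
      by (intro frac) (auto simp: mult.commute)
  qed
  have xy: "x (Suc k) < y k" for k
  proof -
    have i: "2 * k + 2 = 2 * Suc k" "Suc (2 * k + 2) = 2 * k + 3" "(-1 :: real) ^ (2 * Suc k) = 1" by simp_all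
    show ?thesis unfolding x_def y_def
      using det[of "2 * k + 2", unfolded i(2), unfolded i(1) i(3)] Qo[of k] Qe[of "Suc k"]
      by (intro frac) (simp_all only: of_nat_0_less_iff mult.commute zero_less_one)
  qed
  have xm: "x k \<le> x l" if "k \<le> l" for k l using that xs lift_Suc_mono_le[of x k l] less_imp_le by blast
  have ym: "y l \<le> y k" if "k \<le> l" for k l using that ys lift_Suc_antimono_le[of y k l] less_imp_le by blast
  have b: "x k \<le> y m" for k m
  proof -
    have "x k \<le> x (max k m)" "x (max k m) < x (Suc (max k m))" "x (Suc (max k m)) < y (max k m)" "y (max k m) \<le> y m"
      using xm xs xy ym by auto
    then show ?thesis by linarith
  qed
  define \<alpha> where "\<alpha> = (SUP k. x k)"
  have bd: "bdd_above (range x)" using b[of _ 0] by (auto intro!: bdd_aboveI)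
  have xa: "x k < \<alpha>" for k
    using xs[of k] cSUP_upper[OF UNIV_I bd, of "Suc k"] by (simp add: \<alpha>_def)
  have ya: "\<alpha> < y k" for k
  proof -
    have "\<alpha> \<le> y (Suc k)" unfolding \<alpha>_def using b by (intro cSUP_least) auto
    then show ?thesis using ys[of k] by linarith
  qed
  have "(-1) ^ n * (real (P n) - \<alpha> * real (Q n)) < 0" for n
  proof (cases "even n")
    case True
    then obtain k where k: "n = 2 * k" by blast
    show ?thesis using xa[of k] Qe[of k] by (simp add: x_def k divide_simps)
  next
    case False
    then obtain k where k: "n = Suc (2 * k)" by (metis oddE Suc_eq_plus1)
    show ?thesis
    proof (cases k)
      case (Suc m)
      then have "n = 2 * m + 3" using k by simp
      then show ?thesis using ya[of m] Qo[of m] False by (simp add: y_def divide_simps)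
    qed (simp add: k)
  qed
  then show ?thesis by blast
qed

definition \<alpha> where "\<alpha> = (SOME \<alpha>. \<forall>n. (-1) ^ n * (real (P n) - \<alpha> * real (Q n)) < 0)"

text \<open>The distance \<open>|P n - \<alpha> * Q n|\<close> with its sign resolved, so that its
  recursion is linear with positive terms.\<close>

definition D where "D n = (-1) ^ Suc n * (real (P n) - \<alpha> * real (Q n))"

lemma D_pos: "0 < D n"
  using someI_ex[OF alpha_ex] unfolding \<alpha>_def[symmetric] D_def by auto

lemma abs_D: "\<bar>real (P n) - \<alpha> * real (Q n)\<bar> = D n"
proof -
  have "\<bar>real (P n) - \<alpha> * real (Q n)\<bar> = \<bar>D n\<bar>" by (simp add: D_def abs_mult)
  then show ?thesis using D_pos[of n] by simp
qed

lemma D_rec: "D n = real (a n) * D (Suc n) + D (Suc (Suc n))"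
  by (simp add: D_def algebra_simps P.simps(3) Q.simps(3))

lemma QD: "real (Q (Suc n)) * D n + real (Q n) * D (Suc n) = 1"
proof -
  have "real (Q (Suc n)) * D n + real (Q n) * D (Suc n)
    = (-1)^n * (real (P (Suc n)) * real (Q n) - real (P n) * real (Q (Suc n)))"
    by (simp add: D_def algebra_simps)
  then show ?thesis by (simp add: det flip: power_add)
qed

text \<open>The classical two-sided expansion: \<open>\<zeta> n\<close> is the complete quotient
  that starts with the digit \<open>a n\<close>, and \<open>\<beta> n\<close> is the expansion of
  the earlier digits read backwards, down to \<open>\<beta> 1 = 0\<close>.\<close>

definition \<zeta> where "\<zeta> n = D n / D (Suc n)"
definition \<beta> where "\<beta> n = real (Q n) / real (Q (Suc n))"

lemma zeta_rec: "\<zeta> n = real (a n) + 1 / \<zeta> (Suc n)"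
  using D_rec[of n] D_pos[of "Suc n"] by (simp add: \<zeta>_def field_simps)

lemma zeta_pos: "0 < \<zeta> n" using D_pos by (simp add: \<zeta>_def)

lemma zeta_gt: "real (a n) < \<zeta> n" "1 \<le> \<zeta> n"
proof -
  have "0 < 1 / \<zeta> (Suc n)" using zeta_pos[of "Suc n"] by simp
  moreover have "1 \<le> real (a n)" using a_pos[of n] by simp
  ultimately show "real (a n) < \<zeta> n" "1 \<le> \<zeta> n" using zeta_rec[of n] by linarith+
qed

lemma zeta_le: "\<zeta> n \<le> real (a n) + 1"
proof -
  have "1 / \<zeta> (Suc n) \<le> 1" using zeta_gt(2)[of "Suc n"] by (simp add: divide_simps)
  then show ?thesis using zeta_rec[of n] by linarith
qed

lemma beta_rec: 
  assumes "1 \<le> n"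
  shows "\<beta> (Suc n) = 1 / (real (a n) + \<beta> n)"
proof -
  have "0 < real (Q (Suc n))" using Q_pos'[of "Suc n"] assms by simp
  then have "real (a n) + \<beta> n = real (Q (Suc (Suc n))) / real (Q (Suc n))"
    by (simp add: \<beta>_def Q.simps(3) field_simps)
  then show ?thesis by (simp add: \<beta>_def)
qed

lemma beta_bounds: "1 \<le> n \<Longrightarrow> 0 \<le> \<beta> n" "1 \<le> n \<Longrightarrow> \<beta> n \<le> 1"
  using Q_mono[of "n - 1"] Q_pos[of "n - 1"] by (cases n; auto simp: \<beta>_def)+

lemma zeta_cfe: "1 / \<zeta> n = cfe (map a [n..<n + k]) (1 / \<zeta> (n + k))"
proof (induction k arbitrary: n)
  case (Suc k)
  have "map a [n..<n + Suc k] = a n # map a [Suc n..<Suc n + k]"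
    by (simp add: upt_conv_Cons del: upt_Suc)
  then show ?case using Suc.IH[of "Suc n"] by (simp add: zeta_rec[of n])
qed simp

lemma beta_cfe: "1 \<le> n \<Longrightarrow> \<beta> (n + k) = cfe (rev (map a [n..<n + k])) (\<beta> n)"
  by (induction k) (auto simp: beta_rec)

text \<open>This is \<open>QD\<close> divided by \<open>Q (Suc n) * D (Suc n)\<close>. That product
  is the area of the sheared convergent, so small areas correspond to large values of
  \<open>\<zeta> n + \<beta> n\<close>.\<close>

lemma area_eq: "1 \<le> n \<Longrightarrow> real (Q (Suc n)) * D (Suc n) = 1 / (\<zeta> n + \<beta> n)"
proof -
  assume n: "1 \<le> n"
  have Qp: "0 < Q (Suc n)" using Q_pos[of "n - 1"] n by (cases n) auto
  have "(\<zeta> n + \<beta> n) * (real (Q (Suc n)) * D (Suc n)) = 1"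
    using QD[of n] Qp D_pos[of "Suc n"] by (simp add: \<zeta>_def \<beta>_def field_simps)
  moreover have "0 < \<zeta> n + \<beta> n" using zeta_pos[of n] beta_bounds(1)[OF n] by linarith
  ultimately show ?thesis by (simp add: eq_divide_eq mult.commute)
qed

text \<open>Writing \<open>(p, q)\<close> in the basis of two consecutive convergents, either it is a multiple of the
  first one, or the mixed signs of the coordinates keep it far from the line of co-slope \<open>\<alpha>\<close>.\<close>

lemma approximation_dichotomy:
  fixes p q :: int
  assumes "1 \<le> q"
  obtains n where "2 \<le> n"
    "(\<exists>x::int. p = x * int (P n) \<and> q = x * int (Q n)) \<or> 1 / 4 \<le> real_of_int q * \<bar>real_of_int p - \<alpha> * real_of_int q\<bar>"
proof -
  define n where "n = (LEAST n. q < int (Q (Suc (Suc n))))"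
  have "q < int (Q (Suc (Suc (nat q + 1))))" using Q_ge[of "nat q + 1"] assms by linarith
  then have n1: "q < int (Q (Suc (Suc n)))" unfolding n_def by (rule LeastI)
  have n0: "n \<noteq> 0" using n1 assms by (intro notI) (auto simp: Q.simps(3))
  then obtain k where k: "n = Suc k" using not0_implies_Suc by blast
  have n2: "int (Q (Suc n)) \<le> q" using not_less_Least[of k "\<lambda>n. q < int (Q (Suc (Suc n)))"] k by (auto simp: n_def)
  define m where "m = Suc n"
  have m: "2 \<le> m" "int (Q m) \<le> q" "q < int (Q (Suc m))" using n0 n1 n2 by (auto simp: m_def)
  define s :: int where "s = (-1) ^ m"
  have ss: "s * s = 1" by (simp add: s_def flip: power_add)
  have idet: "int (P (Suc m)) * int (Q m) - int (P m) * int (Q (Suc m)) = s"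
  proof -
    have "real_of_int (int (P (Suc m)) * int (Q m) - int (P m) * int (Q (Suc m))) = real_of_int s"
      using det[of m] by (simp add: s_def)
    then show ?thesis by linarith
  qed
  \<comment> \<open>Cramer's rule; the determinant \<open>s\<close> is its own inverse, so the
    coordinates are integers.\<close>
  define x where "x = s * (int (P (Suc m)) * q - p * int (Q (Suc m)))"
  define y where "y = s * (p * int (Q m) - int (P m) * q)"
  have pe: "p = x * int (P m) + y * int (P (Suc m))" and qe: "q = x * int (Q m) + y * int (Q (Suc m))"
  proof -
    have "x * int (P m) + y * int (P (Suc m)) = s * (int (P (Suc m)) * int (Q m) - int (P m) * int (Q (Suc m))) * p"
      by (simp add: x_def y_def algebra_simps)
    then show "p = x * int (P m) + y * int (P (Suc m))" by (simp add: idet ss)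
    have "x * int (Q m) + y * int (Q (Suc m)) = s * (int (P (Suc m)) * int (Q m) - int (P m) * int (Q (Suc m))) * q"
      by (simp add: x_def y_def algebra_simps)
    then show "q = x * int (Q m) + y * int (Q (Suc m))" by (simp add: idet ss)
  qed
  define X Y A B where "X = real_of_int x" "Y = real_of_int y" "A = real (Q m)" "B = real (Q (Suc m))"
  have qr: "real_of_int q = X * A + Y * B" unfolding X_Y_A_B_def by (subst qe) simp
  have Apos: "0 < A" using Q_pos'[of m] m by (simp add: X_Y_A_B_def)
  have AB: "A \<le> real_of_int q" "real_of_int q < B" using m by (auto simp: X_Y_A_B_def)
  have dr: "\<bar>real_of_int p - \<alpha> * real_of_int q\<bar> = \<bar>X * D m - Y * D (Suc m)\<bar>"
  proof -
    have "real_of_int p - \<alpha> * real_of_int q = X * (real (P m) - \<alpha> * real (Q m)) + Y * (real (P (Suc m)) - \<alpha> * real (Q (Suc m)))"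
      unfolding X_Y_A_B_def by (subst pe, subst qe) (simp add: algebra_simps)
    also have "\<dots> = (-1) ^ Suc m * (X * D m - Y * D (Suc m))"
      by (simp add: D_def algebra_simps flip: power_add)
    finally show ?thesis by (simp add: abs_mult)
  qed
  \<comment> \<open>The two summands of \<open>QD\<close> add up to 1, and the one with
    \<open>B\<close> is the larger.\<close>
  have BD: "1 / 2 \<le> B * D m"
  proof -
    have "D (Suc m) \<le> D m"
    proof -
      have "1 * D (Suc m) \<le> real (a m) * D (Suc m)" using a_pos[of m] D_pos[of "Suc m"] by (intro mult_right_mono) auto
      then show ?thesis using D_rec[of m] D_pos[of "Suc (Suc m)"] by linarith
    qed
    then have "A * D (Suc m) \<le> B * D m" using AB Apos D_pos[of m] D_pos[of "Suc m"] by (intro mult_mono) auto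
    then show ?thesis using QD[of m] by (simp add: X_Y_A_B_def)
  qed
  define q' where "q' = real_of_int q"
  have q': "A \<le> q'" "q' < B" "q' = X * A + Y * B" using AB qr by (auto simp: q'_def)
  have key: "1 / 4 \<le> q' * \<bar>X * D m - Y * D (Suc m)\<bar>" if "y \<noteq> 0"
  proof -
    have ge: "\<bar>X\<bar> * D m \<le> \<bar>X * D m - Y * D (Suc m)\<bar>" if "X * Y \<le> 0"
    proof (cases "X \<ge> 0")
      case True
      then have "X = 0 \<or> Y \<le> 0" using that by (metis mult_pos_pos not_less order_le_less)
      then have "X = 0 \<or> Y * D (Suc m) \<le> 0" using D_pos[of "Suc m"] by (auto simp: mult_nonpos_nonneg)
      then show ?thesis using True D_pos[of m] by auto
    next
      case False
      then have "Y \<ge> 0" using that by (metis mult_neg_neg not_less)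
      then have "Y * D (Suc m) \<ge> 0" "X * D m \<le> 0" using D_pos[of "Suc m"] D_pos[of m] False by (auto simp: mult_nonpos_nonneg)
      then show ?thesis using False by (simp add: abs_if)
    qed
    have "y \<ge> 1 \<or> y \<le> -1" using that by linarith
    then show ?thesis
    proof
      assume "y \<le> -1"
      then have Y: "Y \<le> -1" by (simp add: X_Y_A_B_def)
      then have "Y * B \<le> -1 * B" using q' Apos by (intro mult_right_mono) auto
      then have XA: "B \<le> X * A" using q' Apos by linarith
      then have "0 < X * A" using q' Apos by linarith
      then have X: "0 < X" using Apos by (simp add: zero_less_mult_iff)
      then have "X * Y \<le> 0" using Y by (simp add: mult_nonneg_nonpos)
      have "B * D m \<le> X * A * D m" using XA D_pos[of m] by (intro mult_right_mono) auto
      also have "\<dots> = A * (\<bar>X\<bar> * D m)" using X by simp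
      also have "\<dots> \<le> q' * \<bar>X * D m - Y * D (Suc m)\<bar>"
        using ge[OF \<open>X * Y \<le> 0\<close>] q' Apos D_pos[of m] by (intro mult_mono) auto
      finally show ?thesis using BD by linarith
    next
      \<comment> \<open>Here \<open>x <= -1\<close> and
        \<open>B <= q' + K * A <= 2 * (q' * K)\<close>; the factor 2 lost in this case turns 1/2
        into the constant 1/4.\<close>
      assume y: "y \<ge> 1"
      then have Y: "Y \<ge> 1" by (simp add: X_Y_A_B_def)
      then have "1 * B \<le> Y * B" using q' Apos by (intro mult_right_mono) auto
      then have "X * A < 0" using q' by linarith
      then have X: "X < 0" using Apos by (simp add: mult_less_0_iff)
      then have "x \<le> -1" by (simp add: X_Y_A_B_def)
      then have X1: "X \<le> -1" by (simp add: X_Y_A_B_def)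
      define K where "K = - X"
      have K: "1 \<le> K" "\<bar>X\<bar> = K" using X1 by (auto simp: K_def)
      have "X * Y \<le> 0" using X Y by (simp add: mult_nonpos_nonneg)
      have "B \<le> q' + K * A" using q' \<open>1 * B \<le> Y * B\<close> by (simp add: K_def)
      also have "q' + K * A \<le> 2 * (q' * K)"
      proof -
        have "q' * 1 \<le> q' * K" using K q' Apos by (intro mult_left_mono) auto
        moreover have "A * K \<le> q' * K" using K q' Apos by (intro mult_right_mono) auto
        ultimately show ?thesis by (simp add: mult.commute)
      qed
      finally have "B * D m \<le> 2 * (q' * K) * D m" using D_pos[of m] by (intro mult_right_mono) auto
      then have "1 / 4 \<le> q' * (K * D m)" using BD by simp
      also have "\<dots> \<le> q' * \<bar>X * D m - Y * D (Suc m)\<bar>"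
        using ge[OF \<open>X * Y \<le> 0\<close>] K q' Apos by (intro mult_left_mono) auto
      finally show ?thesis .
    qed
  qed
  show ?thesis
  proof (rule that[OF m(1)])
    show "(\<exists>x::int. p = x * int (P m) \<and> q = x * int (Q m)) \<or> 1 / 4 \<le> real_of_int q * \<bar>real_of_int p - \<alpha> * real_of_int q\<bar>"
    proof (cases "y = 0")
      case True then show ?thesis using pe qe by auto
    next
      case False then show ?thesis using key dr by (auto simp: q'_def)
    qed
  qed
qed

text \<open>Excludes vertical periods later. For a nonzero multiple of a convergent the reason is
  \<open>D n > 0\<close>; otherwise the product with \<open>q\<close> is at least 1/4.\<close>

lemma alpha_not_rational:
  fixes p q :: int
  assumes "p \<noteq> 0 \<or> q \<noteq> 0"
  shows "real_of_int p - \<alpha> * real_of_int q \<noteq> 0"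
proof -
  have pos: "real_of_int p - \<alpha> * real_of_int q \<noteq> 0" if q: "1 \<le> q" for p q :: int
  proof -
    obtain n where n: "2 \<le> n"
      "(\<exists>x::int. p = x * int (P n) \<and> q = x * int (Q n)) \<or> 1 / 4 \<le> real_of_int q * \<bar>real_of_int p - \<alpha> * real_of_int q\<bar>"
      using approximation_dichotomy[OF q] by metis
    from n(2) show ?thesis
    proof
      assume "\<exists>x::int. p = x * int (P n) \<and> q = x * int (Q n)"
      then obtain x where x: "p = x * int (P n)" "q = x * int (Q n)" by blast
      have "real_of_int p - \<alpha> * real_of_int q = real_of_int x * (real (P n) - \<alpha> * real (Q n))"
        by (simp add: x algebra_simps)
      moreover have "x \<noteq> 0" using x q by auto
      moreover have "real (P n) - \<alpha> * real (Q n) \<noteq> 0" using D_pos[of n] by (auto simp: D_def)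
      ultimately show ?thesis by simp
    qed auto
  qed
  consider "1 \<le> q" | "q = 0" | "1 \<le> - q" by linarith
  then show ?thesis
  proof cases
    case 3 then show ?thesis using pos[of "-q" "-p"] by auto
  qed (use pos assms in auto)
qed

text \<open>Lower bound: a primitive vector that is no convergent has area at least 1/4 >= 1 / R,
  late convergents are controlled by \<open>up\<close>, and the finitely many early ones can only
  occur with a large multiple once \<open>|Im v|\<close> is large. Upper bound: the vectors supplied
  by \<open>fr\<close>.\<close>

theorem liminf_area:
  fixes H :: "complex set" and m0 :: nat and R N :: real
  assumes H: "\<And>v. v \<in> H \<Longrightarrow> \<exists>m (p::int) (q::int). m0 \<le> m \<and> coprime p q \<and>
      v = Complex (real m * real_of_int p) (real m * real_of_int q)"
    and m0: "1 \<le> m0" and R: "4 \<le> R" and N: "0 < N"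
    and up: "\<And>\<epsilon>. 0 < \<epsilon> \<Longrightarrow> \<exists>n0. \<forall>n\<ge>n0. \<zeta> n + \<beta> n \<le> R + \<epsilon>"
    and fr: "\<And>\<epsilon> n0. 0 < \<epsilon> \<Longrightarrow> \<exists>n\<ge>n0. R - \<epsilon> \<le> \<zeta> n + \<beta> n \<and>
       (\<exists>v\<in>H. v = Complex (real m0 * real (P (Suc n))) (real m0 * real (Q (Suc n))) \<or>
          v = - Complex (real m0 * real (P (Suc n))) (real m0 * real (Q (Suc n))))"
  shows "Liminf (inf (filtercomap (\<lambda>v. \<bar>Im v\<bar>) at_top)
     (principal ((\<lambda>v. Complex (Re v - \<alpha> * Im v) (Im v)) ` H))) (\<lambda>v. ereal (\<bar>Re v\<bar> * \<bar>Im v\<bar> / N))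
     = ereal (real m0 ^ 2 / (R * N))"
proof (rule Liminf_real_eqI)
  define c where "c = real m0 ^ 2 / R"
  have cpos: "0 < c" using m0 R by (simp add: c_def)
  have c: "real m0 ^ 2 / (R * N) = c / N" by (simp add: c_def)
  fix e :: real assume e: "0 < e"
  define e' where "e' = e * N"
  have e': "0 < e'" using e N by (simp add: e'_def)
  show "\<forall>\<^sub>F v in inf (filtercomap (\<lambda>v. \<bar>Im v\<bar>) at_top) (principal ((\<lambda>v. Complex (Re v - \<alpha> * Im v) (Im v)) ` H)).
     real m0 ^ 2 / (R * N) - e \<le> \<bar>Re v\<bar> * \<bar>Im v\<bar> / N"
  proof -
    \<comment> \<open>With this choice \<open>c * \<epsilon> = e' * R\<close>, whence
      \<open>(c - e') * (R + \<epsilon>) <= m0^2\<close>.\<close>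
    define \<epsilon> where "\<epsilon> = e' * R\<^sup>2 / real m0 ^ 2"
    have eps: "0 < \<epsilon>" using e' R m0 by (simp add: \<epsilon>_def)
    obtain n0 where n0: "\<And>n. n0 \<le> n \<Longrightarrow> \<zeta> n + \<beta> n \<le> R + \<epsilon>" using up[OF eps] by blast
    define n1 where "n1 = max 2 (Suc n0)"
    define \<delta> where "\<delta> = Min ((\<lambda>n. real (Q n) * D n) ` {2..n1})"
    define Qm where "Qm = real (Q n1)"
    note Qp = Q_pos'
    have dpos: "0 < \<delta>" unfolding \<delta>_def using Qp D_pos by (subst Min_gr_iff) (auto simp: n1_def)
    have del: "\<delta> \<le> real (Q n) * D n" if "2 \<le> n" "n \<le> n1" for n
      unfolding \<delta>_def using that by (intro Min_le) auto
    have Qm: "real (Q n) \<le> Qm" "0 < Qm" if "2 \<le> n" "n \<le> n1" for n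
      using Q_mono'[of n n1] Qp[of n1] that by (auto simp: Qm_def n1_def)
    \<comment> \<open>For a convergent of index at most \<open>n1\<close>,
      \<open>|Im v| >= B\<close> forces \<open>m * \<delta> >= c\<close>, and the area is at least
      \<open>m^2 * \<delta>\<close>.\<close>
    define B where "B = max 1 (c * Qm / \<delta>)"
    have main: "c - e' \<le> \<bar>Re v - \<alpha> * Im v\<bar> * \<bar>Im v\<bar>" if v: "v \<in> H" "B \<le> \<bar>Im v\<bar>" for v
    proof -
      obtain m p q where mpq: "m0 \<le> m" "coprime (p::int) q" "v = Complex (real m * real_of_int p) (real m * real_of_int q)"
        using H[OF v(1)] by blast
      have "1 \<le> \<bar>Im v\<bar>" using v(2) by (simp add: B_def)
      then have "q \<noteq> 0" using mpq(3) by (intro notI) auto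
      define p' q' where "p' = (if q > 0 then p else -p)" "q' = (if q > 0 then q else - q)"
      have q': "1 \<le> q'" "coprime p' q'" using \<open>q \<noteq> 0\<close> mpq(2) by (auto simp: p'_q'_def)
      have "\<bar>Re v - \<alpha> * Im v\<bar> = \<bar>real m * (real_of_int p' - \<alpha> * real_of_int q')\<bar>"
        by (auto simp: p'_q'_def mpq(3) algebra_simps abs_if)
      moreover have im: "\<bar>Im v\<bar> = real m * real_of_int q'" using \<open>q \<noteq> 0\<close>
        by (auto simp: p'_q'_def mpq(3) abs_mult)
      ultimately have area: "\<bar>Re v - \<alpha> * Im v\<bar> * \<bar>Im v\<bar> =
          real m ^ 2 * (real_of_int q' * \<bar>real_of_int p' - \<alpha> * real_of_int q'\<bar>)"
        by (simp add: abs_mult power2_eq_square)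
      have mm: "real m0 ^ 2 \<le> real m ^ 2" "1 \<le> real m" using mpq(1) m0 by (auto intro: power_mono)
      obtain n where n: "2 \<le> n"
        "(\<exists>x::int. p' = x * int (P n) \<and> q' = x * int (Q n)) \<or> 1 / 4 \<le> real_of_int q' * \<bar>real_of_int p' - \<alpha> * real_of_int q'\<bar>"
        using approximation_dichotomy[OF q'(1)] by metis
      from n(2) show ?thesis
      proof
        assume q4: "1 / 4 \<le> real_of_int q' * \<bar>real_of_int p' - \<alpha> * real_of_int q'\<bar>"
        have "c \<le> real m0 ^ 2 * (1 / 4)" using R by (simp add: c_def divide_simps mult_left_mono)
        also have "\<dots> \<le> real m ^ 2 * (real_of_int q' * \<bar>real_of_int p' - \<alpha> * real_of_int q'\<bar>)"
          using mm q4 by (intro mult_mono) auto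
        finally show ?thesis using e' area by linarith
      next
        assume "\<exists>x::int. p' = x * int (P n) \<and> q' = x * int (Q n)"
        then obtain x where x: "p' = x * int (P n)" "q' = x * int (Q n)" by blast
        have "x dvd 1" using q'(2) x by (metis coprime_common_divisor dvd_triv_left)
        moreover have "0 < x * int (Q n)" using q'(1) x by linarith
        then have "0 < x" by (simp add: zero_less_mult_iff)
        ultimately have "x = 1" by simp
        then have pq: "p' = int (P n)" "q' = int (Q n)" using x by auto
        have area2: "\<bar>Re v - \<alpha> * Im v\<bar> * \<bar>Im v\<bar> = real m ^ 2 * (real (Q n) * D n)"
          unfolding area pq using abs_D[of n] by simp
        show ?thesis
        proof (cases "n \<le> n1")
          case True
          have "real m * real (Q n) \<le> real m * Qm" using Qm(1)[OF n(1) True] by (intro mult_left_mono) auto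
          then have "B \<le> real m * Qm" using v(2) im pq by simp
          then have "c * Qm / \<delta> \<le> real m * Qm" by (simp add: B_def)
          then have "c \<le> real m * \<delta>" using Qm(2)[OF n(1) True] dpos by (simp add: field_simps)
          also have "\<dots> \<le> real m ^ 2 * (real (Q n) * D n)"
            using del[OF n(1) True] mm dpos by (intro mult_mono) (auto simp: power2_eq_square)
          finally show ?thesis using e' area2 by linarith
        next
          case False
          obtain k where k: "n = Suc k" "n0 \<le> k" "1 \<le> k" using False by (cases n) (auto simp: n1_def)
          have z: "\<zeta> k + \<beta> k \<le> R + \<epsilon>" "0 < \<zeta> k + \<beta> k" using n0[OF k(2)] zeta_pos[of k] beta_bounds[OF k(3)] by auto
          have "c - e' \<le> real m0 ^ 2 * (1 / (R + \<epsilon>))"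
          proof -
            have "(c - e') * (R + \<epsilon>) = real m0 ^ 2 + c * \<epsilon> - e' * R - e' * \<epsilon>"
              using R by (simp add: c_def field_simps)
            also have "c * \<epsilon> = e' * R" using R m0 by (simp add: c_def \<epsilon>_def power2_eq_square)
            finally have "(c - e') * (R + \<epsilon>) \<le> real m0 ^ 2" using e' eps by simp
            then show ?thesis using R eps by (simp add: field_simps)
          qed
          also have "\<dots> \<le> real m ^ 2 * (1 / (\<zeta> k + \<beta> k))"
            using mm z R eps by (intro mult_mono divide_left_mono) auto
          also have "\<dots> = real m ^ 2 * (real (Q n) * D n)" using area_eq[OF k(3)] k(1) by simp
          finally show ?thesis using area2 by linarith
        qed
      qed
    qed
    have "c / N - e \<le> \<bar>Re v - \<alpha> * Im v\<bar> * \<bar>Im v\<bar> / N" if "v \<in> H" "B \<le> \<bar>Im v\<bar>" for v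
      using divide_right_mono[OF main[OF that], of N] N by (simp add: e'_def diff_divide_distrib)
    then show ?thesis unfolding eventually_norm_filter c by (intro exI[of _ B]) auto
  qed
  show "\<exists>\<^sub>F v in inf (filtercomap (\<lambda>v. \<bar>Im v\<bar>) at_top) (principal ((\<lambda>v. Complex (Re v - \<alpha> * Im v) (Im v)) ` H)).
     \<bar>Re v\<bar> * \<bar>Im v\<bar> / N \<le> real m0 ^ 2 / (R * N) + e"
  proof -
    \<comment> \<open>Small enough for \<open>(c + e') * (R - \<epsilon>) >= m0^2\<close>: the
      losses \<open>c * \<epsilon>\<close> and \<open>e' * \<epsilon>\<close> are covered by
      \<open>e' * R\<close> because \<open>R >= 4\<close>.\<close>
    define \<epsilon> where "\<epsilon> = min 1 (e' * R / (2 * c))"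
    have eps: "0 < \<epsilon>" "\<epsilon> \<le> 1" "c * \<epsilon> \<le> e' * R / 2" using e' R cpos by (auto simp: \<epsilon>_def min_def field_simps)
    have main: "\<exists>v\<in>H. B \<le> \<bar>Im v\<bar> \<and> \<bar>Re v - \<alpha> * Im v\<bar> * \<bar>Im v\<bar> \<le> c + e'" for B
    proof -
      obtain n v where n: "nat \<lceil>B\<rceil> + 2 \<le> n" "R - \<epsilon> \<le> \<zeta> n + \<beta> n" and v: "v \<in> H"
        "v = Complex (real m0 * real (P (Suc n))) (real m0 * real (Q (Suc n))) \<or>
          v = - Complex (real m0 * real (P (Suc n))) (real m0 * real (Q (Suc n)))"
        using fr[OF eps(1), of "nat \<lceil>B\<rceil> + 2"] by blast
      obtain k where k: "n = Suc k" using n by (cases n) auto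
      have "nat \<lceil>B\<rceil> \<le> Q (Suc n)" using Q_ge[of k] n(1) unfolding k by linarith
      then have "B \<le> real (Q (Suc n))" by linarith
      also have "\<dots> \<le> real m0 * real (Q (Suc n))" using m0 by (simp add: mult_le_cancel_right1)
      also have "\<dots> = \<bar>Im v\<bar>" using v(2) by auto
      finally have B: "B \<le> \<bar>Im v\<bar>" .
      have "Re v - \<alpha> * Im v = real m0 * (real (P (Suc n)) - \<alpha> * real (Q (Suc n))) \<or>
         Re v - \<alpha> * Im v = - (real m0 * (real (P (Suc n)) - \<alpha> * real (Q (Suc n))))"
        using v(2) by (auto simp: algebra_simps)
      then have "\<bar>Re v - \<alpha> * Im v\<bar> = \<bar>real m0 * (real (P (Suc n)) - \<alpha> * real (Q (Suc n)))\<bar>"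
        by (metis abs_minus_cancel)
      then have "\<bar>Re v - \<alpha> * Im v\<bar> * \<bar>Im v\<bar> = \<bar>real m0 * (real (P (Suc n)) - \<alpha> * real (Q (Suc n)))\<bar> * (real m0 * real (Q (Suc n)))"
        using v(2) by auto
      also have "\<dots> = real m0 ^ 2 * (real (Q (Suc n)) * D (Suc n))"
        by (simp only: abs_mult abs_D) (simp add: power2_eq_square)
      also have "\<dots> = real m0 ^ 2 / (\<zeta> n + \<beta> n)" using area_eq[of n] n by simp
      also have "\<dots> \<le> real m0 ^ 2 / (R - \<epsilon>)" using n(2) R eps by (intro divide_left_mono mult_pos_pos) auto
      also have "\<dots> \<le> c + e'"
      proof -
        have "(c + e') * (R - \<epsilon>) = real m0 ^ 2 - c * \<epsilon> + e' * R - e' * \<epsilon>"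
          using R by (simp add: c_def field_simps)
        moreover have "e' * \<epsilon> \<le> e' * 1" using e' eps by (intro mult_left_mono) auto
        moreover have "e' * 4 \<le> e' * R" using e' R by (intro mult_left_mono) auto
        ultimately have "real m0 ^ 2 \<le> (c + e') * (R - \<epsilon>)" using eps(3) e' by linarith
        then show ?thesis using R eps by (simp add: field_simps)
      qed
      finally show ?thesis using v(1) B by blast
    qed
    have "\<exists>v\<in>H. B \<le> \<bar>Im v\<bar> \<and> \<bar>Re v - \<alpha> * Im v\<bar> * \<bar>Im v\<bar> / N \<le> c / N + e" for B
      using main[of B] N by (auto simp: e'_def field_simps)
    note ex = this
    show ?thesis unfolding frequently_def eventually_norm_filter c
    proof
      assume "\<exists>B. \<forall>v\<in>(\<lambda>v. Complex (Re v - \<alpha> * Im v) (Im v)) ` H. B \<le> \<bar>Im v\<bar> \<longrightarrow>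
         \<not> \<bar>Re v\<bar> * \<bar>Im v\<bar> / N \<le> c / N + e"
      then obtain B where B: "\<And>v. v \<in> H \<Longrightarrow> B \<le> \<bar>Im v\<bar> \<Longrightarrow>
         \<not> \<bar>Re v - \<alpha> * Im v\<bar> * \<bar>Im v\<bar> / N \<le> c / N + e" by auto
      then show False using ex[of B] by blast
    qed
  qed
qed

end

text \<open>The action on types consumes digits in pairs, so the planted digit must sit at an even
  index and the block \<open>rev c @ [A] @ b\<close> must have even length. Parity is repaired by
  appending a digit 1, which merely replaces the tail by another tail in [0, 1].\<close>

lemma hall_blocks:
  assumes x: "45/100 \<le> x" "x \<le> 145/100" and e: "0 < \<epsilon>"
  obtains b c where "set b \<subseteq> {1..4}" "set c \<subseteq> {1..4}" "odd (length b)" "even (length c)"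
    "\<And>t t'. 0 \<le> t \<Longrightarrow> t \<le> 1 \<Longrightarrow> 0 \<le> t' \<Longrightarrow> t' \<le> 1 \<Longrightarrow> \<bar>cfe b t + cfe c t' - x\<bar> < \<epsilon>"
proof -
  obtain b c where bc: "set b \<subseteq> {1..4}" "set c \<subseteq> {1..4}"
    "\<And>t t'. 0 \<le> t \<Longrightarrow> t \<le> 1 \<Longrightarrow> 0 \<le> t' \<Longrightarrow> t' \<le> 1 \<Longrightarrow> \<bar>cfe b t + cfe c t' - x\<bar> < \<epsilon>"
    using hall_approximation[OF x e] by metis
  define b' c' where "b' = (if odd (length b) then b else b @ [1])" "c' = (if even (length c) then c else c @ [1])"
  have u: "0 \<le> cfe [1] t" "cfe [1] t \<le> 1" if "0 \<le> t" "t \<le> 1" for t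
    using that by auto
  show ?thesis
  proof (rule that[of b' c'])
    fix t t' :: real assume "0 \<le> t" "t \<le> 1" "0 \<le> t'" "t' \<le> 1"
    then show "\<bar>cfe b' t + cfe c' t' - x\<bar> < \<epsilon>"
      using bc(3) u unfolding b'_c'_def by (auto simp del: cfe.simps simp: cfe_append)
  qed (use bc(1,2) in \<open>auto simp: b'_c'_def\<close>)
qed

text \<open>The blocks realising \<open>R\<close> ever more precisely are concatenated. The word \<open>u\<close> in front of a
  block steers to a prefix satisfying \<open>Good\<close>.\<close>

theorem recurrent_sequence:
  fixes Good :: "nat list \<Rightarrow> bool" and R :: real
  assumes R: "7 \<le> R"
    and conn: "\<And>w h. even (length w) \<Longrightarrow> \<forall>d\<in>set w. 1 \<le> d \<Longrightarrow> even (length h) \<Longrightarrow> \<forall>d\<in>set h. 1 \<le> d \<Longrightarrow>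
       \<exists>u. even (length u) \<and> set u \<subseteq> {1..4} \<and> Good (w @ u @ h)"
  obtains a where "cf_seq a"
    "\<And>\<epsilon>. 0 < \<epsilon> \<Longrightarrow> \<exists>n0. \<forall>n\<ge>n0. cf_seq.\<zeta> a n + cf_seq.\<beta> a n \<le> R + \<epsilon>"
    "\<And>\<epsilon> n0. 0 < \<epsilon> \<Longrightarrow> \<exists>n\<ge>n0. R - \<epsilon> \<le> cf_seq.\<zeta> a n + cf_seq.\<beta> a n \<and> even n \<and> Good (map a [0..<n])"
proof -
  \<comment> \<open>Subtracting 45/100 puts the remainder \<open>x\<close> into the range of
    \<open>hall_blocks\<close>.\<close>
  define A where "A = nat \<lfloor>R - 45/100\<rfloor>"
  define x where "x = R - real A"
  have A: "6 \<le> A" "45/100 \<le> x" "x \<le> 145/100" using R unfolding A_def x_def by linarith+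
  \<comment> \<open>The error bound holds for all tails in [0, 1], so it is unaffected by what is
    placed before and after the block.\<close>
  define blk where "blk k W u c b \<longleftrightarrow> even (length u) \<and> set u \<subseteq> {1..4::nat} \<and> Good (W @ u @ rev c) \<and>
      set b \<subseteq> {1..4} \<and> set c \<subseteq> {1..4} \<and> odd (length b) \<and> even (length c) \<and>
      (\<forall>t t'. 0 \<le> t \<longrightarrow> t \<le> 1 \<longrightarrow> 0 \<le> t' \<longrightarrow> t' \<le> 1 \<longrightarrow> \<bar>cfe b t + cfe c t' - x\<bar> < 1 / real (Suc k))"
    for k W u c b
  define OK where "OK W \<longleftrightarrow> even (length W) \<and> W \<noteq> [] \<and> (\<forall>d\<in>set W. 1 \<le> (d::nat))" for W
  have "\<exists>W. \<forall>k::nat. OK (W k) \<and> (\<exists>u c b. blk k (W k) u c b \<and> W (Suc k) = W k @ u @ rev c @ [A] @ b)"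
  proof (rule dependent_nat_choice)
    \<comment> \<open>A nonempty start keeps the later indices at least 1, where the formulas for
      \<beta> hold.\<close>
    show "\<exists>W. OK W" by (rule exI[of _ "[1, 1]"]) (simp add: OK_def)
    fix W :: "nat list" and k :: nat
    assume W: "OK W"
    obtain b c where bc: "set b \<subseteq> {1..4}" "set c \<subseteq> {1..4}" "odd (length b)" "even (length c)"
      "\<And>t t'. 0 \<le> t \<Longrightarrow> t \<le> 1 \<Longrightarrow> 0 \<le> t' \<Longrightarrow> t' \<le> 1 \<Longrightarrow> \<bar>cfe b t + cfe c t' - x\<bar> < 1 / real (Suc k)"
      using hall_blocks[OF A(2,3), of "1 / real (Suc k)"] by (metis of_nat_0_less_iff zero_less_Suc zero_less_divide_1_iff)
    obtain u where u: "even (length u)" "set u \<subseteq> {1..4}" "Good (W @ u @ rev c)"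
    proof -
      have "\<forall>d\<in>set (rev c). 1 \<le> d" using bc(2) by auto
      then show ?thesis using conn[of W "rev c"] W bc(4) that by (auto simp: OK_def)
    qed
    have "\<forall>d\<in>set u \<union> set c \<union> set b. 1 \<le> d" using bc u by auto
    then have "OK (W @ u @ rev c @ [A] @ b)" using W u bc A(1) by (auto simp: OK_def)
    then show "\<exists>W'. OK W' \<and> (\<exists>u c b. blk k W u c b \<and> W' = W @ u @ rev c @ [A] @ b)"
      using bc u unfolding blk_def by blast
  qed
  then obtain W where W: "\<And>k. OK (W k)" "\<And>k. \<exists>u c b. blk k (W k) u c b \<and> W (Suc k) = W k @ u @ rev c @ [A] @ b"
    by blast
  obtain u c b where ucb: "\<And>k. blk k (W k) (u k) (c k) (b k)"
    "\<And>k. W (Suc k) = W k @ u k @ rev (c k) @ [A] @ b k"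
    using W(2) by metis
  have len: "k < length (W k)" for k
  proof (induction k)
    case 0 then show ?case using W(1)[of 0] by (auto simp: OK_def)
  next
    case (Suc k) then show ?case by (simp add: ucb(2)[of k])
  qed
  have pre: "\<exists>v. W l = W k @ v" if "k \<le> l" for k l
    using that
  proof (induction l rule: dec_induct)
    case (step l) then show ?case using ucb(2)[of l] by auto
  qed auto
  \<comment> \<open>The words are nested and \<open>W n\<close> is longer than \<open>n\<close>, so
    the diagonal is their common extension.\<close>
  define a where "a n = W n ! n" for n
  have aW: "a n = W k ! n" if "n < length (W k)" for n k
  proof (cases "k \<le> n")
    case True then show ?thesis using pre[OF True] that by (auto simp: a_def nth_append)
  next
    case False then have "n \<le> k" by simp
    then show ?thesis using pre[OF \<open>n \<le> k\<close>] len[of n] by (auto simp: a_def nth_append)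
  qed
  have amap: "map a [0..<n] = take n (W k)" if "n \<le> length (W k)" for n k
    using that aW[of _ k] by (intro nth_equalityI) auto
  have a1: "1 \<le> a n" for n using W(1)[of n] len[of n] by (auto simp: a_def OK_def)
  interpret cf_seq a by standard (rule a1)
  define n where "n k = length (W k @ u k @ rev (c k))" for k
  have nk: "n k = length (W k) + length (u k) + length (c k)" for k by (simp add: n_def)
  have nlt: "n k < length (W (Suc k))" "n k + length (b k) < length (W (Suc k))" for k
    by (simp_all add: n_def ucb(2)[of k])
  have an: "a (n k) = A" for k
    using aW[OF nlt(1)[of k]] by (simp add: ucb(2)[of k] n_def nth_append)
  have mapb: "map a [Suc (n k)..<Suc (n k) + length (b k)] = b k" for k
  proof (rule nth_equalityI)
    fix i assume "i < length (map a [Suc (n k)..<Suc (n k) + length (b k)])"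
    then have i: "i < length (b k)" by (simp del: upt_Suc)
    have "a (Suc (n k) + i) = W (Suc k) ! (Suc (n k) + i)"
      by (rule aW) (use i in \<open>simp add: n_def ucb(2)[of k]\<close>)
    also have "\<dots> = b k ! i"
      using i by (simp add: ucb(2)[of k] n_def nth_append)
    finally show "map a [Suc (n k)..<Suc (n k) + length (b k)] ! i = b k ! i"
      using i by (simp del: upt_Suc)
  qed (simp del: upt_Suc)
  have mapc: "map a [length (W k) + length (u k)..<n k] = rev (c k)" for k
  proof (rule nth_equalityI)
    fix i assume "i < length (map a [length (W k) + length (u k)..<n k])"
    then have i: "i < length (c k)" by (simp add: nk)
    have "a (length (W k) + length (u k) + i) = W (Suc k) ! (length (W k) + length (u k) + i)"
      by (rule aW) (use i in \<open>simp add: ucb(2)[of k]\<close>)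
    also have "\<dots> = rev (c k) ! i"
      using i by (simp add: ucb(2)[of k] nth_append)
    finally show "map a [length (W k) + length (u k)..<n k] ! i = rev (c k) ! i"
      using i by (simp add: nk)
  qed (simp add: nk)
  have val: "\<bar>\<zeta> (n k) + \<beta> (n k) - R\<bar> < 1 / real (Suc k)" for k
  proof -
    have Wk: "1 \<le> length (W k)" using len[of k] by simp
    define t where "t = 1 / \<zeta> (Suc (n k) + length (b k))"
    have t: "0 \<le> t" "t \<le> 1" using zeta_gt(2)[of "Suc (n k) + length (b k)"] by (auto simp: t_def divide_simps)
    have "\<zeta> (n k) = real A + cfe (b k) t"
      using zeta_rec[of "n k"] zeta_cfe[of "Suc (n k)" "length (b k)"] an[of k] mapb[of k] by (simp add: t_def)
    moreover have "\<beta> (n k) = cfe (c k) (\<beta> (length (W k) + length (u k)))"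
      using beta_cfe[of "length (W k) + length (u k)" "length (c k)"] Wk mapc[of k] by (simp add: nk)
    moreover have "0 \<le> \<beta> (length (W k) + length (u k))" "\<beta> (length (W k) + length (u k)) \<le> 1"
      using Wk by (auto intro: beta_bounds)
    ultimately show ?thesis using ucb(1)[of k] t unfolding blk_def x_def by (auto simp: algebra_simps)
  qed
  have small: "a m \<le> 4 \<or> (\<exists>j. m = n j)" if mk: "length (W k) \<le> m" "m < length (W (Suc k))" for m k
  proof (cases "m = n k")
    case False
    let ?i = "m - length (W k)"
    have "a m = W (Suc k) ! m" using mk by (intro aW) auto
    also have "\<dots> = (u k @ rev (c k) @ [A] @ b k) ! ?i" using mk by (simp add: ucb(2)[of k] nth_append)
    also have "\<dots> \<in> set (u k) \<union> set (c k) \<union> set (b k)"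
    proof -
      have "m < length (W k) + length (u k) + length (c k) + 1 + length (b k)"
        using mk(2) by (simp add: ucb(2)[of k])
      moreover have "m \<noteq> length (W k) + length (u k) + length (c k)" using False by (simp add: nk)
      ultimately consider "?i < length (u k)" | "length (u k) \<le> ?i" "?i < length (u k) + length (c k)"
        | "length (u k) + length (c k) < ?i" "?i < length (u k) + length (c k) + 1 + length (b k)"
        using mk(1) by linarith
      then show ?thesis
      proof cases
        case 1 then show ?thesis by (simp add: nth_append)
      next
        case 2
        define j where "j = ?i - length (u k)"
        have j: "j < length (c k)" "?i = length (u k) + j" using 2 by (auto simp: j_def)
        have "rev (c k) ! j \<in> set (rev (c k))" using j by (intro nth_mem) auto
        then show ?thesis unfolding j(2) using j(1) by (simp add: nth_append)
      next
        case 3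
        define j where "j = ?i - length (u k) - length (c k) - 1"
        have j: "j < length (b k)" "?i = length (u k) + length (c k) + Suc j" using 3 by (auto simp: j_def)
        show ?thesis unfolding j(2) using j(1) by (simp add: nth_append)
      qed
    qed
    also have "\<dots> \<subseteq> {1..4}" using ucb(1)[of k] by (auto simp: blk_def)
    finally show ?thesis by simp
  qed blast
  \<comment> \<open>An index with digit at most 4 has \<open>\<zeta> m <= 5\<close> and
    \<open>\<beta> m <= 1\<close>, which stays below \<open>R\<close>; any other index beyond
    \<open>W k\<close> carries a digit planted at stage \<open>k\<close> or later.\<close>
  have dich: "\<zeta> m + \<beta> m \<le> R \<or> (\<exists>j\<ge>k. m = n j)" if m: "length (W k) \<le> m" for m k
  proof -
    define l where "l = (LEAST l. m < length (W (Suc l)))"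
    have "m < length (W (Suc m))" using len[of "Suc m"] by simp
    then have l1: "m < length (W (Suc l))" unfolding l_def by (rule LeastI)
    have kl: "k \<le> l"
    proof (rule ccontr)
      assume "\<not> k \<le> l"
      then have "length (W (Suc l)) \<le> length (W k)" using pre[of "Suc l" k] by auto
      then show False using l1 m by simp
    qed
    have l2: "length (W l) \<le> m"
    proof (cases l)
      case 0 then show ?thesis using kl m by simp
    next
      case (Suc j) then show ?thesis using not_less_Least[of j "\<lambda>l. m < length (W (Suc l))"] by (simp add: l_def)
    qed
    have m1: "1 \<le> m" using m len[of k] by simp
    from small[OF l2 l1] show ?thesis
    proof
      assume "a m \<le> 4"
      then have "\<zeta> m \<le> 5" using zeta_le[of m] by linarith
      then show ?thesis using beta_bounds(2)[OF m1] R by auto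
    next
      assume "\<exists>j. m = n j"
      then obtain j where j: "m = n j" by blast
      have "k \<le> j"
      proof (rule ccontr)
        assume "\<not> k \<le> j"
        then have "length (W (Suc j)) \<le> length (W k)" using pre[of "Suc j" k] by auto
        then show False using nlt(1)[of j] m j by simp
      qed
      then show ?thesis using j by blast
    qed
  qed
  show ?thesis
  proof (rule that)
    show "cf_seq a" by unfold_locales
    fix \<epsilon> :: real assume e: "0 < \<epsilon>"
    obtain k0 where k0: "1 / real (Suc k0) < \<epsilon>" using nat_approx_posE[OF e] by auto
    have k: "1 / real (Suc k) < \<epsilon>" if "k0 \<le> k" for k
    proof -
      have "1 / real (Suc k) \<le> 1 / real (Suc k0)" using that by (intro divide_left_mono) auto
      then show ?thesis using k0 by linarith
    qed
    show "\<exists>n0. \<forall>n\<ge>n0. \<zeta> n + \<beta> n \<le> R + \<epsilon>"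
    proof (intro exI allI impI)
      fix m assume "length (W k0) \<le> m"
      from dich[OF this] show "\<zeta> m + \<beta> m \<le> R + \<epsilon>"
      proof
        assume "\<exists>j\<ge>k0. m = n j"
        then obtain j where "k0 \<le> j" "m = n j" by blast
        then show ?thesis using val[of j] k[of j] by simp
      qed (use e in simp)
    qed
    fix n0
    define j where "j = max k0 n0"
    show "\<exists>n\<ge>n0. R - \<epsilon> \<le> \<zeta> n + \<beta> n \<and> even n \<and> Good (map a [0..<n])"
    proof (intro exI[of _ "n j"] conjI)
      show "n0 \<le> n j" using len[of j] by (simp add: nk j_def)
      show "R - \<epsilon> \<le> \<zeta> (n j) + \<beta> (n j)" using val[of j] k[of j] by (simp add: j_def)
      show "even (n j)" using W(1)[of j] ucb(1)[of j] by (simp add: nk OK_def blk_def)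
      have "map a [0..<n j] = W j @ u j @ rev (c j)"
        using amap[OF less_imp_le[OF nlt(1)[of j]]] by (simp add: ucb(2)[of j] n_def)
      then show "Good (map a [0..<n j])" using ucb(1)[of j] by (simp add: blk_def)
    qed
  qed
qed

section \<open>Steering a pair of bijections\<close>

lemma funpow_return:
  assumes "finite T" "bij_betw h T T" "t \<in> T"
  obtains n where "0 < n" "(h ^^ n) t = t"
proof -
  have mem: "(h ^^ n) x \<in> T" if "x \<in> T" for n x
    using that assms(2) by (induction n) (auto simp: bij_betw_def)
  have "\<not> inj (\<lambda>n. (h ^^ n) t)"
  proof
    assume "inj (\<lambda>n. (h ^^ n) t)"
    moreover have "finite (range (\<lambda>n. (h ^^ n) t))"
      using mem[OF assms(3)] by (intro finite_subset[OF _ assms(1)]) auto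
    ultimately show False using finite_imageD infinite_UNIV_nat by blast
  qed
  then obtain i j where ij: "i < j" "(h ^^ i) t = (h ^^ j) t"
    unfolding inj_def by (metis linorder_neqE_nat)
  have "inj_on (h ^^ i) T" using bij_betw_funpow[OF assms(2)] by (auto simp: bij_betw_def)
  moreover have "(h ^^ i) ((h ^^ (j - i)) t) = (h ^^ i) t"
    using ij by (metis comp_apply funpow_add le_add_diff_inverse less_imp_le)
  ultimately have "(h ^^ (j - i)) t = t" using mem[OF assms(3)] assms(3) by (auto dest: inj_onD)
  then show ?thesis using that[of "j - i"] ij by simp
qed

locale two_bijections =
  fixes T :: "'t set" and f g :: "'t \<Rightarrow> 't"
  assumes finT: "finite T" and f: "bij_betw f T T" and g: "bij_betw g T T"
begin

text \<open>Digits act alternately by powers of \<open>f\<close> and \<open>g\<close>, as the steps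
  of a continued fraction act on a basis. Hence concatenation becomes composition only after a word
  of even length.\<close>

fun wact :: "nat list \<Rightarrow> 't \<Rightarrow> 't" where
  "wact [] t = t"
| "wact [x] t = (f ^^ x) t"
| "wact (x # y # ds) t = wact ds ((g ^^ y) ((f ^^ x) t))"

lemma wact_append: "even (length v) \<Longrightarrow> wact (v @ w) t = wact w (wact v t)"
  by (induction v t rule: wact.induct) auto

lemma bij_funpow: "bij_betw (f ^^ n) T T" "bij_betw (g ^^ n) T T"
  using f g by (auto intro: bij_betw_funpow)

lemma bij_wact: "bij_betw (wact w) T T"
proof (induction w rule: induct_list012)
  case (3 x y ds)
  have "bij_betw (wact ds \<circ> ((g ^^ y) \<circ> (f ^^ x))) T T"
    using 3(1) bij_funpow by (intro bij_betw_trans)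
  moreover have "wact (x # y # ds) = wact ds \<circ> ((g ^^ y) \<circ> (f ^^ x))" by (rule ext) simp
  ultimately show ?case by (simp only:)
next
  case 1
  have "wact [] = id" by (rule ext) simp
  then show ?case by (simp only: bij_betw_id)
next
  case (2 x)
  have "wact [x] = f ^^ x" by (rule ext) simp
  then show ?case using bij_funpow by (simp only:)
qed

lemma wact_mem: "t \<in> T \<Longrightarrow> wact w t \<in> T"
  using bij_wact by (auto simp: bij_betw_def)

text \<open>The digits 1 and 2 keep steering words among the small digits, which cannot disturb the
  limsup.\<close>

definition steer :: "'t \<Rightarrow> 't \<Rightarrow> bool" where
  "steer t t' \<longleftrightarrow> (\<exists>u. even (length u) \<and> set u \<subseteq> {1, 2} \<and> wact u t = t')"

lemma steer_refl: "steer t t"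
  unfolding steer_def by (rule exI[of _ "[]"]) auto

lemma steer_trans: "steer t t' \<Longrightarrow> steer t' t'' \<Longrightarrow> steer t t''"
  unfolding steer_def
proof (elim exE conjE)
  fix u v assume "even (length u)" "set u \<subseteq> {1, 2}" "wact u t = t'" "even (length v)" "set v \<subseteq> {1, 2}" "wact v t' = t''"
  then show "\<exists>u. even (length u) \<and> set u \<subseteq> {1, 2} \<and> wact u t = t''"
    by (intro exI[of _ "u @ v"]) (simp add: wact_append)
qed

lemma steer_step: 
  assumes "x \<in> {1, 2}" "y \<in> {1, 2}"
  shows "steer t (wact [x, y] t)"
  unfolding steer_def using assms by (intro exI[of _ "[x, y]"]) auto

text \<open>The inverse is reached by running forward: on a finite set the orbit of \<open>t\<close>
  under \<open>wact [x, y]\<close> returns to \<open>t\<close>.\<close>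

lemma steer_back:
  assumes "x \<in> {1, 2}" "y \<in> {1, 2}" "t \<in> T"
  shows "steer (wact [x, y] t) t"
proof -
  let ?h = "wact [x, y]"
  obtain n where n: "0 < n" "(?h ^^ n) t = t" using funpow_return[OF finT bij_wact assms(3)] by blast
  have "steer s ((?h ^^ m) s)" for m s
  proof (induction m)
    case (Suc m)
    then show ?case using steer_trans[OF Suc steer_step[OF assms(1,2)]] by simp
  qed (simp add: steer_refl)
  moreover have "(?h ^^ (n - 1)) (?h t) = t" using n by (cases n) (simp_all add: funpow_swap1 del: wact.simps)
  ultimately show ?thesis by metis
qed

lemma steer_sym:
  assumes "steer t t'" "t \<in> T"
  shows "steer t' t"
proof -
  obtain u where u: "even (length u)" "set u \<subseteq> {1, 2}" "wact u t = t'"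
    using assms(1) by (auto simp: steer_def)
  have "steer (wact u t) t" using u(1,2) assms(2)
  proof (induction u arbitrary: t rule: induct_list012)
    case (3 x y ds)
    have m: "wact [x, y] t \<in> T" using wact_mem 3 by blast
    have "steer (wact ds (wact [x, y] t)) (wact [x, y] t)" using 3 m by auto
    moreover have "steer (wact [x, y] t) t" using 3 by (intro steer_back) auto
    ultimately show ?case using steer_trans by simp
  qed (auto simp: steer_refl)
  then show ?thesis using u by simp
qed

text \<open>A single \<open>g\<close> is not an even word with digits 1 and 2, but undoing
  \<open>[1, 1]\<close> and then applying \<open>[1, 2]\<close> leaves exactly one
  \<open>g\<close>.\<close>

lemma steer_g:
  assumes "t \<in> T"
  shows "steer t (g t)"
proof -
  obtain s where s: "s \<in> T" "t = wact [1, 1] s"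
    using bij_wact[of "[1, 1]"] assms by (auto simp: bij_betw_def)
  have "g t = wact [1, 2] s" using s by (simp add: numeral_2_eq_2)
  then have "steer s (g t)" using steer_step[of 1 2 s] by simp
  moreover have "steer t s" using steer_back[of 1 1 s] s by simp
  ultimately show ?thesis using steer_trans by blast
qed

text \<open>Both \<open>t\<close> and \<open>f t\<close> reach \<open>g (f t)\<close>, and steering
  is symmetric.\<close>

lemma steer_f:
  assumes "t \<in> T"
  shows "steer t (f t)"
proof -
  have fT: "f t \<in> T" using f assms by (auto simp: bij_betw_def)
  have "steer t (wact [1, 1] t)" by (rule steer_step) auto
  moreover have "steer (f t) (wact [1, 1] t)" using steer_g[OF fT] by simp
  ultimately show ?thesis using steer_trans steer_sym fT by blast
qed

lemma steer_wact: 
  assumes "t \<in> T"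
  shows "steer t (wact w t)"
proof -
  have fn: "steer t ((f ^^ n) t) \<and> (f ^^ n) t \<in> T" if "t \<in> T" for t n
    using that
  proof (induction n)
    case (Suc n)
    then show ?case using steer_trans[OF _ steer_f[of "(f ^^ n) t"]] f by (auto simp: bij_betw_def)
  qed (simp add: steer_refl)
  have gn: "steer t ((g ^^ n) t) \<and> (g ^^ n) t \<in> T" if "t \<in> T" for t n
    using that
  proof (induction n)
    case (Suc n)
    then show ?case using steer_trans[OF _ steer_g[of "(g ^^ n) t"]] g by (auto simp: bij_betw_def)
  qed (simp add: steer_refl)
  show ?thesis using assms
  proof (induction w arbitrary: t rule: induct_list012)
    case (3 x y ds)
    have "(g ^^ y) ((f ^^ x) t) \<in> T" using fn[of t x] gn[of "(f ^^ x) t" y] 3(3) by blast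
    then have "steer ((g ^^ y) ((f ^^ x) t)) (wact (x # y # ds) t)" using 3(1) by simp
    moreover have "steer t ((g ^^ y) ((f ^^ x) t))"
      using fn[of t x] gn[of "(f ^^ x) t" y] 3(3) steer_trans by blast
    ultimately show ?case using steer_trans by blast
  qed (use fn steer_refl in auto)
qed

text \<open>Steering is symmetric and dominates every word. So the effect of \<open>w\<close> can be
  undone, the target can be pulled back through \<open>h\<close>, and the state after
  \<open>w\<close> is steered to the state before \<open>h\<close>.\<close>

theorem steering:
  assumes "t0 \<in> T" "steer t0 s" "even (length w)" "even (length h)"
  obtains u where "even (length u)" "set u \<subseteq> {1, 2}" "wact (w @ u @ h) t0 = s"
proof -
  have s: "s \<in> T" using assms(1,2) wact_mem by (auto simp: steer_def)
  have "s \<in> wact h ` T" using s bij_betw_imp_surj_on[OF bij_wact] by simp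
  then obtain s' where s': "s' \<in> T" "wact h s' = s" by (elim imageE) simp
  have "steer (wact w t0) t0" using steer_sym steer_wact assms(1) by blast
  moreover have "steer s s'" using steer_sym steer_wact[of s' h] s' by blast
  ultimately have "steer (wact w t0) s'" using assms(2) steer_trans by blast
  then obtain u where "even (length u)" "set u \<subseteq> {1, 2}" "wact u (wact w t0) = s'"
    by (auto simp: steer_def)
  then show ?thesis using that[of u] s' assms by (simp add: wact_append)
qed

end

text \<open>
  A type consists of the two gluing permutations of a tiling by parallelograms and of the set of
  parallelograms with a conical corner. \<open>Rmove\<close> and \<open>Lmove\<close> describe the base changes
  \<open>(v, w + v)\<close> and \<open>(v + w, w)\<close>.
\<close>

definition sq_types :: "'b set \<Rightarrow> (('b \<Rightarrow> 'b) \<times> ('b \<Rightarrow> 'b) \<times> 'b set) set" where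
  "sq_types F = {(r, u, M). r permutes F \<and> u permutes F \<and> M \<subseteq> F}"

definition Rmove :: "('b \<Rightarrow> 'b) \<times> ('b \<Rightarrow> 'b) \<times> 'b set \<Rightarrow> ('b \<Rightarrow> 'b) \<times> ('b \<Rightarrow> 'b) \<times> 'b set" where
  "Rmove = (\<lambda>(r, u, M). (r, u \<circ> r, M))"

definition Lmove :: "('b \<Rightarrow> 'b) \<times> ('b \<Rightarrow> 'b) \<times> 'b set \<Rightarrow> ('b \<Rightarrow> 'b) \<times> ('b \<Rightarrow> 'b) \<times> 'b set" where
  "Lmove = (\<lambda>(r, u, M). (r \<circ> u, u, M))"

lemma sq_moves:
  assumes "finite F"
  shows "two_bijections (sq_types F) Rmove Lmove"
proof -
  have sub: "sq_types F \<subseteq> {p. p permutes F} \<times> {p. p permutes F} \<times> Pow F"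
    by (auto simp: sq_types_def)
  have fin: "finite (sq_types F)"
    by (rule finite_subset[OF sub]) (auto simp: assms finite_permutations)
  have cancel: "u = u'" if ur: "u \<circ> r = u' \<circ> r" "r permutes F" for u u' r :: "'a \<Rightarrow> 'a"
  proof
    fix x
    obtain y where "x = r y" using permutes_surj[OF ur(2)] by (metis surjD)
    then show "u x = u' x" using fun_cong[OF ur(1), of y] by simp
  qed
  have "inj_on Rmove (sq_types F)"
  proof (rule inj_onI)
    fix x y assume xy: "x \<in> sq_types F" "y \<in> sq_types F" "Rmove x = Rmove y"
    obtain r u M r' u' M' where e: "x = (r, u, M)" "y = (r', u', M')" by (metis prod_cases3)
    have "r = r'" "M = M'" "u \<circ> r = u' \<circ> r" using xy(3) by (auto simp: e Rmove_def)
    moreover have "r permutes F" using xy(1) by (simp add: e sq_types_def)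
    ultimately show "x = y" using cancel by (simp add: e)
  qed
  moreover have "inj_on Lmove (sq_types F)"
  proof (rule inj_onI)
    fix x y assume xy: "x \<in> sq_types F" "y \<in> sq_types F" "Lmove x = Lmove y"
    obtain r u M r' u' M' where e: "x = (r, u, M)" "y = (r', u', M')" by (metis prod_cases3)
    have "u = u'" "M = M'" "r \<circ> u = r' \<circ> u" using xy(3) by (auto simp: e Lmove_def)
    moreover have "u permutes F" using xy(1) by (simp add: e sq_types_def)
    ultimately show "x = y" using cancel by (simp add: e)
  qed
  moreover have "Rmove ` sq_types F \<subseteq> sq_types F" "Lmove ` sq_types F \<subseteq> sq_types F"
    by (auto simp: Rmove_def Lmove_def sq_types_def permutes_compose)
  ultimately show ?thesis
    using fin by unfold_locales (auto simp: bij_betw_def endo_inj_surj)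
qed

section \<open>Coordinates adapted to the covering of the torus\<close>

text \<open>The torus is realised inside \<open>\<complex>\<^sup>2\<close>, where Hausdorff and metric arguments are available.\<close>

definition E :: "complex \<Rightarrow> complex \<times> complex" where
  "E z = (cis (2 * pi * Re z), cis (2 * pi * Im z))"

lemma cis_eq_int: "cis (2 * pi * x) = cis (2 * pi * y) \<longleftrightarrow> x - y \<in> \<int>"
proof -
  have "cis (2 * pi * x) = cis (2 * pi * y) \<longleftrightarrow> (\<exists>n::int. 2 * pi * x = 2 * pi * y + 2 * pi * n)"
    unfolding sin_cos_eq_iff[symmetric] by (auto simp: complex_eq_iff)
  also have "\<dots> \<longleftrightarrow> (\<exists>n::int. 2 * pi * (x - y) = 2 * pi * n)" by (auto simp: algebra_simps)
  also have "\<dots> \<longleftrightarrow> (\<exists>n::int. x - y = n)" by simp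
  also have "\<dots> \<longleftrightarrow> x - y \<in> \<int>" by (auto elim: Ints_cases)
  finally show ?thesis .
qed

lemma gauss_ints_iff: "z \<in> gauss_ints \<longleftrightarrow> Re z \<in> \<int> \<and> Im z \<in> \<int>"
  unfolding gauss_ints_def by (auto simp: complex_eq_iff elim!: Ints_cases)

lemma gauss_ints_add: "z \<in> gauss_ints \<Longrightarrow> w \<in> gauss_ints \<Longrightarrow> z + w \<in> gauss_ints"
  by (auto simp: gauss_ints_iff)

lemma gauss_ints_minus: "z \<in> gauss_ints \<Longrightarrow> - z \<in> gauss_ints"
  by (auto simp: gauss_ints_iff)

lemma E_eq_iff: "E z = E w \<longleftrightarrow> z - w \<in> gauss_ints"
  by (simp add: E_def cis_eq_int gauss_ints_iff)

lemma E_add_gauss: "l \<in> gauss_ints \<Longrightarrow> E (z + l) = E z" "l \<in> gauss_ints \<Longrightarrow> E (z - l) = E z"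
  by (auto simp: E_eq_iff gauss_ints_minus)

lemma continuous_on_E: "continuous_on A E"
  unfolding E_def by (intro continuous_intros)

lemma Ints_small: "x \<in> \<int> \<Longrightarrow> \<bar>x\<bar> < 1 \<Longrightarrow> x = (0::real)"
  by (auto elim!: Ints_cases)

lemma gauss_ints_small: 
  assumes "z \<in> gauss_ints" "cmod z < 1"
  shows "z = 0"
proof -
  have "\<bar>Re z\<bar> < 1" "\<bar>Im z\<bar> < 1" using abs_Re_le_cmod[of z] abs_Im_le_cmod[of z] assms by auto
  then show ?thesis using assms Ints_small by (auto simp: gauss_ints_iff complex_eq_iff)
qed

lemma E_inj_near: "E z = E w \<Longrightarrow> cmod (z - c) < 1/2 \<Longrightarrow> cmod (w - c) < 1/2 \<Longrightarrow> z = w"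
proof -
  assume a: "E z = E w" "cmod (z - c) < 1/2" "cmod (w - c) < 1/2"
  have "cmod (z - w) = cmod ((z - c) - (w - c))" by simp
  also have "\<dots> < 1" using norm_triangle_ineq4[of "z - c" "w - c"] a by linarith
  finally show "z = w" using gauss_ints_small[of "z - w"] a(1) by (simp add: E_eq_iff)
qed

lift_definition torus_E :: "torus \<Rightarrow> complex \<times> complex" is E
  by (simp add: E_eq_iff)

lemma torus_E_abs: "torus_E (abs_torus z) = E z"
  by (rule torus_E.abs_eq)

lemma torus_abs_exhaust: obtains z where "t = abs_torus z"
  using that[of "rep_torus t"] Quotient_abs_rep[OF Quotient_torus, of t] by simp

lemma torus_E_inj: "torus_E s = torus_E t \<longleftrightarrow> s = t"
proof -
  obtain z w where "s = abs_torus z" "t = abs_torus w" by (metis torus_abs_exhaust)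
  then show ?thesis by (simp add: torus_E_abs E_eq_iff torus.abs_eq_iff)
qed

lemma continuous_on_torus_E: "continuous_on A torus_E"
proof -
  have "open (torus_E -` U)" if "open U" for U
  proof -
    have "abs_torus -` (torus_E -` U) = E -` U" by (auto simp: torus_E_abs)
    then show ?thesis unfolding open_torus_def
      using continuous_on_E[of UNIV] that by (metis open_vimage)
  qed
  then have "continuous_on UNIV torus_E" by (simp add: continuous_on_open_vimage)
  then show ?thesis using continuous_on_subset by blast
qed

section \<open>The surface, its charts and its covering of the torus\<close>

locale origami =
  fixes X :: "'a::t2_space form_surface" and \<rho> :: "'a \<Rightarrow> torus"
  assumes ts: "translation_surface X" and sq: "square_covering (flat X) \<rho>"
begin

abbreviation "S \<equiv> surf X"
abbreviation "Sg \<equiv> cone_pts X"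

definition e :: "'a \<Rightarrow> complex \<times> complex" where "e x = torus_E (\<rho> x)"

lemma e_eq_iff: "e x = E z \<longleftrightarrow> \<rho> x = abs_torus z"
  unfolding e_def torus_E_abs[symmetric] by (rule torus_E_inj)

lemma flat_sel [simp]: "pts (flat X) = S" "sing (flat X) = Sg"
  by (simp_all add: flat_def)

lemma compact_S: "compact S" and finite_Sg: "finite Sg" and Sg_sub: "Sg \<subseteq> S"
  and zeros_sub: "form_zeros X \<subseteq> Sg" and rs: "riemann_surface S (atlas X)"
  and hf: "holomorphic_form (atlas X) (form X)"
  using ts unfolding translation_surface_def by blast+

lemma cont_e: "continuous_on S e"
proof -
  have "continuous_on S \<rho>" using sq by (simp add: square_covering_def)
  then have "continuous_on S (torus_E \<circ> \<rho>)" using continuous_on_torus_E by (rule continuous_on_compose)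
  then show ?thesis by (simp add: e_def[abs_def] comp_def)
qed

lemma e_Sg: "x \<in> Sg \<Longrightarrow> e x = E 0"
  using sq by (auto simp: square_covering_def e_eq_iff)

lemma chart_local:
  assumes "(U, f) \<in> charts (flat X)" "x \<in> U"
  obtains V c where "openin (top_of_set S) V" "x \<in> V" "V \<subseteq> U" "\<And>y. y \<in> V \<Longrightarrow> e y = E (f y + c)"
proof -
  have "\<forall>x\<in>U. \<exists>V c. openin (top_of_set (pts (flat X))) V \<and> x \<in> V \<and> V \<subseteq> U \<and> (\<forall>y\<in>V. \<rho> y = abs_torus (f y + c))"
    using sq assms(1) unfolding square_covering_def by blast
  then obtain V c where "openin (top_of_set S) V" "x \<in> V" "V \<subseteq> U" "\<forall>y\<in>V. \<rho> y = abs_torus (f y + c)"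
    using assms(2) unfolding flat_sel by blast
  then show ?thesis using that[of V c] by (simp add: e_eq_iff)
qed

lemma charts_iff: "(U, f) \<in> charts (flat X) \<longleftrightarrow> openin (top_of_set S) U \<and> U \<inter> Sg = {} \<and> inj_on f U \<and>
       (\<forall>(V, \<phi>)\<in>atlas X. \<forall>x\<in>U \<inter> V.
          ((f \<circ> inv_into V \<phi>) has_field_derivative form X (V, \<phi>) (\<phi> x)) (at (\<phi> x)))"
  by (simp add: flat_def)

lemma chart_subset:
  assumes "(U, f) \<in> charts (flat X)" "openin (top_of_set S) V" "V \<subseteq> U"
  shows "(V, \<lambda>x. f x + c) \<in> charts (flat X)"
proof -
  have "((\<lambda>x. f x + c) \<circ> inv_into W \<phi> has_field_derivative form X (W, \<phi>) (\<phi> x)) (at (\<phi> x))"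
    if "(W, \<phi>) \<in> atlas X" "x \<in> V \<inter> W" for W \<phi> x
  proof -
    have "((f \<circ> inv_into W \<phi>) has_field_derivative form X (W, \<phi>) (\<phi> x)) (at (\<phi> x))"
      using assms that unfolding charts_iff by blast
    then have "((\<lambda>z. (f \<circ> inv_into W \<phi>) z + c) has_field_derivative form X (W, \<phi>) (\<phi> x) + 0) (at (\<phi> x))"
      by (rule DERIV_add[OF _ DERIV_const])
    then show ?thesis by (simp only: comp_def add_0_right)
  qed
  moreover have "inj_on (\<lambda>x. f x + c) V"
    using assms(1,3) unfolding charts_iff inj_on_def by (metis add_right_cancel subsetD)
  ultimately show ?thesis using assms unfolding charts_iff by auto
qed

lemma atlasD:
  assumes "(V, \<phi>) \<in> atlas X"
  shows "openin (top_of_set S) V" "open (\<phi> ` V)" "homeomorphism V (\<phi> ` V) \<phi> (inv_into V \<phi>)"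
    "form X (V, \<phi>) holomorphic_on \<phi> ` V"
proof -
  have "openin (top_of_set S) V \<and> open (\<phi> ` V) \<and> homeomorphism V (\<phi> ` V) \<phi> (inv_into V \<phi>)"
    using rs assms unfolding riemann_surface_def by blast
  then show "openin (top_of_set S) V" "open (\<phi> ` V)" "homeomorphism V (\<phi> ` V) \<phi> (inv_into V \<phi>)" by auto
  show "form X (V, \<phi>) holomorphic_on \<phi> ` V"
    using hf assms unfolding holomorphic_form_def by blast
qed

lemma atlas_cover: "x \<in> S \<Longrightarrow> \<exists>(V, \<phi>)\<in>atlas X. x \<in> V"
  using rs unfolding riemann_surface_def by blast

lemma atlas_preimage:
  assumes "(V, \<phi>) \<in> atlas X" "open B"
  shows "openin (top_of_set S) (V \<inter> \<phi> -` B)"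
proof -
  have "continuous_on V \<phi>" using atlasD(3)[OF assms(1)] by (rule homeomorphism_cont1)
  then have "openin (top_of_set V) (V \<inter> \<phi> -` B)" using assms(2) by (rule continuous_openin_preimage_gen)
  then show ?thesis using atlasD(1)[OF assms(1)] openin_trans by blast
qed

lemma atlas_open_image:
  assumes "(V, \<phi>) \<in> atlas X" "openin (top_of_set S) W"
  shows "open (\<phi> ` (V \<inter> W))"
proof -
  have "openin (top_of_set V) (V \<inter> W)"
    using assms(2) atlasD(1)[OF assms(1)] by (metis inf_commute inf_le1 openin_Int openin_imp_subset openin_subset_trans)
  then have "openin (top_of_set (\<phi> ` V)) (\<phi> ` (V \<inter> W))"
    using homeomorphism_imp_open_map[OF atlasD(3)[OF assms(1)]] by blast
  then show ?thesis using atlasD(2)[OF assms(1)] openin_open_trans by blast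
qed

lemma atlas_inv: "(V, \<phi>) \<in> atlas X \<Longrightarrow> x \<in> V \<Longrightarrow> inv_into V \<phi> (\<phi> x) = x"
  using homeomorphism_apply1[OF atlasD(3)] .

text \<open>In another chart of the atlas the derivative of the primitive acquires the derivative of
  the transition map, and this is precisely the transformation rule of the form.\<close>

lemma primitive_chart:
  assumes V: "(V, \<phi>) \<in> atlas X"
    and F: "\<And>\<zeta>. \<zeta> \<in> B \<Longrightarrow> (F has_field_derivative form X (V, \<phi>) \<zeta>) (at \<zeta>)"
    and B: "open B" "B \<subseteq> \<phi> ` V" and inj: "inj_on F B"
    and dis: "V \<inter> \<phi> -` B \<inter> Sg = {}"
  shows "(V \<inter> \<phi> -` B, F \<circ> \<phi>) \<in> charts (flat X)"
  unfolding charts_iff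
proof (intro conjI ballI)
  show "openin (top_of_set S) (V \<inter> \<phi> -` B)" by (rule atlas_preimage[OF V B(1)])
  show "V \<inter> \<phi> -` B \<inter> Sg = {}" by (rule dis)
  have "inj_on \<phi> V" using atlasD(3)[OF V] by (metis homeomorphism_def inj_on_inverseI)
  then show "inj_on (F \<circ> \<phi>) (V \<inter> \<phi> -` B)"
    using inj by (auto simp: inj_on_def)
  fix c assume c: "c \<in> atlas X"
  obtain V' \<psi> where c': "c = (V', \<psi>)" by (cases c)
  have V': "(V', \<psi>) \<in> atlas X" using c c' by simp
  have "((F \<circ> \<phi>) \<circ> inv_into V' \<psi> has_field_derivative form X (V', \<psi>) (\<psi> x)) (at (\<psi> x))"
    if x: "x \<in> V \<inter> \<phi> -` B \<inter> V'" for x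
  proof -
    have hol: "(\<phi> \<circ> inv_into V' \<psi>) holomorphic_on \<psi> ` (V' \<inter> V)"
      using rs V V' unfolding riemann_surface_def by fastforce
    have op: "open (\<psi> ` (V' \<inter> V))" using atlas_open_image[OF V' atlasD(1)[OF V]] .
    have "(\<phi> \<circ> inv_into V' \<psi> has_field_derivative deriv (\<phi> \<circ> inv_into V' \<psi>) (\<psi> x)) (at (\<psi> x))"
      using x holomorphic_derivI[OF hol op] by blast
    moreover have "(F has_field_derivative form X (V, \<phi>) (\<phi> x)) (at ((\<phi> \<circ> inv_into V' \<psi>) (\<psi> x)))"
      using F x atlas_inv[OF V'] by auto
    ultimately have "(F \<circ> (\<phi> \<circ> inv_into V' \<psi>) has_field_derivative
        form X (V, \<phi>) (\<phi> x) * deriv (\<phi> \<circ> inv_into V' \<psi>) (\<psi> x)) (at (\<psi> x))"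
      by (rule DERIV_chain[rotated])
    moreover have "form X (V', \<psi>) (\<psi> x) = form X (V, \<phi>) (\<phi> x) * deriv (\<phi> \<circ> inv_into V' \<psi>) (\<psi> x)"
      using hf V V' x unfolding holomorphic_form_def by fastforce
    ultimately show ?thesis by (simp add: comp_assoc)
  qed
  then show "case c of (V', \<psi>) \<Rightarrow> \<forall>x\<in>V \<inter> \<phi> -` B \<inter> V'.
      ((F \<circ> \<phi>) \<circ> inv_into V' \<psi> has_field_derivative form X (V', \<psi>) (\<psi> x)) (at (\<psi> x))"
    by (simp add: c')
qed

lemma form_nonzero: "(V, \<phi>) \<in> atlas X \<Longrightarrow> x \<in> V \<Longrightarrow> x \<notin> Sg \<Longrightarrow> form X (V, \<phi>) (\<phi> x) \<noteq> 0"
  using zeros_sub unfolding form_zeros_def by blast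

text \<open>\<open>F\<close> is injective near \<open>\<phi> y\<close> because its derivative, the
  form, does not vanish there; the disc is shrunk further to exclude the one point \<open>x\<close>
  that may be singular.\<close>

lemma primitive_chart_at:
  assumes V: "(V, \<phi>) \<in> atlas X"
    and F: "\<And>\<zeta>. \<zeta> \<in> B \<Longrightarrow> (F has_field_derivative form X (V, \<phi>) \<zeta>) (at \<zeta>)"
    and B: "open B" "B \<subseteq> \<phi> ` V" and y: "y \<in> V" "\<phi> y \<in> B" "y \<notin> Sg"
    and dis: "V \<inter> \<phi> -` B \<inter> Sg \<subseteq> {x}" 
  obtains \<delta> where "0 < \<delta>" "ball (\<phi> y) \<delta> \<subseteq> B" "inj_on F (ball (\<phi> y) \<delta>)"
    "(V \<inter> \<phi> -` ball (\<phi> y) \<delta>, F \<circ> \<phi>) \<in> charts (flat X)"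
proof -
  have hol: "F holomorphic_on B"
    using F B(1) by (auto simp: holomorphic_on_def field_differentiable_def intro: has_field_derivative_at_within)
  have "deriv F (\<phi> y) = form X (V, \<phi>) (\<phi> y)" using F[OF y(2)] by (rule DERIV_imp_deriv)
  then have "deriv F (\<phi> y) \<noteq> 0" using form_nonzero[OF V y(1,3)] by simp
  then obtain r where r: "r > 0" "ball (\<phi> y) r \<subseteq> B" "inj_on F (ball (\<phi> y) r)"
    using has_complex_derivative_locally_injective[OF hol y(2) B(1)] by blast
  define d where "d = (if x \<in> V \<and> x \<noteq> y then dist (\<phi> x) (\<phi> y) else r)"
  have ne: "\<phi> x \<noteq> \<phi> y" if "x \<in> V" "x \<noteq> y" using that y(1) atlas_inv[OF V] by metis
  have d: "0 < d" using ne r(1) by (auto simp: d_def)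
  define \<delta> where "\<delta> = min r d"
  have sub: "ball (\<phi> y) \<delta> \<subseteq> ball (\<phi> y) r" by (auto simp: \<delta>_def)
  have "V \<inter> \<phi> -` ball (\<phi> y) \<delta> \<inter> Sg = {}"
  proof (rule ccontr)
    assume "\<not> ?thesis"
    then obtain s where s: "s \<in> V" "\<phi> s \<in> ball (\<phi> y) \<delta>" "s \<in> Sg" by blast
    then have "s = x" using dis sub r(2) by blast
    then have "d = dist (\<phi> x) (\<phi> y)" using s y(3) by (auto simp: d_def)
    then show False using s \<open>s = x\<close> by (simp add: \<delta>_def dist_commute)
  qed
  then have "(V \<inter> \<phi> -` ball (\<phi> y) \<delta>, F \<circ> \<phi>) \<in> charts (flat X)"
    using sub r B by (intro primitive_chart[OF V, of "ball (\<phi> y) \<delta>" F] F) (auto intro: inj_on_subset)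
  then show ?thesis using that[of \<delta>] sub r d by (auto simp: \<delta>_def intro: inj_on_subset)
qed

text \<open>Around every point, conical or not, the covering map has a branched coordinate: the primitive
  of the form, with its constant chosen such that it lifts \<open>\<rho>\<close>.\<close>

lemma local_coordinate:
  assumes x: "x \<in> S" and ez: "e x = E z"
  obtains U \<Phi> where "openin (top_of_set S) U" "x \<in> U" "continuous_on U \<Phi>" "\<Phi> x = z"
    "\<And>y. y \<in> U \<Longrightarrow> e y = E (\<Phi> y)" "\<And>y. y \<in> U \<Longrightarrow> \<Phi> y = z \<Longrightarrow> y = x"
    "\<And>y. y \<in> U \<Longrightarrow> cmod (\<Phi> y - z) < 1/2"
    "\<And>W. openin (top_of_set S) W \<Longrightarrow> W \<subseteq> U \<Longrightarrow> open (\<Phi> ` W)"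
    "x \<notin> Sg \<Longrightarrow> U \<inter> Sg = {} \<and> inj_on \<Phi> U \<and> (U, \<Phi>) \<in> charts (flat X)"
proof -
  obtain V \<phi> where V: "(V, \<phi>) \<in> atlas X" and xV: "x \<in> V" using atlas_cover[OF x] by blast
  define p where "p = \<phi> x"
  define w where "w = form X (V, \<phi>)"
  define g where "g = inv_into V \<phi>"
  have hom: "homeomorphism V (\<phi> ` V) \<phi> g" using atlasD(3)[OF V] by (simp add: g_def)
  have VS: "V \<subseteq> S" using atlasD(1)[OF V] by (rule openin_imp_subset)
  have op: "open (\<phi> ` V - \<phi> ` (V \<inter> Sg - {x}))"
    using finite_Sg atlasD(2)[OF V] by (intro open_Diff finite_imp_closed) auto
  have "p \<notin> \<phi> ` (V \<inter> Sg - {x})"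
  proof
    assume "p \<in> \<phi> ` (V \<inter> Sg - {x})"
    then obtain s where s: "s \<in> V" "s \<noteq> x" "\<phi> s = \<phi> x" unfolding p_def by (metis DiffE IntE image_iff singletonI)
    then show False using atlas_inv[OF V s(1)] atlas_inv[OF V xV] by simp
  qed
  then have pm: "p \<in> \<phi> ` V - \<phi> ` (V \<inter> Sg - {x})" using xV by (simp add: p_def)
  obtain r where r: "0 < r" "ball p r \<subseteq> \<phi> ` V - \<phi> ` (V \<inter> Sg - {x})"
    by (rule openE[OF op pm])
  have rV: "ball p r \<subseteq> \<phi> ` V" using r by blast
  have dis: "V \<inter> \<phi> -` ball p r \<inter> Sg \<subseteq> {x}" using r by blast
  have pB: "p \<in> ball p r" using r by simp
  have gB: "g \<zeta> \<in> V" "\<phi> (g \<zeta>) = \<zeta>" if "\<zeta> \<in> ball p r" for \<zeta>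
    using that rV hom by (auto simp: homeomorphism_def)
  have gp: "g p = x" using atlas_inv[OF V xV] by (simp add: g_def p_def)
  have gSg: "g \<zeta> \<notin> Sg" if "\<zeta> \<in> ball p r - {p}" for \<zeta>
  proof
    assume "g \<zeta> \<in> Sg"
    then have "g \<zeta> = x" using dis gB[of \<zeta>] that by auto
    then show False using gB[of \<zeta>] that by (simp add: p_def)
  qed
  have "w holomorphic_on ball p r"
    using atlasD(4)[OF V] rV unfolding w_def by (rule holomorphic_on_subset)
  then obtain F where "\<And>\<zeta>. \<zeta> \<in> ball p r \<Longrightarrow> (F has_field_derivative w \<zeta>) (at \<zeta> within ball p r)"
    using holomorphic_convex_primitive'[OF convex_ball open_ball] by metis
  then have F: "\<And>\<zeta>. \<zeta> \<in> ball p r \<Longrightarrow> (F has_field_derivative w \<zeta>) (at \<zeta>)"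
    by (simp add: at_within_open[OF _ open_ball])
  have Fhol: "F holomorphic_on ball p r"
    unfolding holomorphic_on_open[OF open_ball] using F by blast
  have Fcont: "continuous_on (ball p r) F" using Fhol by (rule holomorphic_on_imp_continuous_on)
  have loc: "\<exists>T c. open T \<and> \<zeta> \<in> T \<and> (\<forall>\<xi>\<in>T. e (g \<xi>) = E (F \<xi> + c))" if \<zeta>: "\<zeta> \<in> ball p r - {p}" for \<zeta>
  proof -
    have y: "g \<zeta> \<in> V" "\<phi> (g \<zeta>) = \<zeta>" "g \<zeta> \<notin> Sg" using \<zeta> gB gSg by auto
    obtain \<delta> where d: "0 < \<delta>" "ball \<zeta> \<delta> \<subseteq> ball p r"
      "(V \<inter> \<phi> -` ball \<zeta> \<delta>, F \<circ> \<phi>) \<in> charts (flat X)"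
      using primitive_chart_at[OF V F[unfolded w_def] open_ball rV y(1) _ y(3) dis] y \<zeta> by (metis DiffD1)
    obtain V' c where V': "openin (top_of_set S) V'" "g \<zeta> \<in> V'" "V' \<subseteq> V \<inter> \<phi> -` ball \<zeta> \<delta>"
      "\<And>y. y \<in> V' \<Longrightarrow> e y = E ((F \<circ> \<phi>) y + c)"
      using chart_local[OF d(3), of "g \<zeta>"] y d(1) by auto
    have "open (\<phi> ` (V \<inter> V'))" using atlas_open_image[OF V V'(1)] .
    moreover have "\<zeta> \<in> \<phi> ` (V \<inter> V')" using y V'(2) by force
    moreover have "e (g \<xi>) = E (F \<xi> + c)" if \<xi>: "\<xi> \<in> \<phi> ` (V \<inter> V')" for \<xi>
    proof -
      obtain y where "y \<in> V" "y \<in> V'" "\<xi> = \<phi> y" using \<xi> by blast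
      then show ?thesis using V'(4)[of y] atlas_inv[OF V] by (simp add: g_def)
    qed
    ultimately show ?thesis by blast
  qed
  have conn: "connected (ball p r - {p})" by (rule connected_punctured_ball) simp
  obtain \<zeta>0 where z0: "\<zeta>0 \<in> ball p r - {p}"
  proof -
    have "dist p (p + of_real (r / 2)) < r" "p + of_real (r / 2) \<noteq> p" using r by (auto simp: dist_norm)
    then show ?thesis using that[of "p + of_real (r / 2)"] by auto
  qed
  obtain T0 c0 where T0: "open T0" "\<zeta>0 \<in> T0" "\<And>\<xi>. \<xi> \<in> T0 \<Longrightarrow> e (g \<xi>) = E (F \<xi> + c0)"
    using loc[OF z0] by blast
  \<comment> \<open>The local constants of the covering differ by Gaussian integers and the
    punctured disc is connected, so one constant serves everywhere.\<close>
  have punct: "e (g \<zeta>) = E (F \<zeta> + c0)" if \<zeta>: "\<zeta> \<in> ball p r - {p}" for \<zeta>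
  proof (rule connected_induction_simple[OF conn z0 \<zeta>, where P = "\<lambda>\<zeta>. e (g \<zeta>) = E (F \<zeta> + c0)"])
    show "e (g \<zeta>0) = E (F \<zeta>0 + c0)" using T0 by simp
    fix a assume a: "a \<in> ball p r - {p}"
    obtain T c where T: "open T" "a \<in> T" "\<And>\<xi>. \<xi> \<in> T \<Longrightarrow> e (g \<xi>) = E (F \<xi> + c)" using loc[OF a] by blast
    show "\<exists>T. openin (top_of_set (ball p r - {p})) T \<and> a \<in> T \<and>
        (\<forall>x\<in>T. \<forall>y\<in>T. e (g x) = E (F x + c0) \<longrightarrow> e (g y) = E (F y + c0))"
    proof (intro exI[of _ "(ball p r - {p}) \<inter> T"] conjI ballI impI)
      fix x y assume xy: "x \<in> (ball p r - {p}) \<inter> T" "y \<in> (ball p r - {p}) \<inter> T" "e (g x) = E (F x + c0)"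
      then have "E (F x + c) = E (F x + c0)" using T(3) by auto
      then have "c - c0 \<in> gauss_ints" by (simp add: E_eq_iff)
      then have "E (F y + c) = E (F y + c0)" by (simp add: E_eq_iff)
      then show "e (g y) = E (F y + c0)" using T(3) xy by auto
    qed (use a T in auto)
  qed
  \<comment> \<open>The centre may be conical and then lies in no translation chart; the identity
    extends to it by continuity.\<close>
  have all: "e (g \<zeta>) = E (F \<zeta> + c0)" if "\<zeta> \<in> ball p r" for \<zeta>
  proof (cases "\<zeta> = p")
    case True
    have cg: "continuous_on (ball p r) g"
      using hom rV by (metis continuous_on_subset homeomorphism_cont2)
    have "continuous_on (ball p r) (\<lambda>\<zeta>. e (g \<zeta>))"
      using gB VS by (intro continuous_on_compose2[OF cont_e cg]) auto
    then have l1: "((\<lambda>\<zeta>. e (g \<zeta>)) \<longlongrightarrow> e (g p)) (at p)"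
      using pB by (metis continuous_on at_within_open open_ball)
    have "continuous_on (ball p r) (\<lambda>\<zeta>. E (F \<zeta> + c0))"
      by (intro continuous_on_compose2[OF continuous_on_E[of UNIV]] continuous_intros Fcont) auto
    then have l2: "((\<lambda>\<zeta>. E (F \<zeta> + c0)) \<longlongrightarrow> E (F p + c0)) (at p)"
      using pB by (metis continuous_on at_within_open open_ball)
    have ev: "eventually (\<lambda>\<zeta>. E (F \<zeta> + c0) = e (g \<zeta>)) (at p)"
      unfolding eventually_at using r punct by (intro exI[of _ r]) (auto simp: dist_commute)
    have "((\<lambda>\<zeta>. e (g \<zeta>)) \<longlongrightarrow> E (F p + c0)) (at p)"
      using tendsto_cong[OF ev] l2 by blast
    then have "E (F p + c0) = e (g p)" using l1 by (rule LIM_unique)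
    then show ?thesis using True by simp
  next
    case False then show ?thesis using punct that by auto
  qed
  define c where "c = z - F p"
  have "E (F p + c0) = E z" using all[OF pB] ez gp by simp
  then have cc: "c0 - c \<in> gauss_ints" by (simp add: E_eq_iff c_def algebra_simps)
  have all': "e (g \<zeta>) = E (F \<zeta> + c)" if "\<zeta> \<in> ball p r" for \<zeta>
    using all[OF that] cc by (simp add: E_eq_iff)
  \<comment> \<open>The form does not vanish off the singularities. Nonconstancy then yields
    isolated zeros of \<open>F - F p\<close> and the open mapping property.\<close>
  have "\<not> F constant_on ball p r"
  proof
    assume "F constant_on ball p r"
    then obtain k where k: "\<And>\<zeta>. \<zeta> \<in> ball p r \<Longrightarrow> F \<zeta> = k" by (auto simp: constant_on_def)
    have "\<zeta>0 \<in> ball p r" using z0 by simp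
    have "((\<lambda>_. k) has_field_derivative w \<zeta>0) (at \<zeta>0)"
      using F[OF \<open>\<zeta>0 \<in> ball p r\<close>] k by (rule has_field_derivative_transform_within_open[OF _ open_ball \<open>\<zeta>0 \<in> ball p r\<close>])
    then have "w \<zeta>0 = 0" by (metis DERIV_const DERIV_unique)
    moreover have "w \<zeta>0 \<noteq> 0" using form_nonzero[OF V, of "g \<zeta>0"] gB[of \<zeta>0] gSg[OF z0] z0 by (auto simp: w_def)
    ultimately show False by simp
  qed
  note nconst = this
  obtain r1 where r1: "0 < r1" "ball p r1 \<subseteq> ball p r" "\<And>\<zeta>. \<zeta> \<in> ball p r1 - {p} \<Longrightarrow> F \<zeta> - F p \<noteq> 0"
  proof -
    have "\<exists>\<beta>\<in>ball p r. F \<beta> \<noteq> F p" using nconst unfolding constant_on_def by blast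
    then obtain \<beta> where b: "\<beta> \<in> ball p r" "F \<beta> - F p \<noteq> 0" by auto
    have h: "(\<lambda>\<zeta>. F \<zeta> - F p) holomorphic_on ball p r" using Fhol by (intro holomorphic_intros)
    have "F p - F p = 0" by simp
    then obtain r' where "0 < r'" "ball p r' \<subseteq> ball p r" "\<And>\<zeta>. \<zeta> \<in> ball p r' - {p} \<Longrightarrow> F \<zeta> - F p \<noteq> 0"
      using isolated_zeros[OF h open_ball connected_ball pB _ b] by metis
    then show ?thesis using that by metis
  qed
  obtain r2 where r2: "0 < r2" "\<And>\<zeta>. \<zeta> \<in> ball p r \<Longrightarrow> \<zeta> \<in> ball p r2 \<Longrightarrow> cmod (F \<zeta> - F p) < 1/2"
  proof -
    have "(0::real) < 1/2" by simp
    then obtain d where "0 < d" "\<forall>\<zeta>\<in>ball p r. dist \<zeta> p < d \<longrightarrow> dist (F \<zeta>) (F p) < 1/2"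
      using Fcont pB unfolding continuous_on_iff by blast
    then show ?thesis using that[of d] by (simp add: dist_norm dist_commute norm_minus_commute)
  qed
  obtain r3 where r3: "0 < r3" "x \<notin> Sg \<Longrightarrow> inj_on F (ball p r3) \<and> (V \<inter> \<phi> -` ball p r3, F \<circ> \<phi>) \<in> charts (flat X)"
  proof (cases "x \<in> Sg")
    case True then show ?thesis using that[of 1] by simp
  next
    case False
    have px: "\<phi> x \<in> ball p r" using pB by (simp add: p_def)
    obtain \<delta> where d: "0 < \<delta>" "inj_on F (ball (\<phi> x) \<delta>)" "(V \<inter> \<phi> -` ball (\<phi> x) \<delta>, F \<circ> \<phi>) \<in> charts (flat X)"
      using primitive_chart_at[OF V F[unfolded w_def] open_ball rV xV px False dis] by metis
    show ?thesis by (rule that[of \<delta>]) (use d in \<open>auto simp: p_def\<close>)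
  qed
  define s where "s = min r (min r1 (min r2 r3))"
  have s: "0 < s" "ball p s \<subseteq> ball p r" "ball p s \<subseteq> ball p r1" "ball p s \<subseteq> ball p r2" "ball p s \<subseteq> ball p r3"
    using r r1 r2 r3 by (auto simp: s_def)
  define U where "U = V \<inter> \<phi> -` ball p s"
  define \<Phi> where "\<Phi> y = F (\<phi> y) + c" for y
  have phU: "\<phi> y \<in> ball p s" "y \<in> V" "g (\<phi> y) = y" if "y \<in> U" for y
    using that atlas_inv[OF V] by (auto simp: U_def g_def)
  have phB: "\<phi> y \<in> ball p r" "\<phi> y \<in> ball p r1" "\<phi> y \<in> ball p r2" "\<phi> y \<in> ball p r3" if "y \<in> U" for y
    using phU(1)[OF that] s by blast+
  show ?thesis
  proof (rule that[of U \<Phi>])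
    show U: "openin (top_of_set S) U" unfolding U_def by (rule atlas_preimage[OF V open_ball])
    show "x \<in> U" using xV s by (simp add: U_def p_def)
    have "continuous_on V \<phi>" using hom by (rule homeomorphism_cont1)
    then have "continuous_on U \<phi>" by (rule continuous_on_subset) (auto simp: U_def)
    then show "continuous_on U \<Phi>" unfolding \<Phi>_def
      using phU s by (intro continuous_intros continuous_on_compose2[OF Fcont]) auto
    show "\<Phi> x = z" by (simp add: \<Phi>_def c_def p_def)
    show "e y = E (\<Phi> y)" if "y \<in> U" for y
      using all'[of "\<phi> y"] phU[OF that] s by (auto simp: \<Phi>_def)
    show "y = x" if "y \<in> U" "\<Phi> y = z" for y
    proof -
      have "F (\<phi> y) = F p" using that by (simp add: \<Phi>_def c_def)
      then have "\<phi> y = p" using r1(3)[of "\<phi> y"] phB(2)[OF that(1)] by auto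
      then show ?thesis using phU(3)[OF that(1)] gp by simp
    qed
    show "cmod (\<Phi> y - z) < 1/2" if "y \<in> U" for y
      using r2(2)[OF phB(1,3)[OF that]] by (simp add: \<Phi>_def c_def)
    show "open (\<Phi> ` W)" if W: "openin (top_of_set S) W" "W \<subseteq> U" for W
    proof -
      have "open (\<phi> ` (V \<inter> W))" by (rule atlas_open_image[OF V W(1)])
      moreover have "V \<inter> W = W" using W(2) by (auto simp: U_def)
      moreover have "\<phi> ` W \<subseteq> ball p r" using W(2) phB(1) by blast
      ultimately have "open (F ` \<phi> ` W)"
        using open_mapping_thm[OF Fhol open_ball connected_ball _ _ nconst] by simp
      then have "open ((+) c ` F ` \<phi> ` W)" by (rule open_translation)
      moreover have "(+) c ` F ` \<phi> ` W = \<Phi> ` W" by (auto simp: \<Phi>_def image_image add.commute)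
      ultimately show ?thesis by simp
    qed
    assume xs: "x \<notin> Sg"
    have "U \<inter> Sg \<subseteq> {x}" using dis s by (auto simp: U_def)
    then have "U \<inter> Sg = {}" using xs by auto
    moreover have "inj_on \<Phi> U"
    proof (rule inj_onI)
      fix y y' assume y: "y \<in> U" "y' \<in> U" "\<Phi> y = \<Phi> y'"
      then have "F (\<phi> y) = F (\<phi> y')" by (simp add: \<Phi>_def)
      then have "\<phi> y = \<phi> y'" using r3(2)[OF xs] phB(4) y(1,2) unfolding inj_on_def by blast
      then show "y = y'" using phU(3) y(1,2) by metis
    qed
    moreover have "(U, \<Phi>) \<in> charts (flat X)"
    proof -
      have "(V \<inter> \<phi> -` ball p r3, F \<circ> \<phi>) \<in> charts (flat X)" using r3(2)[OF xs] by simp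
      moreover have "U \<subseteq> V \<inter> \<phi> -` ball p r3" using phB(4) phU(2) by blast
      ultimately have "(U, \<lambda>x. (F \<circ> \<phi>) x + c) \<in> charts (flat X)" using chart_subset U by blast
      moreover have "\<Phi> = (\<lambda>x. (F \<circ> \<phi>) x + c)" by (rule ext) (simp add: \<Phi>_def)
      ultimately show ?thesis by simp
    qed
    ultimately show "U \<inter> Sg = {} \<and> inj_on \<Phi> U \<and> (U, \<Phi>) \<in> charts (flat X)" by blast
  qed
qed

end

section \<open>Lifting convex sets\<close>

lemma finite_separation:
  fixes p :: "'a::t2_space"
  assumes "finite F" "p \<notin> F"
  shows "\<exists>A B. open A \<and> open B \<and> p \<in> A \<and> F \<subseteq> B \<and> A \<inter> B = {}"
  using assms
proof (induction F)
  case empty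
  show ?case by (intro exI[of _ UNIV] exI[of _ "{}"]) auto
next
  case (insert q F)
  obtain A B where AB: "open A" "open B" "p \<in> A" "F \<subseteq> B" "A \<inter> B = {}" using insert by blast
  obtain A' B' where A'B': "open A'" "open B'" "p \<in> A'" "q \<in> B'" "A' \<inter> B' = {}"
    using hausdorff[of p q] insert.prems by blast
  show ?case
    using AB A'B' by (intro exI[of _ "A \<inter> A'"] exI[of _ "B \<union> B'"]) auto
qed

lemma gauss_ints_punctured_nbhd:
  assumes "z \<notin> gauss_ints"
  obtains \<epsilon> where "0 < \<epsilon>" "ball z \<epsilon> \<inter> gauss_ints = {}"
proof -
  have "E z \<noteq> E 0" using assms by (simp add: E_eq_iff)
  then have "open (E -` (- {E 0}))" "z \<in> E -` (- {E 0})"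
    using continuous_on_E[of UNIV] by (auto intro!: open_vimage)
  then obtain \<epsilon> where \<epsilon>: "0 < \<epsilon>" "ball z \<epsilon> \<subseteq> E -` (- {E 0})" by (rule openE)
  have "ball z \<epsilon> \<inter> gauss_ints = {}"
  proof -
    have "E w = E 0" if "w \<in> gauss_ints" for w using that by (simp add: E_eq_iff)
    then show ?thesis using \<epsilon>(2) by blast
  qed
  then show ?thesis using that \<epsilon>(1) by blast
qed

context origami begin

definition Fib :: "complex \<Rightarrow> 'a set" where "Fib z = {x \<in> S. e x = E z}"

lemma Fib_I: "x \<in> S \<Longrightarrow> e x = E z \<Longrightarrow> x \<in> Fib z" by (simp add: Fib_def)
lemma Fib_D: "x \<in> Fib z \<Longrightarrow> x \<in> S" "x \<in> Fib z \<Longrightarrow> e x = E z" by (auto simp: Fib_def)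

lemma Fib_cong: "E z = E w \<Longrightarrow> Fib z = Fib w" by (simp add: Fib_def)

lemma Fib_not_Sg: "z \<notin> gauss_ints \<Longrightarrow> x \<in> Fib z \<Longrightarrow> x \<notin> Sg"
  using e_Sg[of x] by (auto simp: Fib_def E_eq_iff)

text \<open>Compactness of \<open>S\<close> makes the covering a closed map: the image of
  \<open>S - G\<close> is compact and misses \<open>E z\<close>.\<close>

lemma fibre_tube:
  assumes "open G" "Fib z \<subseteq> G"
  obtains \<epsilon> where "0 < \<epsilon>" "\<And>x z'. x \<in> S \<Longrightarrow> z' \<in> ball z \<epsilon> \<Longrightarrow> e x = E z' \<Longrightarrow> x \<in> G"
proof -
  have "compact (S - G)" using compact_S assms(1) by (rule compact_diff)
  then have "compact (e ` (S - G))"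
    using cont_e by (intro compact_continuous_image) (auto intro: continuous_on_subset)
  then have "open (- (e ` (S - G)))" by (intro open_Compl compact_imp_closed)
  then have "open (E -` (- (e ` (S - G))))" using continuous_on_E[of UNIV] by (rule open_vimage)
  moreover have "z \<in> E -` (- (e ` (S - G)))" using assms(2) by (auto simp: Fib_def)
  ultimately obtain \<epsilon> where \<epsilon>: "0 < \<epsilon>" "ball z \<epsilon> \<subseteq> E -` (- (e ` (S - G)))" by (rule openE)
  show ?thesis
  proof (rule that[OF \<epsilon>(1)])
    fix x z' assume "x \<in> S" "z' \<in> ball z \<epsilon>" "e x = E z'"
    then show "x \<in> G" using \<epsilon>(2) by (metis ComplD DiffI image_eqI subsetD vimageD)
  qed
qed

text \<open>A fibre is compact, and it is discrete since a branched coordinate takes its central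
  value only at its centre. Fibres over lattice points are included.\<close>

lemma finite_Fib: "finite (Fib z)"
proof -
  have "\<exists>T. open T \<and> x \<in> T \<and> Fib z \<inter> T \<subseteq> {x}" if x: "x \<in> Fib z" for x
  proof -
    obtain U \<Phi> where U: "openin (top_of_set S) U" "x \<in> U"
      "\<And>y. y \<in> U \<Longrightarrow> e y = E (\<Phi> y)" "\<And>y. y \<in> U \<Longrightarrow> \<Phi> y = z \<Longrightarrow> y = x"
      "\<And>y. y \<in> U \<Longrightarrow> cmod (\<Phi> y - z) < 1/2"
      using local_coordinate[OF Fib_D[OF x]] by metis
    obtain T where T: "open T" "U = S \<inter> T" using U(1) by (auto simp: openin_open)
    have "y = x" if "y \<in> Fib z" "y \<in> T" for y
    proof -
      have y: "y \<in> U" using that T(2) by (auto simp: Fib_def)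
      have "E (\<Phi> y) = E z" using U(3)[OF y] Fib_D(2)[OF that(1)] by simp
      then have "\<Phi> y = z" using U(5)[OF y] by (intro E_inj_near[of _ _ z]) auto
      then show ?thesis using U(4)[OF y] by simp
    qed
    then show ?thesis using T U(2) by blast
  qed
  then obtain T where T: "\<And>x. x \<in> Fib z \<Longrightarrow> open (T x) \<and> x \<in> T x \<and> Fib z \<inter> T x \<subseteq> {x}" by metis
  have "Fib z = S \<inter> e -` {E z}" by (auto simp: Fib_def)
  moreover have "closedin (top_of_set S) (S \<inter> e -` {E z})"
    using cont_e by (rule continuous_closedin_preimage) simp
  ultimately have "compact (Fib z)" using compact_S closedin_compact by metis
  then obtain C where C: "C \<subseteq> Fib z" "finite C" "Fib z \<subseteq> (\<Union>x\<in>C. T x)"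
    using T by (elim compactE_image[of _ "Fib z" T]) auto
  then have "Fib z \<subseteq> C" using T by blast
  then show ?thesis using C(2) finite_subset by blast
qed

text \<open>Separates one point of a fibre from the others, uniformly for nearby fibres. A connected
  set over a small disc is thereby confined to \<open>O1\<close> or to \<open>O2\<close>.\<close>

lemma fibre_nbhd:
  assumes p: "p \<in> Fib z" and O: "open G" "p \<in> G"
  obtains O1 O2 \<epsilon> where "open O1" "open O2" "O1 \<inter> O2 = {}" "p \<in> O1" "O1 \<subseteq> G" "0 < \<epsilon>"
    "\<And>x z'. x \<in> S \<Longrightarrow> z' \<in> ball z \<epsilon> \<Longrightarrow> e x = E z' \<Longrightarrow> x \<in> O1 \<union> O2"
proof -
  obtain A B where AB: "open A" "open B" "p \<in> A" "Fib z - {p} \<subseteq> B" "A \<inter> B = {}"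
  proof -
    have "finite (Fib z - {p})" "p \<notin> Fib z - {p}" using finite_Fib by auto
    from finite_separation[OF this] show ?thesis using that by metis
  qed
  have G': "open (A \<inter> G \<union> B)" "Fib z \<subseteq> A \<inter> G \<union> B" using AB O by auto
  obtain \<epsilon> where \<epsilon>: "0 < \<epsilon>" "\<And>x z'. x \<in> S \<Longrightarrow> z' \<in> ball z \<epsilon> \<Longrightarrow> e x = E z' \<Longrightarrow> x \<in> A \<inter> G \<union> B"
    using fibre_tube[OF G'] by metis
  show ?thesis using AB O \<epsilon> by (intro that[of "A \<inter> G" B \<epsilon>]) auto
qed

text \<open>Agreement is an open condition because a coordinate is injective near the regular point
  \<open>a s\<close>, and a closed one because the space is Hausdorff.\<close>

lemma unique_lift:
  fixes a b :: "'c::topological_space \<Rightarrow> 'a"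
  assumes C: "connected C" and ca: "continuous_on C a" and cb: "continuous_on C b"
    and aS: "a ` C \<subseteq> S" and bS: "b ` C \<subseteq> S" and eq: "\<And>t. t \<in> C \<Longrightarrow> e (a t) = e (b t)"
    and nS: "\<And>t. t \<in> C \<Longrightarrow> a t \<notin> Sg" and t0: "t0 \<in> C" "a t0 = b t0" and t: "t \<in> C"
  shows "a t = b t"
proof (rule connected_induction_simple[OF C t0(1) t, where P = "\<lambda>t. a t = b t"])
  show "a t0 = b t0" by (rule t0)
  fix s assume s: "s \<in> C"
  show "\<exists>T. openin (top_of_set C) T \<and> s \<in> T \<and> (\<forall>x\<in>T. \<forall>y\<in>T. a x = b x \<longrightarrow> a y = b y)"
  proof (cases "a s = b s")
    case True
    obtain z where z: "\<rho> (a s) = abs_torus z" by (rule torus_abs_exhaust)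
    then have ez: "e (a s) = E z" by (simp add: e_eq_iff)
    have sS: "a s \<in> S" using aS s by blast
    obtain U \<Phi> where U: "openin (top_of_set S) U" "a s \<in> U"
      "\<And>y. y \<in> U \<Longrightarrow> e y = E (\<Phi> y)" "\<And>y. y \<in> U \<Longrightarrow> cmod (\<Phi> y - z) < 1/2"
      "a s \<notin> Sg \<Longrightarrow> U \<inter> Sg = {} \<and> inj_on \<Phi> U \<and> (U, \<Phi>) \<in> charts (flat X)"
      using local_coordinate[OF sS ez] by metis
    obtain T where T: "open T" "U = S \<inter> T" using U(1) by (auto simp: openin_open)
    have "openin (top_of_set C) (C \<inter> a -` T)" "openin (top_of_set C) (C \<inter> b -` T)"
      using ca cb T(1) by (auto intro: continuous_openin_preimage_gen)
    then have "openin (top_of_set C) ((C \<inter> a -` T) \<inter> (C \<inter> b -` T))" by (rule openin_Int)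
    moreover have "s \<in> (C \<inter> a -` T) \<inter> (C \<inter> b -` T)" using s U(2) T(2) True by auto
    moreover have "a x = b x" if "x \<in> (C \<inter> a -` T) \<inter> (C \<inter> b -` T)" for x
    proof -
      have x: "x \<in> C" "a x \<in> U" "b x \<in> U" using that aS bS T(2) by auto
      have "E (\<Phi> (a x)) = E (\<Phi> (b x))" using U(3) x eq[OF x(1)] by metis
      then have "\<Phi> (a x) = \<Phi> (b x)" using U(4) x by (intro E_inj_near[of _ _ z]) auto
      then show ?thesis using U(5)[OF nS[OF s]] x unfolding inj_on_def by blast
    qed
    ultimately show ?thesis by blast
  next
    case False
    obtain A B where AB: "open A" "open B" "a s \<in> A" "b s \<in> B" "A \<inter> B = {}"
      using hausdorff[OF False] by blast
    have "openin (top_of_set C) (C \<inter> a -` A)" "openin (top_of_set C) (C \<inter> b -` B)"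
      using ca cb AB by (auto intro: continuous_openin_preimage_gen)
    then have "openin (top_of_set C) ((C \<inter> a -` A) \<inter> (C \<inter> b -` B))" by (rule openin_Int)
    moreover have "s \<in> (C \<inter> a -` A) \<inter> (C \<inter> b -` B)" using s AB by auto
    moreover have "a x \<noteq> b x" if "x \<in> (C \<inter> a -` A) \<inter> (C \<inter> b -` B)" for x using that AB(5) by auto
    ultimately show ?thesis by blast
  qed
qed

text \<open>\<open>D\<close> may contain lattice points. There the covering may ramify, so existence
  and uniqueness of lifts are first established for sets that avoid the lattice.\<close>

definition islift :: "complex set \<Rightarrow> (complex \<Rightarrow> 'a) \<Rightarrow> bool" where
  "islift D \<phi> \<longleftrightarrow> continuous_on D \<phi> \<and> \<phi> ` D \<subseteq> S \<and> (\<forall>z\<in>D. e (\<phi> z) = E z)"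

lemma islift_subset: "islift D \<phi> \<Longrightarrow> D' \<subseteq> D \<Longrightarrow> islift D' \<phi>"
  unfolding islift_def using continuous_on_subset by blast

lemma islift_Fib: "islift D \<phi> \<Longrightarrow> z \<in> D \<Longrightarrow> \<phi> z \<in> Fib z"
  unfolding islift_def Fib_def by auto

lemma islift_unique:
  assumes "connected D" "D \<inter> gauss_ints = {}" "islift D \<phi>" "islift D \<psi>" "w \<in> D" "\<phi> w = \<psi> w" "z \<in> D"
  shows "\<phi> z = \<psi> z"
proof (rule unique_lift[where a = \<phi> and b = \<psi> and C = D and ?t0.0 = w])
  show "\<phi> t \<notin> Sg" if "t \<in> D" for t
    using Fib_not_Sg[OF _ islift_Fib[OF assms(3) that]] assms(2) that by blast
qed (use assms in \<open>auto simp: islift_def\<close>)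

lemma islift_translate:
  assumes "islift D \<phi>" "l \<in> gauss_ints" "\<And>z. z \<in> D' \<Longrightarrow> z + l \<in> D"
  shows "islift D' (\<lambda>z. \<phi> (z + l))"
  unfolding islift_def
proof (intro conjI ballI)
  show "continuous_on D' (\<lambda>z. \<phi> (z + l))"
  proof (rule continuous_on_compose2[of D \<phi>])
    show "continuous_on D' (\<lambda>z. z + l)" by (intro continuous_intros)
  qed (use assms(1,3) in \<open>auto simp: islift_def\<close>)
  show "(\<lambda>z. \<phi> (z + l)) ` D' \<subseteq> S" using assms(1,3) by (auto simp: islift_def)
  fix z assume "z \<in> D'"
  then have "e (\<phi> (z + l)) = E (z + l)" using assms(1,3) by (auto simp: islift_def)
  then show "e (\<phi> (z + l)) = E z" using E_add_gauss(1)[OF assms(2)] by simp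
qed

text \<open>The inverse of an injective coordinate. Regular points over the lattice are included,
  which matters when the midpoint of a saddle connection lies over a lattice point.\<close>

lemma local_lift:
  assumes x: "x \<in> Fib z" "x \<notin> Sg"
  obtains \<delta> \<theta> U where "0 < \<delta>" "\<delta> \<le> 1/2" "islift (ball z \<delta>) \<theta>" "\<theta> z = x" "openin (top_of_set S) U" "x \<in> U"
    "\<And>y z'. y \<in> U \<Longrightarrow> z' \<in> ball z \<delta> \<Longrightarrow> e y = E z' \<Longrightarrow> \<theta> z' = y"
proof -
  obtain U \<Phi> where U: "openin (top_of_set S) U" "x \<in> U" "continuous_on U \<Phi>" "\<Phi> x = z"
      "\<And>y. y \<in> U \<Longrightarrow> e y = E (\<Phi> y)" "\<And>y. y \<in> U \<Longrightarrow> cmod (\<Phi> y - z) < 1/2"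
      "\<And>W. openin (top_of_set S) W \<Longrightarrow> W \<subseteq> U \<Longrightarrow> open (\<Phi> ` W)"
      "inj_on \<Phi> U"
    using local_coordinate[OF Fib_D[OF x(1)]] x(2) by metis
  define \<theta> where "\<theta> = inv_into U \<Phi>"
  have inv: "\<theta> (\<Phi> y) = y" if "y \<in> U" for y using U(8) that by (simp add: \<theta>_def)
  have "continuous_on (\<Phi> ` U) \<theta>"
  proof (rule continuous_on_inverse_open_map[OF U(3) refl inv])
    fix W assume W: "openin (top_of_set U) W"
    then have "open (\<Phi> ` W)" using U(7)[of W] openin_trans[OF W U(1)] openin_imp_subset[OF W] by blast
    then show "openin (top_of_set (\<Phi> ` U)) (\<Phi> ` W)"
      using openin_imp_subset[OF W] by (intro open_subset) auto
  qed
  moreover have "\<theta> ` \<Phi> ` U \<subseteq> S" using inv openin_imp_subset[OF U(1)] by auto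
  moreover have "e (\<theta> w) = E w" if "w \<in> \<Phi> ` U" for w using that inv U(5) by auto
  ultimately have lift: "islift (\<Phi> ` U) \<theta>" by (simp add: islift_def)
  have op: "open (\<Phi> ` U)" using U(7)[OF U(1)] by simp
  have zm: "z \<in> \<Phi> ` U" using U(2,4) by force
  obtain \<delta> where d: "0 < \<delta>" "ball z \<delta> \<subseteq> \<Phi> ` U" by (rule openE[OF op zm])
  define \<delta>' where "\<delta>' = min \<delta> (1/2)"
  have sub: "ball z \<delta>' \<subseteq> \<Phi> ` U" using d(2) by (auto simp: \<delta>'_def)
  show ?thesis
  proof (rule that[of \<delta>' \<theta> U])
    show "\<theta> z = x" using inv[OF U(2)] U(4) by simp
    fix y z' assume y: "y \<in> U" "z' \<in> ball z \<delta>'" "e y = E z'"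
    have "\<Phi> y = z'"
    proof (rule E_inj_near[of _ _ z])
      show "E (\<Phi> y) = E z'" using y U(5) by simp
      show "cmod (z' - z) < 1/2" using y(2) by (simp add: \<delta>'_def dist_norm norm_minus_commute)
    qed (use U(6) y in auto)
    then show "\<theta> z' = y" using inv[OF y(1)] by simp
  qed (use d U sub islift_subset[OF lift sub] in \<open>auto simp: \<delta>'_def\<close>)
qed

text \<open>The finitely many sheets over \<open>z\<close> have a common radius, and by the tube
  argument every point over a nearby \<open>z'\<close> lies on one of them. So a sheet can be
  prescribed through any point over the disc.\<close>

lemma even_covering:
  assumes z: "z \<notin> gauss_ints"
  obtains \<epsilon> where "0 < \<epsilon>" "ball z \<epsilon> \<inter> gauss_ints = {}"
    "\<And>z' x'. z' \<in> ball z \<epsilon> \<Longrightarrow> x' \<in> Fib z' \<Longrightarrow> \<exists>\<theta>. islift (ball z \<epsilon>) \<theta> \<and> \<theta> z' = x'"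
proof -
  have "\<exists>\<delta> \<theta> T. 0 < \<delta> \<and> islift (ball z \<delta>) \<theta> \<and> open T \<and> x \<in> T \<and>
     (\<forall>y\<in>S \<inter> T. \<forall>z'\<in>ball z \<delta>. e y = E z' \<longrightarrow> \<theta> z' = y)" if x: "x \<in> Fib z" for x
  proof -
    obtain \<delta> \<theta> U where "0 < \<delta>" "islift (ball z \<delta>) \<theta>" "openin (top_of_set S) U" "x \<in> U"
      "\<And>y z'. y \<in> U \<Longrightarrow> z' \<in> ball z \<delta> \<Longrightarrow> e y = E z' \<Longrightarrow> \<theta> z' = y"
      using local_lift[OF x Fib_not_Sg[OF z x]] by metis
    then show ?thesis unfolding openin_open by blast
  qed
  then obtain \<delta> \<theta> T where T: "\<And>x. x \<in> Fib z \<Longrightarrow> 0 < \<delta> x \<and> islift (ball z (\<delta> x)) (\<theta> x) \<and> open (T x) \<and> x \<in> T x \<and>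
     (\<forall>y\<in>S \<inter> T x. \<forall>z'\<in>ball z (\<delta> x). e y = E z' \<longrightarrow> \<theta> x z' = y)" by metis
  obtain \<epsilon>0 where e0: "0 < \<epsilon>0" "\<And>x z'. x \<in> S \<Longrightarrow> z' \<in> ball z \<epsilon>0 \<Longrightarrow> e x = E z' \<Longrightarrow> x \<in> (\<Union>x\<in>Fib z. T x)"
  proof -
    have "open (\<Union>x\<in>Fib z. T x)" "Fib z \<subseteq> (\<Union>x\<in>Fib z. T x)" using T by auto
    then show ?thesis using fibre_tube that by metis
  qed
  obtain \<epsilon>1 where e1: "0 < \<epsilon>1" "ball z \<epsilon>1 \<inter> gauss_ints = {}" using gauss_ints_punctured_nbhd[OF z] by blast
  define \<epsilon> where "\<epsilon> = Min (insert \<epsilon>0 (insert \<epsilon>1 (\<delta> ` Fib z)))"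
  have fin: "finite (insert \<epsilon>0 (insert \<epsilon>1 (\<delta> ` Fib z)))" using finite_Fib by simp
  have pos: "0 < \<epsilon>" unfolding \<epsilon>_def using T e0 e1 finite_Fib by (subst Min_gr_iff) auto
  have le: "\<epsilon> \<le> \<epsilon>0" "\<epsilon> \<le> \<epsilon>1" "\<And>x. x \<in> Fib z \<Longrightarrow> \<epsilon> \<le> \<delta> x"
    unfolding \<epsilon>_def by (rule Min_le[OF fin]; simp)+
  show ?thesis
  proof (rule that[OF pos])
    show "ball z \<epsilon> \<inter> gauss_ints = {}" using e1(2) subset_ball[OF le(2)] by blast
    fix z' x' assume zx: "z' \<in> ball z \<epsilon>" "x' \<in> Fib z'"
    then have "x' \<in> (\<Union>x\<in>Fib z. T x)" using e0(2)[of x' z'] le(1) by (auto simp: Fib_def)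
    then obtain x where x: "x \<in> Fib z" "x' \<in> T x" by blast
    have sub: "ball z \<epsilon> \<subseteq> ball z (\<delta> x)" using le(3)[OF x(1)] by (rule subset_ball)
    have "\<theta> x z' = x'" using T[OF x(1)] x(2) zx sub by (auto simp: Fib_def)
    moreover have "islift (ball z \<epsilon>) (\<theta> x)" using T[OF x(1)] sub islift_subset by blast
    ultimately show "\<exists>\<theta>. islift (ball z \<epsilon>) \<theta> \<and> \<theta> z' = x'" by blast
  qed
qed

text \<open>The radius is a Lebesgue number for the cover of \<open>K\<close> by evenly covered
  discs.\<close>

lemma uniform_covering:
  assumes K: "compact K" "K \<inter> gauss_ints = {}"
  obtains \<epsilon> where "0 < \<epsilon>" "\<And>z. z \<in> K \<Longrightarrow> ball z \<epsilon> \<inter> gauss_ints = {}"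
    "\<And>z x. z \<in> K \<Longrightarrow> x \<in> Fib z \<Longrightarrow> \<exists>\<theta>. islift (ball z \<epsilon>) \<theta> \<and> \<theta> z = x"
proof -
  have "\<exists>\<epsilon>. 0 < \<epsilon> \<and> ball z \<epsilon> \<inter> gauss_ints = {} \<and>
     (\<forall>z'\<in>ball z \<epsilon>. \<forall>x'\<in>Fib z'. \<exists>\<theta>. islift (ball z \<epsilon>) \<theta> \<and> \<theta> z' = x')" if "z \<in> K" for z
    using even_covering[of z] that K(2) by (metis disjoint_iff)
  then obtain r where r: "\<And>z. z \<in> K \<Longrightarrow> 0 < r z \<and> ball z (r z) \<inter> gauss_ints = {} \<and>
     (\<forall>z'\<in>ball z (r z). \<forall>x'\<in>Fib z'. \<exists>\<theta>. islift (ball z (r z)) \<theta> \<and> \<theta> z' = x')" by metis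
  have "K \<subseteq> \<Union>((\<lambda>z. ball z (r z)) ` K)" using r by auto
  then obtain \<epsilon> where \<epsilon>: "0 < \<epsilon>" "\<And>z. z \<in> K \<Longrightarrow> \<exists>G\<in>(\<lambda>z. ball z (r z)) ` K. ball z \<epsilon> \<subseteq> G"
    using Heine_Borel_lemma[OF K(1)] by (metis (no_types, lifting) imageE open_ball)
  show ?thesis
  proof (rule that[OF \<epsilon>(1)])
    fix z assume z: "z \<in> K"
    obtain w where w: "w \<in> K" "ball z \<epsilon> \<subseteq> ball w (r w)" using \<epsilon>(2)[OF z] by blast
    then show "ball z \<epsilon> \<inter> gauss_ints = {}" using r by blast
    have "z \<in> ball w (r w)" using subsetD[OF w(2), of z] \<epsilon>(1) by simp
    then show "\<exists>\<theta>. islift (ball z \<epsilon>) \<theta> \<and> \<theta> z = x" if "x \<in> Fib z" for x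
      using r[OF w(1)] that islift_subset w(2) by meson
  qed
qed

text \<open>Lifts are glued from discs around the points \<open>\<pi> z\<close> of a set where a lift is known.\<close>

lemma lift_extend:
  assumes K1: "convex K1" "K1 \<inter> gauss_ints = {}" and \<phi>: "islift K1 \<phi>"
    and pi: "continuous_on K2 \<pi>" "\<pi> ` K2 \<subseteq> K1" "\<And>z. z \<in> K2 \<Longrightarrow> dist (\<pi> z) z < \<epsilon>"
    and eps: "\<And>z. z \<in> K1 \<Longrightarrow> ball z \<epsilon> \<inter> gauss_ints = {}"
      "\<And>z x. z \<in> K1 \<Longrightarrow> x \<in> Fib z \<Longrightarrow> \<exists>\<theta>. islift (ball z \<epsilon>) \<theta> \<and> \<theta> z = x"
  obtains \<psi> where "islift K2 \<psi>" "\<And>z. z \<in> K2 \<Longrightarrow> \<pi> z = z \<Longrightarrow> \<psi> z = \<phi> z"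
proof -
  have "\<exists>\<theta>. islift (ball z \<epsilon>) \<theta> \<and> \<theta> z = \<phi> z" if "z \<in> K1" for z
    using eps(2)[OF that] islift_Fib[OF \<phi> that] by blast
  then obtain \<theta> where \<theta>: "\<And>z. z \<in> K1 \<Longrightarrow> islift (ball z \<epsilon>) (\<theta> z) \<and> \<theta> z z = \<phi> z" by metis
  define \<psi> where "\<psi> z = \<theta> (\<pi> z) z" for z
  have agree: "\<psi> z' = \<theta> (\<pi> z) z'"
    if z: "z \<in> K2" "z' \<in> K2" and d: "dist (\<pi> z) (\<pi> z') < \<epsilon>" "dist (\<pi> z) z' < \<epsilon>" for z z'
  proof -
    have p: "\<pi> z \<in> K1" "\<pi> z' \<in> K1" using z pi(2) by auto
    have e0: "0 < \<epsilon>" using pi(3)[OF z(1)] by (meson dist_pos_lt not_less order_trans zero_le_dist le_less_trans)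
    \<comment> \<open>The two disc lifts are compared at \<open>\<pi> z'\<close>, inside
      \<open>K1\<close>, where both follow \<phi>; the equality then spreads over the convex lens of
      the two discs to \<open>z'\<close>.\<close>
    have "\<theta> (\<pi> z) (\<pi> z') = \<phi> (\<pi> z')"
    proof (rule islift_unique[where D = "ball (\<pi> z) \<epsilon> \<inter> K1" and w = "\<pi> z"
          and \<phi> = "\<theta> (\<pi> z)" and \<psi> = \<phi> and z = "\<pi> z'"])
      show "connected (ball (\<pi> z) \<epsilon> \<inter> K1)" using K1(1) by (intro convex_connected convex_Int convex_ball)
      show "islift (ball (\<pi> z) \<epsilon> \<inter> K1) (\<theta> (\<pi> z))" using \<theta>[OF p(1)] islift_subset by blast
      show "islift (ball (\<pi> z) \<epsilon> \<inter> K1) \<phi>" using \<phi> islift_subset by blast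
    qed (use K1 p d e0 \<theta> in auto)
    then have eq: "\<theta> (\<pi> z) (\<pi> z') = \<theta> (\<pi> z') (\<pi> z')" using \<theta>[OF p(2)] by simp
    have "\<theta> (\<pi> z) z' = \<theta> (\<pi> z') z'"
    proof (rule islift_unique[where w = "\<pi> z'" and D = "ball (\<pi> z) \<epsilon> \<inter> ball (\<pi> z') \<epsilon>"
          and \<phi> = "\<theta> (\<pi> z)" and \<psi> = "\<theta> (\<pi> z')" and z = z'])
      show "connected (ball (\<pi> z) \<epsilon> \<inter> ball (\<pi> z') \<epsilon>)" by (intro convex_connected convex_Int convex_ball)
      show "islift (ball (\<pi> z) \<epsilon> \<inter> ball (\<pi> z') \<epsilon>) (\<theta> (\<pi> z))" using \<theta>[OF p(1)] islift_subset by blast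
      show "islift (ball (\<pi> z) \<epsilon> \<inter> ball (\<pi> z') \<epsilon>) (\<theta> (\<pi> z'))" using \<theta>[OF p(2)] islift_subset by blast
      show "ball (\<pi> z) \<epsilon> \<inter> ball (\<pi> z') \<epsilon> \<inter> gauss_ints = {}" using eps(1)[OF p(1)] by blast
    qed (use d e0 eq pi(3)[OF z(2)] in auto)
    then show ?thesis by (simp add: \<psi>_def)
  qed
  show ?thesis
  proof (rule that[of \<psi>])
    show "islift K2 \<psi>"
      unfolding islift_def
    proof (intro conjI ballI)
      show "continuous_on K2 \<psi>"
        unfolding continuous_on_def
      proof
        fix z assume z: "z \<in> K2"
        have p: "\<pi> z \<in> K1" using z pi(2) by auto
        have zb: "z \<in> ball (\<pi> z) \<epsilon>" using pi(3)[OF z] by simp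
        then have "0 < \<epsilon>" by (metis dist_self ball_eq_empty empty_iff not_less)
        have "continuous_on (ball (\<pi> z) \<epsilon>) (\<theta> (\<pi> z))" using \<theta>[OF p] by (simp add: islift_def)
        then have "isCont (\<theta> (\<pi> z)) z" using zb by (metis continuous_on_eq_continuous_at open_ball)
        then have "(\<theta> (\<pi> z) \<longlongrightarrow> \<psi> z) (at z within K2)"
          unfolding \<psi>_def isCont_def by (rule tendsto_within_subset) simp
        moreover have "eventually (\<lambda>z'. \<theta> (\<pi> z) z' = \<psi> z') (at z within K2)"
        proof -
          have "(\<pi> \<longlongrightarrow> \<pi> z) (at z within K2)" using pi(1) z by (simp add: continuous_on_def)
          then have "eventually (\<lambda>z'. dist (\<pi> z') (\<pi> z) < \<epsilon>) (at z within K2)" using \<open>0 < \<epsilon>\<close> by (rule tendstoD)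
          moreover have "eventually (\<lambda>z'. z' \<in> ball (\<pi> z) \<epsilon>) (at z within K2)"
            unfolding eventually_at_topological using zb by (intro exI[of _ "ball (\<pi> z) \<epsilon>"]) auto
          moreover have "eventually (\<lambda>z'. z' \<in> K2) (at z within K2)" by (simp add: eventually_at_filter)
          ultimately show ?thesis
            by eventually_elim (use agree[OF z] in \<open>auto simp: dist_commute\<close>)
        qed
        ultimately show "(\<psi> \<longlongrightarrow> \<psi> z) (at z within K2)" by (rule Lim_transform_eventually)
      qed
      have "\<psi> z \<in> Fib z" if z: "z \<in> K2" for z
      proof -
        have p: "\<pi> z \<in> K1" using z pi(2) by auto
        have "z \<in> ball (\<pi> z) \<epsilon>" using pi(3)[OF z] by simp
        then show ?thesis unfolding \<psi>_def using \<theta>[OF p] islift_Fib by blast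
      qed
      then show "\<psi> ` K2 \<subseteq> S" "\<And>z. z \<in> K2 \<Longrightarrow> e (\<psi> z) = E z" by (auto simp: Fib_def)
    qed
    fix z assume z: "z \<in> K2" "\<pi> z = z"
    then have "z \<in> K1" using pi(2) by force
    then show "\<psi> z = \<phi> z" using \<theta> z(2) by (simp add: \<psi>_def)
  qed
qed

text \<open>The set is contracted towards \<open>z0\<close>. Between consecutive homothetic copies
  points move by less than \<epsilon>, so \<open>lift_extend\<close> applies with a homothety as
  projection, and \<open>M\<close> steps lead from \<open>{z0}\<close> to \<open>K\<close>.\<close>

lemma lift_compact_convex:
  assumes K: "compact K" "convex K" "K \<inter> gauss_ints = {}" and z0: "z0 \<in> K" and x0: "x0 \<in> Fib z0"
  obtains \<phi> where "islift K \<phi>" "\<phi> z0 = x0"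
proof -
  obtain \<epsilon> where \<epsilon>: "0 < \<epsilon>" "\<And>z. z \<in> K \<Longrightarrow> ball z \<epsilon> \<inter> gauss_ints = {}"
    "\<And>z x. z \<in> K \<Longrightarrow> x \<in> Fib z \<Longrightarrow> \<exists>\<theta>. islift (ball z \<epsilon>) \<theta> \<and> \<theta> z = x"
    using uniform_covering[OF K(1,3)] by metis
  obtain B where B: "\<And>z. z \<in> K \<Longrightarrow> dist z0 z \<le> B"
    using compact_imp_bounded[OF K(1)] bounded_any_center[of K z0] by blast
  have B0: "0 \<le> B" using B[OF z0] by simp
  obtain M :: nat where M: "B / \<epsilon> < real M" using reals_Archimedean2 by blast
  then have M0: "0 < M" using B0 \<epsilon>(1) by (metis divide_nonneg_pos not_less of_nat_0 gr0I)
  define h where "h t z = z0 + of_real t * (z - z0)" for t :: real and z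
  define Kn where "Kn n = h (real n / real M) ` K" for n
  have hK: "h t z \<in> K" if "0 \<le> t" "t \<le> 1" "z \<in> K" for t z
  proof -
    have "h t z = (1 - t) *\<^sub>R z0 + t *\<^sub>R z" by (simp add: h_def scaleR_conv_of_real algebra_simps)
    then show ?thesis using that K(2) z0 by (simp add: convexD_alt)
  qed
  have Kn_sub: "Kn n \<subseteq> K" if "n \<le> M" for n
    using that M0 hK unfolding Kn_def by auto
  have conv: "convex (Kn n)" for n
  proof -
    define t where "t = real n / real M"
    have "h t z = (z0 - t *\<^sub>R z0) + t *\<^sub>R z" for z
      by (simp add: h_def scaleR_conv_of_real algebra_simps)
    then have "Kn n = (+) (z0 - t *\<^sub>R z0) ` ((*\<^sub>R) t ` K)"
      by (simp add: Kn_def image_image flip: t_def)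
    then show ?thesis using K(2) by (simp only: convex_translation convex_scaling)
  qed
  have "\<exists>\<phi>. islift (Kn n) \<phi> \<and> \<phi> z0 = x0" if "n \<le> M" for n
    using that
  proof (induction n)
    case 0
    have "Kn 0 = {z0}" using z0 by (auto simp: Kn_def h_def)
    then show ?case using x0 by (intro exI[of _ "\<lambda>_. x0"]) (auto simp: islift_def Fib_def)
  next
    case (Suc n)
    then obtain \<phi> where \<phi>: "islift (Kn n) \<phi>" "\<phi> z0 = x0" by auto
    have nM: "n \<le> M" using Suc by simp
    define \<pi> where "\<pi> = h (real n / real (Suc n))"
    have pih: "\<pi> (h (real (Suc n) / real M) z) = h (real n / real M) z" for z
      using M0 by (simp add: \<pi>_def h_def field_simps del: of_nat_Suc)
    have piK: "\<pi> ` Kn (Suc n) \<subseteq> Kn n" using pih by (auto simp: Kn_def)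
    have dist: "dist (\<pi> z) z < \<epsilon>" if zz: "z \<in> Kn (Suc n)" for z
    proof -
      obtain \<kappa> where k: "\<kappa> \<in> K" "z = h (real (Suc n) / real M) \<kappa>" using zz by (auto simp: Kn_def)
      have "\<pi> z - z = - (of_real (1 / real M) * (\<kappa> - z0))"
        unfolding k(2) pih using M0 by (simp add: h_def field_simps)
      then have "dist (\<pi> z) z = dist z0 \<kappa> / real M"
        using M0 by (simp add: dist_norm norm_mult norm_divide norm_minus_commute)
      also have "\<dots> \<le> B / real M" using B[OF k(1)] by (intro divide_right_mono) auto
      also have "\<dots> < \<epsilon>" using M M0 \<epsilon>(1) by (simp add: field_simps)
      finally show ?thesis .
    qed
    have cpi: "continuous_on (Kn (Suc n)) \<pi>" unfolding \<pi>_def h_def by (intro continuous_intros)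
    have lf: "Kn n \<inter> gauss_ints = {}" using Kn_sub[OF nM] K(3) by blast
    obtain \<psi> where \<psi>: "islift (Kn (Suc n)) \<psi>" "\<And>z. z \<in> Kn (Suc n) \<Longrightarrow> \<pi> z = z \<Longrightarrow> \<psi> z = \<phi> z"
      using lift_extend[OF conv lf \<phi>(1) cpi piK dist] \<epsilon>(2,3) Kn_sub[OF nM] by (metis subsetD)
    have "h (real (Suc n) / real M) z0 = z0" "\<pi> z0 = z0" by (auto simp: h_def \<pi>_def)
    then have "\<psi> z0 = x0" using \<psi>(2)[of z0] \<phi>(2) z0 unfolding Kn_def by (metis image_eqI)
    then show ?case using \<psi>(1) by blast
  qed
  from this[of M] obtain \<phi> where "islift (Kn M) \<phi>" "\<phi> z0 = x0" by blast
  moreover have "Kn M = K" using M0 by (auto simp: Kn_def h_def)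
  ultimately show ?thesis using that by simp
qed

text \<open>The value at \<open>z\<close> is transported along the segment from \<open>z0\<close>.
  For all points near \<open>z\<close> these segments lie in the convex hull of \<open>z0\<close>
  and a small disc, a compact convex set with a single lift, which gives continuity.\<close>

lemma lift_open_convex:
  assumes D: "open D" "convex D" "D \<inter> gauss_ints = {}" and z0: "z0 \<in> D" and x0: "x0 \<in> Fib z0"
  obtains \<phi> where "islift D \<phi>" "\<phi> z0 = x0"
proof -
  have seg: "closed_segment z0 z \<subseteq> D" if "z \<in> D" for z
    using that z0 D(2) by (simp add: closed_segment_subset)
  have "\<exists>\<phi>. islift (closed_segment z0 z) \<phi> \<and> \<phi> z0 = x0" if "z \<in> D" for z
    using lift_compact_convex[of "closed_segment z0 z" z0 x0] seg[OF that] D(3) x0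
    by (metis compact_segment(1) convex_closed_segment ends_in_segment(1) inf_mono subset_empty subset_refl)
  then obtain \<theta> where \<theta>: "\<And>z. z \<in> D \<Longrightarrow> islift (closed_segment z0 z) (\<theta> z) \<and> \<theta> z z0 = x0" by metis
  define \<phi> where "\<phi> z = \<theta> z z" for z
  have local: "\<exists>\<delta>>0. \<exists>\<kappa>. islift (ball z \<delta>) \<kappa> \<and> ball z \<delta> \<subseteq> D \<and> (\<forall>z'\<in>ball z \<delta>. \<phi> z' = \<kappa> z')" if z: "z \<in> D" for z
  proof -
    obtain \<delta> where d: "0 < \<delta>" "cball z \<delta> \<subseteq> D" using D(1) z open_contains_cball by blast
    define K where "K = convex hull (insert z0 (cball z \<delta>))"
    have "insert z0 (cball z \<delta>) \<subseteq> D" using d z0 by blast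
    then have "K \<subseteq> D" unfolding K_def using D(2) by (rule hull_minimal)
    moreover have "compact K" "convex K" unfolding K_def by (auto intro!: compact_convex_hull)
    moreover have "insert z0 (cball z \<delta>) \<subseteq> K" unfolding K_def by (rule hull_subset)
    ultimately have K: "compact K" "convex K" "K \<subseteq> D" "z0 \<in> K" "cball z \<delta> \<subseteq> K" by auto
    obtain \<kappa> where k: "islift K \<kappa>" "\<kappa> z0 = x0"
      using lift_compact_convex[OF K(1,2) _ K(4) x0] K(3) D(3) by blast
    have "\<phi> z' = \<kappa> z'" if z': "z' \<in> ball z \<delta>" for z'
      unfolding \<phi>_def
    proof (rule islift_unique[where D = "closed_segment z0 z'" and w = z0 and \<phi> = "\<theta> z'" and \<psi> = \<kappa> and z = z'])
      have "z' \<in> K" using z' K(5) by auto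
      then have sK: "closed_segment z0 z' \<subseteq> K" using K(2,4) by (simp add: closed_segment_subset)
      then show "closed_segment z0 z' \<inter> gauss_ints = {}" using K(3) D(3) by blast
      show "islift (closed_segment z0 z') \<kappa>" using islift_subset[OF k(1) sK] .
      have "z' \<in> D" using z' d(2) by auto
      then show "islift (closed_segment z0 z') (\<theta> z')" "\<theta> z' z0 = \<kappa> z0" using \<theta> k(2) by auto
    qed auto
    moreover have "islift (ball z \<delta>) \<kappa>" using islift_subset[OF k(1)] K(5) by (meson ball_subset_cball subset_trans)
    ultimately show ?thesis using d by (meson ball_subset_cball subset_trans)
  qed
  have "islift D \<phi>"
    unfolding islift_def
  proof (intro conjI ballI)
    show "continuous_on D \<phi>"
    proof (rule continuous_at_imp_continuous_on, rule ballI)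
      fix z assume z: "z \<in> D"
      obtain \<delta> \<kappa> where dk: "0 < \<delta>" "islift (ball z \<delta>) \<kappa>" "\<forall>z'\<in>ball z \<delta>. \<phi> z' = \<kappa> z'" using local[OF z] by blast
      have "continuous_on (ball z \<delta>) \<phi>"
        using dk(2,3) by (metis continuous_on_cong islift_def)
      then show "isCont \<phi> z" using dk(1) by (metis centre_in_ball continuous_on_eq_continuous_at open_ball)
    qed
    have "\<phi> z \<in> Fib z" if "z \<in> D" for z using islift_Fib[of "closed_segment z0 z" "\<theta> z" z] \<theta>[OF that] by (simp add: \<phi>_def)
    then show "\<phi> ` D \<subseteq> S" "\<And>z. z \<in> D \<Longrightarrow> e (\<phi> z) = E z" by (auto simp: Fib_def)
  qed
  moreover have "\<phi> z0 = x0" using \<theta>[OF z0] by (simp add: \<phi>_def)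
  ultimately show ?thesis using that by blast
qed

text \<open>Over a lattice point on the boundary the covering may ramify, so no local lift is at
  hand. Compactness provides a cluster point \<open>p\<close>; the image of \<open>D\<close> near
  \<open>z\<close> is connected and confined by \<open>fibre_nbhd\<close>, so it stays near
  \<open>p\<close>, which is therefore a limit.\<close>

lemma lift_limit:
  assumes D: "convex D" and \<phi>: "islift D \<phi>" and z: "z \<in> closure D"
  shows "\<exists>p\<in>Fib z. \<forall>G. open G \<longrightarrow> p \<in> G \<longrightarrow> (\<exists>\<epsilon>>0. \<forall>z'\<in>D. dist z z' < \<epsilon> \<longrightarrow> \<phi> z' \<in> G)"
proof -
  have "\<exists>p\<in>S. \<forall>G \<epsilon>. open G \<longrightarrow> p \<in> G \<longrightarrow> 0 < \<epsilon> \<longrightarrow> (\<exists>z'\<in>D. dist z z' < \<epsilon> \<and> \<phi> z' \<in> G)"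
  proof (rule ccontr)
    assume "\<not> ?thesis"
    then have "\<forall>p\<in>S. \<exists>G \<epsilon>. open G \<and> p \<in> G \<and> 0 < \<epsilon> \<and> (\<forall>z'\<in>D. dist z z' < \<epsilon> \<longrightarrow> \<phi> z' \<notin> G)"
      by (simp only: bex_simps ball_simps not_all not_ex not_imp de_Morgan_conj imp_conv_disj bex_triv not_not HOL.simp_thms Bex_def Ball_def) meson
    from bchoice[OF this] obtain G where
      "\<forall>p\<in>S. \<exists>\<epsilon>. open (G p) \<and> p \<in> G p \<and> 0 < \<epsilon> \<and> (\<forall>z'\<in>D. dist z z' < \<epsilon> \<longrightarrow> \<phi> z' \<notin> G p)" ..
    from bchoice[OF this] obtain \<epsilon> where
      "\<forall>p\<in>S. open (G p) \<and> p \<in> G p \<and> 0 < \<epsilon> p \<and> (\<forall>z'\<in>D. dist z z' < \<epsilon> p \<longrightarrow> \<phi> z' \<notin> G p)" ..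
    then have G: "\<And>p. p \<in> S \<Longrightarrow> open (G p) \<and> p \<in> G p \<and> 0 < \<epsilon> p \<and> (\<forall>z'\<in>D. dist z z' < \<epsilon> p \<longrightarrow> \<phi> z' \<notin> G p)"
      by blast
    obtain C where C: "C \<subseteq> S" "finite C" "S \<subseteq> (\<Union>p\<in>C. G p)"
      by (rule compactE_image[OF compact_S, of S G]) (use G in auto)
    define r where "r = Min (insert 1 (\<epsilon> ` C))"
    have r: "0 < r" unfolding r_def using C G by (subst Min_gr_iff) auto
    have rle: "r \<le> \<epsilon> p" if "p \<in> C" for p unfolding r_def using C that by (intro Min_le) auto
    obtain z' where z': "z' \<in> D" "dist z' z < r" using z r closure_approachable by blast
    have "\<phi> z' \<in> S" using \<phi> z'(1) by (auto simp: islift_def)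
    then obtain p where "p \<in> C" "\<phi> z' \<in> G p" using C(3) by blast
    then show False using G[of p] C(1) rle[of p] z' by (auto simp: dist_commute)
  qed
  then obtain p where p: "p \<in> S"
    "\<And>G \<epsilon>. open G \<Longrightarrow> p \<in> G \<Longrightarrow> 0 < \<epsilon> \<Longrightarrow> \<exists>z'\<in>D. dist z z' < \<epsilon> \<and> \<phi> z' \<in> G" by blast
  have "e p = E z"
  proof (rule ccontr)
    assume ne: "e p \<noteq> E z"
    obtain A B where AB: "open A" "open B" "e p \<in> A" "E z \<in> B" "A \<inter> B = {}" using hausdorff[OF ne] by blast
    obtain T where T: "open T" "S \<inter> e -` A = S \<inter> T"
      using continuous_openin_preimage_gen[OF cont_e AB(1)] by (auto simp: openin_open)
    have "open (E -` B)" "z \<in> E -` B" using AB continuous_on_E[of UNIV] by (auto intro: open_vimage)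
    then obtain \<epsilon> where \<epsilon>: "0 < \<epsilon>" "ball z \<epsilon> \<subseteq> E -` B" by (rule openE)
    have "p \<in> T" using T(2) p(1) AB(3) by blast
    then obtain z' where z': "z' \<in> D" "dist z z' < \<epsilon>" "\<phi> z' \<in> T" using p(2)[OF T(1) _ \<epsilon>(1)] by blast
    have "\<phi> z' \<in> S" "e (\<phi> z') = E z'" using \<phi> z'(1) by (auto simp: islift_def)
    then have "\<phi> z' \<in> S \<inter> e -` A" unfolding T(2) using z'(3) by blast
    then have "E z' \<in> A" using \<open>e (\<phi> z') = E z'\<close> by simp
    moreover have "E z' \<in> B" using \<epsilon>(2) z'(2) by auto
    ultimately show False using AB(5) by blast
  qed
  then have pF: "p \<in> Fib z" using p(1) by (simp add: Fib_def)
  show ?thesis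
  proof (intro bexI[OF _ pF] allI impI)
    fix G assume G: "open G" "p \<in> G"
    obtain O1 O2 \<epsilon> where O: "open O1" "open O2" "O1 \<inter> O2 = {}" "p \<in> O1" "O1 \<subseteq> G" "0 < \<epsilon>"
      "\<And>x z'. x \<in> S \<Longrightarrow> z' \<in> ball z \<epsilon> \<Longrightarrow> e x = E z' \<Longrightarrow> x \<in> O1 \<union> O2"
      using fibre_nbhd[OF pF G] by metis
    obtain w where w: "w \<in> D" "dist z w < \<epsilon>" "\<phi> w \<in> O1" using p(2)[OF O(1,4,6)] by blast
    have "connected (\<phi> ` (D \<inter> ball z \<epsilon>))"
      using \<phi> D by (intro connected_continuous_image convex_connected convex_Int convex_ball)
        (auto simp: islift_def intro: continuous_on_subset)
    moreover have "\<phi> ` (D \<inter> ball z \<epsilon>) \<subseteq> O1 \<union> O2"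
    proof (rule image_subsetI)
      fix v assume "v \<in> D \<inter> ball z \<epsilon>"
      then show "\<phi> v \<in> O1 \<union> O2" using O(7)[of "\<phi> v" v] islift_Fib[OF \<phi>, of v] by (simp add: Fib_def)
    qed
    ultimately have "O1 \<inter> \<phi> ` (D \<inter> ball z \<epsilon>) = {} \<or> O2 \<inter> \<phi> ` (D \<inter> ball z \<epsilon>) = {}"
      using connectedD[OF _ O(1,2)] O(3) by blast
    then have "\<phi> ` (D \<inter> ball z \<epsilon>) \<subseteq> O1" using w \<open>\<phi> ` (D \<inter> ball z \<epsilon>) \<subseteq> O1 \<union> O2\<close> by auto
    then have "\<phi> z' \<in> G" if "z' \<in> D" "dist z z' < \<epsilon>" for z'
      using that O(5) by (metis IntI image_subset_iff mem_ball subsetD)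
    then show "\<exists>\<epsilon>>0. \<forall>z'\<in>D. dist z z' < \<epsilon> \<longrightarrow> \<phi> z' \<in> G" using O(6) by blast
  qed
qed

lemma lift_closure:
  assumes D: "convex D" and \<phi>: "islift D \<phi>"
  obtains \<psi> where "islift (closure D) \<psi>" "\<And>z. z \<in> D \<Longrightarrow> \<psi> z = \<phi> z"
proof -
  have "\<forall>z\<in>closure D. \<exists>p. p \<in> Fib z \<and> (\<forall>G. open G \<longrightarrow> p \<in> G \<longrightarrow> (\<exists>\<epsilon>>0. \<forall>z'\<in>D. dist z z' < \<epsilon> \<longrightarrow> \<phi> z' \<in> G))"
  proof
    fix z assume "z \<in> closure D"
    from lift_limit[OF D \<phi> this]
    show "\<exists>p. p \<in> Fib z \<and> (\<forall>G. open G \<longrightarrow> p \<in> G \<longrightarrow> (\<exists>\<epsilon>>0. \<forall>z'\<in>D. dist z z' < \<epsilon> \<longrightarrow> \<phi> z' \<in> G))"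
      unfolding Bex_def .
  qed
  from bchoice[OF this] obtain \<psi> where "\<forall>z\<in>closure D. \<psi> z \<in> Fib z \<and>
      (\<forall>G. open G \<longrightarrow> \<psi> z \<in> G \<longrightarrow> (\<exists>\<epsilon>>0. \<forall>z'\<in>D. dist z z' < \<epsilon> \<longrightarrow> \<phi> z' \<in> G))" ..
  then have \<psi>: "\<And>z. z \<in> closure D \<Longrightarrow> \<psi> z \<in> Fib z \<and>
      (\<forall>G. open G \<longrightarrow> \<psi> z \<in> G \<longrightarrow> (\<exists>\<epsilon>>0. \<forall>z'\<in>D. dist z z' < \<epsilon> \<longrightarrow> \<phi> z' \<in> G))" by blast
  have eq: "\<psi> z = \<phi> z" if z: "z \<in> D" for z
  proof (rule ccontr)
    assume ne: "\<psi> z \<noteq> \<phi> z"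
    obtain A B where AB: "open A" "open B" "\<psi> z \<in> A" "\<phi> z \<in> B" "A \<inter> B = {}" using hausdorff[OF ne] by blast
    have "z \<in> closure D" using z closure_subset by blast
    then obtain \<epsilon> where "0 < \<epsilon>" "\<forall>z'\<in>D. dist z z' < \<epsilon> \<longrightarrow> \<phi> z' \<in> A" using \<psi> AB by blast
    then have "\<phi> z \<in> A" using z by auto
    then show False using AB by blast
  qed
  have "islift (closure D) \<psi>"
    unfolding islift_def
  proof (intro conjI ballI)
    show "continuous_on (closure D) \<psi>"
      unfolding continuous_on_topological
    proof (intro ballI allI impI)
      fix z B assume z: "z \<in> closure D" and B: "open B" "\<psi> z \<in> B"
      obtain O1 O2 \<epsilon> where O: "open O1" "open O2" "O1 \<inter> O2 = {}" "\<psi> z \<in> O1" "O1 \<subseteq> B" "0 < \<epsilon>"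
        "\<And>x z'. x \<in> S \<Longrightarrow> z' \<in> ball z \<epsilon> \<Longrightarrow> e x = E z' \<Longrightarrow> x \<in> O1 \<union> O2"
        using fibre_nbhd[OF conjunct1[OF \<psi>[OF z]] B] by metis
      obtain \<epsilon>' where e': "0 < \<epsilon>'" "\<forall>z'\<in>D. dist z z' < \<epsilon>' \<longrightarrow> \<phi> z' \<in> O1" using \<psi>[OF z] O(1,4) by blast
      define r where "r = min \<epsilon> \<epsilon>'"
      \<comment> \<open>Otherwise points of \<open>D\<close> close to \<open>z'\<close> would be
        mapped into \<open>O2\<close>, but being close to \<open>z\<close> also into
        \<open>O1\<close>.\<close>
      have "\<psi> z' \<in> B" if z': "z' \<in> closure D" "z' \<in> ball z r" for z'
      proof (rule ccontr)
        assume "\<psi> z' \<notin> B"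
        then have "\<psi> z' \<in> O2" using O(5) O(7)[of "\<psi> z'" z'] \<psi>[OF z'(1)] z'(2) by (auto simp: r_def Fib_def)
        then obtain \<epsilon>2 where e2: "0 < \<epsilon>2" "\<forall>w\<in>D. dist z' w < \<epsilon>2 \<longrightarrow> \<phi> w \<in> O2" using \<psi>[OF z'(1)] O(2) by blast
        have "0 < min \<epsilon>2 (r - dist z z')" using e2 z'(2) by simp
        then obtain w where w: "w \<in> D" "dist w z' < min \<epsilon>2 (r - dist z z')" using z'(1) closure_approachable by blast
        have "dist w z' < r - dist z z'" "r \<le> \<epsilon>'" using w(2) by (auto simp: r_def)
        then have "dist z w < \<epsilon>'" using dist_triangle[of z w z'] dist_commute[of z' w] by linarith
        then have "\<phi> w \<in> O1" "\<phi> w \<in> O2" using e' e2 w by (auto simp: dist_commute)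
        then show False using O(3) by blast
      qed
      then show "\<exists>A. open A \<and> z \<in> A \<and> (\<forall>y\<in>closure D. y \<in> A \<longrightarrow> \<psi> y \<in> B)"
        using O(6) e'(1) by (intro exI[of _ "ball z r"]) (auto simp: r_def)
    qed
    show "\<psi> ` closure D \<subseteq> S" "\<And>z. z \<in> closure D \<Longrightarrow> e (\<psi> z) = E z" using \<psi> by (auto simp: Fib_def)
  qed
  then show ?thesis using that eq by blast
qed

end

section \<open>Gluing data of the squares of a lattice basis\<close>

definition cross :: "complex \<Rightarrow> complex \<Rightarrow> real" where
  "cross v z = Re v * Im z - Im v * Re z"

lemma cross_inner: "cross v z = Complex (- Im v) (Re v) \<bullet> z"
  by (simp add: cross_def inner_complex_def)

lemma cross_simps [simp]:
  "cross v (x + y) = cross v x + cross v y" "cross (x + y) v = cross x v + cross y v"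
  "cross (- v) x = - cross v x" "cross v (- x) = - cross v x"
  "cross (of_real t * v) x = t * cross v x" "cross v (of_real t * x) = t * cross v x"
  "cross v v = 0" "cross v 0 = 0" "cross 0 v = 0"
  by (simp_all add: cross_def algebra_simps)

lemma cross_commute: "cross w v = - cross v w"
  by (simp add: cross_def)

lemma cross_gauss: "v \<in> gauss_ints \<Longrightarrow> w \<in> gauss_ints \<Longrightarrow> cross v w \<in> \<int>"
  by (auto simp: cross_def gauss_ints_iff)

lemma gauss_ints_of_int: "v \<in> gauss_ints \<Longrightarrow> t \<in> \<int> \<Longrightarrow> of_real t * v \<in> gauss_ints"
  by (auto simp: gauss_ints_iff)

text \<open>For a Gaussian integer \<open>v\<close> the values of \<open>cross v\<close> on the
  lattice are integers, so the region between consecutive integral levels is a convex set without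
  lattice points.\<close>

definition strip :: "complex \<Rightarrow> int \<Rightarrow> complex set" where
  "strip v k = {z. real_of_int k < cross v z \<and> cross v z < real_of_int k + 1}"

lemma open_strip: "open (strip v k)" and convex_strip: "convex (strip v k)"
proof -
  have "strip v k = {z. Complex (- Im v) (Re v) \<bullet> z > real_of_int k} \<inter> {z. Complex (- Im v) (Re v) \<bullet> z < real_of_int k + 1}"
    by (auto simp: strip_def cross_inner)
  then show "open (strip v k)" "convex (strip v k)"
    by (simp_all add: open_Int open_halfspace_gt open_halfspace_lt convex_Int convex_halfspace_gt convex_halfspace_lt)
qed

lemma strip_free: 
  assumes "v \<in> gauss_ints"
  shows "strip v k \<inter> gauss_ints = {}"
proof -
  have False if z: "z \<in> gauss_ints" "z \<in> strip v k" for z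
  proof -
    obtain n :: int where "cross v z = n" using cross_gauss[OF assms z(1)] by (auto elim: Ints_cases)
    then have "real_of_int k < real_of_int n" "real_of_int n < real_of_int k + 1" using z(2) by (simp_all add: strip_def)
    then have "real_of_int k < real_of_int n" "real_of_int n < real_of_int (k + 1)" by simp_all
    then show False unfolding of_int_less_iff by linarith
  qed
  then show ?thesis by blast
qed

text \<open>Includes the lower edge, which for \<open>k = 0\<close> is the line through 0 that
  carries the saddle connections of direction \<open>v\<close>. It is approached along the normal
  \<open>\<i> * v\<close>.\<close>

lemma strip_closure:
  assumes "v \<noteq> 0" "real_of_int k \<le> cross v z" "cross v z < real_of_int k + 1"
  shows "z \<in> closure (strip v k)"
  unfolding closure_approachable
proof (intro allI impI)
  fix \<epsilon> :: real assume e: "0 < \<epsilon>"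
  define n where "n = cmod v"
  have n: "0 < n" using assms(1) by (simp add: n_def)
  have "cross v (\<i> * v) = (Re v)\<^sup>2 + (Im v)\<^sup>2" by (simp add: cross_def power2_eq_square)
  then have n2: "cross v (\<i> * v) = n\<^sup>2" by (simp add: n_def cmod_power2)
  define t where "t = min (\<epsilon> / (2 * n)) ((real_of_int k + 1 - cross v z) / (2 * n\<^sup>2))"
  have t: "0 < t" using e n assms(3) by (simp add: t_def)
  have "t * n \<le> \<epsilon> / (2 * n) * n" using n by (intro mult_right_mono) (auto simp: t_def)
  then have t1: "t * n < \<epsilon>" using e n by simp
  have "t * n\<^sup>2 \<le> (real_of_int k + 1 - cross v z) / (2 * n\<^sup>2) * n\<^sup>2" using n by (intro mult_right_mono) (auto simp: t_def)
  then have t2: "t * n\<^sup>2 < real_of_int k + 1 - cross v z" using n assms(3) by simp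
  have c: "cross v (z + of_real t * (\<i> * v)) = cross v z + t * n\<^sup>2" unfolding cross_simps n2 ..
  have "0 < t * n\<^sup>2" using t n by simp
  then have "z + of_real t * (\<i> * v) \<in> strip v k" unfolding strip_def mem_Collect_eq c using t2 assms(2) by linarith
  moreover have "dist (z + of_real t * (\<i> * v)) z < \<epsilon>"
    using t t1 by (simp add: dist_norm norm_mult n_def)
  ultimately show "\<exists>y\<in>strip v k. dist y z < \<epsilon>" by blast
qed

lemma strip_nonzero: "z \<in> strip v k \<Longrightarrow> v \<noteq> 0"
  by (auto simp: strip_def)

definition ctr :: "complex \<Rightarrow> complex \<Rightarrow> complex" where "ctr v w = (v + w) / 2"

definition zbasis :: "complex \<Rightarrow> complex \<Rightarrow> bool" where
  "zbasis v w \<longleftrightarrow> v \<in> gauss_ints \<and> w \<in> gauss_ints \<and> cross v w = 1"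

context origami begin

lemma strip_lift:
  assumes "v \<in> gauss_ints" "z \<in> strip v k" "x \<in> Fib z"
  obtains \<psi> where "islift (closure (strip v k)) \<psi>" "\<psi> z = x"
proof -
  obtain \<phi> where \<phi>: "islift (strip v k) \<phi>" "\<phi> z = x"
    using lift_open_convex[OF open_strip convex_strip strip_free[OF assms(1)] assms(2,3)] by metis
  obtain \<psi> where "islift (closure (strip v k)) \<psi>" "\<And>w. w \<in> strip v k \<Longrightarrow> \<psi> w = \<phi> w"
    using lift_closure[OF convex_strip \<phi>(1)] by metis
  then show ?thesis using that \<phi>(2) assms(2) by metis
qed

text \<open>On a set that touches the lattice a lift is still determined, by continuity, by its
  values on a dense connected part without lattice points.\<close>

lemma islift_unique_closure:
  assumes D: "connected D" "D \<inter> gauss_ints = {}" and A: "D \<subseteq> A" "A \<subseteq> closure D"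
    and l: "islift A \<phi>" "islift A \<psi>" and w: "w \<in> D" "\<phi> w = \<psi> w" and z: "z \<in> A"
  shows "\<phi> z = \<psi> z"
proof (rule ccontr)
  assume ne: "\<phi> z \<noteq> \<psi> z"
  obtain U V where UV: "open U" "open V" "\<phi> z \<in> U" "\<psi> z \<in> V" "U \<inter> V = {}" using hausdorff[OF ne] by blast
  have c: "continuous_on A \<phi>" "continuous_on A \<psi>" using l by (auto simp: islift_def)
  obtain T where T: "open T" "z \<in> T" "\<And>y. y \<in> A \<Longrightarrow> y \<in> T \<Longrightarrow> \<phi> y \<in> U"
    using c(1) z UV unfolding continuous_on_topological by meson
  obtain T' where T': "open T'" "z \<in> T'" "\<And>y. y \<in> A \<Longrightarrow> y \<in> T' \<Longrightarrow> \<psi> y \<in> V"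
    using c(2) z UV unfolding continuous_on_topological by meson
  have "open (T \<inter> T')" "z \<in> T \<inter> T'" using T T' by auto
  then have "D \<inter> (T \<inter> T') \<noteq> {}" using z A(2) by (meson closure_iff_nhds_not_empty in_mono subset_refl)
  then obtain y where y: "y \<in> D" "y \<in> T" "y \<in> T'" by blast
  have "\<phi> y = \<psi> y"
    using islift_unique[OF D islift_subset[OF l(1) A(1)] islift_subset[OF l(2) A(1)] w y(1)] .
  then show False using T(3)[of y] T'(3)[of y] y A(1) UV(5) by auto
qed

text \<open>Parallel transport along a segment; it is only meaningful if the segment avoids \<open>\<int>\<^sup>2\<close>.\<close>

definition tr :: "complex \<Rightarrow> complex \<Rightarrow> 'a \<Rightarrow> 'a" where
  "tr z z' x = (SOME y. \<exists>\<phi>. islift (closed_segment z z') \<phi> \<and> \<phi> z = x \<and> \<phi> z' = y)"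

lemma tr_eq:
  assumes D: "convex D" "D \<inter> gauss_ints = {}" and l: "islift D \<phi>" and z: "z \<in> D" "z' \<in> D"
  shows "tr z z' (\<phi> z) = \<phi> z'"
  unfolding tr_def
proof (rule some_equality)
  have sub: "closed_segment z z' \<subseteq> D" using z D(1) by (simp add: closed_segment_subset)
  show "\<exists>\<phi>'. islift (closed_segment z z') \<phi>' \<and> \<phi>' z = \<phi> z \<and> \<phi>' z' = \<phi> z'"
    using islift_subset[OF l sub] by blast
  fix y assume "\<exists>\<phi>'. islift (closed_segment z z') \<phi>' \<and> \<phi>' z = \<phi> z \<and> \<phi>' z' = y"
  then obtain \<phi>' where p: "islift (closed_segment z z') \<phi>'" "\<phi>' z = \<phi> z" "\<phi>' z' = y" by blast
  have "\<phi>' z' = \<phi> z'"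
    by (rule islift_unique[where D = "closed_segment z z'" and w = z, OF _ _ p(1) islift_subset[OF l sub]])
       (use sub D(2) p in auto)
  then show "y = \<phi> z'" using p by simp
qed

lemma tr_strip:
  assumes v: "v \<in> gauss_ints" and l: "islift (closure (strip v k)) \<phi>" and z: "z \<in> strip v k" "z' \<in> strip v k"
  shows "tr z z' (\<phi> z) = \<phi> z'"
  using tr_eq[OF convex_strip strip_free[OF v] islift_subset[OF l closure_subset] z] .

lemma tr_strip_Fib:
  assumes v: "v \<in> gauss_ints" and z: "z \<in> strip v k" "z' \<in> strip v k" and x: "x \<in> Fib z"
  shows "tr z z' x \<in> Fib z'"
proof -
  obtain \<psi> where \<psi>: "islift (closure (strip v k)) \<psi>" "\<psi> z = x" by (rule strip_lift[OF v z(1) x])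
  have t: "tr z z' x = \<psi> z'" using tr_strip[OF v \<psi>(1)] z \<psi>(2) by auto
  have "z' \<in> closure (strip v k)" using z(2) closure_subset by blast
  then show "tr z z' x \<in> Fib z'" unfolding t using islift_Fib[OF \<psi>(1)] by blast
qed

lemma tr_strip_comp:
  assumes v: "v \<in> gauss_ints" and z: "z \<in> strip v k" "z' \<in> strip v k" "z'' \<in> strip v k" and x: "x \<in> Fib z"
  shows "tr z' z'' (tr z z' x) = tr z z'' x"
proof -
  obtain \<psi> where \<psi>: "islift (closure (strip v k)) \<psi>" "\<psi> z = x" by (rule strip_lift[OF v z(1) x])
  show ?thesis using tr_strip[OF v \<psi>(1)] z \<psi>(2) by auto
qed

lemma tr_strip_refl:
  assumes v: "v \<in> gauss_ints" and z: "z \<in> strip v k" and x: "x \<in> Fib z"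
  shows "tr z z x = x"
proof -
  obtain \<psi> where \<psi>: "islift (closure (strip v k)) \<psi>" "\<psi> z = x" by (rule strip_lift[OF v z x])
  show ?thesis using tr_strip[OF v \<psi>(1) z z] \<psi>(2) by simp
qed

lemma strip_translate:
  assumes "v \<in> gauss_ints" "l \<in> gauss_ints"
  obtains j where "\<And>z. z + l \<in> strip v j \<longleftrightarrow> z \<in> strip v k" "\<And>z. z - l \<in> strip v k \<longleftrightarrow> z \<in> strip v j"
proof -
  obtain n :: int where n: "cross v l = n" using cross_gauss[OF assms] by (auto elim: Ints_cases)
  have m: "cross v (z - l) = cross v z - n" for z
    using cross_simps(1)[of v "z - l" l] n by simp
  show ?thesis by (rule that[of "k + n"]) (auto simp: strip_def n m)
qed

lemma Fib_translate: "l \<in> gauss_ints \<Longrightarrow> Fib (z + l) = Fib z"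
  by (rule Fib_cong) (rule E_add_gauss)

text \<open>The covering condition is invariant under lattice translations of the plane, so the same
  lift is read in shifted coordinates.\<close>

lemma tr_translate:
  assumes v: "v \<in> gauss_ints" and l: "l \<in> gauss_ints" and z: "z \<in> strip v k" "z' \<in> strip v k" and x: "x \<in> Fib z"
  shows "tr (z + l) (z' + l) x = tr z z' x"
proof -
  obtain \<psi> where \<psi>: "islift (closure (strip v k)) \<psi>" "\<psi> z = x" by (rule strip_lift[OF v z(1) x])
  obtain j where j: "\<And>z. z + l \<in> strip v j \<longleftrightarrow> z \<in> strip v k" "\<And>z. z - l \<in> strip v k \<longleftrightarrow> z \<in> strip v j"
    using strip_translate[OF v l] by metis
  have lift: "islift (strip v j) (\<lambda>z. \<psi> (z + - l))"
  proof (rule islift_translate[OF islift_subset[OF \<psi>(1) closure_subset] gauss_ints_minus[OF l]])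
    show "z + - l \<in> strip v k" if "z \<in> strip v j" for z using that j(2)[of z] by simp
  qed
  have "tr (z + l) (z' + l) ((\<lambda>z. \<psi> (z + - l)) (z + l)) = (\<lambda>z. \<psi> (z + - l)) (z' + l)"
    using tr_eq[OF convex_strip strip_free[OF v] lift] z j(1) by blast
  then show ?thesis using \<psi>(2) tr_strip[OF v \<psi>(1) z] by simp
qed

text \<open>Whether the corner of the square through \<open>x\<close> that lies over 0 is a conical singularity.\<close>

definition mark :: "complex \<Rightarrow> 'a \<Rightarrow> bool" where
  "mark z x \<longleftrightarrow> (\<exists>\<psi>. islift (closed_segment 0 z) \<psi> \<and> \<psi> z = x \<and> \<psi> 0 \<in> Sg)"

text \<open>The segment from 0 to \<open>z\<close> lies in the strip except for the point 0, so the
  lift that occurs in \<open>mark\<close> is the restriction of the lift of the strip.\<close>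

lemma mark_iff:
  assumes v: "v \<in> gauss_ints" and l: "islift (closure (strip v 0)) \<psi>" and z: "z \<in> strip v 0"
  shows "mark z (\<psi> z) \<longleftrightarrow> \<psi> 0 \<in> Sg"
proof -
  let ?A = "closed_segment 0 z"
  have v0: "v \<noteq> 0" using strip_nonzero[OF z] .
  have ray: "of_real t * z \<in> strip v 0" if "0 < t" "t \<le> 1" for t
  proof -
    have c: "0 < cross v z" "cross v z < 1" using z by (auto simp: strip_def)
    have "t * cross v z \<le> 1 * cross v z" using that c by (intro mult_right_mono) auto
    then have "t * cross v z < 1" using c by linarith
    then show ?thesis using that c by (simp add: strip_def)
  qed
  have seg: "\<exists>t. 0 \<le> t \<and> t \<le> 1 \<and> y = of_real t * z" if "y \<in> ?A" for y
    using that by (auto simp: closed_segment_def scaleR_conv_of_real)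
  have zcl: "0 \<in> closure (strip v 0)" using v0 by (intro strip_closure) auto
  have sub: "?A \<subseteq> closure (strip v 0)"
  proof
    fix y assume "y \<in> ?A"
    then obtain t where t: "0 \<le> t" "t \<le> 1" "y = of_real t * z" using seg by blast
    show "y \<in> closure (strip v 0)"
    proof (cases "t = 0")
      case False then show ?thesis using ray[of t] t closure_subset by auto
    qed (use t zcl in simp)
  qed
  have cl: "?A \<subseteq> closure (?A \<inter> strip v 0)"
  proof
    fix y assume y: "y \<in> ?A"
    then obtain t where t: "0 \<le> t" "t \<le> 1" "y = of_real t * z" using seg by blast
    show "y \<in> closure (?A \<inter> strip v 0)"
    proof (cases "t = 0")
      case False
      then have "y \<in> ?A \<inter> strip v 0" using ray[of t] t y by auto
      then show ?thesis using closure_subset[of "?A \<inter> strip v 0"] by blast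
    next
      case True
      show ?thesis unfolding closure_approachable
      proof (intro allI impI)
        fix \<epsilon> :: real assume "0 < \<epsilon>"
        define A where "A = cmod z + 1"
        define s where "s = min 1 (\<epsilon> / (2 * A))"
        have nz: "0 < A" by (simp add: add_nonneg_pos A_def)
        have s: "0 < s" "s \<le> 1" using \<open>0 < \<epsilon>\<close> nz by (auto simp: s_def)
        have "s * cmod z \<le> \<epsilon> / (2 * A) * A"
          using nz \<open>0 < \<epsilon>\<close> by (intro mult_mono) (auto simp: s_def A_def)
        also have "\<dots> = \<epsilon> / 2" using nz by (simp add: field_simps)
        finally have "s * cmod z < \<epsilon>" using \<open>0 < \<epsilon>\<close> by simp
        moreover have "of_real s * z \<in> ?A"
          using s by (auto simp: closed_segment_def scaleR_conv_of_real)
        ultimately show "\<exists>u\<in>?A \<inter> strip v 0. dist u y < \<epsilon>"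
          using ray[OF s] True t s by (intro bexI[of _ "of_real s * z"]) (auto simp: norm_mult)
      qed
    qed
  qed
  show ?thesis
  proof
    assume "mark z (\<psi> z)"
    then obtain \<psi>' where p: "islift ?A \<psi>'" "\<psi>' z = \<psi> z" "\<psi>' 0 \<in> Sg" by (auto simp: mark_def)
    have "\<psi>' 0 = \<psi> 0"
    proof (rule islift_unique_closure[where D = "?A \<inter> strip v 0" and w = z and A = ?A])
      show "connected (?A \<inter> strip v 0)" by (intro convex_connected convex_Int convex_strip convex_closed_segment)
      show "islift ?A \<psi>" by (rule islift_subset[OF l sub])
      show "?A \<inter> strip v 0 \<inter> gauss_ints = {}" using strip_free[OF v] by blast
    qed (use p z cl in auto)
    then show "\<psi> 0 \<in> Sg" using p by simp
  next
    assume "\<psi> 0 \<in> Sg"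
    then show "mark z (\<psi> z)" unfolding mark_def using islift_subset[OF l sub] by blast
  qed
qed

lemma mark_tr:
  assumes v: "v \<in> gauss_ints" and z: "z \<in> strip v 0" "z' \<in> strip v 0" and x: "x \<in> Fib z"
  shows "mark z' (tr z z' x) \<longleftrightarrow> mark z x"
proof -
  obtain \<psi> where \<psi>: "islift (closure (strip v 0)) \<psi>" "\<psi> z = x" by (rule strip_lift[OF v z(1) x])
  show ?thesis
    using mark_iff[OF v \<psi>(1) z(1)] mark_iff[OF v \<psi>(1) z(2)] tr_strip[OF v \<psi>(1) z] \<psi>(2) by simp
qed

text \<open>The effect on the fibre of replacing the basis \<open>(p, q)\<close> by \<open>(p, q + p)\<close>. The sign of the
  determinant is left free, so that the move \<open>(p + q, q)\<close> is covered as well.\<close>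

lemma shear_fibre:
  fixes p q :: complex and \<sigma> :: real
  assumes p: "p \<in> gauss_ints" and q: "q \<in> gauss_ints" and \<sigma>: "\<sigma> = 1 \<or> \<sigma> = -1" and det: "cross p q = \<sigma>"
  defines "c \<equiv> (p + q) / 2" and "c' \<equiv> (p + (q + p)) / 2"
  assumes x: "x \<in> Fib c"
  shows "tr c c' x \<in> Fib c'" "tr c' c (tr c c' x) = x"
    "tr c (c + p) x \<in> Fib c" "tr c (c + q) x \<in> Fib c"
    "tr c' (c' + p) (tr c c' x) = tr c c' (tr c (c + p) x)"
    "tr c' (c' + (q + p)) (tr c c' x) = tr c c' (tr c (c + q) (tr c (c + p) x))"
    "mark c' (tr c c' x) \<longleftrightarrow> mark c x"
proof -
  define pt where "pt s t = of_real s * p + of_real t * q" for s t :: real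
  have det': "cross q p = - \<sigma>" using det cross_commute by metis
  have ss: "\<sigma> * \<sigma> = 1" using \<sigma> by auto
  \<comment> \<open>Signs are chosen so that \<open>cross\<close> with \<open>P\<close>,
    \<open>Q\<close> and \<open>R\<close> is \<open>t\<close>, \<open>s\<close> and
    \<open>s - t\<close> in the coordinates \<open>pt s t\<close>, whatever the sign of the
    determinant.\<close>
  define P where "P = of_real \<sigma> * p"
  define Q where "Q = of_real (- \<sigma>) * q"
  define R where "R = of_real (- \<sigma>) * (p + q)"
  have s1: "\<sigma> \<in> \<int>" "- \<sigma> \<in> \<int>" using \<sigma> by auto
  have PQR: "P \<in> gauss_ints" "Q \<in> gauss_ints" "R \<in> gauss_ints"
    unfolding P_def Q_def R_def using s1 p q by (auto intro: gauss_ints_of_int gauss_ints_add simp del: of_real_minus)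
  have cP: "cross P (pt s t) = t" for s t
    using ss by (simp add: P_def pt_def det del: of_real_minus)
  have cQ: "cross Q (pt s t) = s" for s t
    using ss by (simp add: Q_def pt_def det' del: of_real_minus)
  have cR: "cross R (pt s t) = s - t" for s t
  proof -
    have "cross R (pt s t) = s * (- \<sigma> * (0 + - \<sigma>)) + t * (- \<sigma> * (\<sigma> + 0))"
      by (simp only: R_def pt_def cross_simps det det')
    also have "\<dots> = (\<sigma> * \<sigma>) * (s - t)" by (simp add: algebra_simps)
    finally show ?thesis by (simp add: ss)
  qed
  have stP: "pt s t \<in> strip P k \<longleftrightarrow> real_of_int k < t \<and> t < real_of_int k + 1" for s t k
    by (simp add: strip_def cP)
  have stQ: "pt s t \<in> strip Q k \<longleftrightarrow> real_of_int k < s \<and> s < real_of_int k + 1" for s t k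
    by (simp add: strip_def cQ)
  have stR: "pt s t \<in> strip R k \<longleftrightarrow> real_of_int k < s - t \<and> s - t < real_of_int k + 1" for s t k
    by (simp add: strip_def cR)
  note st = stP stQ stR
  have shp: "pt s t + p = pt (s + 1) t" and shq: "pt s t + q = pt s (t + 1)" for s t
    by (simp_all add: pt_def algebra_simps)
  have cpt: "c = pt (1/2) (1/2)" "c' = pt 1 (1/2)"
    by (simp_all add: c_def c'_def pt_def field_simps)
  have "c' + (q + p) = pt 1 (1/2) + q + p" unfolding cpt by (simp only: add.assoc)
  then have sums: "c + p = pt (3/2) (1/2)" "c + q = pt (1/2) (3/2)" "c' + p = pt 2 (1/2)" "c' + (q + p) = pt 2 (3/2)"
    unfolding cpt shp shq by simp_all
  have xc: "x \<in> Fib (pt (1/2) (1/2))" using x by (simp add: cpt)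
  have Fs: "Fib (pt s t + p) = Fib (pt s t)" "Fib (pt s t + q) = Fib (pt s t)" for s t
    using Fib_translate[OF p] Fib_translate[OF q] by simp_all
  have F1: "Fib (pt (3/2) (1/2)) = Fib (pt (1/2) (1/2))" "Fib (pt (1/2) (3/2)) = Fib (pt (1/2) (1/2))"
    "Fib (pt (3/2) (3/2)) = Fib (pt (1/2) (1/2))"
    using Fs(1)[of "1/2" "1/2"] Fs(2)[of "1/2" "1/2"] Fs(1)[of "1/2" "3/2"] by (simp_all add: shp shq)
  show "tr c c' x \<in> Fib c'" unfolding cpt
    by (rule tr_strip_Fib[OF PQR(1), of _ 0]) (use xc in \<open>auto simp: st\<close>)
  have "tr c' c (tr c c' x) = tr c c x" unfolding cpt
    by (rule tr_strip_comp[OF PQR(1), of _ 0]) (use xc in \<open>auto simp: st\<close>)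
  also have "\<dots> = x" unfolding cpt
    by (rule tr_strip_refl[OF PQR(1), of _ 0]) (use xc in \<open>auto simp: st\<close>)
  finally show "tr c' c (tr c c' x) = x" .
  have x1F: "tr c (c + p) x \<in> Fib (pt (3/2) (1/2))" unfolding sums unfolding cpt
    by (rule tr_strip_Fib[OF PQR(1), of _ 0]) (use xc in \<open>auto simp: st\<close>)
  then show Fp: "tr c (c + p) x \<in> Fib c" by (simp add: F1 cpt)
  have qF: "tr c (c + q) y \<in> Fib c" if "y \<in> Fib c" for y
  proof -
    have "tr c (c + q) y \<in> Fib (pt (1/2) (3/2))" unfolding sums unfolding cpt
      by (rule tr_strip_Fib[OF PQR(2), of _ 0]) (use that in \<open>auto simp: st cpt\<close>)
    then show ?thesis by (simp add: F1 cpt)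
  qed
  then show "tr c (c + q) x \<in> Fib c" using x .
  define x1 where "x1 = tr c (c + p) x"
  have x1: "x1 = tr (pt (1/2) (1/2)) (pt (3/2) (1/2)) x" unfolding x1_def sums unfolding cpt ..
  have x1F': "x1 \<in> Fib (pt (3/2) (1/2))" "x1 \<in> Fib (pt (1/2) (1/2))" using x1F by (simp_all add: x1_def F1)
  have "tr c' (c' + p) (tr c c' x) = tr (pt (1/2) (1/2)) (pt 2 (1/2)) x"
    unfolding sums unfolding cpt
    by (rule tr_strip_comp[OF PQR(1), of _ 0]) (use xc in \<open>auto simp: st\<close>)
  also have "\<dots> = tr (pt (3/2) (1/2)) (pt 2 (1/2)) x1"
    unfolding x1 by (rule tr_strip_comp[OF PQR(1), of _ 0, symmetric]) (use xc in \<open>auto simp: st\<close>)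
  also have "\<dots> = tr (pt (1/2) (1/2) + p) (pt 1 (1/2) + p) x1" by (simp add: shp)
  also have "\<dots> = tr (pt (1/2) (1/2)) (pt 1 (1/2)) x1"
    by (rule tr_translate[OF PQR(1) p, of _ 0]) (use x1F' in \<open>auto simp: st\<close>)
  finally show "tr c' (c' + p) (tr c c' x) = tr c c' (tr c (c + p) x)" by (simp add: x1_def cpt)
  \<comment> \<open>Waypoints that bend the diagonal from \<open>c'\<close> to
    \<open>c' + (q + p)\<close>. The leg from \<open>?a\<close> to \<open>?b\<close> lies both in
    the strip \<open>0 < s - t < 1\<close> of the diagonal and in the strip \<open>1 < s < 2\<close>
    of the step along \<open>q\<close>, so its transport can be read in either.\<close>
  let ?a = "pt (6/5) (1/2)" and ?b = "pt (9/5) (3/2)"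
  define xa where "xa = tr (pt (1/2) (1/2)) ?a x"
  define xb where "xb = tr ?a ?b xa"
  have xaF: "xa \<in> Fib ?a" unfolding xa_def
    by (rule tr_strip_Fib[OF PQR(1), of _ 0]) (use xc in \<open>auto simp: st\<close>)
  have xbF: "xb \<in> Fib ?b" unfolding xb_def
    by (rule tr_strip_Fib[OF PQR(3), of _ 0]) (use xaF in \<open>auto simp: st\<close>)
  define y where "y = tr (pt (1/2) (1/2)) (pt 1 (1/2)) x"
  have yF: "y \<in> Fib (pt 1 (1/2))" unfolding y_def
    by (rule tr_strip_Fib[OF PQR(1), of _ 0]) (use xc in \<open>auto simp: st\<close>)
  have ya: "tr (pt 1 (1/2)) ?a y = xa" unfolding y_def xa_def
    by (rule tr_strip_comp[OF PQR(1), of _ 0]) (use xc in \<open>auto simp: st\<close>)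
  have yb: "tr (pt 1 (1/2)) ?b y = xb"
    unfolding xb_def ya[symmetric]
    by (rule tr_strip_comp[OF PQR(3), of _ 0, symmetric]) (use yF in \<open>auto simp: st\<close>)
  have lhs: "tr (pt 1 (1/2)) (pt 2 (3/2)) y = tr ?b (pt 2 (3/2)) xb"
    unfolding yb[symmetric]
    by (rule tr_strip_comp[OF PQR(3), of _ 0, symmetric]) (use yF in \<open>auto simp: st\<close>)
  define x2 where "x2 = tr c (c + q) x1"
  have x2F: "x2 \<in> Fib c" unfolding x2_def using qF x1F' by (simp add: cpt)
  have "x2 = tr (pt (1/2) (1/2)) (pt (1/2) (3/2)) x1" unfolding x2_def sums unfolding cpt ..
  also have "\<dots> = tr (pt (1/2) (1/2) + p) (pt (1/2) (3/2) + p) x1"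
    by (rule tr_translate[OF PQR(2) p, of _ 0, symmetric]) (use x1F' in \<open>auto simp: st\<close>)
  also have "\<dots> = tr (pt (3/2) (1/2)) (pt (3/2) (3/2)) x1" by (simp add: shp)
  finally have x2: "x2 = tr (pt (3/2) (1/2)) (pt (3/2) (3/2)) x1" .
  have x1a: "tr (pt (3/2) (1/2)) ?a x1 = xa" unfolding x1 xa_def
    by (rule tr_strip_comp[OF PQR(1), of _ 0]) (use xc in \<open>auto simp: st\<close>)
  have x1b: "tr (pt (3/2) (1/2)) ?b x1 = xb"
    unfolding xb_def x1a[symmetric]
    by (rule tr_strip_comp[OF PQR(2), of _ 1, symmetric]) (use x1F' in \<open>auto simp: st\<close>)
  have x2b: "x2 = tr ?b (pt (3/2) (3/2)) xb"
    unfolding x2 x1b[symmetric]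
    by (rule tr_strip_comp[OF PQR(2), of _ 1, symmetric]) (use x1F' in \<open>auto simp: st\<close>)
  have "tr c c' x2 = tr (pt (1/2) (1/2) + (p + q)) (pt 1 (1/2) + (p + q)) x2"
    unfolding cpt
    by (rule tr_translate[OF PQR(1) gauss_ints_add[OF p q], of _ 0, symmetric]) (use x2F in \<open>auto simp: st cpt\<close>)
  also have "\<dots> = tr (pt (3/2) (3/2)) (pt 2 (3/2)) x2" by (simp add: shp shq flip: add.assoc)
  also have "\<dots> = tr ?b (pt 2 (3/2)) xb"
    unfolding x2b by (rule tr_strip_comp[OF PQR(1), of _ 1]) (use xbF in \<open>auto simp: st\<close>)
  finally have rhs: "tr c c' x2 = tr ?b (pt 2 (3/2)) xb" .
  show "tr c' (c' + (q + p)) (tr c c' x) = tr c c' (tr c (c + q) (tr c (c + p) x))"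
    unfolding x1_def[symmetric] x2_def[symmetric] rhs lhs[symmetric] unfolding sums unfolding cpt y_def ..
  show "mark c' (tr c c' x) \<longleftrightarrow> mark c x"
    unfolding cpt by (rule mark_tr[OF PQR(1)]) (use xc in \<open>auto simp: st\<close>)
qed

text \<open>\<open>(r, u, M)\<close> records how the squares of the lattice basis \<open>(v, w)\<close> are glued along \<open>v\<close> and \<open>w\<close>,
  and which squares have a conical singularity in their corner.\<close>

definition sqtyp :: "'b set \<Rightarrow> complex \<Rightarrow> complex \<Rightarrow> ('b \<Rightarrow> 'b) \<times> ('b \<Rightarrow> 'b) \<times> 'b set \<Rightarrow> bool" where
  "sqtyp F v w = (\<lambda>(r, u, M). \<exists>h. bij_betw h F (Fib (ctr v w)) \<and>
     (\<forall>x\<in>F. tr (ctr v w) (ctr v w + v) (h x) = h (r x) \<and> tr (ctr v w) (ctr v w + w) (h x) = h (u x) \<and>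
        (x \<in> M \<longleftrightarrow> mark (ctr v w) (h x))))"

lemma bij_tr:
  assumes "\<And>x. x \<in> A \<Longrightarrow> f x \<in> B" "\<And>x. x \<in> B \<Longrightarrow> g x \<in> A" "\<And>x. x \<in> A \<Longrightarrow> g (f x) = x" "\<And>x. x \<in> B \<Longrightarrow> f (g x) = x"
  shows "bij_betw f A B"
  using assms by (intro bij_betwI[where g = g]) auto

lemma tr_bij_shear:
  fixes p q :: complex and \<sigma> :: real
  assumes p: "p \<in> gauss_ints" and q: "q \<in> gauss_ints" and \<sigma>: "\<sigma> = 1 \<or> \<sigma> = -1" and det: "cross p q = \<sigma>"
  shows "bij_betw (tr ((p + q) / 2) ((p + (q + p)) / 2)) (Fib ((p + q) / 2)) (Fib ((p + (q + p)) / 2))"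
proof -
  let ?c = "(p + q) / 2" and ?c' = "(p + (q + p)) / 2"
  define P where "P = of_real \<sigma> * p"
  have P: "P \<in> gauss_ints" unfolding P_def using \<sigma> p by (intro gauss_ints_of_int) auto
  have "cross P ?c = 1/2" "cross P ?c' = 1/2"
  proof -
    have c: "?c = of_real (1/2) * (p + q)" "?c' = of_real (1/2) * (p + (q + p))" by simp_all
    show "cross P ?c = 1/2" unfolding c P_def cross_simps det using \<sigma> by auto
    show "cross P ?c' = 1/2" unfolding c P_def cross_simps det using \<sigma> by auto
  qed
  then have s: "?c \<in> strip P 0" "?c' \<in> strip P 0" by (auto simp: strip_def)
  show ?thesis
    by (rule bij_tr[where g = "tr ?c' ?c"])
       (simp_all only: tr_strip_Fib[OF P s(1,2)] tr_strip_Fib[OF P s(2,1)] tr_strip_comp[OF P s(1,2,1)]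
          tr_strip_comp[OF P s(2,1,2)] tr_strip_refl[OF P s(1)] tr_strip_refl[OF P s(2)])
qed

lemma sqtyp_Rmove:
  fixes \<sigma> :: real
  assumes bb: "v \<in> gauss_ints" "w \<in> gauss_ints" "\<sigma> = 1 \<or> \<sigma> = -1" "cross v w = \<sigma>" and t: "t \<in> sq_types F"
  shows "sqtyp F v w t \<longleftrightarrow> sqtyp F v (w + v) (Rmove t)"
proof -
  obtain r u M where tt: "t = (r, u, M)" by (cases t)
  have perm: "r permutes F" "u permutes F" using t by (auto simp: tt sq_types_def)
  have rF: "r x \<in> F" if "x \<in> F" for x using perm that by (simp add: permutes_in_image)
  define c c' where "c = ctr v w" "c' = ctr v (w + v)"
  note sf = shear_fibre[OF bb, folded ctr_def, folded c_c'_def]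
  have bij: "bij_betw (tr c c') (Fib c) (Fib c')"
    using tr_bij_shear[OF bb] by (simp add: c_c'_def ctr_def)
  show ?thesis
  proof
    assume "sqtyp F v w t"
    then obtain h where h: "bij_betw h F (Fib c)" "\<And>x. x \<in> F \<Longrightarrow> tr c (c + v) (h x) = h (r x)"
      "\<And>x. x \<in> F \<Longrightarrow> tr c (c + w) (h x) = h (u x)" "\<And>x. x \<in> F \<Longrightarrow> x \<in> M \<longleftrightarrow> mark c (h x)"
      by (auto simp: sqtyp_def tt c_c'_def)
    have hF: "h x \<in> Fib c" if "x \<in> F" for x using h(1) that by (auto simp: bij_betw_def)
    show "sqtyp F v (w + v) (Rmove t)"
      unfolding sqtyp_def tt Rmove_def prod.case c_c'_def[symmetric]
    proof (intro exI[of _ "tr c c' \<circ> h"] conjI ballI)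
      show "bij_betw (tr c c' \<circ> h) F (Fib c')" using h(1) bij by (rule bij_betw_trans)
      fix x assume x: "x \<in> F"
      show "tr c' (c' + v) ((tr c c' \<circ> h) x) = (tr c c' \<circ> h) (r x)"
        using sf(5)[OF hF[OF x]] h(2)[OF x] by simp
      show "tr c' (c' + (w + v)) ((tr c c' \<circ> h) x) = (tr c c' \<circ> h) ((u \<circ> r) x)"
        using sf(6)[OF hF[OF x]] h(2)[OF x] h(3)[OF rF[OF x]] by simp
      show "x \<in> M \<longleftrightarrow> mark c' ((tr c c' \<circ> h) x)" using sf(7)[OF hF[OF x]] h(4)[OF x] by simp
    qed
  next
    assume "sqtyp F v (w + v) (Rmove t)"
    then obtain h' where h': "bij_betw h' F (Fib c')" "\<And>x. x \<in> F \<Longrightarrow> tr c' (c' + v) (h' x) = h' (r x)"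
      "\<And>x. x \<in> F \<Longrightarrow> tr c' (c' + (w + v)) (h' x) = h' (u (r x))" "\<And>x. x \<in> F \<Longrightarrow> x \<in> M \<longleftrightarrow> mark c' (h' x)"
      by (auto simp: sqtyp_def tt c_c'_def Rmove_def)
    define g where "g = inv_into (Fib c) (tr c c')"
    define h where "h = g \<circ> h'"
    have gb: "bij_betw g (Fib c') (Fib c)" unfolding g_def using bij by (rule bij_betw_inv_into)
    have hb: "bij_betw h F (Fib c)" unfolding h_def using h'(1) gb by (rule bij_betw_trans)
    have hF: "h x \<in> Fib c" if "x \<in> F" for x using hb that by (auto simp: bij_betw_def)
    have h'F: "h' x \<in> Fib c'" if "x \<in> F" for x using h'(1) that by (auto simp: bij_betw_def)
    have th: "tr c c' (h x) = h' x" if "x \<in> F" for x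
      unfolding h_def g_def comp_def using bij_betw_inv_into_right[OF bij h'F[OF that]] .
    have inj: "a = b" if "tr c c' a = tr c c' b" "a \<in> Fib c" "b \<in> Fib c" for a b
      using bij that by (auto simp: bij_betw_def inj_on_def)
    have r1: "tr c (c + v) (h x) = h (r x)" if x: "x \<in> F" for x
    proof (rule inj)
      show "tr c c' (tr c (c + v) (h x)) = tr c c' (h (r x))"
        using sf(5)[OF hF[OF x]] th[OF x] th[OF rF[OF x]] h'(2)[OF x] by simp
    qed (use sf(3)[OF hF[OF x]] hF[OF rF[OF x]] in auto)
    have u1: "tr c (c + w) (h x) = h (u x)" if x: "x \<in> F" for x
    proof -
      \<comment> \<open>The hypothesis describes \<open>u\<close> only through
        \<open>u \<circ> r\<close>; every label is of the form \<open>r y\<close>.\<close>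
      obtain y where y: "y \<in> F" "x = r y" using permutes_image[OF perm(1)] x by auto
      have ux: "u x \<in> F" using perm(2) x by (simp add: permutes_in_image)
      show ?thesis
      proof (rule inj)
        show "tr c c' (tr c (c + w) (h x)) = tr c c' (h (u x))"
          using sf(6)[OF hF[OF y(1)]] r1[OF y(1)] th[OF y(1)] th[OF ux] h'(3)[OF y(1)] y(2) by simp
      qed (use sf(4)[OF hF[OF x]] hF[OF ux] in auto)
    qed
    show "sqtyp F v w t"
      unfolding sqtyp_def tt prod.case c_c'_def[symmetric]
      using hb r1 u1 sf(7)[OF hF] th h'(4) by (intro exI[of _ h]) auto
  qed
qed

lemma sqtyp_swap: "sqtyp F v w (r, u, M) \<longleftrightarrow> sqtyp F w v (u, r, M)"
  by (auto simp: sqtyp_def ctr_def add.commute)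

text \<open>The second move is the first one with the two vectors exchanged, at the price of the
  determinant -1.\<close>

lemma sqtyp_moves:
  assumes b: "zbasis v w" and t: "t \<in> sq_types F"
  shows "sqtyp F v w t \<longleftrightarrow> sqtyp F v (w + v) (Rmove t)" "sqtyp F v w t \<longleftrightarrow> sqtyp F (v + w) w (Lmove t)"
proof -
  have bb: "v \<in> gauss_ints" "w \<in> gauss_ints" "cross v w = 1" "cross w v = -1"
    using b cross_commute[of w v] by (auto simp: zbasis_def)
  show "sqtyp F v w t \<longleftrightarrow> sqtyp F v (w + v) (Rmove t)" using sqtyp_Rmove[OF bb(1,2) _ bb(3) t] by simp
  obtain r u M where tt: "t = (r, u, M)" by (cases t)
  have t': "(u, r, M) \<in> sq_types F" using t by (simp add: tt sq_types_def)
  have "sqtyp F v w t \<longleftrightarrow> sqtyp F w (v + w) (Rmove (u, r, M))"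
    unfolding tt sqtyp_swap[of F v w] using sqtyp_Rmove[OF bb(2,1) _ bb(4) t'] by simp
  also have "\<dots> \<longleftrightarrow> sqtyp F (v + w) w (Lmove t)"
    by (simp add: tt Rmove_def Lmove_def sqtyp_swap[of F w])
  finally show "sqtyp F v w t \<longleftrightarrow> sqtyp F (v + w) w (Lmove t)" .
qed

end

section \<open>Saddle connections and multiplicities\<close>

lemma closure_strip_shift:
  assumes "z \<in> closure (strip v k)"
  shows "z + of_real t * v \<in> closure (strip v k)"
  unfolding closure_approachable
proof (intro allI impI)
  fix \<epsilon> :: real assume "0 < \<epsilon>"
  then obtain y where y: "y \<in> strip v k" "dist y z < \<epsilon>" using assms closure_approachable by blast
  have "cross v (y + of_real t * v) = cross v y" by simp
  then have "y + of_real t * v \<in> strip v k" using y(1) unfolding strip_def mem_Collect_eq by simp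
  moreover have "dist (y + of_real t * v) (z + of_real t * v) < \<epsilon>" using y(2) by (simp add: dist_norm)
  ultimately show "\<exists>y\<in>strip v k. dist y (z + of_real t * v) < \<epsilon>" by blast
qed

lemma isCont_eventually_in_open:
  assumes "isCont f t" "open T" "f t \<in> T"
  shows "\<forall>\<^sub>F s in nhds t. f s \<in> T"
proof -
  have "(f \<longlongrightarrow> f t) (nhds t)" using assms(1) by (simp add: isCont_def tendsto_at_iff_tendsto_nhds)
  then show ?thesis using assms(2,3) by (rule topological_tendstoD)
qed

lemma zbasis_nonzero: "zbasis v w \<Longrightarrow> v \<noteq> 0"
  by (auto simp: zbasis_def)

lemma line_in_closure: "v \<noteq> 0 \<Longrightarrow> of_real t * v \<in> closure (strip v 0)"
  by (rule strip_closure) auto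

lemma zbasis_line: "zbasis v w \<Longrightarrow> of_real t * v \<in> gauss_ints \<Longrightarrow> t \<in> \<int>"
  using cross_gauss[of "of_real t * v" w] by (auto simp: zbasis_def)

lemma ctr_strip: 
  assumes "zbasis v w"
  shows "ctr v w + of_real t * v \<in> strip v 0" "ctr v w \<in> strip v 0"
proof -
  have "ctr v w = of_real (1/2) * (v + w)" by (simp add: ctr_def)
  then have c: "cross v (ctr v w) = 1/2" using assms unfolding zbasis_def by (simp only: cross_simps) simp
  then have "cross v (ctr v w + of_real t * v) = 1/2" unfolding cross_simps by simp
  then show "ctr v w + of_real t * v \<in> strip v 0" "ctr v w \<in> strip v 0"
    unfolding strip_def mem_Collect_eq c by auto
qed

section \<open>Marked corners along a strip and developed saddle connections\<close>

context origami begin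

text \<open>By translation invariance each gluing along \<open>v\<close> is the transport over the
  next period of the strip, so iterating it amounts to moving along one lift of the strip.\<close>

lemma transport_power:
  assumes b: "zbasis v w" and l: "islift (closure (strip v 0)) \<psi>"
  shows "(tr (ctr v w) (ctr v w + v) ^^ j) (\<psi> (ctr v w)) = \<psi> (ctr v w + of_nat j * v)"
proof (induction j)
  case (Suc j)
  let ?c = "ctr v w"
  have v: "v \<in> gauss_ints" using b by (simp add: zbasis_def)
  have jv: "of_nat j * v \<in> gauss_ints" using gauss_ints_of_int[OF v, of "real j"] by simp
  have m: "?c \<in> strip v 0" "?c + v \<in> strip v 0" "?c + of_nat j * v \<in> strip v 0" "?c + v + of_nat j * v \<in> strip v 0"
    using ctr_strip[OF b] ctr_strip(1)[OF b, of 1] ctr_strip(1)[OF b, of "real j"] ctr_strip(1)[OF b, of "1 + real j"]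
    by (simp_all add: algebra_simps)
  have "?c + of_nat j * v \<in> closure (strip v 0)" using m(3) closure_subset by blast
  then have "\<psi> (?c + of_nat j * v) \<in> Fib (?c + of_nat j * v)" by (rule islift_Fib[OF l])
  then have F: "\<psi> (?c + of_nat j * v) \<in> Fib ?c" using Fib_translate[OF jv] by simp
  have "(tr ?c (?c + v) ^^ Suc j) (\<psi> ?c) = tr ?c (?c + v) (\<psi> (?c + of_nat j * v))" using Suc by simp
  also have "\<dots> = tr (?c + of_nat j * v) (?c + v + of_nat j * v) (\<psi> (?c + of_nat j * v))"
    using tr_translate[OF v jv m(1,2) F] by simp
  also have "\<dots> = \<psi> (?c + v + of_nat j * v)" using tr_strip[OF v l m(3,4)] .
  finally show ?case by (simp add: algebra_simps)
qed simp

lemma mark_power: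
  assumes b: "zbasis v w" and l: "islift (closure (strip v 0)) \<psi>"
  shows "mark (ctr v w) (\<psi> (ctr v w + of_nat j * v)) \<longleftrightarrow> \<psi> (of_nat j * v) \<in> Sg"
proof -
  have v: "v \<in> gauss_ints" using b by (simp add: zbasis_def)
  have jv: "of_nat j * v \<in> gauss_ints" using gauss_ints_of_int[OF v, of "real j"] by simp
  have "islift (closure (strip v 0)) (\<lambda>z. \<psi> (z + of_nat j * v))"
    by (rule islift_translate[OF l jv]) (use closure_strip_shift[of _ v 0 "real j"] in simp)
  from mark_iff[OF v this ctr_strip(2)[OF b]] show ?thesis by simp
qed

text \<open>A singularity is approached from a strip: its branched coordinate is open, so some point
  close to it lies over the strip near 0. The strip lifted through that point is confined by
  \<open>fibre_nbhd\<close>, so over 0 it can only end at the singularity.\<close>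

lemma exists_mark:
  assumes b: "zbasis v w" and "Sg \<noteq> {}"
  shows "\<exists>x\<in>Fib (ctr v w). mark (ctr v w) x"
proof -
  have v: "v \<in> gauss_ints" using b by (simp add: zbasis_def)
  have v0: "v \<noteq> 0" using zbasis_nonzero[OF b] .
  obtain \<sigma> where \<sigma>: "\<sigma> \<in> Sg" using assms(2) by blast
  have sS: "\<sigma> \<in> S" and e0: "e \<sigma> = E 0" using \<sigma> Sg_sub e_Sg by auto
  have sF: "\<sigma> \<in> Fib 0" using sS e0 by (rule Fib_I)
  obtain A B where AB: "open A" "open B" "\<sigma> \<in> A" "Fib 0 - {\<sigma>} \<subseteq> B" "A \<inter> B = {}"
  proof -
    have "finite (Fib 0 - {\<sigma>})" "\<sigma> \<notin> Fib 0 - {\<sigma>}" using finite_Fib by auto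
    from finite_separation[OF this] show ?thesis using that by metis
  qed
  obtain O1 O2 \<epsilon> where O: "open O1" "open O2" "O1 \<inter> O2 = {}" "\<sigma> \<in> O1" "O1 \<subseteq> A" "0 < \<epsilon>"
    "\<And>x z'. x \<in> S \<Longrightarrow> z' \<in> ball 0 \<epsilon> \<Longrightarrow> e x = E z' \<Longrightarrow> x \<in> O1 \<union> O2"
    using fibre_nbhd[OF sF AB(1,3)] by metis
  obtain U \<Phi> where U: "openin (top_of_set S) U" "\<sigma> \<in> U" "\<Phi> \<sigma> = 0"
      "\<And>y. y \<in> U \<Longrightarrow> e y = E (\<Phi> y)" "\<And>W. openin (top_of_set S) W \<Longrightarrow> W \<subseteq> U \<Longrightarrow> open (\<Phi> ` W)"
    using local_coordinate[OF sS e0] by metis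
  have "openin (top_of_set S) (U \<inter> O1)" using U(1) O(1) by (metis openin_Int_open)
  then have "open (\<Phi> ` (U \<inter> O1))" using U(5) by blast
  moreover have "0 \<in> \<Phi> ` (U \<inter> O1)" using U(2,3) O(4) by force
  ultimately obtain \<delta> where d: "0 < \<delta>" "ball 0 \<delta> \<subseteq> \<Phi> ` (U \<inter> O1)" by (rule openE)
  have z0: "0 \<in> closure (strip v 0)" using line_in_closure[OF v0, of 0] by simp
  have "0 < min \<delta> \<epsilon>" using d(1) O(6) by simp
  then obtain z where z: "z \<in> strip v 0" "dist z 0 < min \<delta> \<epsilon>" using z0 closure_approachable by blast
  then have "z \<in> \<Phi> ` (U \<inter> O1)" using d(2) by auto
  then obtain y where y: "y \<in> U" "y \<in> O1" "\<Phi> y = z" by blast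
  have yF: "y \<in> Fib z" using y U(4) openin_imp_subset[OF U(1)] by (auto simp: Fib_def)
  obtain \<psi> where \<psi>: "islift (closure (strip v 0)) \<psi>" "\<psi> z = y" by (rule strip_lift[OF v z(1) yF])
  let ?C = "closure (strip v 0) \<inter> ball 0 \<epsilon>"
  have lC: "islift ?C \<psi>" using \<psi>(1) islift_subset by blast
  have "connected (\<psi> ` ?C)"
  proof (rule connected_continuous_image)
    show "continuous_on ?C \<psi>" using lC by (simp add: islift_def)
    show "connected ?C" by (intro convex_connected convex_Int convex_closure convex_strip convex_ball)
  qed
  moreover have "\<psi> ` ?C \<subseteq> O1 \<union> O2"
  proof (rule image_subsetI)
    fix s assume "s \<in> ?C"
    then show "\<psi> s \<in> O1 \<union> O2" using O(7)[of "\<psi> s" s] islift_Fib[OF lC, of s] by (simp add: Fib_def)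
  qed
  ultimately have "O1 \<inter> \<psi> ` ?C = {} \<or> O2 \<inter> \<psi> ` ?C = {}"
    using connectedD[OF _ O(1,2), of "\<psi> ` ?C"] O(3) by blast
  moreover have "\<psi> z \<in> O1 \<inter> \<psi> ` ?C" using y(2) \<psi>(2) z closure_subset by force
  ultimately have "O2 \<inter> \<psi> ` ?C = {}" by blast
  moreover have "\<psi> 0 \<in> \<psi> ` ?C" using z0 O(6) by (intro imageI) simp
  ultimately have "\<psi> 0 \<in> O1" using \<open>\<psi> ` ?C \<subseteq> O1 \<union> O2\<close> by blast
  moreover have "\<psi> 0 \<in> Fib 0" using islift_Fib[OF \<psi>(1) z0] .
  ultimately have "\<psi> 0 = \<sigma>" using AB(4,5) O(5) by blast
  then have "\<psi> 0 \<in> Sg" using \<sigma> by simp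
  then have "mark (ctr v w) (\<psi> (ctr v w))" using mark_iff[OF v \<psi>(1) ctr_strip(2)[OF b]] by simp
  moreover have "\<psi> (ctr v w) \<in> Fib (ctr v w)"
    using islift_Fib[OF \<psi>(1)] ctr_strip(2)[OF b] closure_subset by blast
  ultimately show ?thesis by blast
qed

definition straight :: "(real \<Rightarrow> 'a) \<Rightarrow> complex \<Rightarrow> bool" where
  "straight \<gamma> u \<longleftrightarrow> path \<gamma> \<and> path_image \<gamma> \<subseteq> S \<and> \<gamma> 0 \<in> Sg \<and> \<gamma> 1 \<in> Sg \<and> (\<forall>t\<in>{0<..<1}. \<gamma> t \<notin> Sg) \<and>
     (\<forall>t\<in>{0<..<1}. \<exists>(U, f)\<in>charts (flat X). \<gamma> t \<in> U \<and>
        (\<forall>\<^sub>F s in nhds t. \<gamma> s \<in> U \<and> f (\<gamma> s) = f (\<gamma> t) + of_real (s - t) * u))"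

lemma saddle_iff: "saddle_connection (flat X) \<gamma> \<longleftrightarrow> (\<exists>u. u \<noteq> 0 \<and> straight \<gamma> u)"
  unfolding saddle_connection_def straight_def by auto

text \<open>Charts enter only through increments, so the covering sends a path developed by any
  \<open>g\<close> to \<open>E\<close> of \<open>g\<close> up to a constant. This serves both
  velocities and periods.\<close>

lemma developed_locally:
  fixes g :: "real \<Rightarrow> complex"
  assumes path: "continuous_on {0..1} \<gamma>" and t: "t \<in> {0<..<1}"
    and U: "(U, f) \<in> charts (flat X)" "\<gamma> t \<in> U"
    and ev: "\<forall>\<^sub>F s in nhds t. \<gamma> s \<in> U \<and> f (\<gamma> s) = f (\<gamma> t) + (g s - g t)"
  obtains c where "\<forall>\<^sub>F s in nhds t. e (\<gamma> s) = E (g s + c)"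
proof -
  obtain V c where V: "openin (top_of_set S) V" "\<gamma> t \<in> V" "V \<subseteq> U" "\<And>y. y \<in> V \<Longrightarrow> e y = E (f y + c)"
    using chart_local[OF U] by metis
  obtain T where T: "open T" "V = S \<inter> T" using V(1) by (auto simp: openin_open)
  have "continuous_on {0<..<1} \<gamma>" using path by (rule continuous_on_subset) auto
  then have "isCont \<gamma> t" using t by (simp add: continuous_on_eq_continuous_at)
  then have "\<forall>\<^sub>F s in nhds t. \<gamma> s \<in> T"
    using T V(2) by (intro isCont_eventually_in_open) auto
  then have "\<forall>\<^sub>F s in nhds t. e (\<gamma> s) = E (g s + (f (\<gamma> t) - g t + c))"
    using ev
  proof eventually_elim
    case (elim s)
    have "U \<subseteq> S" using U(1) by (auto simp: charts_iff dest: openin_imp_subset)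
    then have "\<gamma> s \<in> V" using elim T(2) by blast
    then have "e (\<gamma> s) = E (f (\<gamma> s) + c)" by (rule V(4))
    then show ?case using elim by (simp add: algebra_simps)
  qed
  then show ?thesis by (rule that)
qed

lemma straight_locally:
  assumes "straight \<gamma> u" "t \<in> {0<..<1}"
  obtains c where "\<forall>\<^sub>F s in nhds t. e (\<gamma> s) = E (of_real s * u + c)"
proof -
  obtain U f where U: "(U, f) \<in> charts (flat X)" "\<gamma> t \<in> U"
    "\<forall>\<^sub>F s in nhds t. \<gamma> s \<in> U \<and> f (\<gamma> s) = f (\<gamma> t) + of_real (s - t) * u"
    using assms unfolding straight_def by blast
  have c: "continuous_on {0..1} \<gamma>" using assms(1) by (simp add: straight_def path_def)
  have ev: "\<forall>\<^sub>F s in nhds t. \<gamma> s \<in> U \<and> f (\<gamma> s) = f (\<gamma> t) + (of_real s * u - of_real t * u)"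
    using U(3) by (rule eventually_mono) (auto simp: algebra_simps)
  show ?thesis using developed_locally[where g = "\<lambda>s. of_real s * u", OF c assms(2) U(1,2) ev] that by blast
qed

lemma closure_unit_open: "closure {0<..<1::real} = {0..1}"
  by (rule closure_greaterThanLessThan) simp

text \<open>The local constants agree modulo the lattice by connectedness, the endpoints follow by
  continuity, and the start over 0 makes the constant a Gaussian integer.\<close>

lemma straight_E:
  assumes st: "straight \<gamma> u" and t: "t \<in> {0..1}"
  shows "e (\<gamma> t) = E (of_real t * u)"
proof -
  have cont: "continuous_on {0..1} \<gamma>" and im: "\<gamma> ` {0..1} \<subseteq> S"
    using st by (auto simp: straight_def path_def path_image_def)
  have half: "1/2 \<in> {0<..<1::real}" by simp
  obtain c0 where c0: "\<forall>\<^sub>F s in nhds (1/2). e (\<gamma> s) = E (of_real s * u + c0)"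
    by (rule straight_locally[OF st half])
  have on: "e (\<gamma> t) = E (of_real t * u + c0)" if t: "t \<in> {0<..<1}" for t
  proof (rule connected_induction_simple[OF _ half t, where P = "\<lambda>t. e (\<gamma> t) = E (of_real t * u + c0)"])
    show "connected {0<..<1::real}" by simp
    show "e (\<gamma> (1/2)) = E (of_real (1/2) * u + c0)" using eventually_nhds_x_imp_x[OF c0] .
    fix a :: real assume a: "a \<in> {0<..<1}"
    obtain c where "\<forall>\<^sub>F s in nhds a. e (\<gamma> s) = E (of_real s * u + c)" by (rule straight_locally[OF st a])
    then obtain T where T: "open T" "a \<in> T" "\<And>s. s \<in> T \<Longrightarrow> e (\<gamma> s) = E (of_real s * u + c)"
      by (auto simp: eventually_nhds)
    show "\<exists>T. openin (top_of_set {0<..<1}) T \<and> a \<in> T \<and>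
        (\<forall>x\<in>T. \<forall>y\<in>T. e (\<gamma> x) = E (of_real x * u + c0) \<longrightarrow> e (\<gamma> y) = E (of_real y * u + c0))"
    proof (intro exI[of _ "{0<..<1} \<inter> T"] conjI ballI impI)
      fix x y assume xy: "x \<in> {0<..<1} \<inter> T" "y \<in> {0<..<1} \<inter> T" "e (\<gamma> x) = E (of_real x * u + c0)"
      then have "E (of_real x * u + c) = E (of_real x * u + c0)" using T(3)[of x] by simp
      then have "c - c0 \<in> gauss_ints" by (simp add: E_eq_iff)
      then have "E (of_real y * u + c) = E (of_real y * u + c0)" by (simp add: E_eq_iff)
      then show "e (\<gamma> y) = E (of_real y * u + c0)" using T(3)[of y] xy by simp
    qed (use a T in auto)
  qed
  have ce: "continuous_on {0..1} (\<lambda>t. e (\<gamma> t) - E (of_real t * u + c0))"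
    using im by (intro continuous_on_diff continuous_on_compose2[OF cont_e cont]
      continuous_on_compose2[OF continuous_on_E[of UNIV]] continuous_intros) auto
  have all: "e (\<gamma> t) = E (of_real t * u + c0)" if t: "t \<in> {0..1}" for t
  proof -
    have "e (\<gamma> t) - E (of_real t * u + c0) = 0"
      by (rule continuous_constant_on_closure[of "{0<..<1}" "\<lambda>t. e (\<gamma> t) - E (of_real t * u + c0)"])
         (use on t in \<open>auto simp: closure_unit_open ce\<close>)
    then show ?thesis by simp
  qed
  have "E 0 = E c0" using all[of 0] st e_Sg[of "\<gamma> 0"] by (simp add: straight_def)
  then have "0 - c0 \<in> gauss_ints" by (simp only: E_eq_iff)
  then have "c0 \<in> gauss_ints" using gauss_ints_minus[of "0 - c0"] by simp
  then show ?thesis using all[OF t] E_add_gauss(1) by simp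
qed

lemma straight_has_period: "straight \<gamma> u \<Longrightarrow> has_period (flat X) \<gamma> u"
  unfolding has_period_def
proof (intro exI[of _ "\<lambda>s. of_real s * u"] conjI ballI)
  assume st: "straight \<gamma> u"
  fix t :: real assume t: "t \<in> {0<..<1}"
  obtain U f where U: "(U, f) \<in> charts (flat X)" "\<gamma> t \<in> U"
    "\<forall>\<^sub>F s in nhds t. \<gamma> s \<in> U \<and> f (\<gamma> s) = f (\<gamma> t) + of_real (s - t) * u"
    using st t unfolding straight_def by blast
  have "\<forall>\<^sub>F s in nhds t. \<gamma> s \<in> U \<and> of_real s * u - of_real t * u = f (\<gamma> s) - f (\<gamma> t)"
    using U(3) by (rule eventually_mono) (auto simp: algebra_simps)
  then show "\<exists>(U, f)\<in>charts (flat X). \<gamma> t \<in> U \<and>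
      (\<forall>\<^sub>F s in nhds t. \<gamma> s \<in> U \<and> of_real s * u - of_real t * u = f (\<gamma> s) - f (\<gamma> t))"
    using U(1,2) by blast
qed (auto intro!: continuous_intros)

text \<open>The charts witnessing the velocity and the period may differ. Through the covering,
  \<open>g\<close> minus the linear development is locally constant modulo the lattice, hence
  constant.\<close>

lemma period_unique:
  assumes st: "straight \<gamma> u" and p: "has_period (flat X) \<gamma> v"
  shows "v = u"
proof -
  obtain g where g: "continuous_on {0..1} g" "g 1 - g 0 = v"
    "\<And>t. t \<in> {0<..<1} \<Longrightarrow> \<exists>(U, f)\<in>charts (flat X). \<gamma> t \<in> U \<and>
       (\<forall>\<^sub>F s in nhds t. \<gamma> s \<in> U \<and> g s - g t = f (\<gamma> s) - f (\<gamma> t))"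
    using p unfolding has_period_def by blast
  have cont: "continuous_on {0..1} \<gamma>" using st by (simp add: straight_def path_def)
  define h where "h s = g s - of_real s * u" for s
  have ch: "continuous_on {0..1} h" unfolding h_def by (intro continuous_intros g(1))
  have loc: "\<forall>\<^sub>F s in nhds t. h s = h t" if t: "t \<in> {0<..<1}" for t
  proof -
    obtain U f where U: "(U, f) \<in> charts (flat X)" "\<gamma> t \<in> U"
      "\<forall>\<^sub>F s in nhds t. \<gamma> s \<in> U \<and> g s - g t = f (\<gamma> s) - f (\<gamma> t)" using g(3)[OF t] by blast
    have "\<forall>\<^sub>F s in nhds t. \<gamma> s \<in> U \<and> f (\<gamma> s) = f (\<gamma> t) + (g s - g t)"
      using U(3) by (rule eventually_mono) auto
    then obtain c where c: "\<forall>\<^sub>F s in nhds t. e (\<gamma> s) = E (g s + c)"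
      using developed_locally[OF cont t U(1,2)] by blast
    obtain c' where c': "\<forall>\<^sub>F s in nhds t. e (\<gamma> s) = E (of_real s * u + c')"
      by (rule straight_locally[OF st t])
    have d: "\<forall>\<^sub>F s in nhds t. h s + (c - c') \<in> gauss_ints"
      using c c'
    proof eventually_elim
      case (elim s)
      then have "E (g s + c) = E (of_real s * u + c')" by simp
      then show ?case by (simp add: E_eq_iff h_def algebra_simps)
    qed
    have dt: "h t + (c - c') \<in> gauss_ints" using eventually_nhds_x_imp_x[OF d] .
    have "continuous_on {0<..<1} h" using ch by (rule continuous_on_subset) auto
    then have "isCont h t" using t by (simp add: continuous_on_eq_continuous_at)
    then have "(h \<longlongrightarrow> h t) (nhds t)"
      by (simp add: isCont_def tendsto_at_iff_tendsto_nhds)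
    then have "\<forall>\<^sub>F s in nhds t. dist (h s) (h t) < 1" by (rule tendstoD) simp
    with d show ?thesis
    proof eventually_elim
      case (elim s)
      have "h s + (c - c') - (h t + (c - c')) \<in> gauss_ints" using elim(1) dt by (rule gauss_ints_diff)
      then have "h s - h t \<in> gauss_ints" by (simp add: algebra_simps)
      then have "h s - h t = 0" using elim(2) by (intro gauss_ints_small) (auto simp: dist_norm)
      then show ?case by simp
    qed
  qed
  have half: "1/2 \<in> {0<..<1::real}" by simp
  have on: "h t = h (1/2)" if t: "t \<in> {0<..<1}" for t
  proof (rule connected_induction_simple[OF _ half t, where P = "\<lambda>t. h t = h (1/2)"])
    show "connected {0<..<1::real}" by simp
    fix a :: real assume a: "a \<in> {0<..<1}"
    obtain T where T: "open T" "a \<in> T" "\<And>s. s \<in> T \<Longrightarrow> h s = h a"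
      using loc[OF a] by (auto simp: eventually_nhds)
    show "\<exists>T. openin (top_of_set {0<..<1}) T \<and> a \<in> T \<and> (\<forall>x\<in>T. \<forall>y\<in>T. h x = h (1/2) \<longrightarrow> h y = h (1/2))"
    proof (intro exI[of _ "{0<..<1} \<inter> T"] conjI ballI impI)
      fix x y assume "x \<in> {0<..<1} \<inter> T" "y \<in> {0<..<1} \<inter> T" "h x = h (1/2)"
      then show "h y = h (1/2)" using T(3)[of x] T(3)[of y] by simp
    qed (use a T in auto)
  qed simp
  have all: "h t = h (1/2)" if "t \<in> {0..1}" for t
    using continuous_constant_on_closure[of "{0<..<1}" h "h (1/2)" t] ch on that
    unfolding closure_unit_open by blast
  have "h 0 = h 1" using all[of 0] all[of 1] by simp
  then show ?thesis using g(2) by (simp add: h_def algebra_simps)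
qed

lemma Hol_iff: "v \<in> Hol (flat X) \<longleftrightarrow> v \<noteq> 0 \<and> (\<exists>\<gamma>. straight \<gamma> v)"
proof
  assume "v \<in> Hol (flat X)"
  then obtain \<gamma> u where "u \<noteq> 0" "straight \<gamma> u" "has_period (flat X) \<gamma> v"
    unfolding Hol_def saddle_iff by blast
  then show "v \<noteq> 0 \<and> (\<exists>\<gamma>. straight \<gamma> v)" using period_unique by blast
next
  assume "v \<noteq> 0 \<and> (\<exists>\<gamma>. straight \<gamma> v)"
  then show "v \<in> Hol (flat X)" unfolding Hol_def saddle_iff using straight_has_period by blast
qed

text \<open>Lattice points on the line spanned by \<open>v\<close> are integer multiples of
  \<open>v\<close>, so singularities inside the segment could only lie there, where
  \<open>inner\<close> excludes them. At regular points over the lattice a local coordinate is still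
  a translation chart and develops the edge linearly.\<close>

lemma lift_straight:
  assumes b: "zbasis v w" and l: "islift (closure (strip v 0)) \<psi>" and m: "1 \<le> m"
    and ends: "\<psi> 0 \<in> Sg" "\<psi> (of_nat m * v) \<in> Sg"
    and inner: "\<And>j. 0 < j \<Longrightarrow> j < m \<Longrightarrow> \<psi> (of_nat j * v) \<notin> Sg"
  shows "straight (\<lambda>t. \<psi> (of_real (t * real m) * v)) (of_nat m * v)"
proof -
  define \<gamma> where "\<gamma> t = \<psi> (of_real (t * real m) * v)" for t
  have v0: "v \<noteq> 0" using zbasis_nonzero[OF b] .
  have lc: "continuous_on (closure (strip v 0)) \<psi>" using l by (simp add: islift_def)
  have cont: "continuous_on UNIV \<gamma>" unfolding \<gamma>_def
  proof (rule continuous_on_compose2[OF lc])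
    show "continuous_on UNIV (\<lambda>t. of_real (t * real m) * v)" by (intro continuous_intros)
    show "(\<lambda>t. of_real (t * real m) * v) ` UNIV \<subseteq> closure (strip v 0)"
      by (rule image_subsetI) (rule line_in_closure[OF v0])
  qed
  have gF: "\<gamma> t \<in> Fib (of_real (t * real m) * v)" for t
    unfolding \<gamma>_def by (rule islift_Fib[OF l line_in_closure[OF v0]])
  have int: "\<gamma> t \<notin> Sg" if t: "t \<in> {0<..<1}" for t
  proof (cases "t * real m \<in> \<int>")
    case True
    then obtain k :: int where k: "t * real m = k" by (auto elim: Ints_cases)
    have "0 < t * real m" using t m by simp
    moreover have "t * real m < 1 * real m" using t m by (intro mult_strict_right_mono) auto
    ultimately have "0 < k" "k < int m" using k by auto
    then have "0 < nat k" "nat k < m" "of_real (t * real m) = (of_nat (nat k) :: complex)" using k by auto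
    then show ?thesis using inner[of "nat k"] by (simp add: \<gamma>_def)
  next
    case False
    then have "of_real (t * real m) * v \<notin> gauss_ints" using zbasis_line[OF b] by blast
    then show ?thesis using Fib_not_Sg gF by blast
  qed
  have dev: "\<exists>(U, f)\<in>charts (flat X). \<gamma> t \<in> U \<and>
        (\<forall>\<^sub>F s in nhds t. \<gamma> s \<in> U \<and> f (\<gamma> s) = f (\<gamma> t) + of_real (s - t) * (of_nat m * v))"
    if t: "t \<in> {0<..<1}" for t
  proof -
    let ?z = "of_real (t * real m) * v"
    obtain U \<Phi> where U: "openin (top_of_set S) U" "\<gamma> t \<in> U" "\<Phi> (\<gamma> t) = ?z"
      "\<And>y. y \<in> U \<Longrightarrow> e y = E (\<Phi> y)" "\<And>y. y \<in> U \<Longrightarrow> cmod (\<Phi> y - ?z) < 1/2" "(U, \<Phi>) \<in> charts (flat X)"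
      using local_coordinate[OF Fib_D[OF gF[of t]]] int[OF t] by metis
    obtain T where T: "open T" "U = S \<inter> T" using U(1) by (auto simp: openin_open)
    have gT: "\<forall>\<^sub>F s in nhds t. \<gamma> s \<in> T"
    proof -
      have "isCont \<gamma> t" using cont by (simp add: continuous_on_eq_continuous_at)
      then show ?thesis using T U(2) by (intro isCont_eventually_in_open) auto
    qed
    have near: "\<forall>\<^sub>F s in nhds t. dist (of_real (s * real m) * v) ?z < 1/2"
    proof -
      have "((\<lambda>s. of_real (s * real m) * v) \<longlongrightarrow> ?z) (nhds t)"
        by (intro tendsto_intros) (simp add: filterlim_ident)
      then show ?thesis by (rule tendstoD) simp
    qed
    have "\<forall>\<^sub>F s in nhds t. \<gamma> s \<in> U \<and> \<Phi> (\<gamma> s) = \<Phi> (\<gamma> t) + of_real (s - t) * (of_nat m * v)"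
      using gT near
    proof eventually_elim
      case (elim s)
      have sU: "\<gamma> s \<in> U" using elim(1) T(2) gF[of s] by (auto simp: Fib_def)
      have "E (\<Phi> (\<gamma> s)) = E (of_real (s * real m) * v)" using U(4)[OF sU] gF[of s] by (simp add: Fib_def)
      then have "\<Phi> (\<gamma> s) = of_real (s * real m) * v"
        using U(5)[OF sU] elim(2) by (intro E_inj_near[of _ _ ?z]) (auto simp: dist_norm)
      then show ?case using sU U(3) by (simp add: algebra_simps)
    qed
    then show ?thesis using U(2,6) by blast
  qed
  show ?thesis
    unfolding straight_def \<gamma>_def[symmetric]
  proof (intro conjI ballI)
    show "path \<gamma>" using cont by (auto simp: path_def intro: continuous_on_subset)
    show "path_image \<gamma> \<subseteq> S" using gF by (auto simp: path_image_def Fib_def)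
    show "\<gamma> 0 \<in> Sg" "\<gamma> 1 \<in> Sg" using ends by (simp_all add: \<gamma>_def)
  qed (use int dev in auto)
qed

text \<open>A saddle connection is part of the edge of a developed strip. Its midpoint is regular,
  so a local lift there leads into the strip; the strip lifted from that point has the saddle
  connection on its boundary by uniqueness of lifts.\<close>

lemma straight_lift:
  assumes b: "zbasis v w" and st: "straight \<gamma> (of_int k * v)"
  obtains \<psi> where "islift (closure (strip v 0)) \<psi>" "\<And>t. t \<in> {0..1} \<Longrightarrow> \<psi> (of_real t * (of_int k * v)) = \<gamma> t"
proof -
  have v: "v \<in> gauss_ints" using b by (simp add: zbasis_def)
  have v0: "v \<noteq> 0" using zbasis_nonzero[OF b] .
  let ?u = "of_int k * v"
  have uc: "of_real t * ?u \<in> closure (strip v 0)" for t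
    using line_in_closure[OF v0, of "t * real_of_int k"] by (simp add: mult.assoc)
  have cont: "continuous_on {0..1} \<gamma>" and im: "\<gamma> ` {0..1} \<subseteq> S"
    using st by (auto simp: straight_def path_def path_image_def)
  let ?z = "of_real (1/2) * ?u"
  have xF: "\<gamma> (1/2) \<in> Fib ?z" "\<gamma> (1/2) \<notin> Sg"
    using straight_E[OF st, of "1/2"] im st by (auto simp: Fib_def straight_def)
  obtain \<delta> \<theta> where th: "0 < \<delta>" "islift (ball ?z \<delta>) \<theta>" "\<theta> ?z = \<gamma> (1/2)"
    using local_lift[OF xF] by metis
  obtain z where z: "z \<in> strip v 0" "dist z ?z < \<delta>" using uc[of "1/2"] th(1) closure_approachable by blast
  have zb: "z \<in> ball ?z \<delta>" using z(2) by (simp add: dist_commute)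
  obtain \<psi> where \<psi>: "islift (closure (strip v 0)) \<psi>" "\<psi> z = \<theta> z"
    by (rule strip_lift[OF v z(1) islift_Fib[OF th(2) zb]])
  have agree: "\<psi> ?z = \<theta> ?z"
  proof (rule islift_unique_closure[where D = "strip v 0 \<inter> ball ?z \<delta>" and A = "closure (strip v 0) \<inter> ball ?z \<delta>" and w = z])
    show "connected (strip v 0 \<inter> ball ?z \<delta>)" by (intro convex_connected convex_Int convex_strip convex_ball)
    show "strip v 0 \<inter> ball ?z \<delta> \<inter> gauss_ints = {}" using strip_free[OF v] by blast
    show "strip v 0 \<inter> ball ?z \<delta> \<subseteq> closure (strip v 0) \<inter> ball ?z \<delta>" using closure_subset by blast
    show "closure (strip v 0) \<inter> ball ?z \<delta> \<subseteq> closure (strip v 0 \<inter> ball ?z \<delta>)"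
      using open_Int_closure_subset[of "ball ?z \<delta>" "strip v 0"] by (simp add: Int_commute)
    show "islift (closure (strip v 0) \<inter> ball ?z \<delta>) \<psi>" using \<psi>(1) islift_subset by blast
    show "islift (closure (strip v 0) \<inter> ball ?z \<delta>) \<theta>" using th(2) islift_subset by blast
    show "z \<in> strip v 0 \<inter> ball ?z \<delta>" using z(1) zb by blast
    show "\<psi> z = \<theta> z" by (rule \<psi>(2))
    show "?z \<in> closure (strip v 0) \<inter> ball ?z \<delta>" using uc[of "1/2"] th(1) by simp
  qed
  define b' where "b' t = \<psi> (of_real t * ?u)" for t
  have lc: "continuous_on (closure (strip v 0)) \<psi>" using \<psi>(1) by (simp add: islift_def)
  have cb: "continuous_on {0..1} b'" unfolding b'_def
  proof (rule continuous_on_compose2[OF lc])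
    show "continuous_on {0..1} (\<lambda>t. of_real t * ?u)" by (intro continuous_intros)
    show "(\<lambda>t. of_real t * ?u) ` {0..1} \<subseteq> closure (strip v 0)" by (rule image_subsetI) (rule uc)
  qed
  have bF: "b' t \<in> Fib (of_real t * ?u)" for t unfolding b'_def by (rule islift_Fib[OF \<psi>(1) uc])
  have on: "\<gamma> t = b' t" if t: "t \<in> {0<..<1}" for t
  proof (rule unique_lift[where a = \<gamma> and b = b' and C = "{0<..<1}" and ?t0.0 = "1/2"])
    show "continuous_on {0<..<1} \<gamma>" "continuous_on {0<..<1} b'"
      using cont cb by (auto intro: continuous_on_subset)
    show "\<gamma> ` {0<..<1} \<subseteq> S" using im by auto
    show "b' ` {0<..<1} \<subseteq> S" using bF by (auto simp: Fib_def)
    show "e (\<gamma> t) = e (b' t)" if "t \<in> {0<..<1}" for t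
      using straight_E[OF st, of t] bF[of t] that by (simp add: Fib_def)
    show "\<gamma> t \<notin> Sg" if "t \<in> {0<..<1}" for t using st that by (simp add: straight_def)
    show "\<gamma> (1/2) = b' (1/2)" using agree th(3) by (simp add: b'_def)
  qed (use t in auto)
  have all: "\<gamma> t = b' t" if t: "t \<in> {0..1}" for t
  proof (rule ccontr)
    assume ne: "\<gamma> t \<noteq> b' t"
    obtain A B where AB: "open A" "open B" "\<gamma> t \<in> A" "b' t \<in> B" "A \<inter> B = {}" using hausdorff[OF ne] by blast
    obtain T where T: "open T" "t \<in> T" "\<And>y. y \<in> {0..1} \<Longrightarrow> y \<in> T \<Longrightarrow> \<gamma> y \<in> A"
      using cont t AB unfolding continuous_on_topological by meson
    obtain T' where T': "open T'" "t \<in> T'" "\<And>y. y \<in> {0..1} \<Longrightarrow> y \<in> T' \<Longrightarrow> b' y \<in> B"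
      using cb t AB unfolding continuous_on_topological by meson
    have "t \<in> closure {0<..<1}" using t by (simp add: closure_unit_open)
    moreover have "open (T \<inter> T')" "t \<in> T \<inter> T'" using T T' by auto
    ultimately have "{0<..<1} \<inter> (T \<inter> T') \<noteq> {}" by (meson closure_iff_nhds_not_empty subset_refl)
    then obtain y where y: "y \<in> {0<..<1}" "y \<in> T" "y \<in> T'" by blast
    then have "\<gamma> y \<in> A" "b' y \<in> B" using T(3)[of y] T'(3)[of y] by auto
    then show False using on[OF y(1)] AB(5) by auto
  qed
  show ?thesis by (rule that[OF \<psi>(1)]) (use all in \<open>simp add: b'_def\<close>)
qed

end

text \<open>The shortest passage along \<open>v\<close> between marked squares. As the minimum is
  taken over all marked squares, no mark can lie in between.\<close>

definition type_mult :: "('b \<Rightarrow> 'b) \<times> ('b \<Rightarrow> 'b) \<times> 'b set \<Rightarrow> nat" where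
  "type_mult = (\<lambda>(r, u, M). LEAST m. 1 \<le> m \<and> (\<exists>x\<in>M. (r ^^ m) x \<in> M))"

section \<open>Multiplicities read off from types\<close>

context origami begin

lemma type_marks:
  assumes b: "zbasis v w" and t: "sqtyp F v w (r, u, M)" and r: "r permutes F"
  obtains h where "bij_betw h F (Fib (ctr v w))"
    "\<And>x \<psi> j. x \<in> F \<Longrightarrow> islift (closure (strip v 0)) \<psi> \<Longrightarrow> \<psi> (ctr v w) = h x \<Longrightarrow>
        (r ^^ j) x \<in> M \<longleftrightarrow> \<psi> (of_nat j * v) \<in> Sg"
proof -
  let ?c = "ctr v w"
  obtain h where h: "bij_betw h F (Fib ?c)" "\<And>x. x \<in> F \<Longrightarrow> tr ?c (?c + v) (h x) = h (r x)"
    "\<And>x. x \<in> F \<Longrightarrow> x \<in> M \<longleftrightarrow> mark ?c (h x)"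
    using t unfolding sqtyp_def prod.case by blast
  have rj: "(r ^^ j) x \<in> F \<and> (tr ?c (?c + v) ^^ j) (h x) = h ((r ^^ j) x)" if "x \<in> F" for x j
    using that h(2) r by (induction j) (auto simp: permutes_in_image)
  show ?thesis
  proof (rule that[OF h(1)])
    fix x \<psi> j assume x: "x \<in> F" and l: "islift (closure (strip v 0)) \<psi>" and hx: "\<psi> ?c = h x"
    have "\<psi> (?c + of_nat j * v) = h ((r ^^ j) x)" using transport_power[OF b l, of j] rj[OF x, of j] hx by simp
    then show "(r ^^ j) x \<in> M \<longleftrightarrow> \<psi> (of_nat j * v) \<in> Sg"
      using mark_power[OF b l, of j] h(3) rj[OF x, of j] by simp
  qed
qed

text \<open>On the edge of a developed strip the marks of the iterates of \<open>r\<close> are the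
  singularities at the multiples of \<open>v\<close>. A shortest passage between marks gives a
  saddle connection, and every period \<open>k * v\<close> gives a passage of length
  \<open>|k|\<close>. Passages exist since some square is marked and its orbit under
  \<open>r\<close> returns.\<close>

lemma type_mult_props:
  assumes b: "zbasis v w" and tt: "(r, u, M) \<in> sq_types F" and F: "finite F" and t: "sqtyp F v w (r, u, M)" and ne: "Sg \<noteq> {}"
  shows "1 \<le> type_mult (r, u, M)" "of_nat (type_mult (r, u, M)) * v \<in> Hol (flat X)"
    "of_int k * v \<in> Hol (flat X) \<Longrightarrow> type_mult (r, u, M) \<le> nat \<bar>k\<bar>"
proof -
  let ?c = "ctr v w"
  have v: "v \<in> gauss_ints" using b by (simp add: zbasis_def)
  have v0: "v \<noteq> 0" using zbasis_nonzero[OF b] .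
  have r: "r permutes F" and M: "M \<subseteq> F" using tt by (auto simp: sq_types_def)
  obtain h where h: "bij_betw h F (Fib ?c)"
    "\<And>x \<psi> j. x \<in> F \<Longrightarrow> islift (closure (strip v 0)) \<psi> \<Longrightarrow> \<psi> ?c = h x \<Longrightarrow>
        (r ^^ j) x \<in> M \<longleftrightarrow> \<psi> (of_nat j * v) \<in> Sg"
    using type_marks[OF b t r] by metis
  have lift: "\<exists>\<psi>. islift (closure (strip v 0)) \<psi> \<and> \<psi> ?c = h x" if "x \<in> F" for x
  proof -
    have "h x \<in> Fib ?c" using h(1) that by (auto simp: bij_betw_def)
    then show ?thesis using strip_lift[OF v ctr_strip(2)[OF b]] by metis
  qed
  define m where "m = type_mult (r, u, M)"
  have m_eq: "m = (LEAST m. 1 \<le> m \<and> (\<exists>x\<in>M. (r ^^ m) x \<in> M))" by (simp add: m_def type_mult_def)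
  have "\<exists>m. 1 \<le> m \<and> (\<exists>x\<in>M. (r ^^ m) x \<in> M)"
  proof -
    obtain y where y: "y \<in> Fib ?c" "mark ?c y" using exists_mark[OF b ne] by blast
    have "y \<in> h ` F" using bij_betw_imp_surj_on[OF h(1)] y(1) by simp
    then obtain x where x: "x \<in> F" "h x = y" by (elim imageE) simp
    obtain \<psi> where \<psi>: "islift (closure (strip v 0)) \<psi>" "\<psi> ?c = h x" using lift[OF x(1)] by blast
    have "\<psi> 0 \<in> Sg" using mark_iff[OF v \<psi>(1) ctr_strip(2)[OF b]] \<psi>(2) x(2) y(2) by simp
    then have xM: "x \<in> M" using h(2)[OF x(1) \<psi>, of 0] by simp
    obtain n where "0 < n" "(r ^^ n) x = x"
      using funpow_return[OF F permutes_imp_bij[OF r] x(1)] by blast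
    then have "1 \<le> n" "(r ^^ n) x \<in> M" using xM by simp_all
    then show ?thesis using xM by blast
  qed
  from LeastI_ex[OF this] have m: "1 \<le> m" "\<exists>x\<in>M. (r ^^ m) x \<in> M" by (auto simp: m_eq)
  have min: "m \<le> j" if "1 \<le> j" "x \<in> M" "(r ^^ j) x \<in> M" for j x
    unfolding m_eq using that by (intro Least_le) auto
  show "1 \<le> type_mult (r, u, M)" using m(1) by (simp add: m_def)
  show "of_nat (type_mult (r, u, M)) * v \<in> Hol (flat X)"
  proof -
    obtain x where x: "x \<in> M" "(r ^^ m) x \<in> M" using m(2) by blast
    have xF: "x \<in> F" using x M by blast
    obtain \<psi> where \<psi>: "islift (closure (strip v 0)) \<psi>" "\<psi> ?c = h x" using lift[OF xF] by blast
    note hh = h(2)[OF xF \<psi>]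
    have "straight (\<lambda>t. \<psi> (of_real (t * real m) * v)) (of_nat m * v)"
    proof (rule lift_straight[OF b \<psi>(1) m(1)])
      show "\<psi> 0 \<in> Sg" using hh[of 0] x(1) by simp
      show "\<psi> (of_nat m * v) \<in> Sg" using hh[of m] x(2) by simp
      fix j assume j: "0 < j" "j < m"
      show "\<psi> (of_nat j * v) \<notin> Sg" using hh[of j] min[of j x] x(1) j by auto
    qed
    moreover have "of_nat m * v \<noteq> 0" using m(1) v0 by simp
    ultimately show ?thesis unfolding Hol_iff m_def[symmetric] by blast
  qed
  assume "of_int k * v \<in> Hol (flat X)"
  then obtain \<gamma> where k0: "k \<noteq> 0" and st: "straight \<gamma> (of_int k * v)" by (auto simp: Hol_iff)
  obtain \<psi> where \<psi>: "islift (closure (strip v 0)) \<psi>"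
    "\<And>t. t \<in> {0..1} \<Longrightarrow> \<psi> (of_real t * (of_int k * v)) = \<gamma> t"
    using straight_lift[OF b st] by metis
  have ends: "\<psi> 0 \<in> Sg" "\<psi> (of_int k * v) \<in> Sg"
    using \<psi>(2)[of 0] \<psi>(2)[of 1] st by (simp_all add: straight_def)
  \<comment> \<open>For negative \<open>k\<close> the lift is shifted so that the passage starts at
    the other end.\<close>
  obtain \<psi>' where \<psi>': "islift (closure (strip v 0)) \<psi>'" "\<psi>' 0 \<in> Sg" "\<psi>' (of_nat (nat \<bar>k\<bar>) * v) \<in> Sg"
  proof (cases "0 < k")
    case True then show ?thesis using that[of \<psi>] \<psi>(1) ends by simp
  next
    case False
    have kv: "of_int k * v \<in> gauss_ints" using gauss_ints_of_int[OF v, of "real_of_int k"] by simp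
    have "islift (closure (strip v 0)) (\<lambda>z. \<psi> (z + of_int k * v))"
      by (rule islift_translate[OF \<psi>(1) kv]) (use closure_strip_shift[of _ v 0 "real_of_int k"] in simp)
    moreover have "of_nat (nat \<bar>k\<bar>) * v + of_int k * v = 0" using False by simp
    ultimately show ?thesis using that[of "\<lambda>z. \<psi> (z + of_int k * v)"] ends by simp
  qed
  have "\<psi>' ?c \<in> Fib ?c" using islift_Fib[OF \<psi>'(1)] ctr_strip(2)[OF b] closure_subset by blast
  then have "\<psi>' ?c \<in> h ` F" using bij_betw_imp_surj_on[OF h(1)] by simp
  then obtain x where x: "x \<in> F" "\<psi>' ?c = h x" by (elim imageE) simp
  have "x \<in> M" "(r ^^ nat \<bar>k\<bar>) x \<in> M"
    using h(2)[OF x(1) \<psi>'(1) x(2), of 0] h(2)[OF x(1) \<psi>'(1) x(2), of "nat \<bar>k\<bar>"] \<psi>'(2,3) by auto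
  moreover have "1 \<le> nat \<bar>k\<bar>" using k0 by linarith
  ultimately show "type_mult (r, u, M) \<le> nat \<bar>k\<bar>" using min unfolding m_def by blast
qed

lemma multiplicity_straight:
  assumes st: "straight \<gamma> (of_int k * Complex (of_int p) (of_int q))" and cop: "coprime p q"
  shows "multiplicity (flat X) \<gamma> = nat \<bar>k\<bar>"
  unfolding multiplicity_def
proof (rule the_equality)
  define p' q' where "p' = (if k < 0 then - p else p)" "q' = (if k < 0 then - q else q)"
  have "coprime p' q'" using cop by (simp add: p'_q'_def)
  moreover have "of_nat (nat \<bar>k\<bar>) * Complex (of_int p') (of_int q') = of_int k * Complex (of_int p) (of_int q)"
    by (simp add: p'_q'_def complex_eq_iff)
  then have "has_period (flat X) \<gamma> (of_nat (nat \<bar>k\<bar>) * Complex (of_int p') (of_int q'))"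
    using straight_has_period[OF st] by simp
  ultimately show "\<exists>p q. coprime p q \<and> has_period (flat X) \<gamma> (of_nat (nat \<bar>k\<bar>) * Complex (of_int p) (of_int q))"
    by blast
next
  fix m assume "\<exists>p q. coprime p q \<and> has_period (flat X) \<gamma> (of_nat m * Complex (of_int p) (of_int q))"
  then obtain p' q' where pq: "coprime p' q'" "has_period (flat X) \<gamma> (of_nat m * Complex (of_int p') (of_int q'))"
    by blast
  have eq: "of_nat m * Complex (of_int p') (of_int q') = of_int k * Complex (of_int p) (of_int q)"
    using period_unique[OF st pq(2)] .
  have "real_of_int (int m * p') = real_of_int (k * p)" "real_of_int (int m * q') = real_of_int (k * q)"
    using eq by (simp_all add: complex_eq_iff)
  then have "int m * p' = k * p" "int m * q' = k * q" by linarith+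
  then have "gcd (int m * p') (int m * q') = gcd (k * p) (k * q)" by simp
  then have "int m = \<bar>k\<bar>" using pq(1) cop by (simp add: gcd_mult_left)
  then show "m = nat \<bar>k\<bar>" by simp
qed

text \<open>The factor \<open>c\<close> in \<open>mult_coslope\<close> is real, but periods are
  Gaussian integers and \<open>(p, q)\<close> is primitive, so it is an integer \<open>k\<close>;
  the competing multiplicities are the numbers \<open>|k|\<close>.\<close>

lemma mult_coslope_type:
  assumes pq: "quotient_of x = (p, q)" and b: "zbasis (Complex (of_int p) (of_int q)) w"
    and tt: "(r, u, M) \<in> sq_types F" and F: "finite F" and t: "sqtyp F (Complex (of_int p) (of_int q)) w (r, u, M)"
    and ne: "Sg \<noteq> {}" and gauss: "Hol (flat X) \<subseteq> gauss_ints"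
  shows "mult_coslope (flat X) x = type_mult (r, u, M)"
proof -
  let ?v = "Complex (of_int p) (of_int q)"
  have cop: "coprime p q" using pq by (rule quotient_of_coprime)
  note props = type_mult_props[OF b tt F t ne]
  have P: "(\<exists>\<gamma> v c. saddle_connection (flat X) \<gamma> \<and> has_period (flat X) \<gamma> v \<and> m = multiplicity (flat X) \<gamma> \<and>
        (case quotient_of x of (p, q) \<Rightarrow> v = of_real c * Complex (of_int p) (of_int q)))
      \<longleftrightarrow> (\<exists>k. m = nat \<bar>k\<bar> \<and> of_int k * ?v \<in> Hol (flat X))" for m
  proof
    assume "\<exists>\<gamma> v c. saddle_connection (flat X) \<gamma> \<and> has_period (flat X) \<gamma> v \<and> m = multiplicity (flat X) \<gamma> \<and>
        (case quotient_of x of (p, q) \<Rightarrow> v = of_real c * Complex (of_int p) (of_int q))"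
    then obtain \<gamma> v c where g: "saddle_connection (flat X) \<gamma>" "has_period (flat X) \<gamma> v"
      "m = multiplicity (flat X) \<gamma>" "v = of_real c * ?v" by (auto simp: pq)
    have vH: "v \<in> Hol (flat X)" using g(1,2) unfolding Hol_def by blast
    then have "c \<in> \<int>" using gauss zbasis_line[OF b, of c] g(4) by blast
    then obtain k :: int where k: "c = k" by (auto elim: Ints_cases)
    obtain u' where "straight \<gamma> u'" using g(1) unfolding saddle_iff by blast
    then have "straight \<gamma> v" using period_unique g(2) by blast
    then have "m = nat \<bar>k\<bar>" using multiplicity_straight[OF _ cop, of \<gamma> k] g(3,4) k by simp
    then show "\<exists>k. m = nat \<bar>k\<bar> \<and> of_int k * ?v \<in> Hol (flat X)" using vH g(4) k by auto
  next
    assume "\<exists>k. m = nat \<bar>k\<bar> \<and> of_int k * ?v \<in> Hol (flat X)"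
    then obtain k where k: "m = nat \<bar>k\<bar>" "of_int k * ?v \<in> Hol (flat X)" by blast
    then obtain \<gamma> where g: "of_int k * ?v \<noteq> 0" "straight \<gamma> (of_int k * ?v)" unfolding Hol_iff by blast
    have "saddle_connection (flat X) \<gamma>" unfolding saddle_iff using g by blast
    moreover have "has_period (flat X) \<gamma> (of_int k * ?v)" using straight_has_period[OF g(2)] .
    moreover have "m = multiplicity (flat X) \<gamma>" using multiplicity_straight[OF g(2) cop] k(1) by simp
    ultimately show "\<exists>\<gamma> v c. saddle_connection (flat X) \<gamma> \<and> has_period (flat X) \<gamma> v \<and> m = multiplicity (flat X) \<gamma> \<and>
        (case quotient_of x of (p, q) \<Rightarrow> v = of_real c * Complex (of_int p) (of_int q))"
      by (intro exI[of _ \<gamma>] exI[of _ "of_int k * ?v"] exI[of _ "real_of_int k"]) (simp add: pq)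
  qed
  show ?thesis
    unfolding mult_coslope_def P
  proof (rule Least_equality)
    show "\<exists>k. type_mult (r, u, M) = nat \<bar>k\<bar> \<and> of_int k * ?v \<in> Hol (flat X)"
      using props(2) by (intro exI[of _ "int (type_mult (r, u, M))"]) simp
    show "type_mult (r, u, M) \<le> m" if "\<exists>k. m = nat \<bar>k\<bar> \<and> of_int k * ?v \<in> Hol (flat X)" for m
      using that props(3) by blast
  qed
qed

end

section \<open>Area\<close>

definition shear :: "real \<Rightarrow> complex \<Rightarrow> complex" where
  "shear \<alpha> z = Complex (Re z - \<alpha> * Im z) (Im z)"

lemma shear_inverse [simp]: "shear (- \<alpha>) (shear \<alpha> z) = z" "shear \<alpha> (shear (- \<alpha>) z) = z"
  by (simp_all add: shear_def complex_eq_iff)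

lemma continuous_on_shear: "continuous_on A (shear \<alpha>)"
  unfolding shear_def complex_eq_iff[symmetric] Complex_eq by (intro continuous_intros)

lemma shear_image: "shear \<alpha> ` B = shear (- \<alpha>) -` B"
proof
  show "shear \<alpha> ` B \<subseteq> shear (- \<alpha>) -` B" by auto
  show "shear (- \<alpha>) -` B \<subseteq> shear \<alpha> ` B" by (metis image_eqI shear_inverse(2) subsetI vimageD)
qed

lemma shear_image_borel: "B \<in> sets borel \<Longrightarrow> shear \<alpha> ` B \<in> sets borel"
  unfolding shear_image
  using measurable_sets[OF borel_measurable_continuous_onI[OF continuous_on_shear], of B "- \<alpha>"] by simp

text \<open>A shear translates each horizontal slice, so by Fubini boxes have the right
  measure.\<close>

lemma lborel_complex_shear:
  "lborel = distr (lborel \<Otimes>\<^sub>M lborel) borel (\<lambda>(y, x). Complex (x - \<alpha> * y) y)"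
proof (rule lborel_eqI)
  let ?f = "\<lambda>(y, x). Complex (x - \<alpha> * y) y"
  have "continuous_on UNIV ?f"
    unfolding case_prod_beta Complex_eq by (intro continuous_intros)
  then have "?f \<in> borel_measurable borel" by (rule borel_measurable_continuous_onI)
  then have meas: "?f \<in> lborel \<Otimes>\<^sub>M lborel \<rightarrow>\<^sub>M borel"
    by (simp add: lborel_prod)
  fix l u :: complex
  assume lu: "\<And>b. b \<in> Basis \<Longrightarrow> l \<bullet> b \<le> u \<bullet> b"
  have "Re l \<le> Re u" "Im l \<le> Im u" using lu[of 1] lu[of \<i>] by (simp_all add: Basis_complex_def)
  note le = this
  have inb: "z \<in> box l u \<longleftrightarrow> Re l < Re z \<and> Re z < Re u \<and> Im l < Im z \<and> Im z < Im u" for z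
    by (auto simp: mem_box Basis_complex_def)
  have pre: "?f -` box l u \<inter> space (lborel \<Otimes>\<^sub>M lborel) \<in> sets (lborel \<Otimes>\<^sub>M lborel)"
    using measurable_sets[OF meas, of "box l u"] by simp
  have "emeasure (distr (lborel \<Otimes>\<^sub>M lborel) borel ?f) (box l u)
      = emeasure (lborel \<Otimes>\<^sub>M lborel) (?f -` box l u \<inter> space (lborel \<Otimes>\<^sub>M lborel))"
    using meas by (rule emeasure_distr) simp
  also have "\<dots> = (\<integral>\<^sup>+ y. emeasure lborel (Pair y -` (?f -` box l u \<inter> space (lborel \<Otimes>\<^sub>M lborel))) \<partial>lborel)"
    by (rule lborel.emeasure_pair_measure_alt[OF pre])
  also have "\<dots> = (\<integral>\<^sup>+ y. ennreal (Re u - Re l) * indicator {Im l<..<Im u} y \<partial>lborel)"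
  proof (rule nn_integral_cong)
    fix y :: real
    have "Pair y -` (?f -` box l u \<inter> space (lborel \<Otimes>\<^sub>M lborel)) =
      (if y \<in> {Im l<..<Im u} then {Re l + \<alpha> * y<..<Re u + \<alpha> * y} else {})"
      by (auto simp: inb space_pair_measure)
    then show "emeasure lborel (Pair y -` (?f -` box l u \<inter> space (lborel \<Otimes>\<^sub>M lborel))) =
       ennreal (Re u - Re l) * indicator {Im l<..<Im u} y"
      using le by simp
  qed
  also have "\<dots> = ennreal (Re u - Re l) * ennreal (Im u - Im l)"
    using le by (simp add: nn_integral_cmult_indicator)
  also have "\<dots> = ennreal (\<Prod>b\<in>Basis. (u - l) \<bullet> b)"
    using le by (simp add: Basis_complex_def ennreal_mult)
  finally show "emeasure (distr (lborel \<Otimes>\<^sub>M lborel) borel ?f) (box l u) = (\<Prod>b\<in>Basis. (u - l) \<bullet> b)" .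
qed simp

text \<open>Lebesgue measure is written over slices twice, with parameter \<alpha> for the image and
  with parameter 0 for \<open>B\<close>; the two preimages coincide.\<close>

lemma emeasure_shear:
  assumes B: "B \<in> sets borel"
  shows "emeasure lborel (shear \<alpha> ` B) = emeasure lborel B"
proof -
  let ?f = "\<lambda>\<alpha> (y, x). Complex (x - \<alpha> * y) y"
  have meas: "?f a \<in> lborel \<Otimes>\<^sub>M lborel \<rightarrow>\<^sub>M borel" for a
  proof -
    have "continuous_on UNIV (?f a)"
      unfolding case_prod_beta Complex_eq by (intro continuous_intros)
    then have "?f a \<in> borel_measurable borel" by (rule borel_measurable_continuous_onI)
    then show ?thesis
      by (simp add: lborel_prod)
  qed
  have "emeasure lborel (shear \<alpha> ` B) = emeasure (lborel \<Otimes>\<^sub>M lborel) (?f \<alpha> -` (shear \<alpha> ` B) \<inter> space (lborel \<Otimes>\<^sub>M lborel))"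
    by (subst lborel_complex_shear[of \<alpha>], rule emeasure_distr[OF meas shear_image_borel[OF B]])
  also have "?f \<alpha> -` (shear \<alpha> ` B) = ?f 0 -` B"
    unfolding shear_image by (auto simp: shear_def)
  also have "emeasure (lborel \<Otimes>\<^sub>M lborel) (?f 0 -` B \<inter> space (lborel \<Otimes>\<^sub>M lborel)) = emeasure lborel B"
  proof (rule sym)
    show "emeasure lborel B = emeasure (lborel \<Otimes>\<^sub>M lborel) (?f 0 -` B \<inter> space (lborel \<Otimes>\<^sub>M lborel))"
      by (subst lborel_complex_shear[of 0], rule emeasure_distr[OF meas B])
  qed
  finally show ?thesis .
qed

lemma emeasure_translate:
  fixes c :: complex
  assumes B: "B \<in> sets borel"
  shows "(\<lambda>z. z + c) ` B \<in> sets borel" "emeasure lborel ((\<lambda>z. z + c) ` B) = emeasure lborel B"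
proof -
  have eq: "(\<lambda>z. z + c) ` B = (+) (- c) -` B" by (auto simp: image_iff) (metis diff_add_cancel)
  have m: "(+) (- c) \<in> borel_measurable borel" by measurable
  show "(\<lambda>z. z + c) ` B \<in> sets borel" unfolding eq using measurable_sets[OF m B] by simp
  have "emeasure lborel B = emeasure (distr lborel borel ((+) (- c))) B"
    by (simp add: lborel_distr_plus)
  also have "\<dots> = emeasure lborel ((+) (- c) -` B \<inter> space lborel)"
    by (rule emeasure_distr) (use m B in auto)
  finally show "emeasure lborel ((\<lambda>z. z + c) ` B) = emeasure lborel B" unfolding eq by simp
qed

text \<open>A countable subcover and its disjointification reduce this to single shears followed by
  translations. Images of different pieces may overlap, hence an inequality.\<close>

lemma locally_shear_measure:
  fixes h :: "complex \<Rightarrow> complex"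
  assumes W: "W \<in> sets borel"
    and loc: "\<And>y. y \<in> W \<Longrightarrow> \<exists>\<delta>>0. \<exists>c. \<forall>y'\<in>W \<inter> ball y \<delta>. h y' = shear \<alpha> y' + c"
  shows "h ` W \<in> sets borel" "emeasure lborel (h ` W) \<le> emeasure lborel W"
proof -
  have "h ` W \<in> sets borel \<and> emeasure lborel (h ` W) \<le> emeasure lborel W"
  proof (cases "W = {}")
    case False
    obtain \<delta> c where d: "\<And>y. y \<in> W \<Longrightarrow> 0 < \<delta> y \<and> (\<forall>y'\<in>W \<inter> ball y (\<delta> y). h y' = shear \<alpha> y' + c y)"
      using loc by metis
    obtain F' where F': "F' \<subseteq> (\<lambda>y. ball y (\<delta> y)) ` W" "countable F'" "\<Union>F' = \<Union>((\<lambda>y. ball y (\<delta> y)) ` W)"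
      by (rule Lindelof[of "(\<lambda>y. ball y (\<delta> y)) ` W"]) auto
    have "\<exists>C. countable C \<and> C \<subseteq> W \<and> F' = (\<lambda>y. ball y (\<delta> y)) ` C"
      using iffD1[OF countable_subset_image conjI[OF F'(2,1)]] .
    then obtain C where C: "C \<subseteq> W" "countable C" "F' = (\<lambda>y. ball y (\<delta> y)) ` C" by (elim exE conjE)
    have cov: "W \<subseteq> (\<Union>y\<in>C. ball y (\<delta> y))"
    proof
      fix y assume y: "y \<in> W"
      then have "y \<in> \<Union>F'" unfolding F'(3) using d[OF y] by (intro UnionI[of "ball y (\<delta> y)"]) auto
      then show "y \<in> (\<Union>y\<in>C. ball y (\<delta> y))" by (simp add: C(3))
    qed
    have Cne: "C \<noteq> {}" using cov False by auto
    define y where "y = from_nat_into C"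
    have yC: "y n \<in> W" for n using from_nat_into[OF Cne] C(1) by (auto simp: y_def)
    have yr: "range y = C" unfolding y_def using Cne C(2) by (rule range_from_nat_into)
    define B where "B n = W \<inter> ball (y n) (\<delta> (y n))" for n
    define D where "D = disjointed B"
    have Bs: "range B \<subseteq> sets borel" using W by (auto simp: B_def)
    have Ds: "D n \<in> sets borel" for n
      using sets.range_disjointed_sets[OF Bs] unfolding D_def by blast
    have DB: "D n \<subseteq> B n" for n unfolding D_def by (rule disjointed_subset)
    have UD: "(\<Union>n. D n) = W"
    proof -
      have "(\<Union>n. D n) = (\<Union>n. B n)" unfolding D_def by (rule UN_disjointed_eq)
      also have "\<dots> = W" using cov yr by (auto simp: B_def)
      finally show ?thesis .
    qed
    have img: "h ` D n = (\<lambda>z. z + c (y n)) ` shear \<alpha> ` D n" for n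
    proof -
      have "h z = shear \<alpha> z + c (y n)" if "z \<in> D n" for z
        using that DB[of n] d[OF yC[of n]] by (auto simp: B_def)
      then show ?thesis by (auto simp: image_image intro!: image_cong)
    qed
    have hs: "h ` D n \<in> sets borel" "emeasure lborel (h ` D n) = emeasure lborel (D n)" for n
      unfolding img using emeasure_translate[OF shear_image_borel[OF Ds]] emeasure_shear[OF Ds] by auto
    have hW: "h ` W = (\<Union>n. h ` D n)" using UD by blast
    have m: "h ` W \<in> sets borel" unfolding hW using hs(1) by auto
    have "emeasure lborel (h ` W) \<le> (\<Sum>n. emeasure lborel (h ` D n))"
      unfolding hW using hs(1) by (intro emeasure_subadditive_countably) auto
    also have "\<dots> = (\<Sum>n. emeasure lborel (D n))" by (simp add: hs(2))
    also have "\<dots> = emeasure lborel (\<Union>n. D n)"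
      using Ds disjoint_family_disjointed by (intro suminf_emeasure) (auto simp: D_def)
    finally show ?thesis using m UD by simp
  qed simp
  then show "h ` W \<in> sets borel" "emeasure lborel (h ` W) \<le> emeasure lborel W" by auto
qed

definition sq_ctr :: complex where "sq_ctr = Complex (1/2) (1/2)"
definition unit_sq :: "complex set" where "unit_sq = {z. 0 < Re z \<and> Re z < 1 \<and> 0 < Im z \<and> Im z < 1}"

lemma strip_1: "strip 1 0 = {z. 0 < Im z \<and> Im z < 1}" and strip_i: "strip (- \<i>) 0 = {z. 0 < Re z \<and> Re z < 1}"
  by (auto simp: strip_def cross_def)

lemma unit_sq_box: "unit_sq = box 0 (Complex 1 1)"
  by (auto simp: unit_sq_def mem_box Basis_complex_def)

lemma unit_sq_props: "open unit_sq" "convex unit_sq" "unit_sq \<subseteq> strip 1 0" "sq_ctr \<in> unit_sq"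
    "unit_sq \<in> sets borel" "emeasure lborel unit_sq = 1"
proof -
  show "open unit_sq" "convex unit_sq" "unit_sq \<in> sets borel" by (simp_all add: unit_sq_box open_box convex_box)
  show "unit_sq \<subseteq> strip 1 0" "sq_ctr \<in> unit_sq" by (auto simp: unit_sq_def strip_1 sq_ctr_def)
  have "emeasure lborel (box 0 (Complex 1 1)) = (\<Prod>b\<in>Basis. (Complex 1 1 - 0) \<bullet> b)"
    by (rule emeasure_lborel_box) (auto simp: Basis_complex_def)
  then show "emeasure lborel unit_sq = 1" by (simp add: unit_sq_box Basis_complex_def)
qed

lemma gauss_one: "1 \<in> gauss_ints" "- \<i> \<in> gauss_ints"
  by (auto simp: gauss_ints_iff)

lemma unit_sq_inj: "E z = E w \<Longrightarrow> z \<in> unit_sq \<Longrightarrow> w \<in> unit_sq \<Longrightarrow> z = w"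
  using Ints_small[of "Re z - Re w"] Ints_small[of "Im z - Im w"]
  by (auto simp: E_eq_iff gauss_ints_iff unit_sq_def complex_eq_iff)

lemma closed_unit_rep:
  obtains z' where "E z' = E z" "0 \<le> Re z'" "Re z' < 1" "0 \<le> Im z'" "Im z' < 1"
proof (rule that[of "Complex (frac (Re z)) (frac (Im z))"])
  show "E (Complex (frac (Re z)) (frac (Im z))) = E z"
    by (auto simp: E_eq_iff gauss_ints_iff frac_def)
qed (auto simp: frac_lt_1)

section \<open>Developed unit squares and the total area\<close>

context origami begin

text \<open>Translation charts are described by derivatives in the coordinates of the atlas;
  differentiability there gives continuity.\<close>

lemma chart_continuous:
  assumes U: "(U, f) \<in> charts (flat X)"
  shows "continuous_on U f"
  unfolding continuous_on_topological
proof (intro ballI allI impI)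
  fix y B assume y: "y \<in> U" and B: "open B" "f y \<in> B"
  have US: "U \<subseteq> S" using U by (auto simp: charts_iff dest: openin_imp_subset)
  obtain V \<phi> where V: "(V, \<phi>) \<in> atlas X" "y \<in> V" using atlas_cover[of y] US y by blast
  define g where "g = f \<circ> inv_into V \<phi>"
  have "(g has_field_derivative form X (V, \<phi>) (\<phi> y)) (at (\<phi> y))"
    using U V y unfolding charts_iff g_def by blast
  then have "isCont g (\<phi> y)" by (rule DERIV_isCont)
  moreover have "g (\<phi> y) = f y" using atlas_inv[OF V] by (simp add: g_def)
  ultimately obtain A where A: "open A" "\<phi> y \<in> A" "\<And>w. w \<in> A \<Longrightarrow> g w \<in> B"
    using B by (metis continuous_at_open)
  obtain T where T: "open T" "V \<inter> \<phi> -` A = S \<inter> T"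
    using atlas_preimage[OF V(1) A(1)] by (auto simp: openin_open)
  show "\<exists>A. open A \<and> y \<in> A \<and> (\<forall>y\<in>U. y \<in> A \<longrightarrow> f y \<in> B)"
  proof (intro exI[of _ T] conjI ballI impI)
    show "y \<in> T" using T(2) V(2) A(2) by blast
    fix y' assume y': "y' \<in> U" "y' \<in> T"
    then have v: "y' \<in> V" "\<phi> y' \<in> A" using T(2) US by blast+
    show "f y' \<in> B" using A(3)[OF v(2)] atlas_inv[OF V(1) v(1)] by (simp add: g_def)
  qed (rule T(1))
qed

text \<open>Up to a constant, \<open>f \<circ> \<psi>\<close> minus the identity takes values in the
  lattice near \<open>z\<close>, and it is continuous, so it is locally constant.\<close>

lemma chart_lift_translation:
  assumes U: "(U, f) \<in> charts (flat X)" and l: "islift D \<psi>" and D: "open D" and z: "z \<in> D" "\<psi> z \<in> U"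
  obtains \<delta> c where "0 < \<delta>" "\<And>z'. z' \<in> D \<Longrightarrow> \<psi> z' \<in> U \<Longrightarrow> dist z z' < \<delta> \<Longrightarrow> f (\<psi> z') = z' + c"
proof -
  obtain V c where V: "openin (top_of_set S) V" "\<psi> z \<in> V" "V \<subseteq> U" "\<And>y. y \<in> V \<Longrightarrow> e y = E (f y + c)"
    using chart_local[OF U z(2)] by metis
  obtain T where T: "open T" "V = S \<inter> T" using V(1) by (auto simp: openin_open)
  define D' where "D' = D \<inter> \<psi> -` T"
  have lc: "continuous_on D \<psi>" and lS: "\<And>z'. z' \<in> D \<Longrightarrow> \<psi> z' \<in> S" and le: "\<And>z'. z' \<in> D \<Longrightarrow> e (\<psi> z') = E z'"
    using l by (auto simp: islift_def)
  have D'V: "\<psi> z' \<in> V" if "z' \<in> D'" for z' using that lS T(2) by (auto simp: D'_def)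
  have oD': "open D'" unfolding D'_def using lc D T(1) by (rule continuous_open_preimage)
  have zD': "z \<in> D'" using z(1) V(2) T(2) by (auto simp: D'_def)
  define k where "k z' = f (\<psi> z') + c - z'" for z'
  have kc: "continuous_on D' k" unfolding k_def
  proof (intro continuous_intros continuous_on_compose2[OF chart_continuous[OF U]])
    show "continuous_on D' \<psi>" using lc by (rule continuous_on_subset) (auto simp: D'_def)
    show "\<psi> ` D' \<subseteq> U" using D'V V(3) by blast
  qed
  have kg: "k z' \<in> gauss_ints" if "z' \<in> D'" for z'
  proof -
    have "E (f (\<psi> z') + c) = E z'" using V(4)[OF D'V[OF that]] le[of z'] that by (auto simp: D'_def)
    then show ?thesis by (simp add: E_eq_iff k_def)
  qed
  have "isCont k z" using kc oD' zD' by (simp add: continuous_on_eq_continuous_at)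
  then obtain \<delta>1 where d1: "0 < \<delta>1" "\<And>z'. dist z' z < \<delta>1 \<Longrightarrow> dist (k z') (k z) < 1"
    unfolding continuous_at_eps_delta using zero_less_one by metis
  obtain \<delta>2 where d2: "0 < \<delta>2" "ball z \<delta>2 \<subseteq> D'" by (rule openE[OF oD' zD'])
  show ?thesis
  proof (rule that[of "min \<delta>1 \<delta>2" "k z - c"])
    show "0 < min \<delta>1 \<delta>2" using d1 d2 by simp
    fix z' assume z': "z' \<in> D" "\<psi> z' \<in> U" "dist z z' < min \<delta>1 \<delta>2"
    then have "z' \<in> D'" using d2 by auto
    have "dist (k z') (k z) < 1" using d1(2)[of z'] z'(3) by (simp add: dist_commute)
    then have "k z' - k z = 0"
      using gauss_ints_diff[OF kg[OF \<open>z' \<in> D'\<close>] kg[OF zD']] by (intro gauss_ints_small) (auto simp: dist_norm)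
    then show "f (\<psi> z') = z' + (k z - c)" by (simp add: k_def algebra_simps)
  qed
qed

lemma chart_piece_measure:
  assumes U: "(U, f) \<in> charts (flat X)" and v: "v \<in> gauss_ints"
    and l: "islift (closure (strip v 0)) \<psi>" and W: "W \<subseteq> strip v 0" "W \<in> sets borel"
  shows "W \<inter> \<psi> -` U \<in> sets borel"
    "shear \<alpha> ` f ` \<psi> ` (W \<inter> \<psi> -` U) \<in> sets borel"
    "emeasure lborel (shear \<alpha> ` f ` \<psi> ` (W \<inter> \<psi> -` U)) \<le> emeasure lborel (W \<inter> \<psi> -` U)"
proof -
  let ?D = "strip v 0"
  have l': "islift ?D \<psi>" using islift_subset[OF l closure_subset] .
  have "openin (top_of_set S) U" using U by (simp add: charts_iff)
  then obtain T where T: "open T" "U = S \<inter> T" by (auto simp: openin_open)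
  have "open (?D \<inter> \<psi> -` T)" using l' open_strip T(1) by (intro continuous_open_preimage) (auto simp: islift_def)
  moreover have "W \<inter> \<psi> -` U = W \<inter> (?D \<inter> \<psi> -` T)" using W(1) T(2) l' by (auto simp: islift_def)
  ultimately show Wb: "W \<inter> \<psi> -` U \<in> sets borel" using W(2) by auto
  define h where "h z = shear \<alpha> (f (\<psi> z))" for z
  have loc: "\<exists>\<delta>>0. \<exists>c. \<forall>y'\<in>(W \<inter> \<psi> -` U) \<inter> ball y \<delta>. h y' = shear \<alpha> y' + c" if y: "y \<in> W \<inter> \<psi> -` U" for y
  proof -
    have yD: "y \<in> ?D" "\<psi> y \<in> U" using y W(1) by auto
    obtain \<delta> c where d: "0 < \<delta>" "\<And>z'. z' \<in> ?D \<Longrightarrow> \<psi> z' \<in> U \<Longrightarrow> dist y z' < \<delta> \<Longrightarrow> f (\<psi> z') = z' + c"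
      using chart_lift_translation[OF U l' open_strip yD] by metis
    have "h y' = shear \<alpha> y' + shear \<alpha> c" if y': "y' \<in> (W \<inter> \<psi> -` U) \<inter> ball y \<delta>" for y'
    proof -
      have "f (\<psi> y') = y' + c" using d(2)[of y'] y' W(1) by auto
      then show ?thesis by (simp add: h_def shear_def complex_eq_iff algebra_simps)
    qed
    then show ?thesis using d(1) by blast
  qed
  have img: "h ` (W \<inter> \<psi> -` U) = shear \<alpha> ` f ` \<psi> ` (W \<inter> \<psi> -` U)" by (simp add: h_def image_image)
  show "shear \<alpha> ` f ` \<psi> ` (W \<inter> \<psi> -` U) \<in> sets borel"
    "emeasure lborel (shear \<alpha> ` f ` \<psi> ` (W \<inter> \<psi> -` U)) \<le> emeasure lborel (W \<inter> \<psi> -` U)"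
    using locally_shear_measure[OF Wb loc] unfolding img by auto
qed

text \<open>
  \<open>sl 1 x\<close> and \<open>sl (- \<i>) x\<close> develop the horizontal and the vertical strip through the square of centre \<open>x\<close>;
  the vertical one is needed for the horizontal edges of the squares.
\<close>

definition sl :: "complex \<Rightarrow> 'a \<Rightarrow> complex \<Rightarrow> 'a" where
  "sl v x = (SOME \<psi>. islift (closure (strip v 0)) \<psi> \<and> \<psi> sq_ctr = x)"

abbreviation hl where "hl \<equiv> sl 1"
abbreviation vl where "vl \<equiv> sl (- \<i>)"

lemma sl:
  assumes "v \<in> gauss_ints" "sq_ctr \<in> strip v 0" "x \<in> Fib sq_ctr"
  shows "islift (closure (strip v 0)) (sl v x) \<and> sl v x sq_ctr = x"
proof -
  obtain \<psi> where "islift (closure (strip v 0)) \<psi>" "\<psi> sq_ctr = x" by (rule strip_lift[OF assms])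
  then have "islift (closure (strip v 0)) \<psi> \<and> \<psi> sq_ctr = x" by blast
  then show ?thesis unfolding sl_def by (rule someI[where P = "\<lambda>\<psi>. islift (closure (strip v 0)) \<psi> \<and> \<psi> sq_ctr = x"])
qed

lemma sq_ctr_strip: "sq_ctr \<in> strip 1 0" "sq_ctr \<in> strip (- \<i>) 0"
  by (simp_all add: strip_1 strip_i sq_ctr_def)

lemmas hl = sl[OF gauss_one(1) sq_ctr_strip(1)] and vl = sl[OF gauss_one(2) sq_ctr_strip(2)]

lemma sl_surj:
  assumes v: "v \<in> gauss_ints" and c: "sq_ctr \<in> strip v 0" and y: "y \<in> Fib z" "z \<in> strip v 0"
  shows "\<exists>x\<in>Fib sq_ctr. sl v x z = y"
proof -
  obtain \<psi> where p: "islift (closure (strip v 0)) \<psi>" "\<psi> z = y" by (rule strip_lift[OF v y(2,1)])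
  have x: "\<psi> sq_ctr \<in> Fib sq_ctr" using islift_Fib[OF p(1)] c closure_subset by blast
  note h = sl[OF v c x]
  have "sl v (\<psi> sq_ctr) z = \<psi> z"
    by (rule islift_unique[OF convex_connected[OF convex_strip] strip_free[OF v]
          islift_subset[OF conjunct1[OF h] closure_subset] islift_subset[OF p(1) closure_subset] c conjunct2[OF h] y(2)])
  then show ?thesis using x p(2) by blast
qed

lemmas hl_surj = sl_surj[OF gauss_one(1) sq_ctr_strip(1)] and vl_surj = sl_surj[OF gauss_one(2) sq_ctr_strip(2)]

text \<open>The surface consists of open squares, vertical edges, horizontal edges and vertices.
  Edges and vertices are mapped to null sets, so only the parts of the chart in the open squares
  count.\<close>

lemma chart_area_le:
  assumes U: "(U, f) \<in> charts (flat X)"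
  shows "emeasure lborel (shear \<alpha> ` f ` U) \<le> (\<Sum>x\<in>Fib sq_ctr. emeasure lborel (unit_sq \<inter> hl x -` U))"
proof -
  \<comment> \<open>The vertical edge on \<open>Re z = 0\<close> lies in the horizontal strip, the
    horizontal edge on \<open>Im z = 0\<close> in the vertical one.\<close>
  define VE where "VE = cbox 0 \<i> \<inter> strip 1 0"
  define HE where "HE = cbox 0 1 \<inter> strip (- \<i>) 0"
  have VEs: "VE \<in> sets borel" and HEs: "HE \<in> sets borel"
    unfolding VE_def HE_def using open_strip by (auto intro!: sets.Int borel_closed[OF closed_cbox] borel_open)
  have "emeasure lborel (cbox 0 \<i>) = 0" "emeasure lborel (cbox 0 (1::complex)) = 0"
    by (auto simp: emeasure_lborel_cbox_eq Basis_complex_def)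
  then have null: "emeasure lborel (VE \<inter> A) = 0" "emeasure lborel (HE \<inter> A) = 0" for A
  proof -
    have z: "emeasure lborel (C \<inter> B \<inter> A) = 0" if "emeasure lborel C = 0" "closed C" for B C :: "complex set"
    proof -
      have "emeasure lborel (C \<inter> B \<inter> A) \<le> emeasure lborel C"
        by (rule emeasure_mono) (use borel_closed[OF that(2)] in auto)
      then show ?thesis using that(1) by simp
    qed
    show "emeasure lborel (VE \<inter> A) = 0" "emeasure lborel (HE \<inter> A) = 0"
      unfolding VE_def HE_def
      using z[OF \<open>emeasure lborel (cbox 0 \<i>) = 0\<close> closed_cbox] z[OF \<open>emeasure lborel (cbox 0 1) = 0\<close> closed_cbox] by blast+
  qed
  define g where "g = shear \<alpha> \<circ> f"
  define A1 where "A1 x = g ` hl x ` (unit_sq \<inter> hl x -` U)" for x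
  define A2 where "A2 x = g ` hl x ` (VE \<inter> hl x -` U)" for x
  define A3 where "A3 x = g ` vl x ` (HE \<inter> vl x -` U)" for x
  define A4 where "A4 = g ` (U \<inter> Fib 0)"
  have p1: "A1 x \<in> sets borel" "emeasure lborel (A1 x) \<le> emeasure lborel (unit_sq \<inter> hl x -` U)" if "x \<in> Fib sq_ctr" for x
    using chart_piece_measure(2,3)[OF U gauss_one(1) conjunct1[OF hl[OF that]] unit_sq_props(3,5), of \<alpha>]
    by (auto simp: A1_def g_def image_comp[symmetric] comp_assoc image_image)
  have p2: "A2 x \<in> sets borel" "emeasure lborel (A2 x) \<le> emeasure lborel (VE \<inter> hl x -` U)" if "x \<in> Fib sq_ctr" for x
    using chart_piece_measure(2,3)[OF U gauss_one(1) conjunct1[OF hl[OF that]] _ VEs, of \<alpha>]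
    by (auto simp: A2_def g_def image_comp[symmetric] comp_assoc image_image VE_def)
  have p3: "A3 x \<in> sets borel" "emeasure lborel (A3 x) \<le> emeasure lborel (HE \<inter> vl x -` U)" if "x \<in> Fib sq_ctr" for x
    using chart_piece_measure(2,3)[OF U gauss_one(2) conjunct1[OF vl[OF that]] _ HEs, of \<alpha>]
    by (auto simp: A3_def g_def image_comp[symmetric] comp_assoc image_image HE_def)
  have fin4: "finite A4" unfolding A4_def using finite_Fib by auto
  have p4: "A4 \<in> sets borel" "emeasure lborel A4 = 0"
    using fin4 by (auto simp: borel_closed finite_imp_closed emeasure_lborel_countable countable_finite)
  have US: "U \<subseteq> S" using U by (auto simp: charts_iff dest: openin_imp_subset)
  let ?F = "Fib sq_ctr"
  have cover: "g ` U \<subseteq> (\<Union>x\<in>?F. A1 x) \<union> ((\<Union>x\<in>?F. A2 x) \<union> ((\<Union>x\<in>?F. A3 x) \<union> A4))"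
  proof (rule image_subsetI)
    fix y assume y: "y \<in> U"
    obtain z0 where "\<rho> y = abs_torus z0" by (rule torus_abs_exhaust)
    then have "e y = E z0" by (simp add: e_eq_iff)
    then obtain z where z: "e y = E z" "0 \<le> Re z" "Re z < 1" "0 \<le> Im z" "Im z < 1"
      using closed_unit_rep[of z0] by metis
    have yF: "y \<in> Fib z" using y US z(1) by (auto simp: Fib_def)
    consider "Re z = 0 \<and> Im z = 0" | "Re z = 0 \<and> 0 < Im z" | "0 < Re z \<and> Im z = 0" | "0 < Re z \<and> 0 < Im z"
      using z by linarith
    then show "g y \<in> (\<Union>x\<in>?F. A1 x) \<union> ((\<Union>x\<in>?F. A2 x) \<union> ((\<Union>x\<in>?F. A3 x) \<union> A4))"
    proof cases
      case 1
      then have "z = 0" by (simp add: complex_eq_iff)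
      then have "g y \<in> A4" unfolding A4_def using y yF by blast
      then show ?thesis by blast
    next
      case 2
      then have m: "z \<in> strip 1 0" "z \<in> VE" using z by (auto simp: strip_1 VE_def mem_box Basis_complex_def)
      obtain x where x: "x \<in> ?F" "hl x z = y" using hl_surj[OF yF m(1)] by blast
      then have "g y \<in> A2 x" unfolding A2_def using m y by blast
      then show ?thesis using x by blast
    next
      case 3
      then have m: "z \<in> strip (- \<i>) 0" "z \<in> HE" using z by (auto simp: strip_i HE_def mem_box Basis_complex_def)
      obtain x where x: "x \<in> ?F" "vl x z = y" using vl_surj[OF yF m(1)] by blast
      then have "g y \<in> A3 x" unfolding A3_def using m y by blast
      then show ?thesis using x by blast
    next
      case 4
      then have m: "z \<in> strip 1 0" "z \<in> unit_sq" using z by (auto simp: strip_1 unit_sq_def)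
      obtain x where x: "x \<in> ?F" "hl x z = y" using hl_surj[OF yF m(1)] by blast
      then have "g y \<in> A1 x" unfolding A1_def using m y by blast
      then show ?thesis using x by blast
    qed
  qed
  have fin: "finite ?F" by (rule finite_Fib)
  have s: "(\<Union>x\<in>?F. A1 x) \<in> sets lborel" "(\<Union>x\<in>?F. A2 x) \<in> sets lborel" "(\<Union>x\<in>?F. A3 x) \<in> sets lborel" "A4 \<in> sets lborel"
    using fin p1 p2 p3 p4 by (auto intro!: sets.finite_UN)
  have e2: "emeasure lborel (\<Union>x\<in>?F. A2 x) = 0"
  proof -
    have "emeasure lborel (\<Union>x\<in>?F. A2 x) \<le> (\<Sum>x\<in>?F. emeasure lborel (A2 x))"
      using fin p2 by (intro emeasure_subadditive_finite) auto
    also have "\<dots> \<le> (\<Sum>x\<in>?F. 0)" using p2(2) null by (intro sum_mono) metis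
    finally show ?thesis by simp
  qed
  have e3: "emeasure lborel (\<Union>x\<in>?F. A3 x) = 0"
  proof -
    have "emeasure lborel (\<Union>x\<in>?F. A3 x) \<le> (\<Sum>x\<in>?F. emeasure lborel (A3 x))"
      using fin p3 by (intro emeasure_subadditive_finite) auto
    also have "\<dots> \<le> (\<Sum>x\<in>?F. 0)" using p3(2) null by (intro sum_mono) metis
    finally show ?thesis by simp
  qed
  have "emeasure lborel (g ` U) \<le> emeasure lborel ((\<Union>x\<in>?F. A1 x) \<union> ((\<Union>x\<in>?F. A2 x) \<union> ((\<Union>x\<in>?F. A3 x) \<union> A4)))"
    using cover s by (intro emeasure_mono) auto
  also have "\<dots> \<le> emeasure lborel (\<Union>x\<in>?F. A1 x) + emeasure lborel ((\<Union>x\<in>?F. A2 x) \<union> ((\<Union>x\<in>?F. A3 x) \<union> A4))"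
    using s by (intro emeasure_subadditive) auto
  also have "emeasure lborel ((\<Union>x\<in>?F. A2 x) \<union> ((\<Union>x\<in>?F. A3 x) \<union> A4)) = 0"
    using s e2 e3 p4(2) by (simp add: emeasure_Un_null_set null_sets_def)
  also have "emeasure lborel (\<Union>x\<in>?F. A1 x) + 0 \<le> (\<Sum>x\<in>?F. emeasure lborel (A1 x))"
    using fin p1 by (simp, intro emeasure_subadditive_finite) auto
  also have "\<dots> \<le> (\<Sum>x\<in>?F. emeasure lborel (unit_sq \<inter> hl x -` U))" using p1(2) by (intro sum_mono)
  finally show ?thesis by (simp add: g_def image_comp)
qed

lemma hl_lift_sq: "x \<in> Fib sq_ctr \<Longrightarrow> islift unit_sq (hl x)"
  using hl islift_subset unit_sq_props(3) closure_subset by blast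

lemma hl_inj: 
  assumes "x \<in> Fib sq_ctr" "x' \<in> Fib sq_ctr" "z \<in> unit_sq" "z' \<in> unit_sq" "hl x z = hl x' z'"
  shows "z = z'" "x = x'"
proof -
  have "e (hl x z) = E z" "e (hl x' z') = E z'"
    using hl_lift_sq[OF assms(1)] hl_lift_sq[OF assms(2)] assms(3,4) unfolding islift_def by blast+
  then have "E z = E z'" using assms(5) by simp
  then show zz: "z = z'" using assms(3,4) by (rule unit_sq_inj)
  have "hl x sq_ctr = hl x' sq_ctr"
  proof (rule islift_unique[OF convex_connected[OF unit_sq_props(2)] _ hl_lift_sq[OF assms(1)] hl_lift_sq[OF assms(2)] assms(3)])
    show "unit_sq \<inter> gauss_ints = {}" using unit_sq_props(3) strip_free[OF gauss_one(1), of 0] by blast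
    show "hl x z = hl x' z" using assms(5) zz by simp
  qed (rule unit_sq_props(4))
  then show "x = x'" using hl[OF assms(1)] hl[OF assms(2)] by simp
qed

text \<open>Near each of its points the inverse of the developed square coincides with a local
  coordinate, which already is a translation chart. Openness and the derivative condition are
  inherited from it.\<close>

lemma square_chart:
  assumes x: "x \<in> Fib sq_ctr"
  shows "(hl x ` unit_sq, inv_into unit_sq (hl x)) \<in> charts (flat X)"
proof -
  let ?U = "hl x ` unit_sq"
  define f where "f = inv_into unit_sq (hl x)"
  have l: "islift unit_sq (hl x)" by (rule hl_lift_sq[OF x])
  have inj: "inj_on (hl x) unit_sq" using hl_inj[OF x x] by (auto simp: inj_on_def)
  have fh: "f (hl x z) = z" if "z \<in> unit_sq" for z using inj that by (simp add: f_def)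
  have nSg: "?U \<inter> Sg = {}"
  proof -
    have "hl x z \<notin> Sg" if "z \<in> unit_sq" for z
    proof (rule Fib_not_Sg[OF _ islift_Fib[OF l that]])
      show "z \<notin> gauss_ints" using that unit_sq_props(3) strip_free[OF gauss_one(1), of 0] by blast
    qed
    then show ?thesis by blast
  qed
  have loc: "\<exists>N \<Phi>. openin (top_of_set S) N \<and> y \<in> N \<and> N \<subseteq> ?U \<and> (N, \<Phi>) \<in> charts (flat X) \<and> (\<forall>y'\<in>N. f y' = \<Phi> y')"
    if y: "y \<in> ?U" for y
  proof -
    obtain z where z: "z \<in> unit_sq" "y = hl x z" using y by blast
    have yF: "y \<in> Fib z" using islift_Fib[OF l z(1)] z(2) by simp
    have yS: "y \<notin> Sg" using nSg y by blast
    obtain \<delta> \<theta> U1 where d: "0 < \<delta>" "islift (ball z \<delta>) \<theta>" "\<theta> z = y" "openin (top_of_set S) U1" "y \<in> U1"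
      "\<And>y z'. y \<in> U1 \<Longrightarrow> z' \<in> ball z \<delta> \<Longrightarrow> e y = E z' \<Longrightarrow> \<theta> z' = y"
      using local_lift[OF yF yS] by metis
    obtain r where r: "0 < r" "ball z r \<subseteq> unit_sq" by (rule openE[OF unit_sq_props(1) z(1)])
    define s where "s = min \<delta> r"
    have s: "0 < s" "ball z s \<subseteq> ball z \<delta>" "ball z s \<subseteq> unit_sq" using d(1) r by (auto simp: s_def)
    obtain U2 \<Phi> where U2: "openin (top_of_set S) U2" "y \<in> U2" "continuous_on U2 \<Phi>" "\<Phi> y = z"
      "\<And>y. y \<in> U2 \<Longrightarrow> e y = E (\<Phi> y)" "(U2, \<Phi>) \<in> charts (flat X)"
      using local_coordinate[OF Fib_D[OF yF]] yS by metis
    have "openin (top_of_set U2) (U2 \<inter> \<Phi> -` ball z s)" using U2(3) by (rule continuous_openin_preimage_gen) simp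
    then have "openin (top_of_set S) (U2 \<inter> \<Phi> -` ball z s)" using U2(1) openin_trans by blast
    then have oN: "openin (top_of_set S) (U1 \<inter> (U2 \<inter> \<Phi> -` ball z s))" using d(4) by (rule openin_Int[rotated])
    define N where "N = U1 \<inter> (U2 \<inter> \<Phi> -` ball z s)"
    have key: "y' = hl x (\<Phi> y')" "\<Phi> y' \<in> unit_sq" if y': "y' \<in> N" for y'
    proof -
      have m: "y' \<in> U1" "y' \<in> U2" "\<Phi> y' \<in> ball z s" using y' by (auto simp: N_def)
      have t: "\<theta> (\<Phi> y') = y'" using d(6)[OF m(1)] m(3) s(2) U2(5)[OF m(2)] by blast
      have "\<theta> (\<Phi> y') = hl x (\<Phi> y')"
      proof (rule islift_unique[where D = "ball z s" and w = z and \<phi> = \<theta> and \<psi> = "hl x"])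
        show "ball z s \<inter> gauss_ints = {}" using s(3) unit_sq_props(3) strip_free[OF gauss_one(1), of 0] by blast
        show "islift (ball z s) \<theta>" "islift (ball z s) (hl x)" using d(2) l s islift_subset by blast+
      qed (use d(3) z(2) s(1) m(3) in auto)
      then show "y' = hl x (\<Phi> y')" using t by simp
      show "\<Phi> y' \<in> unit_sq" using m(3) s(3) by blast
    qed
    have "N \<subseteq> ?U" using key by blast
    moreover have "f y' = \<Phi> y'" if "y' \<in> N" for y' using fh[OF key(2)[OF that]] key(1)[OF that] by simp
    moreover have "y \<in> N" using d(5) U2(2,4) s(1) by (simp add: N_def)
    moreover have "(N, \<Phi>) \<in> charts (flat X)"
    proof -
      have "U1 \<inter> (U2 \<inter> \<Phi> -` ball z s) \<subseteq> U2" by blast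
      from chart_subset[OF U2(6) oN this, of 0] show ?thesis by (simp add: N_def)
    qed
    ultimately show ?thesis using oN unfolding N_def by blast
  qed
  have open_U: "openin (top_of_set S) ?U"
    by (subst openin_subopen) (use loc in blast)
  show ?thesis
    unfolding charts_iff f_def[symmetric]
  proof (intro conjI ballI)
    show "openin (top_of_set S) ?U" by (rule open_U)
    show "?U \<inter> Sg = {}" by (rule nSg)
    show "inj_on f ?U" using fh by (auto simp: inj_on_def)
    fix c assume c: "c \<in> atlas X"
    obtain V \<phi> where cv: "c = (V, \<phi>)" by (cases c)
    have V: "(V, \<phi>) \<in> atlas X" using c cv by simp
    have "((f \<circ> inv_into V \<phi>) has_field_derivative form X (V, \<phi>) (\<phi> y)) (at (\<phi> y))" if y: "y \<in> ?U \<inter> V" for y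
    proof -
      obtain N \<Phi> where N: "openin (top_of_set S) N" "y \<in> N" "(N, \<Phi>) \<in> charts (flat X)" "\<And>y'. y' \<in> N \<Longrightarrow> f y' = \<Phi> y'"
        using loc[of y] y by blast
      have "((\<Phi> \<circ> inv_into V \<phi>) has_field_derivative form X (V, \<phi>) (\<phi> y)) (at (\<phi> y))"
        using N(2,3) V y unfolding charts_iff by blast
      moreover have "open (\<phi> ` (V \<inter> N))" by (rule atlas_open_image[OF V N(1)])
      moreover have "\<phi> y \<in> \<phi> ` (V \<inter> N)" using y N(2) by blast
      moreover have "(\<Phi> \<circ> inv_into V \<phi>) w = (f \<circ> inv_into V \<phi>) w" if "w \<in> \<phi> ` (V \<inter> N)" for w
        using that atlas_inv[OF V] N(4) by auto
      ultimately show ?thesis by (rule has_field_derivative_transform_within_open)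
    qed
    then show "case c of (V, \<phi>) \<Rightarrow> \<forall>y\<in>?U \<inter> V. ((f \<circ> inv_into V \<phi>) has_field_derivative form X (V, \<phi>) (\<phi> y)) (at (\<phi> y))"
      by (simp add: cv)
  qed
qed

text \<open>The developed squares are connected, open in the surface and pairwise disjoint, and they
  exhaust the preimage of the open unit square.\<close>

lemma squares_are_components: "unit_squares (flat X) \<rho> = (\<lambda>x. hl x ` unit_sq) ` Fib sq_ctr"
proof -
  define G where "G = {x \<in> S. \<exists>s t. 0 < s \<and> s < 1 \<and> 0 < t \<and> t < 1 \<and> \<rho> x = abs_torus (Complex s t)}"
  let ?F = "Fib sq_ctr" and ?C = "\<lambda>x. hl x ` unit_sq"
  have G_iff: "y \<in> G \<longleftrightarrow> (\<exists>z\<in>unit_sq. y \<in> Fib z)" for y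
  proof
    assume "y \<in> G"
    then obtain s t where st: "y \<in> S" "0 < s" "s < 1" "0 < t" "t < 1" "e y = E (Complex s t)" by (auto simp: G_def e_eq_iff)
    then show "\<exists>z\<in>unit_sq. y \<in> Fib z" by (intro bexI[of _ "Complex s t"]) (auto simp: Fib_def unit_sq_def)
  next
    assume "\<exists>z\<in>unit_sq. y \<in> Fib z"
    then obtain z where z: "z \<in> unit_sq" "y \<in> S" "\<rho> y = abs_torus (Complex (Re z) (Im z))" by (auto simp: Fib_def e_eq_iff)
    then show "y \<in> G" unfolding G_def unit_sq_def by blast
  qed
  have GU: "G = (\<Union>x\<in>?F. ?C x)"
  proof
    show "G \<subseteq> (\<Union>x\<in>?F. ?C x)"
    proof
      fix y assume "y \<in> G"
      then obtain z where z: "z \<in> unit_sq" "y \<in> Fib z" using G_iff by blast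
      then obtain x where "x \<in> ?F" "hl x z = y" using hl_surj[of y z] unit_sq_props(3) by blast
      then show "y \<in> (\<Union>x\<in>?F. ?C x)" using z(1) by blast
    qed
    show "(\<Union>x\<in>?F. ?C x) \<subseteq> G" using G_iff islift_Fib[OF hl_lift_sq] by blast
  qed
  have op: "openin (top_of_set S) (?C x)" if "x \<in> ?F" for x using square_chart[OF that] by (simp add: charts_iff)
  have comp: "?C x \<in> components G" if x: "x \<in> ?F" for x
    unfolding in_components_maximal
  proof (intro conjI allI impI)
    show "?C x \<noteq> {}" using unit_sq_props(4) by blast
    show "?C x \<subseteq> G" using GU x by blast
    show "connected (?C x)"
      using hl_lift_sq[OF x] convex_connected[OF unit_sq_props(2)]
      by (intro connected_continuous_image) (auto simp: islift_def)
    fix D assume D: "D \<noteq> {} \<and> ?C x \<subseteq> D \<and> D \<subseteq> G \<and> connected D"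
    obtain T1 where T1: "open T1" "?C x = S \<inter> T1" using op[OF x] by (auto simp: openin_open)
    have "openin (top_of_set S) (\<Union>x'\<in>?F - {x}. ?C x')" using op by (intro openin_Union) auto
    then obtain T2 where T2: "open T2" "(\<Union>x'\<in>?F - {x}. ?C x') = S \<inter> T2" by (auto simp: openin_open)
    have GS: "G \<subseteq> S" by (auto simp: G_def)
    have cov: "D \<subseteq> T1 \<union> T2" using D GU T1(2) T2(2) by blast
    have disj: "T1 \<inter> T2 \<inter> D = {}"
    proof (rule ccontr)
      assume "\<not> ?thesis"
      then obtain y where "y \<in> T1" "y \<in> T2" "y \<in> S" using D GS by blast
      then have "y \<in> ?C x" "y \<in> (\<Union>x'\<in>?F - {x}. ?C x')" using T1(2) T2(2) by blast+
      then obtain z x' z' where "y = hl x z" "z \<in> unit_sq" "x' \<in> ?F" "x' \<noteq> x" "y = hl x' z'" "z' \<in> unit_sq" by blast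
      then show False using hl_inj(2)[OF x, of x' z z'] by simp
    qed
    have "T1 \<inter> D \<noteq> {}" using D T1(2) unit_sq_props(4) by blast
    then have "T2 \<inter> D = {}" using connectedD[of D T1 T2] D T1(1) T2(1) cov disj by blast
    then show "D = ?C x" using D cov T1(2) GS by blast
  qed
  have "components G = ?C ` ?F"
  proof
    show "?C ` ?F \<subseteq> components G" using comp by blast
    show "components G \<subseteq> ?C ` ?F"
    proof
      fix D assume D: "D \<in> components G"
      obtain y where y: "y \<in> D" using in_components_nonempty[OF D] by blast
      then have "y \<in> G" using in_components_subset[OF D] by blast
      then obtain x where x: "x \<in> ?F" "y \<in> ?C x" using GU by blast
      have "D = ?C x" using components_eq[OF D comp[OF x(1)]] x(2) y by blast
      then show "D \<in> ?C ` ?F" using x(1) by blast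
    qed
  qed
  then show ?thesis by (simp add: unit_squares_def G_def)
qed

lemma card_squares: "card (unit_squares (flat X) \<rho>) = card (Fib sq_ctr)"
proof -
  have "inj_on (\<lambda>x. hl x ` unit_sq) (Fib sq_ctr)"
  proof (rule inj_onI)
    fix x y assume xy: "x \<in> Fib sq_ctr" "y \<in> Fib sq_ctr" "hl x ` unit_sq = hl y ` unit_sq"
    have "hl x sq_ctr \<in> hl y ` unit_sq" using xy(3) unit_sq_props(4) by blast
    then obtain z where "z \<in> unit_sq" "hl x sq_ctr = hl y z" by blast
    then show "x = y" using hl_inj(2)[OF xy(1,2) unit_sq_props(4)] by blast
  qed
  then show ?thesis unfolding squares_are_components by (rule card_image)
qed

text \<open>Disjoint charts cut disjoint pieces out of each square, so no family exceeds the number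
  of squares; the family of the open squares attains it. The shear preserves these areas.\<close>

theorem area_shear:
  assumes A: "\<And>z. lin A z = shear \<alpha> z"
  shows "surface_area (act A (flat X)) = real (card (unit_squares (flat X) \<rho>))"
proof -
  let ?F = "Fib sq_ctr"
  define FF where "FF = {F. finite F \<and> F \<subseteq> charts (act A (flat X)) \<and> pairwise (\<lambda>c d. fst c \<inter> fst d = {}) F}"
  have lA: "lin A \<circ> f = shear \<alpha> \<circ> f" for f :: "'a \<Rightarrow> complex" using A by auto
  have ch: "charts (act A (flat X)) = (\<lambda>(U, f). (U, shear \<alpha> \<circ> f)) ` charts (flat X)"
    by (simp add: act_def lA)
  have up: "(\<Sum>(U, f)\<in>F. emeasure lborel (f ` U)) \<le> of_nat (card ?F)" if F: "F \<in> FF" for F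
  proof -
    have fin: "finite F" and sub: "F \<subseteq> charts (act A (flat X))" and pw: "pairwise (\<lambda>c d. fst c \<inter> fst d = {}) F"
      using F by (auto simp: FF_def)
    have elt: "\<exists>f. (fst c, f) \<in> charts (flat X) \<and> snd c = shear \<alpha> \<circ> f" if "c \<in> F" for c
    proof -
      have "c \<in> (\<lambda>(U, f). (U, shear \<alpha> \<circ> f)) ` charts (flat X)" using that sub unfolding ch by blast
      then obtain p where p: "p \<in> charts (flat X)" "c = (\<lambda>(U, f). (U, shear \<alpha> \<circ> f)) p" by (rule imageE)
      then have "(fst c, snd p) \<in> charts (flat X) \<and> snd c = shear \<alpha> \<circ> snd p" by (cases p) simp
      then show ?thesis by blast
    qed
    have "(\<Sum>(U, f)\<in>F. emeasure lborel (f ` U)) \<le> (\<Sum>c\<in>F. \<Sum>x\<in>?F. emeasure lborel (unit_sq \<inter> hl x -` fst c))"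
    proof (rule sum_mono)
      fix c assume "c \<in> F"
      then obtain f where f: "(fst c, f) \<in> charts (flat X)" "snd c = shear \<alpha> \<circ> f" using elt by blast
      have "emeasure lborel (snd c ` fst c) \<le> (\<Sum>x\<in>?F. emeasure lborel (unit_sq \<inter> hl x -` fst c))"
        using chart_area_le[OF f(1), of \<alpha>] by (simp add: f(2) image_comp)
      then show "(case c of (U, f) \<Rightarrow> emeasure lborel (f ` U)) \<le> (\<Sum>x\<in>?F. emeasure lborel (unit_sq \<inter> hl x -` fst c))"
        by (simp add: case_prod_beta)
    qed
    also have "\<dots> = (\<Sum>x\<in>?F. \<Sum>c\<in>F. emeasure lborel (unit_sq \<inter> hl x -` fst c))" by (rule sum.swap)
    also have "\<dots> \<le> (\<Sum>x\<in>?F. 1)"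
    proof (rule sum_mono)
      fix x assume x: "x \<in> ?F"
      have ms: "unit_sq \<inter> hl x -` fst c \<in> sets borel" if cF: "c \<in> F" for c
      proof -
        obtain f where f: "(fst c, f) \<in> charts (flat X)" using elt[OF cF] by blast
        show ?thesis by (rule chart_piece_measure(1)[OF f gauss_one(1) conjunct1[OF hl[OF x]] unit_sq_props(3,5)])
      qed
      have "disjoint_family_on (\<lambda>c. unit_sq \<inter> hl x -` fst c) F"
        unfolding disjoint_family_on_def using pw unfolding pairwise_def by blast
      then have "(\<Sum>c\<in>F. emeasure lborel (unit_sq \<inter> hl x -` fst c)) = emeasure lborel (\<Union>c\<in>F. unit_sq \<inter> hl x -` fst c)"
        using ms fin by (intro sum_emeasure) auto
      also have "\<dots> \<le> emeasure lborel unit_sq" using unit_sq_props(5) by (intro emeasure_mono) auto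
      finally show "(\<Sum>c\<in>F. emeasure lborel (unit_sq \<inter> hl x -` fst c)) \<le> 1" by (simp add: unit_sq_props(6))
    qed
    finally show ?thesis by simp
  qed
  define c where "c x = (hl x ` unit_sq, shear \<alpha> \<circ> inv_into unit_sq (hl x))" for x
  have disj: "hl x ` unit_sq \<inter> hl y ` unit_sq = {}" if "x \<in> ?F" "y \<in> ?F" "x \<noteq> y" for x y
    using hl_inj(2)[OF that(1,2)] that(3) by blast
  have "c ` ?F \<in> FF"
    unfolding FF_def mem_Collect_eq
  proof (intro conjI)
    show "finite (c ` ?F)" using finite_Fib by simp
    show "c ` ?F \<subseteq> charts (act A (flat X))" unfolding ch c_def using square_chart by (force simp: image_iff)
    show "pairwise (\<lambda>c d. fst c \<inter> fst d = {}) (c ` ?F)"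
      unfolding pairwise_def
    proof (intro ballI impI)
      fix a b assume "a \<in> c ` ?F" "b \<in> c ` ?F" "a \<noteq> b"
      then obtain x y where "x \<in> ?F" "y \<in> ?F" "a = c x" "b = c y" "x \<noteq> y" by blast
      then show "fst a \<inter> fst b = {}" using disj[of x y] by (simp add: c_def)
    qed
  qed
  moreover have "(\<Sum>(U, f)\<in>c ` ?F. emeasure lborel (f ` U)) = of_nat (card ?F)"
  proof -
    have inj: "inj_on c ?F"
    proof (rule inj_onI)
      fix x y assume xy: "x \<in> ?F" "y \<in> ?F" "c x = c y"
      have "hl x ` unit_sq \<noteq> {}" using unit_sq_props(4) by blast
      then show "x = y" using xy disj[of x y] by (auto simp: c_def)
    qed
    have "(\<Sum>(U, f)\<in>c ` ?F. emeasure lborel (f ` U)) = (\<Sum>x\<in>?F. emeasure lborel ((shear \<alpha> \<circ> inv_into unit_sq (hl x)) ` hl x ` unit_sq))"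
      by (subst sum.reindex[OF inj]) (simp add: c_def)
    also have "\<dots> = (\<Sum>x\<in>?F. 1)"
    proof (rule sum.cong[OF refl])
      fix x assume x: "x \<in> ?F"
      have "inj_on (hl x) unit_sq" using hl_inj(1)[OF x x] by (auto simp: inj_on_def)
      then have "inv_into unit_sq (hl x) ` hl x ` unit_sq = unit_sq"
        by (simp add: inv_into_image_cancel)
      then have "(shear \<alpha> \<circ> inv_into unit_sq (hl x)) ` hl x ` unit_sq = shear \<alpha> ` unit_sq"
        by (simp only: image_comp[symmetric])
      then show "emeasure lborel ((shear \<alpha> \<circ> inv_into unit_sq (hl x)) ` hl x ` unit_sq) = 1"
        using emeasure_shear[OF unit_sq_props(5)] unit_sq_props(6) by simp
    qed
    finally show ?thesis by simp
  qed
  ultimately have "of_nat (card ?F) \<le> (SUP F\<in>FF. \<Sum>(U, f)\<in>F. emeasure lborel (f ` U))"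
    by (metis (no_types, lifting) SUP_upper)
  moreover have "(SUP F\<in>FF. \<Sum>(U, f)\<in>F. emeasure lborel (f ` U)) \<le> of_nat (card ?F)"
    using up by (rule SUP_least)
  ultimately have "(SUP F\<in>FF. \<Sum>(U, f)\<in>F. emeasure lborel (f ` U)) = of_nat (card ?F)" by (rule antisym[rotated])
  then show ?thesis
    unfolding surface_area_def FF_def[symmetric] card_squares by (simp add: enn2real_of_nat)
qed

end

section \<open>Directions, types and the Lagrange spectrum\<close>

lemma lin_linear: "lin A (x + y) = lin A x + lin A y" "lin A (x - y) = lin A x - lin A y"
    "lin A (of_real t * x) = of_real t * lin A x"
  by (simp_all add: lin_def complex_eq_iff algebra_simps)

lemma continuous_on_lin: "continuous_on T (lin A)"
  unfolding lin_def Complex_eq by (intro continuous_intros)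

lemma act_charts: "(U, f) \<in> charts Y \<Longrightarrow> (U, lin A \<circ> f) \<in> charts (act A Y)"
  by (force simp: act_def)

lemma act_sel [simp]: "pts (act A Y) = pts Y" "sing (act A Y) = sing Y"
  by (simp_all add: act_def)

lemma saddle_act:
  assumes s: "saddle_connection Y \<gamma>" and inj: "\<And>v. v \<noteq> 0 \<Longrightarrow> lin A v \<noteq> 0"
  shows "saddle_connection (act A Y) \<gamma>"
proof -
  obtain v where v: "v \<noteq> 0" "\<And>t. t \<in> {0<..<1} \<Longrightarrow> \<exists>(U, f)\<in>charts Y. \<gamma> t \<in> U \<and>
        (\<forall>\<^sub>F s in nhds t. \<gamma> s \<in> U \<and> f (\<gamma> s) = f (\<gamma> t) + of_real (s - t) * v)"
    using s unfolding saddle_connection_def by blast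
  have "\<exists>(U, f)\<in>charts (act A Y). \<gamma> t \<in> U \<and>
        (\<forall>\<^sub>F s in nhds t. \<gamma> s \<in> U \<and> f (\<gamma> s) = f (\<gamma> t) + of_real (s - t) * lin A v)" if t: "t \<in> {0<..<1}" for t
  proof -
    obtain U f where U: "(U, f) \<in> charts Y" "\<gamma> t \<in> U"
      and ev: "\<forall>\<^sub>F s in nhds t. \<gamma> s \<in> U \<and> f (\<gamma> s) = f (\<gamma> t) + of_real (s - t) * v"
      using v(2)[OF t] by blast
    have "\<forall>\<^sub>F s in nhds t. \<gamma> s \<in> U \<and> (lin A \<circ> f) (\<gamma> s) = (lin A \<circ> f) (\<gamma> t) + of_real (s - t) * lin A v"
      using ev by (rule eventually_mono) (simp add: lin_linear del: of_real_diff)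
    then show ?thesis using act_charts[OF U(1)] U(2) by blast
  qed
  moreover have "lin A v \<noteq> 0" using inj v(1) by simp
  ultimately show ?thesis using s unfolding saddle_connection_def act_sel by blast
qed

lemma period_act:
  assumes p: "has_period Y \<gamma> v"
  shows "has_period (act A Y) \<gamma> (lin A v)"
proof -
  obtain g where g: "continuous_on {0..1} g" "g 1 - g 0 = v" "\<And>t. t \<in> {0<..<1} \<Longrightarrow> \<exists>(U, f)\<in>charts Y. \<gamma> t \<in> U \<and>
           (\<forall>\<^sub>F s in nhds t. \<gamma> s \<in> U \<and> g s - g t = f (\<gamma> s) - f (\<gamma> t))"
    using p unfolding has_period_def by blast
  define k where "k = lin A \<circ> g"
  have "continuous_on {0..1} k" unfolding k_def using g(1) continuous_on_lin by (rule continuous_on_compose)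
  moreover have "k 1 - k 0 = lin A v" by (simp add: k_def g(2)[symmetric] lin_linear)
  moreover have "\<exists>(U, f)\<in>charts (act A Y). \<gamma> t \<in> U \<and>
        (\<forall>\<^sub>F s in nhds t. \<gamma> s \<in> U \<and> k s - k t = f (\<gamma> s) - f (\<gamma> t))" if t: "t \<in> {0<..<1}" for t
  proof -
    obtain U f where U: "(U, f) \<in> charts Y" "\<gamma> t \<in> U"
      and ev: "\<forall>\<^sub>F s in nhds t. \<gamma> s \<in> U \<and> g s - g t = f (\<gamma> s) - f (\<gamma> t)"
      using g(3)[OF t] by blast
    have "\<forall>\<^sub>F s in nhds t. \<gamma> s \<in> U \<and> k s - k t = (lin A \<circ> f) (\<gamma> s) - (lin A \<circ> f) (\<gamma> t)"
      using ev by (rule eventually_mono) (simp add: k_def lin_linear(2)[symmetric])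
    then show ?thesis using act_charts[OF U(1)] U(2) by blast
  qed
  ultimately show ?thesis unfolding has_period_def by blast
qed

lemma Hol_act_subset:
  assumes "\<And>z. lin B (lin A z) = z"
  shows "lin A ` Hol Y \<subseteq> Hol (act A Y)"
proof
  fix v assume "v \<in> lin A ` Hol Y"
  then obtain u \<gamma> where u: "v = lin A u" "saddle_connection Y \<gamma>" "has_period Y \<gamma> u" by (auto simp: Hol_def)
  have l0: "lin B 0 = 0" by (simp add: lin_def complex_eq_iff)
  have "lin A z \<noteq> 0" if "z \<noteq> 0" for z using assms[of z] that l0 by metis
  then have "saddle_connection (act A Y) \<gamma>" by (rule saddle_act[OF u(2)])
  then show "v \<in> Hol (act A Y)" using period_act[OF u(3), of A] u(1) by (auto simp: Hol_def)
qed

text \<open>\<open>B\<close> undoes the action of \<open>A\<close> on charts, so the inclusion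
  \<open>Hol_act_subset\<close> for both matrices gives equality.\<close>

lemma Hol_act:
  assumes BA: "\<And>z. lin B (lin A z) = z" and AB: "\<And>z. lin A (lin B z) = z"
  shows "Hol (act A Y) = lin A ` Hol Y"
proof
  have "charts (act B (act A Y)) = charts Y"
  proof -
    have "lin B \<circ> (lin A \<circ> f) = f" for f :: "'a \<Rightarrow> complex" using BA by auto
    then show ?thesis by (simp add: act_def image_image case_prod_unfold)
  qed
  then have Y: "act B (act A Y) = Y" by (simp add: act_def)
  show "Hol (act A Y) \<subseteq> lin A ` Hol Y"
  proof
    fix v assume "v \<in> Hol (act A Y)"
    then have "lin B v \<in> Hol Y" using Hol_act_subset[OF AB, of "act A Y"] Y by auto
    then show "v \<in> lin A ` Hol Y" using AB[of v] by (metis image_eqI)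
  qed
qed (rule Hol_act_subset[OF BA])

definition shear_matrix :: "real \<Rightarrow> real^2^2" where
  "shear_matrix \<alpha> = vector [vector [1, - \<alpha>], vector [0, 1]]"

lemma lin_shear_matrix: "lin (shear_matrix \<alpha>) z = shear \<alpha> z"
  by (simp add: lin_def shear_matrix_def shear_def)

lemma shear_matrix_SL2R: "shear_matrix \<alpha> \<in> SL2R"
  by (simp add: SL2R_def shear_matrix_def det_2)

lemma zbasis_add: "zbasis v w \<Longrightarrow> zbasis v (w + v)" "zbasis v w \<Longrightarrow> zbasis (v + w) w" "zbasis v w \<Longrightarrow> zbasis v (w - v)"
  using gauss_ints_add gauss_ints_diff by (auto simp: zbasis_def cross_def algebra_simps)

lemma zbasis_std: "zbasis 1 \<i>"
  by (auto simp: zbasis_def gauss_ints_iff cross_def)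

section \<open>The initial type and the directions reached from it\<close>

context origami begin

lemma tr_permutes:
  assumes v: "v \<in> gauss_ints" and c: "c \<in> strip v k"
  shows "(\<lambda>x. if x \<in> Fib c then tr c (c + v) x else x) permutes Fib c"
proof -
  have cv: "c + v \<in> strip v k" using c by (simp add: strip_def)
  have F: "Fib (c + v) = Fib c" by (rule Fib_translate[OF v])
  have mem: "tr (c + v) c x \<in> Fib c" "tr c (c + v) x \<in> Fib c" if "x \<in> Fib c" for x
    using tr_strip_Fib[OF v c cv that] tr_strip_Fib[OF v cv c] that F by auto
  have "tr (c + v) c (tr c (c + v) x) = x" "tr c (c + v) (tr (c + v) c x) = x" if x: "x \<in> Fib c" for x
  proof -
    have x': "x \<in> Fib (c + v)" using x F by simp
    show "tr (c + v) c (tr c (c + v) x) = x"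
      using tr_strip_comp[OF v c cv c x] tr_strip_refl[OF v c x] by simp
    show "tr c (c + v) (tr (c + v) c x) = x"
      using tr_strip_comp[OF v cv c cv x'] tr_strip_refl[OF v cv x'] by simp
  qed
  then have "bij_betw (tr c (c + v)) (Fib c) (Fib c)" using mem by (intro bij_tr)
  then have "bij_betw (\<lambda>x. if x \<in> Fib c then tr c (c + v) x else x) (Fib c) (Fib c)"
    by (subst bij_betw_cong[where g = "tr c (c + v)"]) auto
  then show ?thesis by (rule bij_imp_permutes) auto
qed

text \<open>The fibre over the centre of the standard square serves as its own set of
  labels.\<close>

lemma initial_type: "\<exists>t\<in>sq_types (Fib (ctr 1 \<i>)). sqtyp (Fib (ctr 1 \<i>)) 1 \<i> t"
proof -
  let ?c = "ctr 1 \<i>"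
  let ?r = "\<lambda>v x. if x \<in> Fib ?c then tr ?c (?c + v) x else x"
  define M where "M = {x \<in> Fib ?c. mark ?c x}"
  have g: "1 \<in> gauss_ints" "\<i> \<in> gauss_ints" by (auto simp: gauss_ints_iff)
  have "?c \<in> strip 1 0" "?c \<in> strip \<i> (-1)" by (auto simp: strip_def cross_def ctr_def)
  then have "?r 1 permutes Fib ?c" "?r \<i> permutes Fib ?c" using tr_permutes g by blast+
  then have "(?r 1, ?r \<i>, M) \<in> sq_types (Fib ?c)" by (simp add: sq_types_def M_def)
  moreover have "sqtyp (Fib ?c) 1 \<i> (?r 1, ?r \<i>, M)"
    unfolding sqtyp_def prod.case by (rule exI[of _ id]) (simp add: M_def)
  ultimately show ?thesis by blast
qed

end

text \<open>The labels stay fixed while the fibre changes with the basis, so that all bases share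
  one finite set of types on which the moves act.\<close>

locale typed_origami = origami +
  fixes F :: "'b set" and t0
  assumes finF: "finite F" and t0: "t0 \<in> sq_types F" "sqtyp F 1 \<i> t0"
begin

interpretation two_bijections "sq_types F" Rmove Lmove by (rule sq_moves[OF finF])

definition realized where
  "realized v w t \<longleftrightarrow> zbasis v w \<and> t \<in> sq_types F \<and> sqtyp F v w t"

lemma realized_R: "realized v w t \<Longrightarrow> realized v (w + v) (Rmove t)"
  using zbasis_add(1) sqtyp_moves(1) bij_betw_imp_surj_on[OF f] unfolding realized_def by blast

lemma realized_L: "realized v w t \<Longrightarrow> realized (v + w) w (Lmove t)"
  using zbasis_add(2) sqtyp_moves(2) bij_betw_imp_surj_on[OF g] unfolding realized_def by blast

lemma realized_R_inverse:
  assumes "realized v w t"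
  obtains s where "realized v (w - v) s" "t = Rmove s"
proof -
  have z: "zbasis v (w - v)" using assms zbasis_add(3) by (auto simp: realized_def)
  have "t \<in> Rmove ` sq_types F" using assms bij_betw_imp_surj_on[OF f] by (simp add: realized_def)
  then obtain s where s: "s \<in> sq_types F" "t = Rmove s" by (elim imageE) simp
  have "sqtyp F v (w - v) s" using sqtyp_moves(1)[OF z s(1)] assms s(2) by (simp add: realized_def)
  then show thesis using that z s by (simp add: realized_def)
qed

lemma realized_Rs: "realized v w t \<Longrightarrow> realized v (w + of_nat k * v) ((Rmove ^^ k) t)"
proof (induction k)
  case (Suc k)
  then show ?case using realized_R[of v "w + of_nat k * v" "(Rmove ^^ k) t"] by (simp add: algebra_simps)
qed simp

lemma realized_Ls: "realized v w t \<Longrightarrow> realized (v + of_nat k * w) w ((Lmove ^^ k) t)"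
proof (induction k)
  case (Suc k)
  then show ?case using realized_L[of "v + of_nat k * w" w "(Lmove ^^ k) t"] by (simp add: algebra_simps)
qed simp

text \<open>Steering from \<open>t0\<close> is demanded besides realisation: it ties every direction
  to the continued fraction construction, which starts at \<open>t0\<close>.\<close>

definition reach where "reach v w \<longleftrightarrow> (\<exists>t. realized v w t \<and> steer t0 t)"

lemma reach_R: "reach v w \<Longrightarrow> reach v (w + v)"
  using realized_R steer_f steer_trans unfolding reach_def realized_def by metis

lemma reach_L: "reach v w \<Longrightarrow> reach (v + w) w"
  using realized_L steer_g steer_trans unfolding reach_def realized_def by metis

lemma reach_R_inverse:
  assumes "reach v w"
  shows "reach v (w - v)"
proof -
  obtain t where t: "realized v w t" "steer t0 t" using assms by (auto simp: reach_def)
  obtain s where s: "realized v (w - v) s" "t = Rmove s" by (rule realized_R_inverse[OF t(1)])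
  have sT: "s \<in> sq_types F" using s(1) by (simp add: realized_def)
  have "steer t s" using steer_sym[OF steer_f[OF sT] sT] s(2) by simp
  then show ?thesis using s(1) steer_trans[OF t(2)] unfolding reach_def by blast
qed

text \<open>The subtractive Euclidean algorithm on \<open>(x, y)\<close>, run as base
  changes.\<close>

lemma reach_coprime:
  assumes "reach v w" "1 \<le> x" "1 \<le> y" "coprime x y"
  shows "\<exists>w'. reach (of_nat x * v + of_nat y * w) w'"
  using assms
proof (induction "x + y" arbitrary: x y v w rule: less_induct)
  case less
  consider "x = y" | "y < x" | "x < y" by linarith
  then show ?case
  proof cases
    case 1
    then have "x = 1" "y = 1" using less.prems(4) by auto
    then show ?thesis using reach_L[OF less.prems(1)] by auto
  next
    case 2
    have cop: "coprime (x - y) y"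
      using less.prems(4) 2 by (metis coprime_iff_gcd_eq_1 gcd_diff1_nat less_imp_le)
    have eq: "of_nat (x - y) * v + of_nat y * (w + v) = of_nat x * v + of_nat y * w"
      using 2 by (simp add: of_nat_diff algebra_simps)
    have "\<exists>w'. reach (of_nat (x - y) * v + of_nat y * (w + v)) w'"
      by (rule less.hyps[OF _ reach_R[OF less.prems(1)] _ _ cop]) (use 2 less.prems in auto)
    then show ?thesis unfolding eq .
  next
    case 3
    have cop: "coprime x (y - x)"
      using less.prems(4) 3 by (metis coprime_commute coprime_iff_gcd_eq_1 gcd_diff1_nat less_imp_le)
    have eq: "of_nat x * (v + w) + of_nat (y - x) * w = of_nat x * v + of_nat y * w"
      using 3 by (simp add: of_nat_diff algebra_simps)
    have "\<exists>w'. reach (of_nat x * (v + w) + of_nat (y - x) * w) w'"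
      by (rule less.hyps[OF _ reach_L[OF less.prems(1)] _ _ cop]) (use 3 less.prems in auto)
    then show ?thesis unfolding eq .
  qed
qed

lemma reach_direction:
  assumes "0 < q" "coprime p q"
  shows "\<exists>w. reach (Complex (of_int p) (of_int q)) w"
proof -
  \<comment> \<open>\<open>p\<close> may be negative: replacing \<open>\<i>\<close> by
    \<open>\<i> - k\<close> in the basis changes the coordinates to \<open>(p + k * q, q)\<close>,
    both positive for this \<open>k\<close>.\<close>
  define k where "k = nat \<bar>p\<bar> + 1"
  have base: "reach 1 (\<i> - of_nat j)" for j
  proof (induction j)
    case 0
    have "realized 1 \<i> t0" using t0 zbasis_std by (simp add: realized_def)
    moreover have "\<i> - of_nat 0 = \<i>" by simp
    ultimately show ?case using steer_refl[of t0] unfolding reach_def by (metis)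
  next
    case (Suc j)
    then show ?case using reach_R_inverse by (fastforce simp: algebra_simps)
  qed
  define x where "x = nat (p + int k * q)"
  have "\<bar>p\<bar> * 1 \<le> \<bar>p\<bar> * q" using assms(1) by (intro mult_left_mono) auto
  then have pos: "1 \<le> p + int k * q" using assms(1) unfolding k_def by (simp add: algebra_simps)
  then have ix: "int x = p + int k * q" by (simp add: x_def)
  have "coprime (int x) q" 
    using assms(2) gcd_add_mult[of q "int k" p] unfolding ix coprime_iff_gcd_eq_1 by (simp add: gcd.commute add.commute)
  then have "coprime (int x) (int (nat q))" using assms(1) by simp
  then have "coprime x (nat q)" by (simp only: coprime_int_iff)
  then obtain w where "reach (of_nat x * 1 + of_nat (nat q) * (\<i> - of_nat k)) w"
  proof -
    have "1 \<le> x" "1 \<le> nat q" using pos ix assms(1) by linarith+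
    from reach_coprime[OF base[of k] this \<open>coprime x (nat q)\<close>] that show ?thesis by blast
  qed
  moreover have "of_nat x * 1 + of_nat (nat q) * (\<i> - of_nat k) = Complex (of_int p) (of_int q)"
  proof -
    have "real x = of_int (p + int k * q)" using ix by (metis of_int_of_nat_eq)
    moreover have "real (nat q) = of_int q" using assms(1) by simp
    ultimately show ?thesis by (simp add: complex_eq_iff algebra_simps)
  qed
  ultimately show ?thesis by metis
qed

lemma coslope_type:
  assumes ne: "Sg \<noteq> {}" and gauss: "Hol (flat X) \<subseteq> gauss_ints" and pq: "quotient_of x = (p, q)"
  obtains t where "t \<in> sq_types F" "steer t0 t" "mult_coslope (flat X) x = type_mult t" "1 \<le> type_mult t"
    "\<forall>k. of_int k * Complex (of_int p) (of_int q) \<in> Hol (flat X) \<longrightarrow> type_mult t \<le> nat \<bar>k\<bar>"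
proof -
  obtain w where "reach (Complex (of_int p) (of_int q)) w"
    using reach_direction[of q p] quotient_of_denom_pos[OF pq] quotient_of_coprime[OF pq] by blast
  then obtain t where t: "realized (Complex (of_int p) (of_int q)) w t" "steer t0 t" by (auto simp: reach_def)
  obtain r u M where tt: "t = (r, u, M)" by (rule prod_cases3)
  have z: "zbasis (Complex (of_int p) (of_int q)) w" "(r, u, M) \<in> sq_types F" "sqtyp F (Complex (of_int p) (of_int q)) w (r, u, M)"
    using t(1) by (auto simp: realized_def tt)
  show thesis
  proof (rule that[of t])
    show "mult_coslope (flat X) x = type_mult t" unfolding tt by (rule mult_coslope_type[OF pq z(1,2) finF z(3) ne gauss])
    show "1 \<le> type_mult t" unfolding tt by (rule type_mult_props(1)[OF z(1,2) finF z(3) ne])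
    show "\<forall>k. of_int k * Complex (of_int p) (of_int q) \<in> Hol (flat X) \<longrightarrow> type_mult t \<le> nat \<bar>k\<bar>"
      unfolding tt using type_mult_props(3)[OF z(1,2) finF z(3) ne] by blast
  qed (use z(2) t(2) tt in auto)
qed

text \<open>The multiplicities of all co-slopes are values of \<open>type_mult\<close> on the finite
  set of types, so the minimum is attained, and at a type that steering can reach.\<close>

lemma M_minus_props:
  assumes ne: "Sg \<noteq> {}" and gauss: "Hol (flat X) \<subseteq> gauss_ints"
  obtains t where "steer t0 t" "t \<in> sq_types F" "type_mult t = M_minus (flat X)" "1 \<le> M_minus (flat X)"
    "\<And>x. M_minus (flat X) \<le> mult_coslope (flat X) x"
proof -
  have ex: "\<exists>t. t \<in> sq_types F \<and> steer t0 t \<and> mult_coslope (flat X) x = type_mult t \<and> 1 \<le> type_mult t" for x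
  proof -
    obtain p q where "quotient_of x = (p, q)" by (cases "quotient_of x")
    then show ?thesis using coslope_type[OF ne gauss] by metis
  qed
  have "range (mult_coslope (flat X)) \<subseteq> type_mult ` sq_types F"
  proof (rule image_subsetI)
    fix x show "mult_coslope (flat X) x \<in> type_mult ` sq_types F" using ex[of x] by (metis imageI)
  qed
  then have fin: "finite (range (mult_coslope (flat X)))" using finT finite_subset by blast
  then have "M_minus (flat X) \<in> range (mult_coslope (flat X))" unfolding M_minus_def by (rule Min_in) simp
  then obtain x where x: "M_minus (flat X) = mult_coslope (flat X) x" by (elim rangeE)
  obtain t where t: "t \<in> sq_types F" "steer t0 t" "mult_coslope (flat X) x = type_mult t" "1 \<le> type_mult t"
    using ex[of x] by blast
  have "M_minus (flat X) \<le> mult_coslope (flat X) y" for y unfolding M_minus_def using fin by (intro Min_le) auto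
  then show thesis using that[of t] t x by simp
qed

text \<open>\<open>Im v \<noteq> 0\<close> gives the direction of \<open>v\<close> a rational
  co-slope, so that \<open>M_minus\<close> bounds the multiple from below. The sign of the multiple
  is moved into \<open>(p, q)\<close>.\<close>

lemma Hol_multiplicity:
  assumes ne: "Sg \<noteq> {}" and gauss: "Hol (flat X) \<subseteq> gauss_ints" and v: "v \<in> Hol (flat X)" "Im v \<noteq> 0"
  shows "\<exists>m (p::int) (q::int). M_minus (flat X) \<le> m \<and> coprime p q \<and>
      v = Complex (real m * real_of_int p) (real m * real_of_int q)"
proof -
  obtain a b where ab: "v = Complex (of_int a) (of_int b)" using v(1) gauss unfolding gauss_ints_def by blast
  have b0: "b \<noteq> 0" using v(2) ab by auto
  define x where "x = (of_int a / of_int b :: rat)"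
  obtain p q where pq: "quotient_of x = (p, q)" by (cases "quotient_of x")
  note q0 = quotient_of_denom_pos[OF pq] and cop = quotient_of_coprime[OF pq]
  have "(of_int a / of_int b :: rat) = of_int p / of_int q" using quotient_of_div[OF pq] by (simp add: x_def)
  then have "of_int (a * q) = (of_int (p * b) :: rat)" using b0 q0 by (simp add: field_simps)
  then have eq: "a * q = p * b" by (simp only: of_int_eq_iff)
  have "q dvd p * b" unfolding eq[symmetric] by simp
  then have "q dvd b" using cop by (simp add: coprime_commute coprime_dvd_mult_right_iff)
  then obtain k where k: "b = q * k" by (elim dvdE)
  have "a = p * k" using eq k q0 by simp
  then have vk: "v = of_int k * Complex (of_int p) (of_int q)" using ab k by (simp add: complex_eq_iff mult.commute)
  obtain t where t: "t \<in> sq_types F" "steer t0 t" "mult_coslope (flat X) x = type_mult t" "1 \<le> type_mult t"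
    "\<forall>k. of_int k * Complex (of_int p) (of_int q) \<in> Hol (flat X) \<longrightarrow> type_mult t \<le> nat \<bar>k\<bar>"
    by (rule coslope_type[OF ne gauss pq])
  have s: "M_minus (flat X) \<le> mult_coslope (flat X) x" by (rule M_minus_props[OF ne gauss])
  have le: "M_minus (flat X) \<le> nat \<bar>k\<bar>" using s t(3) spec[OF t(5), of k] v(1) vk by simp
  have "coprime (sgn k * p) (sgn k * q)"
  proof -
    have "k \<noteq> 0" using k b0 by auto
    then show ?thesis using cop by (cases "k > 0") auto
  qed
  moreover have "v = Complex (real (nat \<bar>k\<bar>) * real_of_int (sgn k * p)) (real (nat \<bar>k\<bar>) * real_of_int (sgn k * q))"
    unfolding vk by (simp add: complex_eq_iff abs_if sgn_if)
  ultimately show ?thesis using le by blast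
qed

text \<open>The initial basis \<open>(1, \<i>)\<close> consists of the convergents 1/0 and 0/1.
  Digits of even index add multiples of the first vector to the second, those of odd index the
  reverse, matching the alternation in \<open>wact\<close>.\<close>

lemma realized_convergents:
  assumes "cf_seq a" "even n"
  shows "realized (Complex (real (cf_seq.P a (Suc n))) (real (cf_seq.Q a (Suc n))))
     (Complex (real (cf_seq.P a n)) (real (cf_seq.Q a n))) (wact (map a [0..<n]) t0)"
proof -
  interpret cf_seq a by fact
  have "realized (Complex (real (P (Suc (2 * k)))) (real (Q (Suc (2 * k)))))
     (Complex (real (P (2 * k))) (real (Q (2 * k)))) (wact (map a [0..<2 * k]) t0)" for k
  proof (induction k)
    case 0
    have "Complex 1 0 = 1" "Complex 0 1 = \<i>" by (simp_all add: complex_eq_iff)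
    then show ?case using t0 zbasis_std by (simp add: realized_def)
  next
    case (Suc k)
    let ?n = "2 * k"
    let ?v = "Complex (real (P (Suc ?n))) (real (Q (Suc ?n)))" and ?w = "Complex (real (P ?n)) (real (Q ?n))"
    let ?t = "wact (map a [0..<?n]) t0"
    have w: "?w + of_nat (a ?n) * ?v = Complex (real (P (Suc (Suc ?n)))) (real (Q (Suc (Suc ?n))))"
      by (simp add: complex_eq_iff P.simps(3) Q.simps(3))
    note R = realized_Rs[OF Suc, of "a ?n", unfolded w]
    have v: "?v + of_nat (a (Suc ?n)) * Complex (real (P (Suc (Suc ?n)))) (real (Q (Suc (Suc ?n))))
      = Complex (real (P (Suc (Suc (Suc ?n))))) (real (Q (Suc (Suc (Suc ?n)))))"
      by (simp add: complex_eq_iff P.simps(3) Q.simps(3))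
    note L = realized_Ls[OF R, of "a (Suc ?n)", unfolded v]
    have "wact (map a [0..<Suc (Suc ?n)]) t0 = wact (map a [0..<?n] @ [a ?n, a (Suc ?n)]) t0"
      by simp
    also have "\<dots> = (Lmove ^^ a (Suc ?n)) ((Rmove ^^ a ?n) ?t)"
      by (subst wact_append) simp_all
    finally show ?case using L by simp
  qed
  from this[of "n div 2"] show ?thesis using assms(2) by simp
qed

text \<open>A prefix is good if it leads from \<open>t0\<close> to a fixed type of minimal
  multiplicity; at such an even index \<open>n\<close> the convergent \<open>Suc n\<close>,
  multiplied by \<open>M_minus\<close>, is a period.\<close>

lemma frequent_minimal:
  assumes ne: "Sg \<noteq> {}" and gauss: "Hol (flat X) \<subseteq> gauss_ints" and R: "7 \<le> R"
  obtains a where "cf_seq a"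
    "\<And>\<epsilon>. 0 < \<epsilon> \<Longrightarrow> \<exists>n0. \<forall>n\<ge>n0. cf_seq.\<zeta> a n + cf_seq.\<beta> a n \<le> R + \<epsilon>"
    "\<And>\<epsilon> n0. 0 < \<epsilon> \<Longrightarrow> \<exists>n\<ge>n0. R - \<epsilon> \<le> cf_seq.\<zeta> a n + cf_seq.\<beta> a n \<and>
        Complex (real (M_minus (flat X)) * real (cf_seq.P a (Suc n))) (real (M_minus (flat X)) * real (cf_seq.Q a (Suc n)))
          \<in> Hol (flat X)"
proof -
  obtain t where t: "steer t0 t" "t \<in> sq_types F" "type_mult t = M_minus (flat X)"
    using M_minus_props[OF ne gauss] by metis
  have conn: "\<exists>u. even (length u) \<and> set u \<subseteq> {1..4} \<and> wact (w @ u @ h) t0 = t"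
    if wh: "even (length w)" "even (length h)" for w h
  proof -
    obtain u where u: "even (length u)" "set u \<subseteq> {1, 2}" "wact (w @ u @ h) t0 = t"
      by (rule steering[OF t0(1) t(1) wh])
    have "set u \<subseteq> {1..4}" using u(2) by auto
    then show ?thesis using u by blast
  qed
  obtain a where a: "cf_seq a"
    "\<And>\<epsilon>. 0 < \<epsilon> \<Longrightarrow> \<exists>n0. \<forall>n\<ge>n0. cf_seq.\<zeta> a n + cf_seq.\<beta> a n \<le> R + \<epsilon>"
    "\<And>\<epsilon> n0. 0 < \<epsilon> \<Longrightarrow> \<exists>n\<ge>n0. R - \<epsilon> \<le> cf_seq.\<zeta> a n + cf_seq.\<beta> a n \<and> even n \<and> wact (map a [0..<n]) t0 = t"
    by (rule recurrent_sequence[OF R, where Good = "\<lambda>w. wact w t0 = t"]) (use conn in blast)+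
  have hol: "Complex (real (M_minus (flat X)) * real (cf_seq.P a (Suc n))) (real (M_minus (flat X)) * real (cf_seq.Q a (Suc n)))
          \<in> Hol (flat X)" if n: "even n" "wact (map a [0..<n]) t0 = t" for n
  proof -
    obtain r u M where tt: "t = (r, u, M)" by (rule prod_cases3)
    let ?v = "Complex (real (cf_seq.P a (Suc n))) (real (cf_seq.Q a (Suc n)))" and ?w = "Complex (real (cf_seq.P a n)) (real (cf_seq.Q a n))"
    have "realized ?v ?w (r, u, M)" using realized_convergents[OF a(1) n(1)] n(2) tt by simp
    then have "of_nat (type_mult (r, u, M)) * ?v \<in> Hol (flat X)"
      using type_mult_props(2)[of ?v ?w r u M F] finF ne by (auto simp: realized_def)
    moreover have "of_nat (type_mult (r, u, M)) * ?v = Complex (real (M_minus (flat X)) * real (cf_seq.P a (Suc n))) (real (M_minus (flat X)) * real (cf_seq.Q a (Suc n)))"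
      using t(3) tt by (simp add: complex_eq_iff)
    ultimately show ?thesis by simp
  qed
  show thesis
  proof (rule that[OF a(1,2)])
    fix \<epsilon> :: real and n0 assume "0 < \<epsilon>"
    then obtain n where "n \<ge> n0" "R - \<epsilon> \<le> cf_seq.\<zeta> a n + cf_seq.\<beta> a n" "even n" "wact (map a [0..<n]) t0 = t"
      using a(3)[of \<epsilon> n0] by blast
    then show "\<exists>n\<ge>n0. R - \<epsilon> \<le> cf_seq.\<zeta> a n + cf_seq.\<beta> a n \<and>
        Complex (real (M_minus (flat X)) * real (cf_seq.P a (Suc n))) (real (M_minus (flat X)) * real (cf_seq.Q a (Suc n)))
          \<in> Hol (flat X)" using hol by blast
  qed
qed

lemma lagrange_a_value:
  assumes ne: "Sg \<noteq> {}" and gauss: "Hol (flat X) \<subseteq> gauss_ints" and R: "7 \<le> R"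
    and N: "card (unit_squares (flat X) \<rho>) = N" "0 < N"
  obtains A where "A \<in> SL2R" "lagrange_a (act A (flat X)) = ereal (real (M_minus (flat X)) ^ 2 / (R * real N))"
proof -
  let ?m = "M_minus (flat X)"
  obtain a where a: "cf_seq a"
    "\<And>\<epsilon>. 0 < \<epsilon> \<Longrightarrow> \<exists>n0. \<forall>n\<ge>n0. cf_seq.\<zeta> a n + cf_seq.\<beta> a n \<le> R + \<epsilon>"
    "\<And>\<epsilon> n0. 0 < \<epsilon> \<Longrightarrow> \<exists>n\<ge>n0. R - \<epsilon> \<le> cf_seq.\<zeta> a n + cf_seq.\<beta> a n \<and>
        Complex (real ?m * real (cf_seq.P a (Suc n))) (real ?m * real (cf_seq.Q a (Suc n))) \<in> Hol (flat X)"
    by (rule frequent_minimal[OF ne gauss R]) blast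
  interpret cf_seq a by (rule a(1))
  let ?A = "shear_matrix \<alpha>"
  \<comment> \<open>The horizontal direction has no rational co-slope. It is set aside here and
    restored by \<open>fil\<close>, as the limit only concerns large \<open>|Im v|\<close>.\<close>
  define H where "H = {v \<in> Hol (flat X). Im v \<noteq> 0}"
  have m1: "1 \<le> ?m" using M_minus_props[OF ne gauss] by metis
  have lim: "Liminf (inf (filtercomap (\<lambda>v. \<bar>Im v\<bar>) at_top) (principal ((\<lambda>v. Complex (Re v - \<alpha> * Im v) (Im v)) ` H)))
      (\<lambda>v. ereal (\<bar>Re v\<bar> * \<bar>Im v\<bar> / real N)) = ereal (real ?m ^ 2 / (R * real N))"
  proof (rule liminf_area[OF _ m1 _ _ a(2)])
    show "\<exists>m (p::int) (q::int). ?m \<le> m \<and> coprime p q \<and> v = Complex (real m * real_of_int p) (real m * real_of_int q)" if "v \<in> H" for v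
      using Hol_multiplicity[OF ne gauss] that unfolding H_def by blast
    show "4 \<le> R" "0 < real N" using R N by auto
    fix \<epsilon> :: real and n0 assume "0 < \<epsilon>"
    \<comment> \<open>An index of at least 1 makes \<open>Q (Suc n)\<close> positive, so the period
      is not horizontal.\<close>
    then obtain n where n: "n \<ge> max n0 1" "R - \<epsilon> \<le> \<zeta> n + \<beta> n"
      "Complex (real ?m * real (P (Suc n))) (real ?m * real (Q (Suc n))) \<in> Hol (flat X)"
      using a(3)[of \<epsilon> "max n0 1"] by blast
    then obtain j where "n = Suc j" by (cases n) auto
    then have "Complex (real ?m * real (P (Suc n))) (real ?m * real (Q (Suc n))) \<in> H"
      using n(3) Q_pos[of j] m1 by (simp add: H_def)
    then show "\<exists>n\<ge>n0. R - \<epsilon> \<le> \<zeta> n + \<beta> n \<and>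
       (\<exists>v\<in>H. v = Complex (real ?m * real (P (Suc n))) (real ?m * real (Q (Suc n))) \<or>
          v = - Complex (real ?m * real (P (Suc n))) (real ?m * real (Q (Suc n))))"
      using n(1,2) by (intro exI[of _ n]) auto
  qed
  have HA: "Hol (act ?A (flat X)) = shear \<alpha> ` Hol (flat X)"
  proof -
    have "Hol (act ?A (flat X)) = lin ?A ` Hol (flat X)"
      by (rule Hol_act[of "shear_matrix (- \<alpha>)"]) (simp_all add: lin_shear_matrix)
    then show ?thesis by (simp add: lin_shear_matrix)
  qed
  have sH: "(\<lambda>v. Complex (Re v - \<alpha> * Im v) (Im v)) ` H = {v \<in> Hol (act ?A (flat X)). Im v \<noteq> 0}"
    unfolding HA H_def by (auto simp: shear_def)
  have nz: "\<forall>\<^sub>F v in filtercomap (\<lambda>v. \<bar>Im v\<bar>) at_top. Im v \<noteq> 0"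
  proof -
    have "\<forall>\<^sub>F x::real in at_top. x \<noteq> 0" by (rule eventually_mono[OF eventually_gt_at_top[of 0]]) auto
    then have "\<forall>\<^sub>F v in filtercomap (\<lambda>v. \<bar>Im v\<bar>) at_top. \<bar>Im v\<bar> \<noteq> 0" by (rule eventually_filtercomapI)
    then show ?thesis by simp
  qed
  have fil: "inf (filtercomap (\<lambda>v. \<bar>Im v\<bar>) at_top) (principal {v \<in> B. Im v \<noteq> 0})
      = inf (filtercomap (\<lambda>v. \<bar>Im v\<bar>) at_top) (principal B)" for B
    unfolding filter_eq_iff eventually_inf_principal
    by (intro allI iffI; erule eventually_elim2[OF nz]) auto
  have area: "surface_area (act ?A (flat X)) = real N"
    using area_shear[of ?A \<alpha>] lin_shear_matrix N(1) by simp
  \<comment> \<open>A vertical period would make \<alpha> rational; hence \<open>lagrange_a\<close>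
    is the liminf and not its default value 0.\<close>
  have novert: "\<not> (\<exists>v\<in>Hol (act ?A (flat X)). Re v = 0)"
  proof
    assume "\<exists>v\<in>Hol (act ?A (flat X)). Re v = 0"
    then obtain v where v: "v \<in> Hol (flat X)" "Re v - \<alpha> * Im v = 0" unfolding HA by (auto simp: shear_def)
    obtain p q where pq: "v = Complex (of_int p) (of_int q)" using v(1) gauss unfolding gauss_ints_def by blast
    have "v \<noteq> 0" using v(1) by (simp add: Hol_iff)
    then have "p \<noteq> 0 \<or> q \<noteq> 0" using pq by (auto simp: complex_eq_iff)
    then show False using alpha_not_rational[of p q] v(2) pq by simp
  qed
  show thesis
  proof (rule that[OF shear_matrix_SL2R[of \<alpha>]])
    show "lagrange_a (act ?A (flat X)) = ereal (real ?m ^ 2 / (R * real N))"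
      unfolding lagrange_a_def using novert lim[unfolded sH fil] by (simp add: area)
  qed
qed

end

theorem theorem1p6:
  fixes X :: "'a::t2_space form_surface" and N :: nat
  assumes "translation_surface X"
    and "square_tiled (flat X) N"
    and "reduced_origami (flat X)"
  shows "ereal ` {r_bound (flat X) N ..} \<subseteq> lagrange_spectrum (flat X)"
proof -
  obtain \<rho> where \<rho>: "square_covering (flat X) \<rho>" "card (unit_squares (flat X) \<rho>) = N"
    using assms(2) by (auto simp: square_tiled_def)
  interpret origami X \<rho> using assms(1) \<rho>(1) by unfold_locales
  have red: "group_closure (Hol (flat X)) = gauss_ints" using assms(3) by (simp add: reduced_origami_def)
  have gauss: "Hol (flat X) \<subseteq> gauss_ints" unfolding red[symmetric] by (auto intro: group_closure.base)
  \<comment> \<open>Without singularities there are no saddle connections, and the periods would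
    generate the trivial group.\<close>
  have ne: "cone_pts X \<noteq> {}"
  proof
    assume "cone_pts X = {}"
    then have "Hol (flat X) = {}" by (auto simp: Hol_def saddle_connection_def)
    then have "gauss_ints = {0}" using red by simp
    moreover have "(1::complex) \<noteq> 0" by simp
    ultimately show False using gauss_one(1) by blast
  qed
  obtain t0 where t0: "t0 \<in> sq_types (Fib (ctr 1 \<i>))" "sqtyp (Fib (ctr 1 \<i>)) 1 \<i> t0" using initial_type by blast
  interpret typed_origami X \<rho> "Fib (ctr 1 \<i>)" t0
    by unfold_locales (use finite_Fib t0 in auto)
  let ?m = "M_minus (flat X)"
  have "Fib (ctr 1 \<i>) \<noteq> {}" using exists_mark[OF zbasis_std ne] by blast
  moreover have "ctr 1 \<i> = sq_ctr" by (simp add: ctr_def sq_ctr_def complex_eq_iff)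
  ultimately have N0: "0 < N" 
    using \<rho>(2) card_squares finite_Fib[of sq_ctr] by (metis card_gt_0_iff)
  have m1: "1 \<le> ?m" using M_minus_props[OF ne gauss] by metis
  show ?thesis
  proof (rule image_subsetI)
    fix r assume "r \<in> {r_bound (flat X) N ..}"
    then have r: "real N / real ?m ^ 2 * real (max (2 * M_plus (flat X) ^ 2 + 1) (max 7 (cusp_width (flat X) + 2))) \<le> r"
      by (simp add: r_bound_def)
    \<comment> \<open>Chosen so that \<open>R * N / M_minus^2\<close> is the prescribed value
      \<open>r\<close>.\<close>
    define R where "R = r * real ?m ^ 2 / real N"
    have "real N / real ?m ^ 2 * 7 \<le> real N / real ?m ^ 2 * real (max (2 * M_plus (flat X) ^ 2 + 1) (max 7 (cusp_width (flat X) + 2)))"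
      by (intro mult_left_mono) auto
    then have "real N / real ?m ^ 2 * 7 \<le> r" using r by linarith
    then have R7: "7 \<le> R" using N0 m1 by (simp add: R_def field_simps)
    obtain A where A: "A \<in> SL2R" "lagrange_a (act A (flat X)) = ereal (real ?m ^ 2 / (R * real N))"
      by (rule lagrange_a_value[OF ne gauss R7 \<rho>(2) N0])
    have "real ?m ^ 2 / (R * real N) = 1 / r" using N0 m1 by (simp add: R_def)
    moreover have "r \<noteq> 0" using R7 by (auto simp: R_def)
    ultimately have "ereal r = 1 / lagrange_a (act A (flat X))" using A(2) by (simp add: one_ereal_def)
    then show "ereal r \<in> lagrange_spectrum (flat X)" using A(1) by (auto simp: lagrange_spectrum_def)
  qed
qed

end
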